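(* Assume the regularity condition that $g$ is strictly concave at every $\xi\in\operatorname{ri}\mathcal U$ with $\xi\notin\mathcal D$, and the jump process condition that there exists an event of full $\mathbb P$-probability on which, for all $x,y\in\mathbb Z^2$, every point of $\operatorname{supp}\mu_{x,y}$ is isolated. Then the following hold for $\mathbb P$-almost every $\omega$ and all $\xi\in\operatorname{ri}\mathcal U$. (a) $\xi\in\mathcal V^\omega$ if and only if there exist $x,y\in\mathbb Z^2$ with $B^{\xi-}(x,y)\ne B^{\xi+}(x,y)$. (b) $\xi\in\mathcal V^\omega$ if and only if there exists $x\in\mathbb Z^2$ such that $\xi=\xi_*(T_x\omega)$. (c) If $\xi\in(\operatorname{ri}\mathcal U)\setminus\mathcal V^\omega$, then for each $x\in\mathbb Z^2$, $\gamma^{x,\xi}:=\gamma^{x,\xi-}=\gamma^{x,\xi+}$ and this is the unique $\mathcal U_\xi$-directed semi-infinite geodesic out of $x$. For any $x,y\in\mathbb Z^2$, $\gamma^{x,\xi}$ and $\gamma^{y,\xi}$ coalesce. (d) If $\xi\in\mathcal V^\omega$, then from each $x\in\mathbb Z^2$ there exist at least two $\xi$-directed semi-infinite geodesics that separate eventually, namely $\gamma^{x,\xi-}$ and $\gamma^{x,\xi+}$. For each pair $x,y\in\mathbb Z^2$, $\gamma^{x,\xi-}$ and $\gamma^{y,\xi-}$ coalesce and $\gamma^{x,\xi+}$ and $\gamma^{y,\xi+}$ coalesce.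
   Context: Directions. $e_1=e_+=(1,0)$, $e_2=e_-=(0,1)$, $\hat e=e_1+e_2$. $\mathcal U=\{te_1+(1-t)e_2:0\le t\le1\}$, $\operatorname{ri}\mathcal U=\mathcal U\setminus\{e_1,e_2\}$. For $\zeta,\eta\in\mathbb R^2$ with $\zeta\cdot\hat e=\eta\cdot\hat e$, $\zeta\prec\eta$ (resp. $\zeta\preceq\eta$) means $\zeta\cdot e_1<\eta\cdot e_1$ (resp. $\le$). Intervals $[\zeta,\eta]$, $]\zeta,\eta[$ etc. in $\mathcal U$ and monotone limits $\zeta\nearrow\xi$, $\zeta\searrow\xi$ refer to this order. Vector inequalities $x\le y$, $x<y$ are coordinatewise. $\sigma$ denotes a sign in $\{-,+\}$. Last-passage percolation. $(\Omega,\mathcal F,\mathbb P)$ is a Polish probability space with a group $\{T_x\}_{x\in\mathbb Z^2}$ of measurable $\mathbb P$-preserving bijections ($T_0=$ identity, $T_xT_y=T_{x+y}$) and real random variables (weights) $\omega_x$, $x\in\mathbb Z^2$, with $\omega_y(T_x\omega)=\omega_{x+y}(\omega)$, that are i.i.d. with continuous distribution, positive variance, and $\mathbb E|\omega_0|^p<\infty$ for some $p>2$. An up-right path has steps in $\{e_1,e_2\}$ and is indexed so that $\pi_k\cdot\hat e=k$. For $x\le y$, $k=x\cdot\hat e$, $m=y\cdot\hat e$, $G_{x,y}=\max\sum_{i=k}^{m-1}\omega_{\pi_i}$ over up-right paths from $x$ to $y$; a maximizer is a (finite) geodesic (a.s. unique). The shape function is the deterministic, concave, symmetric, 1-homogeneous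 $g:\mathbb R_+^2\to\mathbb R$ with a.s. $\lim_n\max_{x\in\mathbb Z_+^2,|x|_1=n}|G_{0,x}-g(x)|/n=0$. For $\xi\in\operatorname{ri}\mathcal U$: $\nabla g(\xi\pm)\cdot e_1=\lim_{\varepsilon\searrow0}\frac{g(\xi\pm\varepsilon e_1)-g(\xi)}{\pm\varepsilon}$, $\nabla g(\xi\pm)\cdot e_2=\lim_{\varepsilon\searrow0}\frac{g(\xi\mp\varepsilon e_2)-g(\xi)}{\mp\varepsilon}$. $\mathcal D=\{\xi\in\operatorname{ri}\mathcal U: g\text{ differentiable at }\xi\}$. $\mathcal U_{\xi\sigma}=\{\zeta\in\operatorname{ri}\mathcal U:g(\zeta)-g(\xi)=\nabla g(\xi\sigma)\cdot(\zeta-\xi)\}$, $\mathcal U_\xi=\mathcal U_{\xi-}\cup\mathcal U_{\xi+}=[\underline\xi,\overline\xi]$. $g$ is strictly concave at $\xi$ if $\mathcal U_\xi=\{\xi\}$. Busemann process. On $\Omega$ there is a fixed family of real random variables $B^{\xi\sigma}(x,y)=B^{\xi\sigma}_{x,y}$ ($x,y\in\mathbb Z^2$, $\xi\in\operatorname{ri}\mathcal U$, $\sigma\in\{-,+\}$), measurable in $(x,y,\omega,\xi)$, constructed in earlier work, with these properties. (B1) On one $T$-invariant event of probability one, for all $x,y,z,\xi,\sigma$: $B^{\xi\sigma}(x+z,y+z,\omega)=B^{\xi\sigma}(x,y,T_z\omega)$; $B^{\xi\sigma}(x,y)+B^{\xi\sigma}(y,z)=B^{\xi\sigma}(x,z)$;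 $\min_{i}B^{\xi\sigma}(x,x+e_i)=\omega_x$; for $\xi\prec\xi'$, $B^{\xi-}(x,x+e_1)\ge B^{\xi+}(x,x+e_1)\ge B^{\xi'-}(x,x+e_1)\ge B^{\xi'+}(x,x+e_1)$ and the reversed inequalities with $e_2$ in place of $e_1$; $B^{\xi-}(x,y)=\lim_{\zeta\nearrow\xi}B^{\zeta\sigma}(x,y)$ and $B^{\xi+}(x,y)=\lim_{\zeta\searrow\xi}B^{\zeta\sigma}(x,y)$; $B^{\xi\sigma}(x,x+e_i)\to\infty$ as $\xi\to e_{3-i}$. (B2) $B^{\xi\sigma}(x,y)$ is integrable and $\mathbb E[B^{\xi\sigma}(x,x+e_i)]=\nabla g(\xi\sigma)\cdot e_i$. (B3) If $\nabla g(\zeta\sigma)=\nabla g(\eta\sigma)$ then $B^{\zeta\sigma}\equiv B^{\eta\sigma}$. (B4) For any $I\subset\mathbb Z^2$, $\{(\omega_x,B^{\xi\sigma}(x,y)):x\in I,y\ge x,\sigma,\xi\}$ is independent of $\{\omega_x: x\not\ge z\ \forall z\in I\}$. (B5) For each fixed $\xi$, a.s.: $B^{\xi\sigma}(x,x+e_1)\ne B^{\xi\sigma}(x,x+e_2)$ for all $x,\sigma$; $n^{-1}\max_{x\in\mathbb Z_+^2,|x|_1=n}|B^{\xi\sigma}(0,x)-x\cdot\nabla g(\xi\sigma)|\to0$; if $\xi\in\mathcal D$ then $B^{\xi+}=B^{\xi-}$; if $\xi,\underline\xi,\overline\xi\in\mathcal D$ then $B^{\xi\pm}(x,y)=\lim_n(G_{x,v_n}-G_{y,v_n})$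 whenever $|v_n|\to\infty$, $v_n/n\to\xi$. Geodesics. A semi-infinite geodesic out of $x$ is a semi-infinite up-right path started at $x$ all of whose finite segments are geodesics. It is directed into $\mathcal A\subset\mathcal U$ ($\mathcal A$-directed) if all limit points of $\pi_n/n$ as $n\to\infty$ lie in $\mathcal A$; $\xi$-directed means $\pi_n/n\to\xi$. Two semi-infinite paths $\pi,\pi'$ coalesce if there is $k$ with $\pi_n=\pi'_n$ for all $n\ge k$. The Busemann geodesic $\gamma^{x,\xi\sigma}$ starts at $x$ and from its current point $z$ steps to $z+e_1$ if $B^{\xi\sigma}(z,z+e_1)<B^{\xi\sigma}(z,z+e_2)$, to $z+e_2$ if $>$ holds, and to $z+e_\sigma$ if equality holds; it is a.s. a semi-infinite geodesic. Competition interface direction. $\xi_*(\omega)\in\operatorname{ri}\mathcal U$ is the (a.s. existing and unique) direction such that $B^{\zeta\pm}(e_1,e_2)<0$ if $\zeta\prec\xi_*(\omega)$ and $B^{\zeta\pm}(e_1,e_2)>0$ if $\zeta\succ\xi_*(\omega)$. Busemann measures. For $x,y\in\mathbb Z^2$ and a compact interval $K\subset\operatorname{ri}\mathcal U$, $\mu^K_{x,y}$ is the signed measure on $K$ with $\mu^K_{x,y}(]\zeta,\eta])=B^{\eta+}_{x,y}-B^{\zeta+}_{x,y}$ and $\mu^K_{x,y}([\zeta,\eta[)=B^{\eta-}_{x,y}-B^{\zeta-}_{x,y}$ for $\zeta\prec\eta$, $[\zeta,\eta]\subset K$. $\operatorname{supp}\mu_{x,y}=\bigcup_{\zeta\prec\eta\text{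 in }\operatorname{ri}\mathcal U}\operatorname{supp}\mu^{[\zeta,\eta]}_{x,y}$, where the support of a signed measure is the smallest closed set whose complement has zero total variation measure. $\mathcal V^\omega=\bigcup_{x,y\in\mathbb Z^2}\operatorname{supp}\mu_{x,y}\subset\operatorname{ri}\mathcal U$. *)

theory Defs
  imports "HOL-Probability.Probability"
begin

subsection \<open>Sites, directions, shape function\<close>

text \<open>The order \<open>\<le>\<close> on pairs is the coordinatewise one throughout.\<close>

type_synonym site = "int \<times> int"
type_synonym vec = "real \<times> real"

datatype side = Minus | Plus

fun side_sign :: "side \<Rightarrow> real" where
  "side_sign Minus = -1"
| "side_sign Plus = 1"

definition e1 :: "'a::zero_neq_one \<times> 'a" where "e1 = (1, 0)"
definition e2 :: "'a::zero_neq_one \<times> 'a" where "e2 = (0, 1)"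

fun e_side :: "side \<Rightarrow> site" where
  "e_side Minus = e2"
| "e_side Plus = e1"

definition level :: "site \<Rightarrow> int" where
  "level x = fst x + snd x"

definition real_site :: "site \<Rightarrow> vec" where
  "real_site x = (of_int (fst x), of_int (snd x))"

definition quadrant_layer :: "nat \<Rightarrow> site set" where
  "quadrant_layer n = {x. 0 \<le> x \<and> \<bar>fst x\<bar> + \<bar>snd x\<bar> = int n}"

definition dirs :: "vec set" where
  "dirs = {t *\<^sub>R e1 + (1 - t) *\<^sub>R e2 | t. 0 \<le> t \<and> t \<le> 1}"

definition ri_dirs :: "vec set" where
  "ri_dirs = dirs - {e1, e2}"

definition dir_less :: "vec \<Rightarrow> vec \<Rightarrow> bool" (infix \<open>\<prec>\<close> 50) where
  "\<zeta> \<prec> \<eta> \<longleftrightarrow> \<zeta> \<bullet> (e1 + e2) = \<eta> \<bullet> (e1 + e2) \<and> \<zeta> \<bullet> e1 < \<eta> \<bullet> e1"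

definition dir_le :: "vec \<Rightarrow> vec \<Rightarrow> bool" (infix \<open>\<preceq>\<close> 50) where
  "\<zeta> \<preceq> \<eta> \<longleftrightarrow> \<zeta> \<bullet> (e1 + e2) = \<eta> \<bullet> (e1 + e2) \<and> \<zeta> \<bullet> e1 \<le> \<eta> \<bullet> e1"

definition dir_Icc :: "vec \<Rightarrow> vec \<Rightarrow> vec set" where
  "dir_Icc \<zeta> \<eta> = {\<theta> \<in> dirs. \<zeta> \<preceq> \<theta> \<and> \<theta> \<preceq> \<eta>}"

definition dir_Ioc :: "vec \<Rightarrow> vec \<Rightarrow> vec set" where
  "dir_Ioc \<zeta> \<eta> = {\<theta> \<in> dirs. \<zeta> \<prec> \<theta> \<and> \<theta> \<preceq> \<eta>}"

definition dir_Ico :: "vec \<Rightarrow> vec \<Rightarrow> vec set" where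
  "dir_Ico \<zeta> \<eta> = {\<theta> \<in> dirs. \<zeta> \<preceq> \<theta> \<and> \<theta> \<prec> \<eta>}"

text \<open>The filters of \<open>\<zeta> \<nearrow> \<xi>\<close> and \<open>\<zeta> \<searrow> \<xi>\<close>; \<open>\<xi>\<close> itself is excluded.\<close>

definition dir_at_left :: "vec \<Rightarrow> vec filter" where
  "dir_at_left \<xi> = (at \<xi> within {\<zeta> \<in> ri_dirs. \<zeta> \<prec> \<xi>})"

definition dir_at_right :: "vec \<Rightarrow> vec filter" where
  "dir_at_right \<xi> = (at \<xi> within {\<zeta> \<in> ri_dirs. \<xi> \<prec> \<zeta>})"

text \<open>The one-sided gradient \<open>\<nabla>g(\<xi>\<sigma>)\<close>: moving towards larger \<open>\<xi>\<close> means increasing the first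
  and decreasing the second coordinate.\<close>

definition side_grad :: "(vec \<Rightarrow> real) \<Rightarrow> vec \<Rightarrow> side \<Rightarrow> vec" where
  "side_grad g \<xi> \<sigma> =
    (let s = side_sign \<sigma> in
      (Lim (at_right 0) (\<lambda>\<epsilon>. (g (\<xi> + (s * \<epsilon>) *\<^sub>R e1) - g \<xi>) / (s * \<epsilon>)),
       Lim (at_right 0) (\<lambda>\<epsilon>. (g (\<xi> - (s * \<epsilon>) *\<^sub>R e2) - g \<xi>) / (- (s * \<epsilon>)))))"

definition diff_dirs :: "(vec \<Rightarrow> real) \<Rightarrow> vec set" where
  "diff_dirs g = {\<xi> \<in> ri_dirs. g differentiable (at \<xi>)}"

definition side_facet :: "(vec \<Rightarrow> real) \<Rightarrow> vec \<Rightarrow> side \<Rightarrow> vec set" where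
  "side_facet g \<xi> \<sigma> = {\<zeta> \<in> ri_dirs. g \<zeta> - g \<xi> = side_grad g \<xi> \<sigma> \<bullet> (\<zeta> - \<xi>)}"

definition facet :: "(vec \<Rightarrow> real) \<Rightarrow> vec \<Rightarrow> vec set" where
  "facet g \<xi> = side_facet g \<xi> Minus \<union> side_facet g \<xi> Plus"

definition strictly_concave_at :: "(vec \<Rightarrow> real) \<Rightarrow> vec \<Rightarrow> bool" where
  "strictly_concave_at g \<xi> \<longleftrightarrow> facet g \<xi> = {\<xi>}"


subsection \<open>Up-right paths, last-passage times, geodesics\<close>

text \<open>A path is a function on \<^typ>\<open>int\<close> of which only the values on its index set matter;
  the point with index \<open>k\<close> lies on level \<open>k\<close>. A weight configuration is a function
  \<open>W :: site \<Rightarrow> real\<close>.\<close>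

definition up_right_on :: "int set \<Rightarrow> (int \<Rightarrow> site) \<Rightarrow> bool" where
  "up_right_on I \<pi> \<longleftrightarrow>
    (\<forall>k\<in>I. level (\<pi> k) = k \<and> (k + 1 \<in> I \<longrightarrow> \<pi> (k + 1) - \<pi> k \<in> {e1, e2}))"

definition up_right_paths :: "site \<Rightarrow> site \<Rightarrow> (int \<Rightarrow> site) set" where
  "up_right_paths x y =
    {\<pi>. up_right_on {level x..level y} \<pi> \<and> \<pi> (level x) = x \<and> \<pi> (level y) = y}"

definition path_weight :: "(site \<Rightarrow> real) \<Rightarrow> (int \<Rightarrow> site) \<Rightarrow> int \<Rightarrow> int \<Rightarrow> real" where
  "path_weight W \<pi> k m = (\<Sum>i\<in>{k..<m}. W (\<pi> i))"

text \<open>Only meaningful for \<open>x \<le> y\<close>; the set of weights is then finite and nonempty.\<close>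

definition LPP :: "(site \<Rightarrow> real) \<Rightarrow> site \<Rightarrow> site \<Rightarrow> real" where
  "LPP W x y = Max ((\<lambda>\<pi>. path_weight W \<pi> (level x) (level y)) ` up_right_paths x y)"

definition semi_infinite_geodesic :: "(site \<Rightarrow> real) \<Rightarrow> site \<Rightarrow> (int \<Rightarrow> site) \<Rightarrow> bool" where
  "semi_infinite_geodesic W x \<pi> \<longleftrightarrow>
    up_right_on {level x..} \<pi> \<and> \<pi> (level x) = x \<and>
    (\<forall>k m. level x \<le> k \<and> k \<le> m \<longrightarrow> path_weight W \<pi> k m = LPP W (\<pi> k) (\<pi> m))"

definition directed_into :: "(int \<Rightarrow> site) \<Rightarrow> vec set \<Rightarrow> bool" where
  "directed_into \<pi> A \<longleftrightarrow>
    (\<forall>r l. strict_mono (r :: nat \<Rightarrow> nat) \<and>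
           (\<lambda>n. real_site (\<pi> (int (r n))) /\<^sub>R real (r n)) \<longlonglongrightarrow> l \<longrightarrow> l \<in> A)"

definition directed_to :: "(int \<Rightarrow> site) \<Rightarrow> vec \<Rightarrow> bool" where
  "directed_to \<pi> \<xi> \<longleftrightarrow> (\<lambda>n::nat. real_site (\<pi> (int n)) /\<^sub>R real n) \<longlonglongrightarrow> \<xi>"

definition coalesce :: "(int \<Rightarrow> site) \<Rightarrow> (int \<Rightarrow> site) \<Rightarrow> bool" where
  "coalesce \<pi> \<pi>' \<longleftrightarrow> (\<exists>k. \<forall>n\<ge>k. \<pi> n = \<pi>' n)"

definition separate_eventually :: "(int \<Rightarrow> site) \<Rightarrow> (int \<Rightarrow> site) \<Rightarrow> bool" where
  "separate_eventually \<pi> \<pi>' \<longleftrightarrow> (\<exists>k. \<forall>n\<ge>k. \<pi> n \<noteq> \<pi>' n)"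


subsection \<open>The probability space, the shape function and the Busemann process\<close>

locale lpp_model = prob_space M
  for M :: "'w::polish_space measure" +
  fixes T :: "site \<Rightarrow> 'w \<Rightarrow> 'w"
    and w :: "site \<Rightarrow> 'w \<Rightarrow> real"
  assumes sets_borel: "sets M = sets borel"
    and T_bij: "bij (T x)"
    and T_measurable: "T x \<in> measurable M M"
    and T_preserving: "distr M M (T x) = M"
    and T_zero: "T 0 = id"
    and T_add: "T x \<circ> T y = T (x + y)"
    and w_shift: "w y (T x \<omega>) = w (x + y) \<omega>"
    and w_measurable: "w x \<in> borel_measurable M"
    and w_indep: "indep_vars (\<lambda>_. borel) w UNIV"
    and w_ident: "distr M borel (w x) = distr M borel (w y)"
    and w_continuous: "continuous_on UNIV (cdf (distr M borel (w 0)))"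
    and w_variance: "variance (w 0) > 0"
    and w_moment: "\<exists>p>2. integrable M (\<lambda>\<omega>. \<bar>w 0 \<omega>\<bar> powr p)"

locale lpp_shape = lpp_model M T w
  for M :: "'w::polish_space measure" and T w +
  fixes g :: "vec \<Rightarrow> real"
  assumes g_concave: "concave_on {0..} g"
    and g_symmetric: "0 \<le> (a, b) \<Longrightarrow> g (a, b) = g (b, a)"
    and g_homogeneous: "0 \<le> p \<Longrightarrow> 0 < c \<Longrightarrow> g (c *\<^sub>R p) = c * g p"
    and g_limit: "AE \<omega> in M.
      (\<lambda>n. Max ((\<lambda>x. \<bar>LPP (\<lambda>z. w z \<omega>) 0 x - g (real_site x)\<bar>) ` quadrant_layer n) / real n)
        \<longlonglongrightarrow> 0"

definition generated_events :: "'w measure \<Rightarrow> ('w \<Rightarrow> real) set \<Rightarrow> 'w set set" where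
  "generated_events M F =
    sigma_sets (space M) {f -` A \<inter> space M | f A. f \<in> F \<and> A \<in> sets borel}"

text \<open>\<open>B \<xi> \<sigma> x y \<omega>\<close> is the Busemann process \<open>B\<^sup>\<xi>\<^sup>\<sigma>(x, y)\<close>; it is only meaningful for
  \<open>\<xi> \<in> ri_dirs\<close>. In the last assumption \<open>\<alpha>\<close> and \<open>\<beta>\<close> are the endpoints of the facet of \<open>\<xi>\<close>.\<close>

locale busemann_process = lpp_shape M T w g
  for M :: "'w::polish_space measure" and T w g +
  fixes B :: "vec \<Rightarrow> side \<Rightarrow> site \<Rightarrow> site \<Rightarrow> 'w \<Rightarrow> real"
  assumes B_measurable:
    "(\<lambda>(x, y, \<omega>, \<xi>). B \<xi> \<sigma> x y \<omega>) \<in> borel_measurable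
       (count_space UNIV \<Otimes>\<^sub>M count_space UNIV \<Otimes>\<^sub>M M \<Otimes>\<^sub>M restrict_space borel ri_dirs)"
    and B_regular: "\<exists>\<Omega>\<^sub>0\<in>sets M. prob \<Omega>\<^sub>0 = 1 \<and> (\<forall>z. T z -` \<Omega>\<^sub>0 = \<Omega>\<^sub>0) \<and>
      (\<forall>\<omega>\<in>\<Omega>\<^sub>0. \<forall>\<xi>\<in>ri_dirs.
        (\<forall>\<sigma> x y z. B \<xi> \<sigma> (x + z) (y + z) \<omega> = B \<xi> \<sigma> x y (T z \<omega>)) \<and>
        (\<forall>\<sigma> x y z. B \<xi> \<sigma> x y \<omega> + B \<xi> \<sigma> y z \<omega> = B \<xi> \<sigma> x z \<omega>) \<and>
        (\<forall>\<sigma> x. min (B \<xi> \<sigma> x (x + e1) \<omega>) (B \<xi> \<sigma> x (x + e2) \<omega>) = w x \<omega>) \<and>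
        (\<forall>\<xi>'\<in>ri_dirs. \<xi> \<prec> \<xi>' \<longrightarrow> (\<forall>x.
           B \<xi> Minus x (x + e1) \<omega> \<ge> B \<xi> Plus x (x + e1) \<omega> \<and>
           B \<xi> Plus x (x + e1) \<omega> \<ge> B \<xi>' Minus x (x + e1) \<omega> \<and>
           B \<xi>' Minus x (x + e1) \<omega> \<ge> B \<xi>' Plus x (x + e1) \<omega> \<and>
           B \<xi> Minus x (x + e2) \<omega> \<le> B \<xi> Plus x (x + e2) \<omega> \<and>
           B \<xi> Plus x (x + e2) \<omega> \<le> B \<xi>' Minus x (x + e2) \<omega> \<and>
           B \<xi>' Minus x (x + e2) \<omega> \<le> B \<xi>' Plus x (x + e2) \<omega>)) \<and>
        (\<forall>\<sigma> x y. ((\<lambda>\<zeta>. B \<zeta> \<sigma> x y \<omega>) \<longlongrightarrow> B \<xi> Minus x y \<omega>) (dir_at_left \<xi>)) \<and>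
        (\<forall>\<sigma> x y. ((\<lambda>\<zeta>. B \<zeta> \<sigma> x y \<omega>) \<longlongrightarrow> B \<xi> Plus x y \<omega>) (dir_at_right \<xi>))) \<and>
      (\<forall>\<omega>\<in>\<Omega>\<^sub>0. \<forall>\<sigma> x.
        filterlim (\<lambda>\<xi>. B \<xi> \<sigma> x (x + e1) \<omega>) at_top (at e2 within ri_dirs) \<and>
        filterlim (\<lambda>\<xi>. B \<xi> \<sigma> x (x + e2) \<omega>) at_top (at e1 within ri_dirs))"
    and B_integrable: "\<xi> \<in> ri_dirs \<Longrightarrow> integrable M (B \<xi> \<sigma> x y)"
    and B_mean: "\<xi> \<in> ri_dirs \<Longrightarrow>
      expectation (B \<xi> \<sigma> x (x + e1)) = side_grad g \<xi> \<sigma> \<bullet> e1 \<and>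
      expectation (B \<xi> \<sigma> x (x + e2)) = side_grad g \<xi> \<sigma> \<bullet> e2"
    and B_grad: "\<zeta> \<in> ri_dirs \<Longrightarrow> \<eta> \<in> ri_dirs \<Longrightarrow>
      side_grad g \<zeta> \<sigma> = side_grad g \<eta> \<sigma> \<Longrightarrow> B \<zeta> \<sigma> = B \<eta> \<sigma>"
    and B_indep: "indep_set
      (generated_events M
        ({w x | x. x \<in> I} \<union> {B \<xi> \<sigma> x y | \<xi> \<sigma> x y. \<xi> \<in> ri_dirs \<and> x \<in> I \<and> x \<le> y}))
      (generated_events M {w x | x. \<forall>z\<in>I. \<not> z \<le> x})"
    and B_fixed_dir: "\<xi> \<in> ri_dirs \<Longrightarrow> AE \<omega> in M.
      (\<forall>\<sigma> x. B \<xi> \<sigma> x (x + e1) \<omega> \<noteq> B \<xi> \<sigma> x (x + e2) \<omega>) \<and>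
      (\<forall>\<sigma>. (\<lambda>n. Max ((\<lambda>x. \<bar>B \<xi> \<sigma> 0 x \<omega> - real_site x \<bullet> side_grad g \<xi> \<sigma>\<bar>) ` quadrant_layer n)
               / real n) \<longlonglongrightarrow> 0) \<and>
      (\<xi> \<in> diff_dirs g \<longrightarrow> (\<forall>x y. B \<xi> Plus x y \<omega> = B \<xi> Minus x y \<omega>)) \<and>
      (\<forall>\<alpha> \<beta>. facet g \<xi> = dir_Icc \<alpha> \<beta> \<and> {\<xi>, \<alpha>, \<beta>} \<subseteq> diff_dirs g \<longrightarrow>
        (\<forall>v :: nat \<Rightarrow> site.
          filterlim (\<lambda>n. norm (real_site (v n))) at_top sequentially \<and>
          (\<lambda>n. real_site (v n) /\<^sub>R real n) \<longlonglongrightarrow> \<xi> \<longrightarrow>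
          (\<forall>\<sigma> x y. (\<lambda>n. LPP (\<lambda>z. w z \<omega>) x (v n) - LPP (\<lambda>z. w z \<omega>) y (v n))
                     \<longlonglongrightarrow> B \<xi> \<sigma> x y \<omega>)))"


subsection \<open>Busemann geodesics and competition interface directions\<close>

definition busemann_step :: "(site \<Rightarrow> site \<Rightarrow> real) \<Rightarrow> side \<Rightarrow> site \<Rightarrow> site" where
  "busemann_step b \<sigma> z =
    (if b z (z + e1) < b z (z + e2) then z + e1
     else if b z (z + e1) > b z (z + e2) then z + e2
     else z + e_side \<sigma>)"

text \<open>The path \<open>\<gamma>\<^sup>x\<^sup>,\<^sup>\<xi>\<^sup>\<sigma>\<close>, indexed by level; it is constant before its first index
  \<^term>\<open>level x\<close>.\<close>

definition busemann_geodesic ::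
  "(vec \<Rightarrow> side \<Rightarrow> site \<Rightarrow> site \<Rightarrow> 'w \<Rightarrow> real) \<Rightarrow> 'w \<Rightarrow> site \<Rightarrow> vec \<Rightarrow> side \<Rightarrow> int \<Rightarrow> site" where
  "busemann_geodesic B \<omega> x \<xi> \<sigma> k =
    (busemann_step (\<lambda>y z. B \<xi> \<sigma> y z \<omega>) \<sigma> ^^ nat (k - level x)) x"

definition cif_dir :: "(vec \<Rightarrow> side \<Rightarrow> site \<Rightarrow> site \<Rightarrow> 'w \<Rightarrow> real) \<Rightarrow> 'w \<Rightarrow> vec" where
  "cif_dir B \<omega> = (THE \<xi>. \<xi> \<in> ri_dirs \<and>
    (\<forall>\<zeta>\<in>ri_dirs. \<forall>\<sigma>. (\<zeta> \<prec> \<xi> \<longrightarrow> B \<zeta> \<sigma> e1 e2 \<omega> < 0) \<and> (\<xi> \<prec> \<zeta> \<longrightarrow> B \<zeta> \<sigma> e1 e2 \<omega> > 0)))"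


subsection \<open>Busemann measures\<close>

definition signed_measure :: "'a measure \<Rightarrow> ('a set \<Rightarrow> real) \<Rightarrow> bool" where
  "signed_measure N m \<longleftrightarrow>
    m {} = 0 \<and>
    (\<forall>A :: nat \<Rightarrow> 'a set. range A \<subseteq> sets N \<and> disjoint_family A \<longrightarrow>
       (\<lambda>n. m (A n)) sums m (\<Union>n. A n))"

definition total_variation :: "'a measure \<Rightarrow> ('a set \<Rightarrow> real) \<Rightarrow> 'a set \<Rightarrow> ennreal" where
  "total_variation N m A =
    (SUP P\<in>{P. finite P \<and> disjoint P \<and> P \<subseteq> sets N \<and> \<Union>P = A}. \<Sum>E\<in>P. ennreal \<bar>m E\<bar>)"

text \<open>The support of a signed Borel measure on \<open>K\<close>. The intersection of all closed sets with null
  complement is itself one of them, since the topology has a countable base.\<close>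

definition signed_support :: "vec set \<Rightarrow> (vec set \<Rightarrow> real) \<Rightarrow> vec set" where
  "signed_support K m =
    \<Inter>{C. closedin (top_of_set K) C \<and> total_variation (restrict_space borel K) m (K - C) = 0}"

text \<open>\<open>f \<xi> \<sigma>\<close> stands for \<open>B\<^sup>\<xi>\<^sup>\<sigma>(x, y)\<close> with \<open>x\<close>, \<open>y\<close>, \<open>\<omega>\<close> fixed. The conditions determine the
  signed measure on the Borel sets of a nondegenerate interval \<open>K\<close>, the only values that matter
  for the support.\<close>

definition busemann_measure :: "(vec \<Rightarrow> side \<Rightarrow> real) \<Rightarrow> vec set \<Rightarrow> vec set \<Rightarrow> real" where
  "busemann_measure f K = (SOME m. signed_measure (restrict_space borel K) m \<and>
    (\<forall>\<zeta>\<in>K. \<forall>\<eta>\<in>K. \<zeta> \<prec> \<eta> \<longrightarrow>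
       m (dir_Ioc \<zeta> \<eta>) = f \<eta> Plus - f \<zeta> Plus \<and>
       m (dir_Ico \<zeta> \<eta>) = f \<eta> Minus - f \<zeta> Minus))"

definition busemann_support ::
  "(vec \<Rightarrow> side \<Rightarrow> site \<Rightarrow> site \<Rightarrow> 'w \<Rightarrow> real) \<Rightarrow> 'w \<Rightarrow> site \<Rightarrow> site \<Rightarrow> vec set" where
  "busemann_support B \<omega> x y =
    \<Union>{signed_support (dir_Icc \<zeta> \<eta>) (busemann_measure (\<lambda>\<xi> \<sigma>. B \<xi> \<sigma> x y \<omega>) (dir_Icc \<zeta> \<eta>))
       | \<zeta> \<eta>. \<zeta> \<in> ri_dirs \<and> \<eta> \<in> ri_dirs \<and> \<zeta> \<prec> \<eta>}"

definition exceptional_dirs ::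
  "(vec \<Rightarrow> side \<Rightarrow> site \<Rightarrow> site \<Rightarrow> 'w \<Rightarrow> real) \<Rightarrow> 'w \<Rightarrow> vec set" where
  "exceptional_dirs B \<omega> = (\<Union>x y. busemann_support B \<omega> x y)"

definition regularity_condition :: "(vec \<Rightarrow> real) \<Rightarrow> bool" where
  "regularity_condition g \<longleftrightarrow> (\<forall>\<xi>\<in>ri_dirs. \<xi> \<notin> diff_dirs g \<longrightarrow> strictly_concave_at g \<xi>)"

definition jump_process_condition ::
  "'w measure \<Rightarrow> (vec \<Rightarrow> side \<Rightarrow> site \<Rightarrow> site \<Rightarrow> 'w \<Rightarrow> real) \<Rightarrow> bool" where
  "jump_process_condition M B \<longleftrightarrow>
    (AE \<omega> in M. \<forall>x y. \<forall>\<xi>\<in>busemann_support B \<omega> x y. \<xi> isolated_in busemann_support B \<omega> x y)"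

end

theory Submission
  imports Defs
begin

text \<open>Directions are written \<open>(t, 1 - t)\<close> with \<open>0 < t < 1\<close>.

  For a fixed direction, Busemann geodesics coalesce. A site whose two upper neighbours start
  geodesics that never meet has a parent and at least one child of the same kind in the dual forest;
  by stationarity such sites have the same density on every level, so no site has two children and
  dual paths never merge. Hence, if two such sites exist with positive probability, the gap between
  them is crossed by geodesics coming from arbitrarily far below. But raising the weights on three sides of a large rectangle around the gap,
  which is independent of the Busemann functions above these sides, makes every such geodesic
  avoid the gap.

  The rest is deterministic, on the event where rational directions behave well. The jump condition
  makes \<open>t \<mapsto> B(x, y)\<close> constant on both sides of each \<open>t\<close>. Since the coalescence point of two
  geodesics is determined by the value of \<open>B\<close> and generic weights, geodesics in nearby
  rational directions coalesce at a fixed place, and letting the direction tend to \<open>t\<close> yields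
  coalescence in every direction and on both sides. A jump at \<open>t\<close> thus forces the two geodesics
  from some site to differ, which means that \<open>t\<close> is the competition interface direction there,
  and conversely. Monotonicity in \<open>t\<close> squeezes every geodesic directed into the facet between the
  two Busemann geodesics.\<close>

section \<open>Paths and cocycles\<close>

text \<open>The obstacle is that coalescence, absence of ties and linear growth of \<open>B\<close>
  are known only almost surely for one direction at a time, while the assertions concern uncountably
  many directions at once, including random ones. Hence everything about an exceptional direction is
  read off from the rational directions on either side of it.

  Ergodicity is not assumed, so there are no zero-one laws. Stationarity alone carries the density
  argument, and two boundary sites on one level are found by comparing infinitely many events of
  equal positive probability. Raising weights is legitimate because \<open>B_indep\<close> makes the
  Busemann functions on and above a level independent of the weights below it; so the contradiction
  uses only boundary information from level 0 upwards and bounds for paths that avoid the changed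
  sites.

  Generic weights give uniqueness of geodesics between any two points, for all pairs at once.
  Transposing the lattice exchanges the two sides of a direction, so that one-sided arguments are
  carried out on the right only.\<close>

lemma level_simps [simp]:
  "level (x + y) = level x + level y" "level (x - y) = level x - level y"
  "level e1 = 1" "level e2 = 1" "level 0 = 0"
  by (auto simp: level_def e1_def e2_def)

lemma site_simps [simp]:
  "fst (e1 :: site) = 1" "snd (e1 :: site) = 0" "fst (e2 :: site) = 0" "snd (e2 :: site) = 1"
  by (auto simp: e1_def e2_def)

lemma e1_neq_e2 [simp]: "(e1 :: site) \<noteq> e2" "(e2 :: site) \<noteq> e1"
  by (auto simp: e1_def e2_def)

lemma site_eqI: "level x = level y \<Longrightarrow> fst x = fst y \<Longrightarrow> x = (y :: site)"
  by (auto simp: level_def prod_eq_iff)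

text \<open>Linear independence of the weights over the integers. Multisets fit because a path
  weight is a sum over the visited sites, and an equation between differences of path weights
  becomes one between multiset sums after moving terms across.\<close>

definition generic_weights :: "(site \<Rightarrow> real) \<Rightarrow> bool" where
  "generic_weights W \<longleftrightarrow> (\<forall>P Q :: site multiset. (\<Sum>x\<in>#P. W x) = (\<Sum>x\<in>#Q. W x) \<longrightarrow> P = Q)"

definition path_mset :: "(int \<Rightarrow> site) \<Rightarrow> int \<Rightarrow> int \<Rightarrow> site multiset" where
  "path_mset \<pi> k m = image_mset \<pi> (mset_set {k..<m})"

lemma path_weight_mset: "path_weight W \<pi> k m = (\<Sum>x\<in>#path_mset \<pi> k m. W x)"
  by (simp add: path_weight_def path_mset_def sum_unfold_sum_mset multiset.map_comp o_def)

lemma in_path_mset: "x \<in># path_mset \<pi> k m \<longleftrightarrow> (\<exists>i. k \<le> i \<and> i < m \<and> x = \<pi> i)"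
  by (auto simp: path_mset_def)

lemma up_right_on_subset: "up_right_on I \<pi> \<Longrightarrow> J \<subseteq> I \<Longrightarrow> up_right_on J \<pi>"
  by (auto simp: up_right_on_def)

lemma up_right_on_level: "up_right_on I \<pi> \<Longrightarrow> k \<in> I \<Longrightarrow> level (\<pi> k) = k"
  by (auto simp: up_right_on_def)

lemma up_right_on_step:
  "up_right_on I \<pi> \<Longrightarrow> k \<in> I \<Longrightarrow> k + 1 \<in> I \<Longrightarrow> \<pi> (k + 1) = \<pi> k + e1 \<or> \<pi> (k + 1) = \<pi> k + e2"
  by (auto simp: up_right_on_def algebra_simps)

lemma up_right_on_mono:
  assumes "up_right_on I \<pi>" "{k..m} \<subseteq> I" "k \<le> m"
  shows "\<pi> k \<le> \<pi> m"
  using assms(3,2)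
proof (induction m rule: int_ge_induct)
  case base
  then show ?case by simp
next
  case (step m)
  have "\<pi> m \<le> \<pi> (m + 1)"
  proof -
    have "m \<in> I" "m + 1 \<in> I" using step by (auto simp: subset_iff)
    then show ?thesis using up_right_on_step[OF assms(1), of m] by (auto simp: less_eq_prod_def)
  qed
  moreover have "\<pi> k \<le> \<pi> m" using step by (intro step.IH) (auto simp: subset_iff)
  ultimately show ?case by simp
qed

text \<open>Paths have arbitrary values off their index set, so there are infinitely many of them;
  only their weights are finite in number. Restriction to the index set puts every path into a
  finite space of functions into a rectangle.\<close>

lemma finite_path_weights:
  "finite ((\<lambda>\<pi>. path_weight W \<pi> (level x) (level y)) ` up_right_paths x y)"
proof -
  let ?I = "{level x..<level y}"
  have "(\<lambda>\<pi>. path_weight W \<pi> (level x) (level y)) ` up_right_paths x y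
      \<subseteq> (\<lambda>\<pi>. path_weight W \<pi> (level x) (level y)) ` (?I \<rightarrow>\<^sub>E ({fst x..fst y} \<times> {snd x..snd y}))"
  proof (intro image_subsetI)
    fix \<pi> assume p: "\<pi> \<in> up_right_paths x y"
    have "path_weight W \<pi> (level x) (level y) = path_weight W (restrict \<pi> ?I) (level x) (level y)"
      by (auto simp: path_weight_def)
    moreover have "restrict \<pi> ?I \<in> ?I \<rightarrow>\<^sub>E ({fst x..fst y} \<times> {snd x..snd y})"
    proof (intro restrict_PiE_iff[THEN iffD2] ballI)
      fix k assume k: "k \<in> ?I"
      have u: "up_right_on {level x..level y} \<pi>" "\<pi> (level x) = x" "\<pi> (level y) = y"
        using p by (auto simp: up_right_paths_def)
      have "\<pi> (level x) \<le> \<pi> k" "\<pi> k \<le> \<pi> (level y)"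
        using k by (auto intro!: up_right_on_mono[OF u(1)])
      then show "\<pi> k \<in> {fst x..fst y} \<times> {snd x..snd y}"
        using u by (auto simp: less_eq_prod_def mem_Times_iff)
    qed
    ultimately show "path_weight W \<pi> (level x) (level y)
        \<in> (\<lambda>\<pi>. path_weight W \<pi> (level x) (level y)) ` (?I \<rightarrow>\<^sub>E ({fst x..fst y} \<times> {snd x..snd y}))"
      by blast
  qed
  then show ?thesis
    by (rule finite_subset) (auto intro!: finite_imageI finite_PiE)
qed

lemma LPP_eqI:
  assumes "\<pi> \<in> up_right_paths x y"
    "\<And>\<pi>'. \<pi>' \<in> up_right_paths x y \<Longrightarrow>
      path_weight W \<pi>' (level x) (level y) \<le> path_weight W \<pi> (level x) (level y)"
  shows "path_weight W \<pi> (level x) (level y) = LPP W x y"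
  unfolding LPP_def using assms by (intro Max_eqI[symmetric] finite_path_weights) auto

text \<open>The level of a site is its index on the path, so a common site is visited at the same
  index by both paths.\<close>

lemma path_mset_inj:
  assumes "up_right_on {k..<m} \<pi>" "up_right_on {k..<m} \<pi>'" "path_mset \<pi> k m \<subseteq># path_mset \<pi>' k m"
    "k \<le> i" "i < m"
  shows "\<pi> i = \<pi>' i"
proof -
  have "\<pi> i \<in># path_mset \<pi>' k m" 
    by (rule mset_subset_eqD[OF assms(3)]) (use assms in \<open>auto simp: in_path_mset\<close>)
  then obtain j where j: "k \<le> j" "j < m" "\<pi> i = \<pi>' j" by (auto simp: in_path_mset)
  have "level (\<pi> i) = i" "level (\<pi>' j) = j" 
    using up_right_on_level[OF assms(1), of i] up_right_on_level[OF assms(2), of j] assms(4,5) j by auto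
  then have "i = j" using j by simp
  then show ?thesis using j by simp
qed

text \<open>Equal weights force equal multisets of sites, and levels turn these back into equal
  paths. The last point is outside the half-open sum and is covered by the hypothesis on the
  ends.\<close>

lemma geodesic_unique:
  assumes W: "generic_weights W"
    and u: "up_right_on {k..m} \<pi>" "up_right_on {k..m} \<pi>'"
    and ends: "\<pi> k = \<pi>' k" "\<pi> m = \<pi>' m"
    and geo: "path_weight W \<pi> k m = LPP W (\<pi> k) (\<pi> m)" "path_weight W \<pi>' k m = LPP W (\<pi> k) (\<pi> m)"
    and i: "k \<le> i" "i \<le> m"
  shows "\<pi> i = \<pi>' i"
proof (cases "i = m")
  case False
  have "path_mset \<pi> k m = path_mset \<pi>' k m"
    using W geo by (auto simp: generic_weights_def path_weight_mset)
  then show ?thesis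
    using i False u by (intro path_mset_inj[of k m]) (auto elim: up_right_on_subset)
qed (use ends in simp)

text \<open>The deterministic content of a Busemann function in one direction. By
  \<open>recover\<close> both increments at a site are at least its weight, and the smaller one
  equals it; all properties of Busemann geodesics rest on this.\<close>

locale cocycle =
  fixes W :: "site \<Rightarrow> real" and b :: "site \<Rightarrow> site \<Rightarrow> real"
  assumes add: "b x y + b y z = b x z"
    and recover: "min (b x (x + e1)) (b x (x + e2)) = W x"
begin

lemma refl [simp]: "b x x = 0"
  using add[of x x x] by simp

lemma antisym: "b x y = - b y x"
  using add[of x y x] by simp

lemma weight_le: "W x \<le> b x (x + e1)" "W x \<le> b x (x + e2)"
  using recover[of x] by linarith+

lemma step_cases: "busemann_step b \<sigma> x = x + e1 \<or> busemann_step b \<sigma> x = x + e2"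
  by (cases \<sigma>) (auto simp: busemann_step_def)

lemma step_weight: "b x (busemann_step b \<sigma> x) = W x"
  using recover[of x] by (cases \<sigma>) (auto simp: busemann_step_def)

lemma level_step [simp]: "level (busemann_step b \<sigma> x) = level x + 1"
  using step_cases[of \<sigma> x] by auto

lemma level_steps [simp]: "level ((busemann_step b \<sigma> ^^ n) x) = level x + int n"
  by (induction n) auto

definition gam :: "side \<Rightarrow> site \<Rightarrow> int \<Rightarrow> site" where
  "gam \<sigma> x k = (busemann_step b \<sigma> ^^ nat (k - level x)) x"

lemma gam_start [simp]: "gam \<sigma> x (level x) = x"
  by (simp add: gam_def)

lemma level_gam: "level x \<le> k \<Longrightarrow> level (gam \<sigma> x k) = k"
  by (simp add: gam_def)

lemma gam_Suc: "level x \<le> k \<Longrightarrow> gam \<sigma> x (k + 1) = busemann_step b \<sigma> (gam \<sigma> x k)"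
proof -
  assume "level x \<le> k"
  then have "nat (k + 1 - level x) = Suc (nat (k - level x))" by simp
  then show ?thesis by (simp add: gam_def)
qed

lemma up_right_gam: "up_right_on {level x..} (gam \<sigma> x)"
  unfolding up_right_on_def
proof (intro ballI conjI impI)
  fix k assume k: "k \<in> {level x..}"
  show "level (gam \<sigma> x k) = k" using k by (simp add: level_gam)
  show "gam \<sigma> x (k + 1) - gam \<sigma> x k \<in> {e1, e2}"
    using k step_cases[of \<sigma> "gam \<sigma> x k"] by (auto simp: gam_Suc)
qed

text \<open>Each step increases \<open>b\<close> by at least the weight it collects, and by
  additivity the increments telescope.\<close>

lemma path_weight_le:
  assumes "k \<le> m" "up_right_on {k..m} \<pi>"
  shows "path_weight W \<pi> k m \<le> b (\<pi> k) (\<pi> m)"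
  using assms
proof (induction m rule: int_ge_induct)
  case base
  then show ?case by (simp add: path_weight_def)
next
  case (step m)
  have "path_weight W \<pi> k (m + 1) = path_weight W \<pi> k m + W (\<pi> m)"
  proof -
    have "{k..<m + 1} = insert m {k..<m}" using step by auto
    then show ?thesis by (simp add: path_weight_def)
  qed
  also have "\<dots> \<le> b (\<pi> k) (\<pi> m) + b (\<pi> m) (\<pi> (m + 1))"
    using step up_right_on_step[of "{k..m + 1}" \<pi> m] weight_le[of "\<pi> m"]
    by (intro add_mono step.IH) (auto elim: up_right_on_subset)
  finally show ?case by (simp add: add)
qed

lemma path_weight_gam:
  assumes "k \<le> m" "level x \<le> k"
  shows "path_weight W (gam \<sigma> x) k m = b (gam \<sigma> x k) (gam \<sigma> x m)"
  using assms
proof (induction m rule: int_ge_induct)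
  case base
  then show ?case by (simp add: path_weight_def)
next
  case (step m)
  have "{k..<m + 1} = insert m {k..<m}" using step by auto
  then have "path_weight W (gam \<sigma> x) k (m + 1) = path_weight W (gam \<sigma> x) k m + W (gam \<sigma> x m)"
    by (simp add: path_weight_def)
  also have "\<dots> = b (gam \<sigma> x k) (gam \<sigma> x m) + b (gam \<sigma> x m) (gam \<sigma> x (m + 1))"
    using step by (simp add: gam_Suc step_weight)
  finally show ?case by (simp add: add)
qed

text \<open>\<open>b\<close> bounds the weight of every competitor between the same end points, and
  \<open>gam\<close> attains the bound because its increments equal the weights.\<close>

lemma gam_geodesic:
  assumes "level x \<le> k" "k \<le> m"
  shows "path_weight W (gam \<sigma> x) k m = LPP W (gam \<sigma> x k) (gam \<sigma> x m)"
proof -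
  have l: "level (gam \<sigma> x k) = k" "level (gam \<sigma> x m) = m" using assms by (auto simp: level_gam)
  have "path_weight W (gam \<sigma> x) (level (gam \<sigma> x k)) (level (gam \<sigma> x m))
      = LPP W (gam \<sigma> x k) (gam \<sigma> x m)"
  proof (rule LPP_eqI)
    show "gam \<sigma> x \<in> up_right_paths (gam \<sigma> x k) (gam \<sigma> x m)"
      unfolding up_right_paths_def l using assms by (auto intro: up_right_on_subset[OF up_right_gam])
    fix \<pi>' assume "\<pi>' \<in> up_right_paths (gam \<sigma> x k) (gam \<sigma> x m)"
    then have "up_right_on {k..m} \<pi>'" "\<pi>' k = gam \<sigma> x k" "\<pi>' m = gam \<sigma> x m"
      by (auto simp: up_right_paths_def l)
    then show "path_weight W \<pi>' (level (gam \<sigma> x k)) (level (gam \<sigma> x m))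
        \<le> path_weight W (gam \<sigma> x) (level (gam \<sigma> x k)) (level (gam \<sigma> x m))"
      using path_weight_le[of k m \<pi>'] path_weight_gam[of k m x] assms l by simp
  qed
  then show ?thesis by (simp add: l)
qed

lemma semi_infinite_geodesic_gam: "semi_infinite_geodesic W x (gam \<sigma> x)"
  unfolding semi_infinite_geodesic_def
  using up_right_gam gam_geodesic by auto

lemma gam_restart:
  assumes "level x \<le> k" "k \<le> m" shows "gam \<sigma> (gam \<sigma> x k) m = gam \<sigma> x m"
  using assms(2)
proof (induction m rule: int_ge_induct)
  case base
  then show ?case using level_gam[OF assms(1)] gam_start by metis
next
  case (step m)
  then show ?case using level_gam[OF assms(1)] assms gam_Suc by simp
qed

lemma gam_merge:
  assumes "level x \<le> k" "level y \<le> k" "gam \<sigma> x k = gam \<sigma> y k" "k \<le> m"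
  shows "gam \<sigma> x m = gam \<sigma> y m"
  using assms gam_restart by metis

text \<open>The bounds on \<open>k\<close> matter: before its starting level a path is constant, and
  an equality there says nothing about the paths.\<close>

lemma coalesce_iff:
  "coalesce (gam \<sigma> x) (gam \<sigma> y) \<longleftrightarrow> (\<exists>k. level x \<le> k \<and> level y \<le> k \<and> gam \<sigma> x k = gam \<sigma> y k)"
proof
  assume "coalesce (gam \<sigma> x) (gam \<sigma> y)"
  then obtain k where "\<forall>n\<ge>k. gam \<sigma> x n = gam \<sigma> y n" by (auto simp: coalesce_def)
  then have "gam \<sigma> x (max k (max (level x) (level y))) = gam \<sigma> y (max k (max (level x) (level y)))"
    by simp
  then show "\<exists>k. level x \<le> k \<and> level y \<le> k \<and> gam \<sigma> x k = gam \<sigma> y k"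
    by (intro exI[of _ "max k (max (level x) (level y))"]) (simp add: le_max_iff_disj)
next
  assume "\<exists>k. level x \<le> k \<and> level y \<le> k \<and> gam \<sigma> x k = gam \<sigma> y k"
  then obtain k where "level x \<le> k" "level y \<le> k" "gam \<sigma> x k = gam \<sigma> y k" by blast
  then have "\<forall>n\<ge>k. gam \<sigma> x n = gam \<sigma> y n" using gam_merge[of x k y] by simp
  then show "coalesce (gam \<sigma> x) (gam \<sigma> y)" by (auto simp: coalesce_def)
qed

text \<open>Subtract the values of \<open>b\<close> from \<open>x\<close> and from \<open>y\<close>
  to the meeting point; each is a path weight. So \<open>b x y\<close> is an integer combination of
  finitely many weights, to which genericity can be applied.\<close>

lemma coalesce_b:
  assumes "level x \<le> k" "level y \<le> k" "gam \<sigma> x k = gam \<sigma> y k"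
  shows "b x y = path_weight W (gam \<sigma> x) (level x) k - path_weight W (gam \<sigma> y) (level y) k"
  using path_weight_gam[of "level x" k x \<sigma>] path_weight_gam[of "level y" k y \<sigma>] assms
    add[of x "gam \<sigma> x k" y] antisym[of "gam \<sigma> y k" y] by simp

end

section \<open>Shielding a gap by heavy weights\<close>

definition box :: "int \<Rightarrow> site set" where
  "box N = {z. \<bar>fst z\<bar> \<le> N \<and> \<bar>snd z\<bar> \<le> N}"

definition chain :: "site list \<Rightarrow> bool" where
  "chain ps \<longleftrightarrow> successively (\<lambda>u v. v = u + e1 \<or> v = u + e2) ps"

lemma chain_map_upt:
  "(\<And>i. k \<le> i \<Longrightarrow> i < n \<Longrightarrow> u (Suc i) = u i + e1 \<or> u (Suc i) = u i + e2) \<Longrightarrow>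
    chain (map u [k..<Suc n])"
  unfolding chain_def successively_conv_nth by (auto simp del: upt_Suc)

text \<open>\<open>off_bound\<close> controls the paths avoiding \<open>R\<close> only, so that it does not involve the weights
  on \<open>R\<close>.\<close>

definition off_bound ::
  "site set \<Rightarrow> int \<Rightarrow> (site \<Rightarrow> real) \<Rightarrow> real \<Rightarrow> (site \<Rightarrow> real) \<Rightarrow> (site \<Rightarrow> real) \<Rightarrow> bool" where
  "off_bound R N l c w h \<longleftrightarrow>
    (\<forall>ps e. chain (ps @ [e]) \<and> set ps \<inter> R = {} \<and> (\<forall>z\<in>set ps. level z < 0) \<and>
       level e = 0 \<and> set (ps @ [e]) \<subseteq> box N \<longrightarrow>
       sum_list (map w ps) + h e \<le> l (hd (ps @ [e])) + c)"

text \<open>Models \<open>h z = b z v\<close> for a fixed far point \<open>v\<close>. Only levels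
  below 0 are constrained, since this is where weights are raised.\<close>

locale superharmonic =
  fixes w h :: "site \<Rightarrow> real"
  assumes sup: "level z < 0 \<Longrightarrow> w z + h (z + e1) \<le> h z" "level z < 0 \<Longrightarrow> w z + h (z + e2) \<le> h z"
begin

lemma row:
  assumes "\<And>k. k < K \<Longrightarrow> i + int k + j < 0 \<and> \<Lambda> \<le> w (i + int k, j)"
  shows "real K * \<Lambda> + h (i + int K, j) \<le> h (i, j)"
  using assms
proof (induction K)
  case (Suc K)
  have "w (i + int K, j) + h ((i + int K, j) + e1) \<le> h (i + int K, j)"
    using Suc.prems[of K] by (intro sup) (auto simp: level_def)
  moreover have "\<Lambda> \<le> w (i + int K, j)" using Suc.prems[of K] by simp
  moreover have "real K * \<Lambda> + h (i + int K, j) \<le> h (i, j)" using Suc by auto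
  ultimately show ?case by (simp add: e1_def algebra_simps)
qed simp

lemma column:
  assumes "\<And>k. k < K \<Longrightarrow> i + j + int k < 0 \<and> \<Lambda> \<le> w (i, j + int k)"
  shows "real K * \<Lambda> + h (i, j + int K) \<le> h (i, j)"
  using assms
proof (induction K)
  case (Suc K)
  have "w (i, j + int K) + h ((i, j + int K) + e2) \<le> h (i, j + int K)"
    using Suc.prems[of K] by (intro sup) (auto simp: level_def)
  moreover have "\<Lambda> \<le> w (i, j + int K)" using Suc.prems[of K] by simp
  moreover have "real K * \<Lambda> + h (i, j + int K) \<le> h (i, j)" using Suc by auto
  ultimately show ?case by (simp add: e2_def algebra_simps)
qed simp

end

lemma optimal_path_sum:
  fixes w h :: "site \<Rightarrow> real"
  assumes "\<And>i. i < n \<Longrightarrow> h (u i) = w (u i) + h (u (Suc i))" "k \<le> n"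
  shows "sum_list (map w (map u [k..<n])) + h (u n) = h (u k)"
  using assms(2)
proof (induction k rule: inc_induct)
  case (step m)
  then have "[m..<n] = m # [Suc m..<n]" by (simp add: upt_conv_Cons)
  then show ?case using step assms(1)[of m] by simp
qed simp

text \<open>Heavy weights on the three sides of a long flat rectangle around the origin: an optimal path
  entering the rectangle would rather follow the boundary up to level \<open>0\<close>.\<close>

lemma rectangle_shield:
  fixes a1 a2 \<Lambda> c :: real and r m N :: int
  assumes ineq: "0 \<le> r" "r < m" "m + 1 < N"
    and bot: "of_int (m - r) * (\<Lambda> - a1) > \<bar>\<Lambda>\<bar> + \<bar>a2\<bar> + 2 * c"
    and col: "of_int (N - 1) * (\<Lambda> - a1) > of_int m * (\<bar>\<Lambda>\<bar> + \<bar>a1\<bar> + 2 * \<bar>a2\<bar>) + 2 * c"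
    and c: "0 \<le> c"
    and l_def: "l = (\<lambda>z. of_int (N - fst z) * a1 + of_int (N - snd z) * a2)"
    and R_def: "R = {z. level z < 0 \<and> - N \<le> fst z \<and> (fst z = - N \<and> \<bar>snd z\<bar> \<le> m \<or> \<bar>snd z\<bar> = m)}"
    and sh: "superharmonic w h"
    and off: "off_bound R N l c w h"
    and low: "\<And>e. e \<in> box N \<Longrightarrow> level e = 0 \<Longrightarrow> l e - c \<le> h e"
    and heavy: "\<And>x. x \<in> R \<Longrightarrow> \<Lambda> \<le> w x"
    and step: "\<And>i. i < n \<Longrightarrow> u (Suc i) = u i + e1 \<or> u (Suc i) = u i + e2"
    and opt: "\<And>i. i < n \<Longrightarrow> h (u i) = w (u i) + h (u (Suc i))"
    and lev: "level (u 0) = - int n" "2 * N \<le> int n"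
  shows "r < \<bar>fst (u n)\<bar>"
proof (rule ccontr)
  interpret superharmonic w h by (rule sh)
  assume "\<not> r < \<bar>fst (u n)\<bar>"
  have level_u: "level (u k) = int k - int n" if "k \<le> n" for k
    using that
  proof (induction k)
    case (Suc k)
    then show ?case using step[of k] by auto
  qed (use lev in simp)
  have mono: "fst (u i) \<le> fst (u k) \<and> snd (u i) \<le> snd (u k)" if "i \<le> k" "k \<le> n" for i k
    using that
  proof (induction k rule: dec_induct)
    case (step k)
    then show ?case using assms(13)[of k] by auto
  qed simp
  have end_n: "\<bar>fst (u n)\<bar> \<le> r" "snd (u n) = - fst (u n)"
    using \<open>\<not> r < \<bar>fst (u n)\<bar>\<close> level_u[of n] by (auto simp: level_def)
  have upper: "fst (u k) \<le> r" "snd (u k) \<le> r" if "k \<le> n" for k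
    using mono[OF that order_refl] end_n by auto
  \<comment> \<open>The path ends in this quadrant and starts outside, its first level being at most
    \<open>- 2 * N\<close>. The end bounds both coordinates by \<open>r < m\<close> throughout, so
    the path can enter only through the left or the bottom side.\<close>
  define inside where "inside k \<longleftrightarrow> - N \<le> fst (u k) \<and> - m \<le> snd (u k)" for k
  have "inside n" using end_n ineq by (auto simp: inside_def)
  define i0 where "i0 = (LEAST k. inside k)"
  have i0: "inside i0" "i0 \<le> n" "\<And>k. k < i0 \<Longrightarrow> \<not> inside k"
    using \<open>inside n\<close> unfolding i0_def by (auto intro: LeastI Least_le dest: not_less_Least)
  have "\<not> inside 0" using lev ineq by (auto simp: inside_def level_def)
  then have "i0 \<noteq> 0" using i0 by metis
  then obtain k0 where k0: "i0 = Suc k0" by (cases i0) auto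
  have "u i0 \<in> R \<and> i0 < n"
  proof -
    have "\<not> inside k0" using i0 k0 by auto
    moreover have "u i0 = u k0 + e1 \<or> u i0 = u k0 + e2" using step[of k0] i0 k0 by auto
    ultimately have "(fst (u i0) = - N \<and> - m \<le> snd (u i0)) \<or> (snd (u i0) = - m \<and> - N \<le> fst (u i0))"
      using i0(1) by (auto simp: inside_def)
    then have "u i0 \<in> R" "level (u i0) < 0"
      using upper[OF i0(2)] ineq by (auto simp: R_def level_def)
    then show ?thesis using level_u[OF i0(2)] i0(2) by auto
  qed
  \<comment> \<open>The last visit to the heavy set before level 0. Afterwards the path avoids
    \<open>R\<close>, so \<open>off_bound\<close> caps what it can still collect.\<close>
  define k where "k = Max {i. i < n \<and> u i \<in> R}"
  have fin: "finite {i. i < n \<and> u i \<in> R}" by simp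
  have "k \<in> {i. i < n \<and> u i \<in> R}"
    unfolding k_def using \<open>u i0 \<in> R \<and> i0 < n\<close> by (intro Max_in fin) auto
  then have k: "k < n" "u k \<in> R" by auto
  have last: "u i \<notin> R" if "k < i" "i < n" for i
  proof
    assume "u i \<in> R"
    then have "i \<le> k" unfolding k_def using that by (intro Max_ge fin) auto
    then show False using that by simp
  qed
  have R_k: "- N \<le> fst (u k)" "- m \<le> snd (u k)" "level (u k) < 0" using k ineq by (auto simp: R_def)
  have in_box: "u i \<in> box N" if "k \<le> i" "i \<le> n" for i
    using mono[of k i] that R_k upper[of i] ineq by (auto simp: box_def)
  have "h (u (Suc k)) \<le> l (u (Suc k)) + c"
  proof -
    let ?ps = "map u [Suc k..<n]"
    have "?ps @ [u n] = map u [Suc k..<Suc n]" using k by simp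
    moreover have "chain (map u [Suc k..<Suc n])" using step by (intro chain_map_upt) auto
    moreover have "hd (map u [Suc k..<Suc n]) = u (Suc k)" using k by (simp add: hd_map del: upt_Suc)
    moreover have "set (map u [Suc k..<Suc n]) \<subseteq> box N" using in_box by auto
    moreover have "set ?ps \<inter> R = {}" using last by auto
    moreover have "\<forall>z\<in>set ?ps. level z < 0" using level_u by auto
    moreover have "level (u n) = 0" using level_u[of n] by simp
    ultimately have "sum_list (map w ?ps) + h (u n) \<le> l (u (Suc k)) + c"
      using off[unfolded off_bound_def, rule_format, of ?ps "u n"] by metis
    then show ?thesis using optimal_path_sum[of n h u w "Suc k"] opt k by auto
  qed
  then have leave: "h (u k) \<le> w (u k) + l (u (Suc k)) + c" using opt[OF k(1)] by simp
  have nextR: "u (Suc k) \<notin> R \<or> Suc k = n" using last k(1) by (metis Suc_lessI lessI)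
  obtain i j where ij: "u k = (i, j)" by force
  have "level (u (Suc k)) = level (u k) + 1" using step[OF k(1)] by auto
  \<comment> \<open>The step out of \<open>R\<close> is compared with staying on \<open>R\<close>
    until level 0, once for the left side and once for the bottom side. The weight at
    \<open>u k\<close> occurs in both alternatives and cancels.\<close>
  show False
  proof (cases "i = - N")
    case True
    have j: "\<bar>j\<bar> \<le> m" using k(2) ij True ineq by (auto simp: R_def)
    have "level (u k) < - 1" using j ineq True by (simp add: ij level_def)
    then have "Suc k \<noteq> n" using level_u[of n] \<open>level (u (Suc k)) = level (u k) + 1\<close> by auto
    then have nR: "u (Suc k) \<notin> R" using nextR by simp
    have "u (Suc k) = u k + e1"
    proof (rule ccontr)
      assume "u (Suc k) \<noteq> u k + e1"
      then have "u (Suc k) = (- N, j + 1)" using step[OF k(1)] ij True by (auto simp: e2_def)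
      then show False using nR upper[of "Suc k"] k j ineq by (auto simp: R_def level_def)
    qed
    then have uS: "u (Suc k) = (- N + 1, j)" using ij True by (simp add: e1_def)
    then have jm: "\<bar>j\<bar> < m" using nR j ineq by (auto simp: R_def level_def)
    \<comment> \<open>The alternative climbs the left side to \<open>(- N, m)\<close> and then
      follows the top side to \<open>(- m, m)\<close>, which lies on level 0.\<close>
    have "w (- N, j) + h (- N, j + 1) \<le> h (- N, j)"
      using sup(2)[of "(- N, j)"] jm ineq by (simp add: e2_def level_def)
    moreover have "real (nat (m - j - 1)) * \<Lambda> + h (- N, j + 1 + int (nat (m - j - 1))) \<le> h (- N, j + 1)"
      using jm ineq by (intro column) (auto intro!: heavy simp: R_def level_def)
    moreover have "real (nat (N - m)) * \<Lambda> + h (- N + int (nat (N - m)), m) \<le> h (- N, m)"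
      using jm ineq by (intro row) (auto intro!: heavy simp: R_def level_def)
    moreover have "l (- m, m) - c \<le> h (- m, m)"
      using ineq by (intro low) (auto simp: box_def level_def)
    moreover have "j + 1 + int (nat (m - j - 1)) = m" "- N + int (nat (N - m)) = - m"
      "real (nat (m - j - 1)) = of_int m - of_int j - 1" "real (nat (N - m)) = of_int N - of_int m"
      using jm ineq by auto
    ultimately have stay: "w (u k) + (of_int m - of_int j - 1) * \<Lambda> + (of_int N - of_int m) * \<Lambda>
        + l (- m, m) - c \<le> h (u k)"
      using ij True by simp
    have "of_int j * (\<Lambda> - a2) \<le> of_int m * (\<bar>\<Lambda>\<bar> + \<bar>a2\<bar>)"
    proof -
      have "of_int j * (\<Lambda> - a2) \<le> \<bar>of_int j\<bar> * \<bar>\<Lambda> - a2\<bar>" by (metis abs_ge_self abs_mult)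
      also have "\<dots> \<le> of_int m * (\<bar>\<Lambda>\<bar> + \<bar>a2\<bar>)" using j by (intro mult_mono) auto
      finally show ?thesis .
    qed
    moreover have "of_int m * (a2 - a1) \<le> of_int m * (\<bar>a1\<bar> + \<bar>a2\<bar>)"
      using ineq by (intro mult_left_mono) auto
    moreover have "(of_int m - of_int j - 1) * \<Lambda> + (of_int N - of_int m) * \<Lambda> + l (- m, m) - l (u (Suc k))
        = of_int (N - 1) * (\<Lambda> - a1) - of_int j * (\<Lambda> - a2) - of_int m * (a2 - a1)"
      by (simp add: l_def uS algebra_simps)
    ultimately show False using stay leave col by (simp add: algebra_simps)
  next
    case False
    have j: "\<bar>j\<bar> = m" "i + j < 0" using k(2) ij False by (auto simp: R_def level_def)
    \<comment> \<open>The top side is excluded because the end of the path keeps second coordinates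
      at most \<open>r < m\<close>. A step along the bottom would stay in \<open>R\<close>, so the
      path leaves upwards, while the alternative runs along the bottom to \<open>(m, - m)\<close> on
      level 0.\<close>
    have "j = - m" using j upper[of k] k ij ineq by auto
    have "u (Suc k) = u k + e2"
    proof (rule ccontr)
      assume "u (Suc k) \<noteq> u k + e2"
      then have uS: "u (Suc k) = (i + 1, - m)" using step[OF k(1)] ij \<open>j = - m\<close> by (auto simp: e1_def)
      have "i + 1 \<le> r" using upper[of "Suc k"] k uS by simp
      then have "level (u (Suc k)) < 0" using uS ineq by (simp add: level_def)
      then have "u (Suc k) \<in> R" "Suc k \<noteq> n"
        using uS R_k(1) ij ineq level_u[of n] by (auto simp: R_def)
      then show False using nextR by simp
    qed
    then have uS: "u (Suc k) = (i, - m + 1)" using ij \<open>j = - m\<close> by (simp add: e2_def)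
    have ir: "i \<le> r" "- N \<le> i" using upper[of "Suc k"] k uS R_k ij by auto
    have "w (i, - m) + h (i + 1, - m) \<le> h (i, - m)"
      using sup(1)[of "(i, - m)"] ir ineq by (simp add: e1_def level_def)
    moreover have "real (nat (m - i - 1)) * \<Lambda> + h (i + 1 + int (nat (m - i - 1)), - m) \<le> h (i + 1, - m)"
      using ir ineq by (intro row) (auto intro!: heavy simp: R_def level_def)
    moreover have "l (m, - m) - c \<le> h (m, - m)"
      using ineq by (intro low) (auto simp: box_def level_def)
    moreover have "i + 1 + int (nat (m - i - 1)) = m" "real (nat (m - i - 1)) = of_int m - of_int i - 1"
      using ir ineq by auto
    ultimately have stay: "w (u k) + (of_int m - of_int i - 1) * \<Lambda> + l (m, - m) - c \<le> h (u k)"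
      using ij \<open>j = - m\<close> by simp
    have "0 \<le> \<Lambda> - a1"
    proof (rule ccontr)
      assume "\<not> 0 \<le> \<Lambda> - a1"
      then have "of_int (m - r) * (\<Lambda> - a1) \<le> 0" using ineq by (intro mult_nonneg_nonpos) auto
      then show False using bot c by linarith
    qed
    then have "of_int (m - r) * (\<Lambda> - a1) \<le> of_int (m - i) * (\<Lambda> - a1)"
      using ir by (intro mult_right_mono) auto
    moreover have "(of_int m - of_int i - 1) * \<Lambda> + l (m, - m) - l (u (Suc k))
        = of_int (m - i) * (\<Lambda> - a1) - \<Lambda> + a2"
      by (simp add: l_def uS algebra_simps)
    ultimately show False using stay leave bot by linarith
  qed
qed

definition shielding :: "real \<Rightarrow> real \<Rightarrow> real \<Rightarrow> int \<Rightarrow> int \<Rightarrow> real \<Rightarrow> site set \<Rightarrow> bool" where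
  "shielding a1 a2 \<Lambda> r N c R \<longleftrightarrow> finite R \<and> (\<forall>z\<in>R. level z < 0) \<and>
    (\<forall>w h u n. superharmonic w h \<and>
      off_bound R N (\<lambda>z. of_int (N - fst z) * a1 + of_int (N - snd z) * a2) c w h \<and>
      (\<forall>e\<in>box N. level e = 0 \<longrightarrow> of_int (N - fst e) * a1 + of_int (N - snd e) * a2 - c \<le> h e) \<and>
      (\<forall>x\<in>R. \<Lambda> \<le> w x) \<and>
      (\<forall>i<n. (u (Suc i) = u i + e1 \<or> u (Suc i) = u i + e2) \<and> h (u i) = w (u i) + h (u (Suc i))) \<and>
      level (u 0) = - int n \<and> 2 * N \<le> int n \<longrightarrow> r < \<bar>fst (u n)\<bar>)"

text \<open>\<open>\<Lambda> - a1\<close> is the gain of a heavy site over the typical yield of a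
  horizontal step. If the height is a small fraction of the length, the gain along the long sides
  beats the loss in the vertical direction and also an error \<open>\<epsilon> * N\<close> with
  small \<open>\<epsilon>\<close>.\<close>

lemma shielding_fst:
  fixes a1 a2 \<Lambda> :: real and r :: int
  assumes "a1 < \<Lambda>" "0 \<le> r"
  shows "\<exists>\<epsilon>>0. \<exists>N0. \<forall>N\<ge>N0. \<exists>R. shielding a1 a2 \<Lambda> r (int N) (\<epsilon> * real N) R"
proof -
  define D K where "D = \<Lambda> - a1" and "K = \<bar>\<Lambda>\<bar> + \<bar>a1\<bar> + 2 * \<bar>a2\<bar> + 1"
  have DK: "D > 0" "K > 0" using assms by (auto simp: D_def K_def)
  \<comment> \<open>\<open>K\<close> bounds the loss per unit of height, so a height of at most
    \<open>\<kappa> * N\<close> costs no more than a quarter of \<open>D * N\<close>. The bound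
    \<open>1 / 4\<close> keeps the rectangle inside the box.\<close>
  define \<kappa> where "\<kappa> = min (1 / 4) (D / (4 * K))"
  have \<kappa>: "\<kappa> > 0" "\<kappa> \<le> 1 / 4" "\<kappa> * K \<le> D / 4"
  proof -
    show "\<kappa> > 0" "\<kappa> \<le> 1 / 4" using DK by (auto simp: \<kappa>_def)
    have "\<kappa> * K \<le> D / (4 * K) * K" using DK by (intro mult_right_mono) (auto simp: \<kappa>_def)
    then show "\<kappa> * K \<le> D / 4" using DK by simp
  qed
  \<comment> \<open>Twice the error is then \<open>\<kappa> * D * N / 4\<close>, a quarter of the
    leading term of \<open>(m - r) * D\<close>.\<close>
  define \<epsilon> where "\<epsilon> = \<kappa> * D / 8"
  have "\<epsilon> > 0" using \<kappa> DK by (simp add: \<epsilon>_def)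
  moreover have "\<exists>R. shielding a1 a2 \<Lambda> r (int N) (\<epsilon> * real N) R"
    if N: "N \<ge> nat \<lceil>2 * (K + D * (1 + of_int r)) / (\<kappa> * D)\<rceil> + 4" for N
  proof -
    define m where "m = \<lfloor>\<kappa> * real N\<rfloor>"
    have m: "of_int m \<le> \<kappa> * real N" "of_int m > \<kappa> * real N - 1" by (auto simp: m_def)
    have "real N \<ge> 2 * (K + D * (1 + of_int r)) / (\<kappa> * D)" "real N \<ge> 4" using N by linarith+
    then have N': "\<kappa> * D * real N \<ge> 2 * (K + D * (1 + of_int r))" "real N \<ge> 4"
      using \<kappa> DK by (auto simp: divide_simps mult_ac)
    have "D * (\<kappa> * real N) \<ge> D * (2 * (1 + of_int r))" using N' DK by (simp add: algebra_simps)
    then have kN: "\<kappa> * real N \<ge> 2 * (1 + of_int r)" using DK by simp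
    then have "of_int r < (of_int m :: real)" 
    proof -
      have "(0::real) \<le> of_int r" using assms(2) by simp
      have "2 + 2 * of_int r \<le> \<kappa> * real N" using kN by (simp add: distrib_left)
      then have "1 + 2 * of_int r < (of_int m :: real)" using m(2) by linarith
      then show ?thesis using \<open>0 \<le> of_int r\<close> by linarith
    qed
    then have rm: "r < m" by simp
    have "\<kappa> * real N \<le> 1 / 4 * real N" using \<kappa> by (intro mult_right_mono) auto
    then have "of_int m + 1 < real N" using m N' by linarith
    then have mN: "m + 1 < int N" by linarith
    have "of_int (m - r) * D \<ge> (\<kappa> * real N - 1 - of_int r) * D"
      using m DK by (intro mult_right_mono) auto
    moreover have "2 * (\<epsilon> * real N) = \<kappa> * D * real N / 4" by (simp add: \<epsilon>_def)
    moreover have "\<kappa> * D * real N > 0" using \<kappa> DK N' by simp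
    moreover have "(\<kappa> * real N - 1 - of_int r) * D = \<kappa> * D * real N - D - D * of_int r"
      "\<kappa> * D * real N \<ge> 2 * K + 2 * D + 2 * (D * of_int r)"
      using N' by (simp_all add: algebra_simps)
    moreover have "D * of_int r \<ge> 0" using DK assms by simp
    moreover have "K = \<bar>\<Lambda>\<bar> + \<bar>a1\<bar> + 2 * \<bar>a2\<bar> + 1" "D > 0" using DK by (simp_all add: K_def)
    ultimately have bot: "of_int (m - r) * (\<Lambda> - a1) > \<bar>\<Lambda>\<bar> + \<bar>a2\<bar> + 2 * (\<epsilon> * real N)"
      unfolding D_def [symmetric] by linarith
    have "of_int m * K \<le> \<kappa> * real N * K" using m DK by (intro mult_right_mono) auto
    also have "\<dots> \<le> D / 4 * real N" using mult_right_mono[OF \<kappa>(3), of "real N"] by (simp add: mult_ac)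
    finally have 1: "of_int m * K \<le> D / 4 * real N" .
    have "\<kappa> * (D * real N) \<le> 1 / 4 * (D * real N)" using \<kappa> DK by (intro mult_right_mono) auto
    then have 2: "2 * (\<epsilon> * real N) \<le> D * real N / 16" by (simp add: \<epsilon>_def mult_ac)
    have "D * real N \<ge> D * 4" using N' DK by (intro mult_left_mono) auto
    moreover have "of_int (int N - 1) * D = D * real N - D" by (simp add: algebra_simps)
    ultimately have "of_int (int N - 1) * D > of_int m * K + 2 * (\<epsilon> * real N)"
      using 1 2 DK(1) by linarith
    moreover have "of_int m * K \<ge> of_int m * (\<bar>\<Lambda>\<bar> + \<bar>a1\<bar> + 2 * \<bar>a2\<bar>)"
      using rm assms by (intro mult_left_mono) (auto simp: K_def)
    ultimately have col: "of_int (int N - 1) * (\<Lambda> - a1) > of_int m * (\<bar>\<Lambda>\<bar> + \<bar>a1\<bar> + 2 * \<bar>a2\<bar>) + 2 * (\<epsilon> * real N)"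
      unfolding D_def [symmetric] by linarith
    define R where "R = {z :: site. level z < 0 \<and> - int N \<le> fst z \<and>
      (fst z = - int N \<and> \<bar>snd z\<bar> \<le> m \<or> \<bar>snd z\<bar> = m)}"
    have "R \<subseteq> {- int N..m} \<times> {- m..m}" using rm assms by (auto simp: R_def level_def)
    then have "finite R" by (rule finite_subset) auto
    moreover have "\<forall>z\<in>R. level z < 0" by (auto simp: R_def)
    ultimately have "shielding a1 a2 \<Lambda> r (int N) (\<epsilon> * real N) R"
      unfolding shielding_def
    proof (intro conjI allI impI; (elim conjE)?)
      fix w h u n
      assume *: "superharmonic w h"
        "off_bound R (int N) (\<lambda>z. of_int (int N - fst z) * a1 + of_int (int N - snd z) * a2) (\<epsilon> * real N) w h"
        "\<forall>e\<in>box (int N). level e = 0 \<longrightarrow> of_int (int N - fst e) * a1 + of_int (int N - snd e) * a2 - \<epsilon> * real N \<le> h e"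
        "\<forall>x\<in>R. \<Lambda> \<le> w x"
        "\<forall>i<n. (u (Suc i) = u i + e1 \<or> u (Suc i) = u i + e2) \<and> h (u i) = w (u i) + h (u (Suc i))"
        "level (u 0) = - int n" "2 * int N \<le> int n"
      show "r < \<bar>fst (u n)\<bar>"
        by (rule rectangle_shield[OF assms(2) rm mN bot col _ refl R_def *(1,2)])
          (use * \<open>\<epsilon> > 0\<close> in auto)
    qed auto
    then show ?thesis by blast
  qed
  ultimately show ?thesis by blast
qed

lemma swap_e [simp]: "prod.swap (e1 :: site) = e2" "prod.swap (e2 :: site) = e1"
  by (auto simp: e1_def e2_def)

lemma swap_add [simp]: "prod.swap (x + y) = prod.swap x + prod.swap (y :: site)"
  by (auto simp: prod_eq_iff)

lemma level_swap [simp]: "level (prod.swap x) = level x"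
  by (simp add: level_def)

text \<open>Transposition exchanges the roles of \<open>a1\<close> and \<open>a2\<close>. The
  conclusion is symmetric because on level 0 both coordinates have the same absolute value.\<close>

lemma shielding_swap:
  assumes "shielding a2 a1 \<Lambda> r N c R"
  shows "shielding a1 a2 \<Lambda> r N c (prod.swap ` R)"
  unfolding shielding_def
proof (intro conjI allI impI; (elim conjE)?)
  show "finite (prod.swap ` R)" "\<forall>z\<in>prod.swap ` R. level z < 0"
    using assms by (auto simp: shielding_def)
  fix w h :: "site \<Rightarrow> real" and u :: "nat \<Rightarrow> site" and n
  assume *: "superharmonic w h"
    "off_bound (prod.swap ` R) N (\<lambda>z. of_int (N - fst z) * a1 + of_int (N - snd z) * a2) c w h"
    "\<forall>e\<in>box N. level e = 0 \<longrightarrow> of_int (N - fst e) * a1 + of_int (N - snd e) * a2 - c \<le> h e"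
    "\<forall>x\<in>prod.swap ` R. \<Lambda> \<le> w x"
    "\<forall>i<n. (u (Suc i) = u i + e1 \<or> u (Suc i) = u i + e2) \<and> h (u i) = w (u i) + h (u (Suc i))"
    "level (u 0) = - int n" "2 * N \<le> int n"
  let ?w = "\<lambda>z. w (prod.swap z)" and ?h = "\<lambda>z. h (prod.swap z)" and ?u = "\<lambda>i. prod.swap (u i)"
  have "r < \<bar>fst (?u n)\<bar>"
  proof (rule assms[unfolded shielding_def, THEN conjunct2, THEN conjunct2, rule_format,
        of ?w ?h n ?u], intro conjI ballI allI impI)
    show "superharmonic ?w ?h"
    proof
      fix z :: site assume "level z < 0"
      then show "?w z + ?h (z + e1) \<le> ?h z" "?w z + ?h (z + e2) \<le> ?h z"
        using superharmonic.sup[OF *(1), of "prod.swap z"] by auto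
    qed
    show "off_bound R N (\<lambda>z. of_int (N - fst z) * a2 + of_int (N - snd z) * a1) c ?w ?h"
      unfolding off_bound_def
    proof (intro allI impI; elim conjE)
      fix ps and e :: site
      assume ps: "chain (ps @ [e])" "set ps \<inter> R = {}" "\<forall>z\<in>set ps. level z < 0" "level e = 0"
        "set (ps @ [e]) \<subseteq> box N"
      have "sum_list (map w (map prod.swap ps)) + h (prod.swap e)
          \<le> of_int (N - fst (hd (map prod.swap ps @ [prod.swap e]))) * a1
            + of_int (N - snd (hd (map prod.swap ps @ [prod.swap e]))) * a2 + c"
      proof (rule *(2)[unfolded off_bound_def, rule_format], intro conjI)
        have "chain (map prod.swap (ps @ [e]))"
          unfolding chain_def successively_map
          by (rule successively_mono[OF ps(1)[unfolded chain_def]]) auto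
        then show "chain (map prod.swap ps @ [prod.swap e])" by simp
        show "set (map prod.swap ps) \<inter> prod.swap ` R = {}" using ps(2) by (force simp: prod_eq_iff)
        show "\<forall>z\<in>set (map prod.swap ps). level z < 0" using ps(3) by auto
        show "level (prod.swap e) = 0" using ps by simp
        show "set (map prod.swap ps @ [prod.swap e]) \<subseteq> box N" using ps(5) by (auto simp: box_def)
      qed
      moreover have "hd (map prod.swap ps @ [prod.swap e]) = prod.swap (hd (ps @ [e]))"
        by (cases ps) auto
      ultimately show "sum_list (map ?w ps) + ?h e
          \<le> of_int (N - fst (hd (ps @ [e]))) * a2 + of_int (N - snd (hd (ps @ [e]))) * a1 + c"
        by (simp add: o_def)
    qed
    show "of_int (N - fst e) * a2 + of_int (N - snd e) * a1 - c \<le> ?h e" if "e \<in> box N" "level e = 0" for e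
      using *(3)[rule_format, of "prod.swap e"] that by (auto simp: box_def)
    show "\<Lambda> \<le> ?w x" if "x \<in> R" for x using *(4) that by auto
    show "?u (Suc i) = ?u i + e1 \<or> ?u (Suc i) = ?u i + e2" "?h (?u i) = ?w (?u i) + ?h (?u (Suc i))"
      if "i < n" for i using *(5) that by auto
    show "level (?u 0) = - int n" "2 * N \<le> int n" using * by auto
  qed
  moreover have "\<bar>fst (?u n)\<bar> = \<bar>fst (u n)\<bar>"
  proof -
    have "level (u i) = int i - int n" if "i \<le> n" for i
      using that
    proof (induction i)
      case (Suc i)
      then show ?case using *(5)[rule_format, of i] by auto
    qed (use * in simp)
    from this[of n] show ?thesis by (simp add: level_def)
  qed
  ultimately show "r < \<bar>fst (u n)\<bar>" by simp
qed

lemma shielding_ex: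
  fixes a1 a2 \<Lambda> :: real and r :: int
  assumes "a1 < \<Lambda> \<or> a2 < \<Lambda>" "0 \<le> r"
  shows "\<exists>\<epsilon>>0. \<exists>N0. \<forall>N\<ge>N0. \<exists>R. shielding a1 a2 \<Lambda> r (int N) (\<epsilon> * real N) R"
  using assms(1)
proof
  assume "a1 < \<Lambda>"
  then show ?thesis using shielding_fst assms(2) by blast
next
  assume "a2 < \<Lambda>"
  then show ?thesis using shielding_fst[of a2 \<Lambda> r a1] assms(2) shielding_swap by meson
qed

section \<open>The forest of a step map and its dual\<close>

text \<open>The map \<open>s\<close> defines a forest of up-right paths. The site \<open>z\<close> is a boundary site if its two
  upper neighbours lie in different trees; \<open>parent\<close> runs through boundary sites down the dual
  forest.\<close>

locale step_map =
  fixes s :: "site \<Rightarrow> site"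
  assumes s_cases: "s z = z + e1 \<or> s z = z + e2"
begin

lemma level_s [simp]: "level (s z) = level z + 1"
  using s_cases[of z] by auto

lemma level_s_pow [simp]: "level ((s ^^ n) z) = level z + int n"
  by (induction n) auto

lemma fst_s: "fst z \<le> fst (s z)" "fst (s z) \<le> fst z + 1"
  using s_cases[of z] by auto

lemma s_pow_Suc: "(s ^^ Suc n) z = (s ^^ n) (s z)"
  by (simp add: funpow_swap1)

text \<open>Paths at the same site move together and others on the same level are at least one
  apart, so they cannot cross.\<close>

lemma s_mono:
  assumes "level u = level v" "fst u \<le> fst v" shows "fst (s u) \<le> fst (s v)"
proof (cases "fst u = fst v")
  case True
  then show ?thesis using site_eqI[of u v] assms by simp
next
  case False
  then show ?thesis using fst_s[of u] fst_s[of v] assms by linarith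
qed

lemma s_pow_mono:
  "level u = level v \<Longrightarrow> fst u \<le> fst v \<Longrightarrow> fst ((s ^^ n) u) \<le> fst ((s ^^ n) v)"
  by (induction n) (auto intro: s_mono)

definition merge :: "site \<Rightarrow> site \<Rightarrow> bool" where
  "merge u v \<longleftrightarrow> (\<exists>n. (s ^^ n) u = (s ^^ n) v)"

lemma merge_refl [simp]: "merge u u"
  by (auto simp: merge_def)

lemma merge_sym: "merge u v \<Longrightarrow> merge v u"
  by (auto simp: merge_def eq_commute)

lemma merge_step: "merge u v \<longleftrightarrow> merge (s u) (s v)"
proof
  assume "merge u v"
  then obtain n where "(s ^^ n) u = (s ^^ n) v" by (auto simp: merge_def)
  then have "(s ^^ Suc n) u = (s ^^ Suc n) v" by simp
  then show "merge (s u) (s v)" unfolding merge_def s_pow_Suc by blast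
next
  assume "merge (s u) (s v)"
  then show "merge u v" unfolding merge_def s_pow_Suc[symmetric] by blast
qed

lemma merge_trans: assumes "merge u v" "merge v x" shows "merge u x"
proof -
  obtain n m where nm: "(s ^^ n) u = (s ^^ n) v" "(s ^^ m) v = (s ^^ m) x"
    using assms by (auto simp: merge_def)
  have "(s ^^ (m + n)) u = (s ^^ (m + n)) v" using nm by (simp add: funpow_add)
  moreover have "(s ^^ (n + m)) v = (s ^^ (n + m)) x" using nm by (simp add: funpow_add)
  ultimately show ?thesis unfolding merge_def by (metis add.commute)
qed

text \<open>Planarity: two paths that meet trap every path between them.\<close>

lemma merge_squeeze:
  assumes "merge u x" "level u = level v" "level v = level x" "fst u \<le> fst v" "fst v \<le> fst x"
  shows "merge u v"
proof -
  obtain n where n: "(s ^^ n) u = (s ^^ n) x" using assms by (auto simp: merge_def)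
  have "fst ((s ^^ n) u) \<le> fst ((s ^^ n) v)" "fst ((s ^^ n) v) \<le> fst ((s ^^ n) x)"
    using assms by (auto intro!: s_pow_mono)
  then have "(s ^^ n) u = (s ^^ n) v" using n assms by (intro site_eqI) auto
  then show ?thesis by (auto simp: merge_def)
qed

definition bd :: "site \<Rightarrow> bool" where
  "bd z \<longleftrightarrow> \<not> merge (z + e1) (z + e2)"

text \<open>The site \<open>z\<close> stands for the dual vertex between \<open>z + e1\<close> and
  \<open>z + e2\<close>. The dual step goes backwards in the direction of the forest edge leaving
  \<open>z\<close>, and thus runs beside this edge without crossing it.\<close>

definition parent :: "site \<Rightarrow> site" where
  "parent z = z + z - s z"

lemma level_parent [simp]: "level (parent z) = level z - 1"
  by (simp add: parent_def)

lemma fst_parent: "fst (parent z) \<le> fst z" "fst z \<le> fst (parent z) + 1"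
  using fst_s[of z] by (auto simp: parent_def)

text \<open>The boundary sites whose parent is \<open>z - e1\<close>; those with parent
  \<open>z - e2\<close> form \<open>via2\<close>. The mass transport argument counts boundary sites
  by these two classes.\<close>

definition via1 :: "site \<Rightarrow> bool" where "via1 z \<longleftrightarrow> bd z \<and> s z = z + e1"
definition via2 :: "site \<Rightarrow> bool" where "via2 z \<longleftrightarrow> bd z \<and> s z = z + e2"

lemma bd_split: "bd z \<longleftrightarrow> via1 z \<or> via2 z"
  using s_cases[of z] by (auto simp: via1_def via2_def)

text \<open>Advance both upper neighbours of \<open>y\<close> by one step. They become the upper
  neighbours of a single child, or coincide, or enclose the middle site \<open>y + e1 + e2\<close>.
  In the last case planarity shows that the outer two merge iff both adjacent pairs do.\<close>

lemma bd_children: "bd y \<longleftrightarrow> via1 (y + e1) \<or> via2 (y + e2)"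
proof -
  have comm: "y + e2 + e1 = y + e1 + e2" by (simp add: algebra_simps)
  consider "s (y + e1) = y + e1 + e1" "s (y + e2) = y + e2 + e1"
    | "s (y + e1) = y + e1 + e1" "s (y + e2) = y + e2 + e2"
    | "s (y + e1) = y + e1 + e2" "s (y + e2) = y + e2 + e1"
    | "s (y + e1) = y + e1 + e2" "s (y + e2) = y + e2 + e2"
    using s_cases by metis
  then show ?thesis
  proof cases
    case 1
    then have "bd y \<longleftrightarrow> \<not> merge (y + e1 + e1) (y + e1 + e2)"
      unfolding bd_def by (subst merge_step) (simp add: comm)
    then show ?thesis using 1 by (auto simp: via1_def via2_def bd_def)
  next
    case 2
    let ?a = "y + e2 + e2" and ?m = "y + e1 + e2" and ?c = "y + e1 + e1"
    have "bd y \<longleftrightarrow> \<not> merge ?c ?a"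
      unfolding bd_def by (subst merge_step) (simp add: 2)
    also have "\<dots> \<longleftrightarrow> \<not> merge ?c ?m \<or> \<not> merge ?m ?a"
    proof -
      have "merge ?a ?m" if "merge ?a ?c" by (rule merge_squeeze[OF that]) auto
      then show ?thesis using merge_trans merge_sym by blast
    qed
    also have "\<dots> \<longleftrightarrow> via1 (y + e1) \<or> via2 (y + e2)"
      using 2 by (auto simp: via1_def via2_def bd_def comm)
    finally show ?thesis .
  next
    case 3
    then have "merge (y + e1) (y + e2)" by (subst merge_step) (simp add: comm)
    then show ?thesis using 3 by (auto simp: via1_def via2_def bd_def)
  next
    case 4
    then have "bd y \<longleftrightarrow> \<not> merge (y + e1 + e2) (y + e2 + e2)"
      unfolding bd_def by (subst merge_step) simp
    then show ?thesis using 4 by (auto simp: via1_def via2_def bd_def comm)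
  qed
qed

lemma bd_parent: "bd z \<Longrightarrow> bd (parent z)"
proof -
  assume z: "bd z"
  from s_cases[of z] show ?thesis
  proof
    assume "s z = z + e1"
    then have "parent z + e1 = z" "via1 z" using z by (auto simp: parent_def via1_def)
    then show ?thesis using bd_children[of "parent z"] by simp
  next
    assume "s z = z + e2"
    then have "parent z + e2 = z" "via2 z" using z by (auto simp: parent_def via2_def)
    then show ?thesis using bd_children[of "parent z"] by simp
  qed
qed

text \<open>If dual paths never merge, then the region between two of them is crossed by forest paths
  coming from arbitrarily low levels.\<close>

lemma survivors:
  assumes no: "\<And>y. \<not> (via1 (y + e1) \<and> via2 (y + e2))"
    and lr: "bd l" "bd r" "level l = level r" "fst l < fst r"
  shows "\<exists>u. level u = level l + 1 - int n \<and> fst l < fst ((s ^^ n) u) \<and> fst ((s ^^ n) u) \<le> fst r"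
proof -
  define L R where "L = (\<lambda>k. (parent ^^ k) l)" and "R = (\<lambda>k. (parent ^^ k) r)"
  have LR: "bd (L k) \<and> bd (R k) \<and> level (L k) = level l - int k \<and> level (R k) = level l - int k
      \<and> fst (L k) < fst (R k)" for k
  proof (induction k)
    case 0
    then show ?case using lr by (auto simp: L_def R_def)
  next
    case (Suc k)
    have eq: "L (Suc k) = parent (L k)" "R (Suc k) = parent (R k)" by (auto simp: L_def R_def)
    \<comment> \<open>If the dual paths met here for the first time, they would come from the two
      children of their common parent, which \<open>no\<close> forbids.\<close>
    have "fst (parent (L k)) \<noteq> fst (parent (R k))"
    proof
      assume *: "fst (parent (L k)) = fst (parent (R k))"
      have p: "parent (L k) = parent (R k)" using Suc * by (intro site_eqI) auto
      have "fst (L k) = fst (R k) - 1"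
        using * fst_parent[of "L k"] fst_parent[of "R k"] Suc by linarith
      moreover obtain q where q: "parent (L k) = q" "parent (R k) = q" using p by simp
      moreover have "L k = q + e1 \<or> L k = q + e2" "R k = q + e1 \<or> R k = q + e2"
        using s_cases[of "L k"] s_cases[of "R k"] q by (auto simp: parent_def algebra_simps)
      moreover have "fst (q + e1) = fst q + 1" "fst (q + e2) = fst q" by auto
      ultimately have LRq: "L k = q + e2" "R k = q + e1" using Suc by (smt (verit))+
      then have "s (q + e2) = q + e2 + e2" "s (q + e1) = q + e1 + e1"
        using q by (auto simp: parent_def algebra_simps)
      then have "via2 (q + e2)" "via1 (q + e1)" using Suc LRq by (auto simp: via1_def via2_def)
      then show False using no by blast
    qed
    then have "fst (parent (L k)) < fst (parent (R k))"
      using fst_parent[of "L k"] fst_parent[of "R k"] Suc by linarith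
    then show ?case using Suc bd_parent eq by auto
  qed
  \<comment> \<open>On the level above, the dual vertex \<open>z\<close> lies between the sites with
    first coordinates \<open>fst z\<close> and \<open>fst z + 1\<close>. This is why being between
    two dual paths is a half-open condition.\<close>
  have inside: "fst l < fst ((s ^^ k) u) \<and> fst ((s ^^ k) u) \<le> fst r"
    if "level u = level l + 1 - int k" "fst (L k) < fst u" "fst u \<le> fst (R k)" for k u
    using that
  proof (induction k arbitrary: u)
    case 0
    then show ?case by (simp add: L_def R_def)
  next
    case (Suc k)
    have eq: "L (Suc k) = parent (L k)" "R (Suc k) = parent (R k)" by (auto simp: L_def R_def)
    have lev: "level u = level (L k)" "level u = level (R k)" using Suc.prems LR[of k] by auto
    have "fst (L k) < fst (s u)"
    proof (cases "fst u \<le> fst (L k)")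
      case True
      then have "u = L k" using Suc.prems eq fst_parent[of "L k"] lev by (intro site_eqI) auto
      then show ?thesis using Suc.prems eq by (simp add: parent_def)
    qed (use fst_s[of u] in linarith)
    moreover have "fst (s u) \<le> fst (R k)"
    proof (cases "fst u = fst (R k)")
      case True
      then have "u = R k" using lev by (intro site_eqI) auto
      then show ?thesis using Suc.prems eq by (simp add: parent_def)
    next
      case False
      then have "fst u < fst (R k)" using Suc.prems eq fst_parent[of "R k"] by auto
      then show ?thesis using fst_s[of u] by linarith
    qed
    moreover have "level (s u) = level l + 1 - int k" using Suc.prems by simp
    ultimately show ?case using Suc.IH[of "s u"] by (simp add: s_pow_Suc del: funpow.simps)
  qed
  define u :: site where "u = (fst (R n), level l + 1 - int n - fst (R n))"
  have "level u = level l + 1 - int n" "fst (L n) < fst u" "fst u \<le> fst (R n)"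
    using LR[of n] by (auto simp: u_def level_def)
  then show ?thesis using inside[of u n] by blast
qed

end

section \<open>Generic weights and stationarity\<close>

lemma sum_mset_count:
  fixes f :: "'a \<Rightarrow> real"
  assumes "finite S" "set_mset A \<subseteq> S"
  shows "(\<Sum>z\<in>#A. f z) = (\<Sum>z\<in>S. real (count A z) * f z)"
  using assms(2)
proof (induction A)
  case (add x A)
  have "(\<Sum>z\<in>S. real (count (add_mset x A) z) * f z)
      = (\<Sum>z\<in>S. real (count A z) * f z + (if z = x then f z else 0))"
    by (intro sum.cong) (auto simp: algebra_simps)
  also have "\<dots> = (\<Sum>z\<in>S. real (count A z) * f z) + f x"
    using add.prems assms(1) by (simp add: sum.distrib)
  finally show ?case using add by simp
qed simp

text \<open>By Fubini: for a fixed value of \<open>Y\<close> a single value of \<open>X\<close>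
  makes the sum vanish, and this value has probability 0.\<close>

lemma (in prob_space) indep_var_atomless_sum_neq_0:
  fixes X Y :: "'a \<Rightarrow> real"
  assumes ind: "indep_var borel X borel Y" and atom: "\<And>c. prob {\<omega> \<in> space M. X \<omega> = c} = 0"
  shows "AE \<omega> in M. X \<omega> + Y \<omega> \<noteq> 0"
proof -
  have [measurable]: "random_variable borel X" "random_variable borel Y"
    using ind by (auto dest: indep_var_rv1 indep_var_rv2)
  interpret X: prob_space "distr M borel X" by (rule prob_space_distr) simp
  interpret Y: prob_space "distr M borel Y" by (rule prob_space_distr) simp
  interpret P: pair_prob_space "distr M borel X" "distr M borel Y" ..
  have "AE y in distr M borel Y. AE x in distr M borel X. x + y \<noteq> 0"
  proof (rule AE_I2)
    fix y :: real
    have "AE \<omega> in M. X \<omega> \<noteq> - y"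
      using atom[of "- y"] by (subst (asm) prob_eq_0) auto
    then show "AE x in distr M borel X. x + y \<noteq> 0"
      by (subst AE_distr_iff) (auto simp: add_eq_0_iff2)
  qed
  then have "AE x in distr M borel X. AE y in distr M borel Y. x + y \<noteq> 0"
    by (subst P.AE_commute) measurable
  then have "AE p in distr M borel X \<Otimes>\<^sub>M distr M borel Y. fst p + snd p \<noteq> 0"
    by (subst (asm) P.AE_pair_iff) measurable
  then have "AE p in distr M (borel \<Otimes>\<^sub>M borel) (\<lambda>\<omega>. (X \<omega>, Y \<omega>)). fst p + snd p \<noteq> 0"
    using ind unfolding indep_var_distribution_eq by (elim conjE) (simp only:)
  then show ?thesis by (subst (asm) AE_distr_iff) auto
qed

context lpp_model begin

lemma space_M [simp]: "space M = UNIV"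
  using sets_eq_imp_space_eq[OF sets_borel] by simp

lemma eventI: "Measurable.pred M P \<Longrightarrow> {\<omega>. P \<omega>} \<in> events"
  by (simp add: pred_def)

lemma AE_not_if_prob_0: "Measurable.pred M P \<Longrightarrow> prob {\<omega>. P \<omega>} = 0 \<Longrightarrow> AE \<omega> in M. \<not> P \<omega>"
  using prob_eq_0[OF eventI, of P] by simp

lemma weight_atomless: "prob {\<omega>. w x \<omega> = c} = 0"
proof -
  have "finite_borel_measure (distr M borel (w 0))"
    by (intro finite_borel_measure.intro finite_borel_measure_axioms.intro prob_space.finite_measure
        prob_space_distr w_measurable) simp
  note isCont_cdf = finite_borel_measure.isCont_cdf[OF this]
  have "isCont (cdf (distr M borel (w 0))) c"
    using w_continuous by (simp add: continuous_on_eq_continuous_at)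
  then have "measure (distr M borel (w 0)) {c} = 0" by (simp add: isCont_cdf)
  then have "measure (distr M borel (w x)) {c} = 0" using w_ident[of x 0] by simp
  then show ?thesis using w_measurable[of x] by (simp add: measure_distr vimage_def)
qed

text \<open>The term of a site with nonzero coefficient is atomless and independent of the rest of
  the sum.\<close>

lemma AE_linear_combination_neq_0:
  fixes c :: "site \<Rightarrow> real"
  assumes "finite S" "x \<in> S" "c x \<noteq> 0"
  shows "AE \<omega> in M. (\<Sum>y\<in>S. c y * w y \<omega>) \<noteq> 0"
proof -
  let ?X = "\<lambda>y \<omega>. c y * w y \<omega>"
  have "indep_vars (\<lambda>_. borel) (\<lambda>y. (\<lambda>r. c y * r) \<circ> w y) UNIV"
    by (rule indep_vars_compose[OF w_indep]) measurable
  from indep_vars_subset[OF this, of "insert x (S - {x})"]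
  have "indep_vars (\<lambda>_. borel) ?X (insert x (S - {x}))"
    by (simp add: o_def)
  then have "indep_var borel (?X x) borel (\<lambda>\<omega>. \<Sum>y\<in>S - {x}. ?X y \<omega>)"
    using assms by (intro indep_vars_sum) auto
  moreover have "prob {\<omega> \<in> space M. ?X x \<omega> = d} = 0" for d
  proof -
    have "{\<omega> \<in> space M. ?X x \<omega> = d} = {\<omega>. w x \<omega> = d / c x}" using assms by (auto simp: field_simps)
    then show ?thesis using weight_atomless by simp
  qed
  ultimately have "AE \<omega> in M. ?X x \<omega> + (\<Sum>y\<in>S - {x}. ?X y \<omega>) \<noteq> 0"
    by (rule indep_var_atomless_sum_neq_0)
  then show ?thesis using assms by (simp add: sum.remove[of S x])
qed

text \<open>Multisets are represented by lists, of which there are countably many. For two different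
  multisets the difference of the sums is a nontrivial linear combination of weights.\<close>

lemma AE_generic_weights: "AE \<omega> in M. generic_weights (\<lambda>z. w z \<omega>)"
proof -
  have "AE \<omega> in M. (\<Sum>z\<in>#mset xs. w z \<omega>) = (\<Sum>z\<in>#mset ys. w z \<omega>) \<longrightarrow> mset xs = mset ys"
    for xs ys :: "site list"
  proof (cases "mset xs = mset ys")
    case False
    define c where "c y = real (count (mset xs) y) - real (count (mset ys) y)" for y
    obtain x where x: "count (mset xs) x \<noteq> count (mset ys) x" using False by (meson multiset_eqI)
    let ?S = "set xs \<union> set ys"
    have sum: "(\<Sum>z\<in>#mset zs. w z \<omega>) = (\<Sum>z\<in>?S. real (count (mset zs) z) * w z \<omega>)"
      if "set zs \<subseteq> ?S" for zs \<omega>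
      using that by (intro sum_mset_count) auto
    have "x \<in> ?S" using x by (metis UnCI count_eq_zero_iff set_mset_mset)
    then have "AE \<omega> in M. (\<Sum>y\<in>?S. c y * w y \<omega>) \<noteq> 0"
      using x by (intro AE_linear_combination_neq_0[of _ x]) (auto simp: c_def)
    then show ?thesis
      by eventually_elim (auto simp: sum c_def left_diff_distrib sum_subtractf)
  qed simp
  then have "AE \<omega> in M. \<forall>xs ys. (\<Sum>z\<in>#mset xs. w z \<omega>) = (\<Sum>z\<in>#mset ys. w z \<omega>) \<longrightarrow> mset xs = mset ys"
    by (simp add: AE_all_countable)
  then show ?thesis
  proof eventually_elim
    case (elim \<omega>)
    show ?case unfolding generic_weights_def
    proof (intro allI impI)
      fix P Q :: "site multiset"
      assume eq: "(\<Sum>x\<in>#P. w x \<omega>) = (\<Sum>x\<in>#Q. w x \<omega>)"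
      obtain xs ys where "mset xs = P" "mset ys = Q" using ex_mset[of P] ex_mset[of Q] by blast
      then show "P = Q" using eq elim by blast
    qed
  qed
qed

lemma T_shift_prob: "A \<in> events \<Longrightarrow> prob (T x -` A) = prob A"
  using measure_distr[OF T_measurable[of x], of A] T_preserving[of x] by simp

lemma T_shift_AE: "AE \<omega> in M. P \<omega> \<Longrightarrow> AE \<omega> in M. P (T x \<omega>)"
proof -
  assume "AE \<omega> in M. P \<omega>"
  then obtain N where N: "{\<omega>. \<not> P \<omega>} \<subseteq> N" "N \<in> null_sets M" by (auto simp: eventually_ae_filter)
  have "T x -` N \<inter> space M \<in> null_sets M"
  proof -
    have "emeasure M (T x -` N \<inter> space M) = emeasure (distr M M (T x)) N"
      using N T_measurable by (intro emeasure_distr[symmetric]) auto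
    then show ?thesis using N measurable_sets[OF T_measurable[of x], of N]
      by (auto simp: T_preserving null_sets_def)
  qed
  then show ?thesis using N(1) by (auto simp: eventually_ae_filter intro!: bexI[of _ "T x -` N"])
qed

end

text \<open>Dominated convergence for indicators. In this form almost sure asymptotics enter
  arguments at one finite scale.\<close>

lemma (in prob_space) AE_eventually_imp_prob:
  assumes [measurable]: "\<And>n::nat. Measurable.pred M (P n)"
    and ev: "AE \<omega> in M. eventually (\<lambda>n. P n \<omega>) sequentially" and \<delta>: "0 < \<delta>"
  shows "\<exists>N0. \<forall>n\<ge>N0. 1 - \<delta> < prob {\<omega> \<in> space M. P n \<omega>}"
proof -
  have "(\<lambda>n. \<integral>\<omega>. indicator {\<omega> \<in> space M. P n \<omega>} \<omega> \<partial>M) \<longlonglongrightarrow> (\<integral>\<omega>. (1::real) \<partial>M)"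
  proof (rule integral_dominated_convergence[where w = "\<lambda>_. 1"])
    show "AE \<omega> in M. (\<lambda>n. indicator {\<omega> \<in> space M. P n \<omega>} \<omega>) \<longlonglongrightarrow> (1::real)"
      using ev AE_space
    proof eventually_elim
      case (elim \<omega>)
      then have "\<forall>\<^sub>F n in sequentially. (1::real) = indicator {\<omega> \<in> space M. P n \<omega>} \<omega>"
        by (auto elim: eventually_mono)
      then show ?case by (rule Lim_transform_eventually[OF tendsto_const])
    qed
  qed (auto simp: indicator_def)
  then have "(\<lambda>n. prob {\<omega> \<in> space M. P n \<omega>}) \<longlonglongrightarrow> 1"
    by (simp add: prob_space)
  then have "\<forall>\<^sub>F n in sequentially. 1 - \<delta> < prob {\<omega> \<in> space M. P n \<omega>}"
    using \<delta> by (intro order_tendstoD(1)) auto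
  then show ?thesis by (simp add: eventually_sequentially)
qed

text \<open>If all intersections were null, the union of \<open>n\<close> of the events would have
  probability \<open>n * p\<close>, eventually exceeding 1.\<close>

lemma (in prob_space) pair_positive:
  assumes A: "\<And>k::nat. A k \<in> events" "\<And>k. prob (A k) = p" and p: "0 < p"
  shows "\<exists>j k. j < k \<and> 0 < prob (A j \<inter> A k)"
proof (rule ccontr)
  assume contra: "\<not> ?thesis"
  have null: "prob (A j \<inter> A k) = 0" if "j < k" for j k
  proof -
    have "\<not> 0 < prob (A j \<inter> A k)" using contra that by blast
    then show ?thesis by (simp add: zero_less_measure_iff)
  qed
  have "prob (\<Union>k<n. A k) = real n * p" for n
  proof (induction n)
    case (Suc n)
    have "prob ((\<Union>k<n. A k) \<inter> A n) \<le> (\<Sum>k<n. prob (A k \<inter> A n))"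
    proof -
      have eq: "(\<Union>k<n. A k) \<inter> A n = (\<Union>k<n. A k \<inter> A n)" by auto
      show ?thesis unfolding eq using A by (intro finite_measure_subadditive_finite) auto
    qed
    also have "\<dots> = 0" using null by simp
    finally have "prob ((\<Union>k<n. A k) \<inter> A n) = 0" by (simp add: measure_le_0_iff)
    moreover have "(\<Union>k<n. A k) \<in> events" using A by auto
    ultimately have "prob ((\<Union>k<n. A k) \<union> A n) = prob (\<Union>k<n. A k) + prob (A n)"
      using A by (subst measure_Un3) (auto simp: fmeasurable_eq_sets)
    moreover have "(\<Union>k<Suc n. A k) = (\<Union>k<n. A k) \<union> A n" by (auto simp: less_Suc_eq)
    ultimately show ?case using Suc A by (simp add: algebra_simps)
  qed simp
  moreover obtain n where "1 < real n * p" using p ex_less_of_nat_mult by blast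
  ultimately show False using prob_le_1[of "\<Union>k<n. A k"] by simp
qed

section \<open>Uniform bounds from the limit shape, and counting paths\<close>

lemma finite_quadrant_layer: "finite (quadrant_layer n)"
proof (rule finite_subset)
  show "quadrant_layer n \<subseteq> {0..int n} \<times> {0..int n}"
    by (auto simp: quadrant_layer_def less_eq_prod_def)
qed auto

lemma shape_bound:
  fixes f :: "site \<Rightarrow> real"
  assumes lim: "(\<lambda>n. Max ((\<lambda>x. \<bar>f x\<bar>) ` quadrant_layer n) / real n) \<longlonglongrightarrow> 0" and "0 < \<epsilon>"
  shows "\<exists>n0. \<forall>n\<ge>n0. \<forall>x\<in>quadrant_layer n. \<bar>f x\<bar> \<le> \<epsilon> * real n"
proof -
  have "\<forall>\<^sub>F n in sequentially. Max ((\<lambda>x. \<bar>f x\<bar>) ` quadrant_layer n) / real n < \<epsilon>"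
    using order_tendstoD(2)[OF lim assms(2)] .
  then obtain n0 where n0: "\<And>n. n \<ge> n0 \<Longrightarrow> Max ((\<lambda>x. \<bar>f x\<bar>) ` quadrant_layer n) / real n < \<epsilon>"
    by (auto simp: eventually_sequentially)
  show ?thesis
  proof (intro exI[of _ "max n0 1"] allI impI ballI)
    fix n x assume n: "n \<ge> max n0 1" and x: "x \<in> quadrant_layer n"
    have "\<bar>f x\<bar> \<le> Max ((\<lambda>x. \<bar>f x\<bar>) ` quadrant_layer n)"
      using x finite_quadrant_layer by (intro Max_ge) auto
    also have "\<dots> \<le> \<epsilon> * real n" using n0[of n] n by (simp add: field_simps)
    finally show "\<bar>f x\<bar> \<le> \<epsilon> * real n" .
  qed
qed

text \<open>The finitely many layers of small index are bounded by one constant, which a large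
  \<open>N\<close> absorbs. On the others the index is at most \<open>4 * N\<close>, whence the
  quarter of \<open>\<epsilon>\<close>.\<close>

lemma shape_bound_box:
  fixes f :: "site \<Rightarrow> real"
  assumes lim: "(\<lambda>n. Max ((\<lambda>x. \<bar>f x\<bar>) ` quadrant_layer n) / real n) \<longlonglongrightarrow> 0" and "0 < \<epsilon>"
  shows "\<exists>N0. \<forall>N\<ge>N0. \<forall>x. 0 \<le> x \<and> fst x \<le> 2 * int N \<and> snd x \<le> 2 * int N \<longrightarrow> \<bar>f x\<bar> \<le> \<epsilon> * real N"
proof -
  obtain n0 where n0: "\<And>n x. n \<ge> n0 \<Longrightarrow> x \<in> quadrant_layer n \<Longrightarrow> \<bar>f x\<bar> \<le> \<epsilon> / 4 * real n"
    using shape_bound[OF lim, of "\<epsilon> / 4"] assms by auto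
  define S where "S = insert 0 (\<Union>n<n0. quadrant_layer n)"
  define C where "C = Max ((\<lambda>x. \<bar>f x\<bar>) ` S)"
  have "finite S" by (auto simp: S_def finite_quadrant_layer)
  then have C: "\<bar>f x\<bar> \<le> C" if "x \<in> S" for x unfolding C_def using that by (intro Max_ge) auto
  show ?thesis
  proof (intro exI[of _ "nat \<lceil>C / \<epsilon>\<rceil>"] allI impI, elim conjE)
    fix N x assume N: "nat \<lceil>C / \<epsilon>\<rceil> \<le> N"
      and x: "0 \<le> (x :: site)" "fst x \<le> 2 * int N" "snd x \<le> 2 * int N"
    define n where "n = nat (fst x + snd x)"
    have xn: "x \<in> quadrant_layer n" using x by (auto simp: quadrant_layer_def n_def less_eq_prod_def)
    show "\<bar>f x\<bar> \<le> \<epsilon> * real N"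
    proof (cases "n < n0")
      case True
      then have "\<bar>f x\<bar> \<le> C" using xn by (intro C) (auto simp: S_def)
      also have "C / \<epsilon> \<le> real N" using N by linarith
      then have "C \<le> \<epsilon> * real N" using assms by (simp add: field_simps)
      finally show ?thesis .
    next
      case False
      then have "\<bar>f x\<bar> \<le> \<epsilon> / 4 * real n" using n0 xn by auto
      also have "\<dots> \<le> \<epsilon> / 4 * (4 * real N)"
        using x assms by (intro mult_left_mono) (auto simp: n_def)
      finally show ?thesis by simp
    qed
  qed
qed

text \<open>The possible sets of sites of an \<open>n\<close>-step path from \<open>x\<close>
  without its end point, which is left out as in \<open>path_weight\<close>.\<close>

fun path_sets :: "nat \<Rightarrow> site \<Rightarrow> site set set" where
  "path_sets 0 x = {{}}"
| "path_sets (Suc n) x = insert x ` (path_sets n (x + e1) \<union> path_sets n (x + e2))"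

lemma finite_path_sets: "finite (path_sets n x)"
  by (induction n arbitrary: x) auto

lemma card_path_sets: "card (path_sets n x) \<le> 2 ^ n"
proof (induction n arbitrary: x)
  case (Suc n)
  have "card (path_sets (Suc n) x) \<le> card (path_sets n (x + e1) \<union> path_sets n (x + e2))"
    by (auto intro!: card_image_le simp: finite_path_sets)
  also have "\<dots> \<le> card (path_sets n (x + e1)) + card (path_sets n (x + e2))" by (rule card_Un_le)
  also have "\<dots> \<le> 2 ^ n + 2 ^ n" by (intro add_mono Suc)
  finally show ?case by simp
qed simp

lemma path_sets_props: "S \<in> path_sets n x \<Longrightarrow> finite S \<and> card S = n \<and> (\<forall>z\<in>S. level x \<le> level z)"
proof (induction n arbitrary: x S)
  case (Suc n)
  then obtain S' where S': "S = insert x S'" "S' \<in> path_sets n (x + e1) \<or> S' \<in> path_sets n (x + e2)"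
    by auto
  then have *: "finite S' \<and> card S' = n \<and> (\<forall>z\<in>S'. level x + 1 \<le> level z)"
    using Suc.IH[of S' "x + e1"] Suc.IH[of S' "x + e2"] by auto
  then have "x \<notin> S'" by auto
  then show ?case using S' * by force
qed simp

context step_map begin

lemma orbit_path_set: "(\<lambda>i. (s ^^ i) x) ` {..<n} \<in> path_sets n x"
proof (induction n arbitrary: x)
  case (Suc n)
  have "(\<lambda>i. (s ^^ i) x) ` {..<Suc n} = insert x ((\<lambda>i. (s ^^ i) (s x)) ` {..<n})"
  proof -
    have "{..<Suc n} = insert 0 (Suc ` {..<n})" by (simp add: lessThan_Suc_eq_insert_0)
    then show ?thesis by (simp add: image_image funpow_swap1)
  qed
  moreover have "(\<lambda>i. (s ^^ i) (s x)) ` {..<n} \<in> path_sets n (x + e1) \<union> path_sets n (x + e2)"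
    using Suc.IH[of "s x"] s_cases[of x] by auto
  ultimately show ?case by simp
qed simp

lemma orbit_inj: "inj_on (\<lambda>i. (s ^^ i) x) A"
proof (rule inj_onI)
  fix i j assume "(s ^^ i) x = (s ^^ j) x"
  then have "level ((s ^^ i) x) = level ((s ^^ j) x)" by simp
  then show "i = j" by simp
qed

end

section \<open>Coalescence in a fixed direction\<close>

text \<open>The Busemann function of a fixed direction and side; \<open>a1\<close> and \<open>a2\<close> are the components of
  the gradient.\<close>

locale stationary_cocycle = lpp_model M T w
  for M :: "'w::polish_space measure" and T w +
  fixes b :: "site \<Rightarrow> site \<Rightarrow> 'w \<Rightarrow> real" and a1 a2 :: real and \<Omega>\<^sub>1 :: "'w set"
  assumes b_measurable [measurable]: "b x y \<in> borel_measurable M"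
    and good_event [measurable]: "\<Omega>\<^sub>1 \<in> events" and prob_good: "prob \<Omega>\<^sub>1 = 1"
    and good_shift: "T z \<omega> \<in> \<Omega>\<^sub>1 \<longleftrightarrow> \<omega> \<in> \<Omega>\<^sub>1"
    and b_shift: "\<omega> \<in> \<Omega>\<^sub>1 \<Longrightarrow> b (x + z) (y + z) \<omega> = b x y (T z \<omega>)"
    and b_add: "\<omega> \<in> \<Omega>\<^sub>1 \<Longrightarrow> b x y \<omega> + b y z \<omega> = b x z \<omega>"
    and b_min: "\<omega> \<in> \<Omega>\<^sub>1 \<Longrightarrow> min (b x (x + e1) \<omega>) (b x (x + e2) \<omega>) = w x \<omega>"
    and b_shape: "AE \<omega> in M. (\<lambda>n. Max ((\<lambda>x. \<bar>b 0 x \<omega> - (of_int (fst x) * a1 + of_int (snd x) * a2)\<bar>)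
        ` quadrant_layer n) / real n) \<longlonglongrightarrow> 0"
    and b_indep: "indep_set
      (generated_events M ({w x | x. x \<in> I} \<union> {b x y | x y. x \<in> I \<and> x \<le> y}))
      (generated_events M {w x | x. \<forall>z\<in>I. \<not> z \<le> x})"
begin

declare w_measurable [measurable] T_measurable [measurable]

lemma AE_good: "AE \<omega> in M. \<omega> \<in> \<Omega>\<^sub>1"
  using prob_good by (rule AE_prob_1)

text \<open>Ties are broken towards \<open>e1\<close>, as on the \<open>Plus\<close> side. In a
  fixed direction there are almost surely no ties, so the same map serves both sides.\<close>

definition st :: "'w \<Rightarrow> site \<Rightarrow> site" where
  "st \<omega> z = (if b z (z + e1) \<omega> \<le> b z (z + e2) \<omega> then z + e1 else z + e2)"

sublocale sm: step_map "st \<omega>" for \<omega>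
  by standard (auto simp: st_def)

lemma cocycle_at: "\<omega> \<in> \<Omega>\<^sub>1 \<Longrightarrow> cocycle (\<lambda>z. w z \<omega>) (\<lambda>x y. b x y \<omega>)"
  using b_add b_min by (simp add: cocycle_def)

lemma st_busemann: "st \<omega> z = busemann_step (\<lambda>x y. b x y \<omega>) Plus z"
  by (auto simp: st_def busemann_step_def)

text \<open>The measurable structure is left open because a smaller one, without some of the weights
  below level 0, is substituted later. A path reads increments of \<open>b\<close> only from its own
  level upwards.\<close>

lemma st_pow_measurable:
  assumes "\<And>z i. level x \<le> level z \<Longrightarrow> b z (z + e1) \<in> borel_measurable N \<and> b z (z + e2) \<in> borel_measurable N"
  shows "Measurable.pred N (\<lambda>\<omega>. (st \<omega> ^^ n) x = y)"
  using assms
proof (induction n arbitrary: x)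
  case 0
  then show ?case by simp
next
  case (Suc n)
  have [measurable]: "Measurable.pred N (\<lambda>\<omega>. (st \<omega> ^^ n) (x + e1) = y)"
    "Measurable.pred N (\<lambda>\<omega>. (st \<omega> ^^ n) (x + e2) = y)"
    using Suc.prems by (auto intro!: Suc.IH)
  have [measurable]: "b x (x + e1) \<in> borel_measurable N" "b x (x + e2) \<in> borel_measurable N"
    using Suc.prems[of x] by auto
  have eq: "(\<lambda>\<omega>. (st \<omega> ^^ Suc n) x = y) = (\<lambda>\<omega>. if b x (x + e1) \<omega> \<le> b x (x + e2) \<omega>
      then (st \<omega> ^^ n) (x + e1) = y else (st \<omega> ^^ n) (x + e2) = y)"
    by (auto simp: sm.s_pow_Suc st_def simp del: funpow.simps)
  show ?case unfolding eq by measurable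
qed

text \<open>Only increments strictly above the level of \<open>x\<close> are involved. Boundary
  sites of level -1 are therefore independent of the weights below level 0.\<close>

lemma bd_measurable:
  assumes "\<And>z i. level x < level z \<Longrightarrow> b z (z + e1) \<in> borel_measurable N \<and> b z (z + e2) \<in> borel_measurable N"
  shows "Measurable.pred N (\<lambda>\<omega>. sm.bd \<omega> x)"
proof -
  have [measurable]: "Measurable.pred N (\<lambda>\<omega>. (st \<omega> ^^ n) (x + e1) = y)"
    "Measurable.pred N (\<lambda>\<omega>. (st \<omega> ^^ n) (x + e2) = y)" for n y
    using assms by (auto intro!: st_pow_measurable)
  have eq: "sm.bd \<omega> x \<longleftrightarrow> \<not> (\<exists>n y. (st \<omega> ^^ n) (x + e1) = y \<and> (st \<omega> ^^ n) (x + e2) = y)" for \<omega>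
    unfolding sm.bd_def sm.merge_def by metis
  show ?thesis unfolding eq by measurable
qed

lemma [measurable]: "Measurable.pred M (\<lambda>\<omega>. sm.bd \<omega> x)"
  by (intro bd_measurable) simp

lemma [measurable]: "Measurable.pred M (\<lambda>\<omega>. st \<omega> x = y)"
  using st_pow_measurable[of x M 1 y] by simp

lemma [measurable]: "Measurable.pred M (\<lambda>\<omega>. sm.via1 \<omega> x)" "Measurable.pred M (\<lambda>\<omega>. sm.via2 \<omega> x)"
  unfolding sm.via1_def sm.via2_def by measurable

lemma st_shift: "\<omega> \<in> \<Omega>\<^sub>1 \<Longrightarrow> st (T x \<omega>) z + x = st \<omega> (z + x)"
  using b_shift[of \<omega> z x "z + e1"] b_shift[of \<omega> z x "z + e2"]
  by (auto simp: st_def algebra_simps)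

lemma st_pow_shift: "\<omega> \<in> \<Omega>\<^sub>1 \<Longrightarrow> (st (T x \<omega>) ^^ n) z + x = (st \<omega> ^^ n) (z + x)"
  by (induction n) (auto simp: st_shift)

lemma merge_shift: "\<omega> \<in> \<Omega>\<^sub>1 \<Longrightarrow> sm.merge (T x \<omega>) u v \<longleftrightarrow> sm.merge \<omega> (u + x) (v + x)"
  by (simp add: sm.merge_def st_pow_shift[symmetric])

lemma via_shift:
  assumes "\<omega> \<in> \<Omega>\<^sub>1"
  shows "sm.bd (T x \<omega>) z \<longleftrightarrow> sm.bd \<omega> (z + x)" "sm.via1 (T x \<omega>) z \<longleftrightarrow> sm.via1 \<omega> (z + x)"
    "sm.via2 (T x \<omega>) z \<longleftrightarrow> sm.via2 \<omega> (z + x)"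
proof -
  show bd: "sm.bd (T x \<omega>) z \<longleftrightarrow> sm.bd \<omega> (z + x)"
    using merge_shift[OF assms, of x "z + e1" "z + e2"] by (simp add: sm.bd_def algebra_simps)
  have "st (T x \<omega>) z = z + e \<longleftrightarrow> st \<omega> (z + x) = z + x + e" for e
    using st_shift[OF assms, of x z] by (auto simp: algebra_simps)
  then show "sm.via1 (T x \<omega>) z \<longleftrightarrow> sm.via1 \<omega> (z + x)" "sm.via2 (T x \<omega>) z \<longleftrightarrow> sm.via2 \<omega> (z + x)"
    using bd by (auto simp: sm.via1_def sm.via2_def)
qed

lemma prob_stationary:
  assumes [measurable]: "Measurable.pred M (\<lambda>\<omega>. P \<omega> 0)"
    and "\<And>\<omega>. \<omega> \<in> \<Omega>\<^sub>1 \<Longrightarrow> P (T x \<omega>) 0 \<longleftrightarrow> P \<omega> x"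
  shows "prob {\<omega>\<in>\<Omega>\<^sub>1. P \<omega> x} = prob {\<omega>\<in>\<Omega>\<^sub>1. P \<omega> (0 :: site)}"
proof -
  have "{\<omega>\<in>\<Omega>\<^sub>1. P \<omega> x} = T x -` {\<omega>\<in>\<Omega>\<^sub>1. P \<omega> 0}"
    using assms(2) by (auto simp: good_shift)
  moreover have "{\<omega>\<in>\<Omega>\<^sub>1. P \<omega> 0} = {\<omega>\<in>space M. \<omega> \<in> \<Omega>\<^sub>1 \<and> P \<omega> 0}" by simp
  then have "{\<omega>\<in>\<Omega>\<^sub>1. P \<omega> 0} \<in> events" by simp
  ultimately show ?thesis using T_shift_prob[of "{\<omega>\<in>\<Omega>\<^sub>1. P \<omega> 0}" x] by (simp only:)
qed

text \<open>Mass transport: every boundary site has a boundary child, and boundary sites have the same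
  density on all levels; hence almost surely no boundary site has two.\<close>

lemma AE_one_child: "AE \<omega> in M. \<forall>y. \<not> (sm.via1 \<omega> (y + e1) \<and> sm.via2 \<omega> (y + e2))"
  unfolding AE_all_countable
proof
  fix y :: site
  define V1 V2 Bd where "V1 x = {\<omega>\<in>\<Omega>\<^sub>1. sm.via1 \<omega> x}" and "V2 x = {\<omega>\<in>\<Omega>\<^sub>1. sm.via2 \<omega> x}"
    and "Bd x = {\<omega>\<in>\<Omega>\<^sub>1. sm.bd \<omega> x}" for x
  have ev: "V1 x \<in> events" "V2 x \<in> events" for x
  proof -
    have "V1 x = {\<omega>\<in>space M. \<omega> \<in> \<Omega>\<^sub>1 \<and> sm.via1 \<omega> x}" "V2 x = {\<omega>\<in>space M. \<omega> \<in> \<Omega>\<^sub>1 \<and> sm.via2 \<omega> x}"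
      by (auto simp: V1_def V2_def)
    then show "V1 x \<in> events" "V2 x \<in> events" by simp_all
  qed
  have stat: "prob (V1 x) = prob (V1 0)" "prob (V2 x) = prob (V2 0)" for x
    unfolding V1_def V2_def
    using prob_stationary[of sm.via1 x] prob_stationary[of sm.via2 x] via_shift[of _ x 0] by auto
  have "Bd 0 = V1 0 \<union> V2 0"
    using sm.bd_split[of _ 0] by (auto simp: Bd_def V1_def V2_def)
  moreover have "V1 0 \<inter> V2 0 = {}"
    by (auto simp: V1_def V2_def sm.via1_def sm.via2_def)
  ultimately have 1: "prob (Bd 0) = prob (V1 0) + prob (V2 0)"
    using ev by (simp add: finite_measure_Union)
  have "Bd y = V1 (y + e1) \<union> V2 (y + e2)"
    using sm.bd_children by (auto simp: Bd_def V1_def V2_def)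
  then have 2: "prob (Bd y) = prob (V1 (y + e1)) + prob (V2 (y + e2)) - prob (V1 (y + e1) \<inter> V2 (y + e2))"
    using ev by (simp add: measure_Un3 fmeasurable_eq_sets)
  have "prob (Bd y) = prob (Bd 0)"
    unfolding Bd_def using prob_stationary[of sm.bd y] via_shift[of _ y 0] by auto
  \<comment> \<open>Splitting the boundary sites by their own step gives the sum of two densities;
    splitting them by their children gives the same sum less the overlap.\<close>
  then have "prob (V1 (y + e1) \<inter> V2 (y + e2)) = 0"
    using 1 2 stat[of "y + e1"] stat[of "y + e2"] by simp
  then have "AE \<omega> in M. \<omega> \<notin> V1 (y + e1) \<inter> V2 (y + e2)"
    using ev by (intro AE_not_in) (auto simp: null_sets_def emeasure_eq_measure)
  then show "AE \<omega> in M. \<not> (sm.via1 \<omega> (y + e1) \<and> sm.via2 \<omega> (y + e2))"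
    using AE_good by eventually_elim (auto simp: V1_def V2_def)
qed

text \<open>Otherwise the weights are essentially bounded by \<open>min a1 a2\<close>; counting paths shows that then no
  path collects asymptotically \<open>min a1 a2\<close> per step, contrary to the shape of \<open>b\<close>.\<close>

lemma heavy_weights: "\<exists>\<Lambda>. 0 < prob {\<omega>. \<Lambda> \<le> w 0 \<omega>} \<and> (a1 < \<Lambda> \<or> a2 < \<Lambda>)"
proof (rule ccontr)
  assume contra: "\<not> ?thesis"
  define c where "c = min a1 a2"
  have null: "prob {\<omega>. \<Lambda> \<le> w 0 \<omega>} = 0" if "c < \<Lambda>" for \<Lambda>
  proof -
    have "\<not> 0 < prob {\<omega>. \<Lambda> \<le> w 0 \<omega>}" using contra that by (auto simp: c_def min_less_iff_disj)
    then show ?thesis by (simp add: zero_less_measure_iff)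
  qed
  have "AE \<omega> in M. \<forall>n. \<not> c + inverse (real (Suc n)) \<le> w 0 \<omega>"
    unfolding AE_all_countable
  proof
    fix n
    show "AE \<omega> in M. \<not> c + inverse (real (Suc n)) \<le> w 0 \<omega>"
      by (rule AE_not_if_prob_0) (measurable, auto intro!: null)
  qed
  moreover have "AE \<omega> in M. w 0 \<omega> \<noteq> c"
    by (rule AE_not_if_prob_0) (measurable, rule weight_atomless)
  ultimately have less: "AE \<omega> in M. w 0 \<omega> < c"
  proof eventually_elim
    case (elim \<omega>)
    show ?case
    proof (rule ccontr)
      assume "\<not> w 0 \<omega> < c"
      then obtain n where "inverse (real (Suc n)) < w 0 \<omega> - c"
        using elim reals_Archimedean[of "w 0 \<omega> - c"] by auto
      then show False using elim by (metis add.commute less_diff_eq less_imp_le)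
    qed
  qed
  have less_all: "AE \<omega> in M. \<forall>x. w x \<omega> < c"
    unfolding AE_all_countable
  proof
    fix x
    have "AE r in distr M borel (w 0). r < c" using less by (subst AE_distr_iff) auto
    then have "AE r in distr M borel (w x). r < c" by (simp only: w_ident[of x 0])
    then show "AE \<omega> in M. w x \<omega> < c" by (subst (asm) AE_distr_iff) auto
  qed
  \<comment> \<open>Weights below \<open>c\<close> make this exponential expectation tend to 0. The
    level \<open>1 / 8\<close> is dictated by the count: Markov's inequality at threshold
    \<open>(1 / 2) ^ n\<close> leaves \<open>(1 / 4) ^ n\<close> per path, and at most
    \<open>2 ^ n\<close> paths leave \<open>(1 / 2) ^ n\<close>.\<close>
  have "(\<lambda>k. \<integral>\<omega>. exp (real k * min 0 (w 0 \<omega> - c)) \<partial>M) \<longlonglongrightarrow> (\<integral>\<omega>. (0::real) \<partial>M)"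
  proof (rule integral_dominated_convergence[where w = "\<lambda>_. 1"])
    show "AE \<omega> in M. (\<lambda>k. exp (real k * min 0 (w 0 \<omega> - c))) \<longlonglongrightarrow> 0"
      using less
    proof eventually_elim
      case (elim \<omega>)
      then have "(\<lambda>k. exp (min 0 (w 0 \<omega> - c)) ^ k) \<longlonglongrightarrow> 0" by (intro LIMSEQ_power_zero) auto
      then show ?case by (simp add: exp_of_nat_mult)
    qed
  qed (auto simp: mult_nonneg_nonpos)
  then have "\<forall>\<^sub>F k in sequentially. (\<integral>\<omega>. exp (real k * min 0 (w 0 \<omega> - c)) \<partial>M) < 1 / 8"
    by (intro order_tendstoD(2)) auto
  then obtain k0 where k0: "\<And>k. k \<ge> k0 \<Longrightarrow> (\<integral>\<omega>. exp (real k * min 0 (w 0 \<omega> - c)) \<partial>M) < 1 / 8"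
    by (auto simp: eventually_sequentially)
  define k where "k = max k0 1"
  define f where "f r = exp (real k * min 0 (r - c))" for r
  have [measurable]: "f \<in> borel_measurable borel" unfolding f_def by measurable
  have f: "0 < f r" "f r \<le> 1" for r by (auto simp: f_def mult_nonneg_nonpos)
  have int: "integrable M (\<lambda>\<omega>. f (w x \<omega>))" for x
    using f by (intro integrable_const_bound[where B = 1]) (auto simp: less_imp_le)
  have phi: "(\<integral>\<^sup>+\<omega>. ennreal (f (w x \<omega>)) \<partial>M) \<le> ennreal (1 / 8)" for x
  proof -
    have "(\<integral>\<^sup>+\<omega>. ennreal (f (w x \<omega>)) \<partial>M) = (\<integral>\<^sup>+r. ennreal (f r) \<partial>distr M borel (w x))"
      by (subst nn_integral_distr) auto
    also have "\<dots> = (\<integral>\<^sup>+r. ennreal (f r) \<partial>distr M borel (w 0))" using w_ident[of x 0] by simp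
    also have "\<dots> = (\<integral>\<^sup>+\<omega>. ennreal (f (w 0 \<omega>)) \<partial>M)" by (subst nn_integral_distr) auto
    also have "\<dots> = ennreal (\<integral>\<omega>. f (w 0 \<omega>) \<partial>M)"
      using f by (intro nn_integral_eq_integral int) (auto simp: less_imp_le)
    also have "\<dots> \<le> ennreal (1 / 8)"
      using k0[of k] by (intro ennreal_leI) (simp add: f_def k_def)
    finally show ?thesis .
  qed
  have path: "prob {\<omega>. (1 / 2) ^ n \<le> (\<Prod>x\<in>S. f (w x \<omega>))} \<le> (1 / 4) ^ n" if S: "S \<in> path_sets n 0" for S n
  proof -
    have fin: "finite S" "card S = n" using path_sets_props[OF S] by auto
    have "indep_vars (\<lambda>_. borel) (\<lambda>x. (\<lambda>r. ennreal (f r)) \<circ> w x) UNIV"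
      by (rule indep_vars_compose[OF w_indep]) measurable
    then have ind: "indep_vars (\<lambda>_. borel) (\<lambda>x \<omega>. ennreal (f (w x \<omega>))) S"
      using indep_vars_subset[of "\<lambda>_. borel" _ UNIV S] by (simp add: o_def)
    have "ennreal ((1 / 2) ^ n) * emeasure M {\<omega> \<in> space M. ennreal ((1 / 2) ^ n) \<le> (\<Prod>x\<in>S. ennreal (f (w x \<omega>)))}
        \<le> (\<integral>\<^sup>+\<omega>. (\<Prod>x\<in>S. ennreal (f (w x \<omega>))) \<partial>M)"
    proof -
      have "ennreal ((1 / 2) ^ n) * emeasure M {\<omega> \<in> space M. ennreal ((1 / 2) ^ n) \<le> (\<Prod>x\<in>S. ennreal (f (w x \<omega>)))}
        = (\<integral>\<^sup>+\<omega>. ennreal ((1 / 2) ^ n) * indicator {\<omega> \<in> space M. ennreal ((1 / 2) ^ n) \<le> (\<Prod>x\<in>S. ennreal (f (w x \<omega>)))} \<omega> \<partial>M)"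
        by (intro nn_integral_cmult_indicator[symmetric]) measurable
      also have "\<dots> \<le> (\<integral>\<^sup>+\<omega>. (\<Prod>x\<in>S. ennreal (f (w x \<omega>))) \<partial>M)"
        by (intro nn_integral_mono) (auto simp: indicator_def)
      finally show ?thesis .
    qed
    also have "\<dots> = (\<Prod>x\<in>S. \<integral>\<^sup>+\<omega>. ennreal (f (w x \<omega>)) \<partial>M)"
      using fin ind by (intro indep_vars_nn_integral) auto
    also have "\<dots> \<le> (\<Prod>x\<in>S. ennreal (1 / 8))" by (intro prod_mono_ennreal phi)
    also have "\<dots> = ennreal ((1 / 8) ^ n)" using fin by (simp add: ennreal_power)
    also have "{\<omega> \<in> space M. ennreal ((1 / 2) ^ n) \<le> (\<Prod>x\<in>S. ennreal (f (w x \<omega>)))}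
        = {\<omega>. (1 / 2) ^ n \<le> (\<Prod>x\<in>S. f (w x \<omega>))}"
      using f by (auto simp: prod_ennreal less_imp_le prod_nonneg)
    finally have "(1 / 2) ^ n * prob {\<omega>. (1 / 2) ^ n \<le> (\<Prod>x\<in>S. f (w x \<omega>))} \<le> (1 / 8) ^ n"
      by (simp add: emeasure_eq_measure ennreal_mult[symmetric] del: ennreal_power)
    then have "prob {\<omega>. (1 / 2) ^ n \<le> (\<Prod>x\<in>S. f (w x \<omega>))} \<le> (1 / 8) ^ n / (1 / 2) ^ n"
      by (simp add: field_simps)
    then show ?thesis by (simp add: power_divide[symmetric])
  qed
  have union: "prob {\<omega>. \<exists>S\<in>path_sets n 0. (1 / 2) ^ n \<le> (\<Prod>x\<in>S. f (w x \<omega>))} \<le> (1 / 2) ^ n" for n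
  proof -
    have "{\<omega>. \<exists>S\<in>path_sets n 0. (1 / 2) ^ n \<le> (\<Prod>x\<in>S. f (w x \<omega>))}
        = (\<Union>S\<in>path_sets n 0. {\<omega>. (1 / 2) ^ n \<le> (\<Prod>x\<in>S. f (w x \<omega>))})" by auto
    also have "prob \<dots> \<le> (\<Sum>S\<in>path_sets n 0. prob {\<omega>. (1 / 2) ^ n \<le> (\<Prod>x\<in>S. f (w x \<omega>))})"
    proof (intro finite_measure_subadditive_finite finite_path_sets image_subsetI)
      fix S assume "S \<in> path_sets n 0"
      show "{\<omega>. (1 / 2) ^ n \<le> (\<Prod>x\<in>S. f (w x \<omega>))} \<in> events"
        by (rule eventI) measurable
    qed
    also have "\<dots> \<le> (\<Sum>S\<in>path_sets n (0 :: site). (1 / 4) ^ n)" by (intro sum_mono path)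
    also have "\<dots> \<le> 2 ^ n * (1 / 4) ^ n"
    proof -
      have "real (card (path_sets n (0 :: site))) \<le> real (2 ^ n)" using card_path_sets by (intro of_nat_mono)
      then show ?thesis by simp
    qed
    also have "\<dots> = (1 / 2 :: real) ^ n" by (simp add: power_mult_distrib[symmetric])
    finally show ?thesis .
  qed
  \<comment> \<open>A deficit of \<open>\<epsilon> * n\<close> below \<open>c * n\<close>,
    multiplied by \<open>k\<close> and exponentiated, is then exactly the factor
    \<open>(1 / 2) ^ n\<close>.\<close>
  define \<epsilon> where "\<epsilon> = ln 2 / real k"
  have "k > 0" by (simp add: k_def)
  then have \<epsilon>: "\<epsilon> > 0" by (simp add: \<epsilon>_def)
  define P where "P n \<omega> \<longleftrightarrow> \<omega> \<in> \<Omega>\<^sub>1 \<and> (\<forall>x. w x \<omega> < c) \<and> (\<forall>x\<in>quadrant_layer n.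
      \<bar>b 0 x \<omega> - (of_int (fst x) * a1 + of_int (snd x) * a2)\<bar> \<le> \<epsilon> * real n)" for n \<omega>
  have "\<exists>N0. \<forall>n\<ge>N0. 1 - 1 / 4 < prob {\<omega> \<in> space M. P n \<omega>}"
  proof (rule AE_eventually_imp_prob)
    show "Measurable.pred M (P n)" for n
      unfolding P_def using finite_quadrant_layer[of n] by measurable
    show "AE \<omega> in M. \<forall>\<^sub>F n in sequentially. P n \<omega>"
      using b_shape AE_good less_all
    proof eventually_elim
      case (elim \<omega>)
      then show ?case
        using shape_bound[OF elim(1) \<epsilon>] by (auto simp: P_def eventually_sequentially)
    qed
  qed simp
  then obtain N0 where N0: "\<forall>n\<ge>N0. 1 - 1 / 4 < prob {\<omega> \<in> space M. P n \<omega>}" by blast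
  define n where "n = max N0 1"
  have n: "n \<ge> 1" "3 / 4 < prob {\<omega>. P n \<omega>}"
    using N0[rule_format, of n] by (auto simp: n_def)
  have "{\<omega>. P n \<omega>} \<subseteq> {\<omega>. \<exists>S\<in>path_sets n 0. (1 / 2) ^ n \<le> (\<Prod>x\<in>S. f (w x \<omega>))}"
  proof safe
    fix \<omega> assume P: "P n \<omega>"
    interpret c: cocycle "\<lambda>z. w z \<omega>" "\<lambda>x y. b x y \<omega>" using P cocycle_at by (simp add: P_def)
    \<comment> \<open>The forest path from the origin collects exactly \<open>b 0 (u n)\<close>,
      which by the shape of \<open>b\<close> is at least \<open>c * n - \<epsilon> * n\<close>. Its
      sites form the required \<open>S\<close>.\<close>
    define u where "u i = (st \<omega> ^^ i) 0" for i
    have "b 0 (u i) \<omega> = (\<Sum>j<i. w (u j) \<omega>)" for i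
    proof (induction i)
      case (Suc i)
      have "b (u i) (u (Suc i)) \<omega> = w (u i) \<omega>"
        using c.step_weight[of "u i" Plus] by (simp add: u_def st_busemann[abs_def])
      then show ?case using Suc c.add[of 0 "u i" "u (Suc i)"] by simp
    qed (simp add: u_def)
    moreover have u: "u i \<in> quadrant_layer i" for i
    proof -
      have "0 \<le> u i"
      proof (induction i)
        case (Suc i)
        then show ?case using sm.s_cases[of \<omega> "u i"] by (auto simp: u_def less_eq_prod_def)
      qed (simp add: u_def)
      moreover have "level (u i) = int i" by (simp add: u_def)
      ultimately show ?thesis by (auto simp: quadrant_layer_def level_def less_eq_prod_def)
    qed
    ultimately have "(\<Sum>j<n. w (u j) \<omega>) \<ge> (of_int (fst (u n)) * a1 + of_int (snd (u n)) * a2) - \<epsilon> * real n"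
      using P u[of n] unfolding P_def by (smt (verit))
    moreover have "of_int (fst (u n)) * a1 + of_int (snd (u n)) * a2 \<ge> real n * c"
    proof -
      have un: "0 \<le> fst (u n)" "0 \<le> snd (u n)" "int n = fst (u n) + snd (u n)"
        using u[of n] by (auto simp: quadrant_layer_def less_eq_prod_def)
      have "of_int (fst (u n)) * a1 + of_int (snd (u n)) * a2 \<ge> of_int (fst (u n)) * c + of_int (snd (u n)) * c"
        using un by (intro add_mono mult_left_mono) (auto simp: c_def)
      moreover have "real n = of_int (fst (u n)) + of_int (snd (u n))" using un(3) by linarith
      ultimately show ?thesis by (simp add: distrib_right)
    qed
    ultimately have sum: "(\<Sum>j<n. (w (u j) \<omega> - c)) \<ge> - \<epsilon> * real n" by (simp add: sum_subtractf)
    show "\<exists>S\<in>path_sets n 0. (1 / 2) ^ n \<le> (\<Prod>x\<in>S. f (w x \<omega>))"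
    proof (rule bexI)
      show "u ` {..<n} \<in> path_sets n 0" using sm.orbit_path_set[of \<omega> 0 n] by (simp add: u_def[abs_def])
      have "(\<Prod>x\<in>u ` {..<n}. f (w x \<omega>)) = (\<Prod>j<n. f (w (u j) \<omega>))"
        using sm.orbit_inj[of \<omega> 0] by (subst prod.reindex) (auto simp: u_def[abs_def] o_def)
      also have "\<dots> = exp (real k * (\<Sum>j<n. (w (u j) \<omega> - c)))"
      proof -
        have "f (w x \<omega>) = exp (real k * (w x \<omega> - c))" for x
        proof -
          have "w x \<omega> < c" using P unfolding P_def by blast
          then show ?thesis by (simp add: f_def)
        qed
        then show ?thesis by (simp add: exp_sum sum_distrib_left)
      qed
      also have "\<dots> \<ge> exp (real k * (- \<epsilon> * real n))"
        using mult_left_mono[OF sum, of "real k"] by simp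
      also have "exp (real k * (- \<epsilon> * real n)) = exp (real n * ln (1 / 2))"
        using \<open>k > 0\<close> by (simp add: \<epsilon>_def ln_div)
      also have "\<dots> = (1 / 2) ^ n" by (subst exp_of_nat_mult) simp
      finally show "(1 / 2) ^ n \<le> (\<Prod>x\<in>u ` {..<n}. f (w x \<omega>))" .
    qed
  qed
  moreover have "{\<omega>. \<exists>S\<in>path_sets n 0. (1 / 2) ^ n \<le> (\<Prod>x\<in>S. f (w x \<omega>))} \<in> events"
    by (rule eventI, rule pred_intros_finite(4)[OF finite_path_sets]) measurable
  ultimately have "prob {\<omega>. P n \<omega>} \<le> prob {\<omega>. \<exists>S\<in>path_sets n 0. (1 / 2) ^ n \<le> (\<Prod>x\<in>S. f (w x \<omega>))}"
    by (rule finite_measure_mono)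
  also have "\<dots> \<le> (1 / 2) ^ n" by (rule union)
  also have "\<dots> \<le> 1 / 2" using n power_decreasing[of 1 n "1/2::real"] by simp
  finally show False using n by simp
qed

end

section \<open>Changing the weights below level 0\<close>

lemma (in cocycle) chain_weight_le:
  "chain (ps @ [e]) \<Longrightarrow> sum_list (map W ps) + b e v \<le> b (hd (ps @ [e])) v"
proof (induction ps)
  case (Cons z ps)
  then have "sum_list (map W ps) + b e v \<le> b (hd (ps @ [e])) v"
    by (cases ps) (auto simp: chain_def)
  moreover have "hd (ps @ [e]) = z + e1 \<or> hd (ps @ [e]) = z + e2"
    using Cons.prems by (cases ps) (auto simp: chain_def)
  then have "W z \<le> b z (hd (ps @ [e]))" using weight_le[of z] by auto
  moreover have "b z (hd (ps @ [e])) + b (hd (ps @ [e])) v = b z v" by (rule add)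
  ultimately show ?case by simp
qed simp

text \<open>Neighbours on a level are the two upper neighbours of one site, so merging propagates
  along the level.\<close>

lemma (in step_map) merge_if_no_bd:
  assumes "\<And>z. \<not> bd z" "level u = level v"
  shows "merge u v"
proof -
  have row: "merge u (fst u + int k, snd u - int k)" for u k
  proof (induction k)
    case (Suc k)
    let ?z = "(fst u + int k, snd u - int k - 1)"
    have "merge (?z + e1) (?z + e2)" using assms(1)[of ?z] by (simp add: bd_def)
    then have "merge (fst u + int k, snd u - int k) (fst u + int (Suc k), snd u - int (Suc k))"
      by (auto simp: e1_def e2_def algebra_simps intro: merge_sym)
    then show ?case using Suc merge_trans by blast
  qed simp
  have *: "merge u v" if "level u = level v" "fst u \<le> fst v" for u v
  proof -
    have "(fst u + int (nat (fst v - fst u)), snd u - int (nat (fst v - fst u))) = v"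
      using that by (auto simp: prod_eq_iff level_def)
    then show ?thesis using row[of u "nat (fst v - fst u)"] by simp
  qed
  show ?thesis using *[of u v] *[of v u] assms(2) merge_sym by (metis linear)
qed

context stationary_cocycle begin

definition upper_events :: "'w set set" where
  "upper_events = generated_events M
     ({w x | x. x \<in> {x. 0 \<le> level x}} \<union> {b x y | x y. x \<in> {x. 0 \<le> level x} \<and> x \<le> y})"

text \<open>Indexing by \<open>option\<close> makes a single family out of all independent blocks:
  \<open>None\<close> carries everything from level 0 upwards, and \<open>Some x\<close> one
  weight.\<close>

definition site_events :: "site option \<Rightarrow> 'w set set" where
  "site_events i = (case i of None \<Rightarrow> upper_events
    | Some x \<Rightarrow> {w x -` A \<inter> space M | A. A \<in> sets borel})"

definition lower_sites :: "site set" where "lower_sites = {x. level x < 0}"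

lemma sigma_sets_finite_INT:
  assumes "finite K" "K \<noteq> {}" "\<And>x. x \<in> K \<Longrightarrow> C x \<in> sigma_sets (space M) F"
  shows "(\<Inter>x\<in>K. C x) \<in> sigma_sets (space M) F"
  using sets.finite_INT[of K C "sigma (space M) F"] assms by (simp add: sets_measure_of)

lemma Int_stable_generated: "Int_stable (generated_events M F)"
proof -
  have this_eq: "sets (sigma (space M) {f -` A \<inter> space M | f A. f \<in> F \<and> A \<in> sets borel}) = generated_events M F"
    unfolding generated_events_def by (rule sets_measure_of) auto
  show ?thesis unfolding Int_stable_def this_eq[symmetric] by blast
qed

text \<open>\<open>b_indep\<close> is applied to the half plane of nonnegative levels; the sites
  that dominate none of its points are those of negative level. Independence of the weights among
  themselves then splits the lower block.\<close>

lemma indep_site_events: "indep_sets site_events (insert None (Some ` lower_sites))"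
proof (rule indep_setsI)
  have I: "{w x | x. \<forall>z\<in>{x. 0 \<le> level x}. \<not> z \<le> x} = w ` lower_sites"
  proof -
    have "(\<forall>z\<in>{x. 0 \<le> level x}. \<not> z \<le> x) \<longleftrightarrow> level x < 0" for x :: site
    proof
      assume *: "\<forall>z\<in>{x. 0 \<le> level x}. \<not> z \<le> x"
      then have "x \<notin> {x. 0 \<le> level x}" by blast
      then show "level x < 0" by simp
    qed (auto simp: level_def less_eq_prod_def)
    then show ?thesis by (auto simp: lower_sites_def)
  qed
  have ind: "indep_set upper_events (generated_events M (w ` lower_sites))"
    using b_indep[of "{x. 0 \<le> level x}"] unfolding I upper_events_def .
  have upper: "upper_events \<subseteq> events" by (rule indep_setD_ev1[OF ind])
  then show "site_events i \<subseteq> events" for i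
    by (cases i) (auto simp: site_events_def intro: measurable_sets[OF w_measurable, simplified])
  have w_ind: "indep_sets (\<lambda>x. {w x -` A \<inter> space M | A. A \<in> sets borel}) UNIV"
    using w_indep unfolding indep_vars_def2 by simp
  fix A and J :: "site option set"
  assume J: "J \<noteq> {}" "J \<subseteq> insert None (Some ` lower_sites)" "finite J" "\<forall>j\<in>J. A j \<in> site_events j"
  define K where "K = Some -` J"
  have K: "finite K" "K \<subseteq> lower_sites" "J - {None} = Some ` K"
    using J by (auto simp: K_def intro!: finite_vimageI)
  have AK: "\<forall>x\<in>K. A (Some x) \<in> {w x -` A \<inter> space M | A. A \<in> sets borel}"
  proof
    fix x assume "x \<in> K"
    then have "A (Some x) \<in> site_events (Some x)" using J(4) unfolding K_def by blast
    then show "A (Some x) \<in> {w x -` A \<inter> space M | A. A \<in> sets borel}"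
      by (simp only: site_events_def option.case)
  qed
  have PK: "prob (\<Inter>x\<in>K. A (Some x)) = (\<Prod>x\<in>K. prob (A (Some x)))" if "K \<noteq> {}"
    by (rule indep_setsD[OF w_ind]) (use that K AK in auto)
  show "prob (\<Inter>j\<in>J. A j) = (\<Prod>j\<in>J. prob (A j))"
  proof (cases "None \<in> J")
    case False
    then have "J = Some ` K" "K \<noteq> {}" using K J by auto
    then show ?thesis using PK by (simp add: prod.reindex)
  next
    case True
    then have JK: "J = insert None (Some ` K)" using K by auto
    show ?thesis
    proof (cases "K = {}")
      case True
      then have "J = {None}" using JK by blast
      then show ?thesis by simp
    next
      case False
      have "(\<Inter>x\<in>K. A (Some x)) \<in> generated_events M (w ` lower_sites)"
        unfolding generated_events_def
      proof (rule sigma_sets_finite_INT[OF K(1) False])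
        fix x assume "x \<in> K"
        have "A (Some x) \<in> {w x -` A \<inter> space M | A. A \<in> sets borel}"
          using AK \<open>x \<in> K\<close> by (rule bspec)
        then obtain C where "A (Some x) = w x -` C \<inter> space M" "C \<in> sets borel"
          unfolding mem_Collect_eq by (elim exE conjE)
        moreover have "w x \<in> w ` lower_sites" using K(2) \<open>x \<in> K\<close> by (intro imageI) auto
        ultimately show "A (Some x) \<in> sigma_sets (space M)
            {f -` A \<inter> space M | f A. f \<in> w ` lower_sites \<and> A \<in> sets borel}"
          by (intro sigma_sets.Basic CollectI exI conjI)
      qed
      moreover have "A None \<in> upper_events"
      proof -
        have "A None \<in> site_events None" using True J(4) by blast
        then show ?thesis by (simp only: site_events_def option.case)
      qed
      ultimately have "prob (A None \<inter> (\<Inter>x\<in>K. A (Some x))) = prob (A None) * prob (\<Inter>x\<in>K. A (Some x))"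
        using ind by (intro indep_setD) auto
      also have "\<dots> = prob (A None) * (\<Prod>x\<in>K. prob (A (Some x)))" using PK False by simp
      finally show ?thesis using JK K by (simp add: prod.reindex image_iff)
    qed
  qed
qed

text \<open>The information left after forgetting the weights on \<open>R\<close>; it is independent
  of those weights.\<close>

definition off_measure :: "site set \<Rightarrow> 'w measure" where
  "off_measure R = sigma (space M) (\<Union>i\<in>insert None (Some ` (lower_sites - R)). site_events i)"

lemma sets_off_measure:
  "sets (off_measure R) = sigma_sets (space M) (\<Union>i\<in>insert None (Some ` (lower_sites - R)). site_events i)"
  unfolding off_measure_def by (rule sets_measure_of) auto

lemma space_off_measure [simp]: "space (off_measure R) = UNIV"
  by (simp add: off_measure_def space_measure_of_conv)

lemma off_measurable:
  "x \<in> lower_sites - R \<Longrightarrow> w x \<in> borel_measurable (off_measure R)"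
  "0 \<le> level x \<Longrightarrow> x \<le> y \<Longrightarrow> b x y \<in> borel_measurable (off_measure R)"
proof -
  assume x: "x \<in> lower_sites - R"
  show "w x \<in> borel_measurable (off_measure R)"
  proof (rule measurableI)
    fix A :: "real set" assume "A \<in> sets borel"
    then have "w x -` A \<inter> space M \<in> site_events (Some x)" by (auto simp: site_events_def)
    then show "w x -` A \<inter> space (off_measure R) \<in> sets (off_measure R)"
      unfolding sets_off_measure using x by (intro sigma_sets.Basic) auto
  qed simp
next
  assume x: "0 \<le> level x" "x \<le> y"
  show "b x y \<in> borel_measurable (off_measure R)"
  proof (rule measurableI)
    fix A :: "real set" assume "A \<in> sets borel"
    then have "b x y -` A \<inter> space M \<in> site_events None"
      unfolding site_events_def option.case upper_events_def generated_events_def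
      using x by (intro sigma_sets.Basic) blast
    then show "b x y -` A \<inter> space (off_measure R) \<in> sets (off_measure R)"
      unfolding sets_off_measure by (intro sigma_sets.Basic) auto
  qed simp
qed

lemma vimage_atLeast: "w x -` {\<Lambda>..} \<inter> space M \<in> {w x -` A \<inter> space M | A. A \<in> sets borel}"
  by (rule CollectI, rule exI[of _ "{\<Lambda>..}"]) simp

text \<open>Regroup the independent blocks into those on \<open>R\<close> and all others.\<close>

lemma heavy_set_indep:
  assumes R: "finite R" "R \<subseteq> lower_sites" and A: "A \<in> sets (off_measure R)"
  shows "A \<in> events" "prob (A \<inter> {\<omega>. \<forall>x\<in>R. \<Lambda> \<le> w x \<omega>}) = prob A * prob {\<omega>. \<forall>x\<in>R. \<Lambda> \<le> w x \<omega>}"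
proof -
  let ?I = "\<lambda>c. if c then insert None (Some ` (lower_sites - R)) else Some ` R"
  let ?S = "\<lambda>c. sigma_sets (space M) (\<Union>i\<in>?I c. site_events i)"
  have "indep_sets ?S UNIV"
  proof (rule indep_sets_collect_sigma)
    have "(\<Union>c. ?I c) \<subseteq> insert None (Some ` lower_sites)" using R by auto
    then show "indep_sets site_events (\<Union>c. ?I c)"
      by (rule indep_sets_mono_index[OF _ indep_site_events])
    show "disjoint_family ?I" by (auto simp: disjoint_family_on_def)
    fix i show "Int_stable (site_events i)"
    proof (cases i)
      case None
      then show ?thesis unfolding site_events_def upper_events_def option.case
        by (simp only: option.case Int_stable_generated)
    next
      case (Some x)
      then show ?thesis
        by (auto simp: site_events_def Int_stable_def) (metis sets.Int vimage_Int)
    qed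
  qed
  then have ev: "?S c \<subseteq> events" and ind: "prob (\<Inter>c. C c) = (\<Prod>c\<in>UNIV. prob (C c))"
    if "\<forall>c. C c \<in> ?S c" for c C
    using indep_setsD[of ?S UNIV UNIV C] that by (auto simp: indep_sets_def)
  let ?H = "{\<omega>. \<forall>x\<in>R. \<Lambda> \<le> w x \<omega>}"
  have H: "?H \<in> ?S False"
  proof (cases "R = {}")
    case True
    then have "?H = space M" by simp
    then show ?thesis using sigma_sets_top by metis
  next
    case False
    have "(\<Inter>x\<in>R. w x -` {\<Lambda>..} \<inter> space M) \<in> ?S False"
    proof (rule sigma_sets_finite_INT[OF R(1) False], intro sigma_sets.Basic)
      fix x assume "x \<in> R"
      have "w x -` {\<Lambda>..} \<inter> space M \<in> site_events (Some x)"
        unfolding site_events_def option.case by (rule vimage_atLeast)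
      moreover have "Some x \<in> ?I False" using \<open>x \<in> R\<close> by simp
      ultimately show "w x -` {\<Lambda>..} \<inter> space M \<in> (\<Union>i\<in>?I False. site_events i)" by (rule UN_I[rotated])
    qed
    moreover have "(\<Inter>x\<in>R. w x -` {\<Lambda>..} \<inter> space M) = ?H" using False by auto
    ultimately show ?thesis by simp
  qed
  have A': "A \<in> ?S True" using A by (simp add: sets_off_measure)
  have "\<forall>c. (if c then A else ?H) \<in> ?S c" using A' H by auto
  note * = this
  show "A \<in> events" using ev[OF *, of True] A' by (rule subsetD)
  show "prob (A \<inter> ?H) = prob A * prob ?H"
    using ind[OF *] by (simp add: UNIV_bool Int_commute mult.commute)
qed

lemma heavy_set_pos:
  assumes "finite R" "0 < prob {\<omega>. \<Lambda> \<le> w 0 \<omega>}"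
  shows "0 < prob {\<omega>. \<forall>x\<in>R. \<Lambda> \<le> w x \<omega>}"
proof (cases "R = {}")
  case True
  then show ?thesis using prob_space by simp
next
  case False
  have w_ind: "indep_sets (\<lambda>x. {w x -` A \<inter> space M | A. A \<in> sets borel}) UNIV"
    using w_indep unfolding indep_vars_def2 by simp
  have "prob (\<Inter>x\<in>R. w x -` {\<Lambda>..} \<inter> space M) = (\<Prod>x\<in>R. prob (w x -` {\<Lambda>..} \<inter> space M))"
    by (rule indep_setsD[OF w_ind subset_UNIV False assms(1)]) (intro ballI vimage_atLeast)
  moreover have "(\<Inter>x\<in>R. w x -` {\<Lambda>..} \<inter> space M) = {\<omega>. \<forall>x\<in>R. \<Lambda> \<le> w x \<omega>}" using False by auto
  moreover have "prob (w x -` {\<Lambda>..} \<inter> space M) = prob {\<omega>. \<Lambda> \<le> w 0 \<omega>}" for x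
  proof -
    have "prob (w x -` {\<Lambda>..} \<inter> space M) = measure (distr M borel (w x)) {\<Lambda>..}"
      by (simp add: measure_distr)
    also have "\<dots> = measure (distr M borel (w 0)) {\<Lambda>..}" using w_ident[of x 0] by simp
    also have "\<dots> = prob (w 0 -` {\<Lambda>..} \<inter> space M)" by (simp add: measure_distr)
    finally show ?thesis by (simp add: vimage_def)
  qed
  ultimately show ?thesis using assms by (simp add: prod_pos)
qed

text \<open>The shape of \<open>b\<close> is known only from the origin into the quadrant. Shift the
  lower left corner of the box to the origin and write \<open>b p v\<close> as the difference of the
  values from that corner to \<open>v\<close> and to \<open>p\<close>; the two errors account for
  the halved \<open>\<epsilon>\<close>.\<close>

lemma AE_typical:
  assumes "0 < \<epsilon>" "0 < q"
  shows "\<exists>N0. \<forall>N\<ge>N0. 1 - q < prob {\<omega>\<in>\<Omega>\<^sub>1. \<forall>p\<in>box (int N).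
    \<bar>b p (int N, int N) \<omega> - (of_int (int N - fst p) * a1 + of_int (int N - snd p) * a2)\<bar> \<le> \<epsilon> * real N}"
proof -
  define lin :: "site \<Rightarrow> real" where "lin x = of_int (fst x) * a1 + of_int (snd x) * a2" for x
  define P where "P N \<omega> \<longleftrightarrow> \<omega> \<in> \<Omega>\<^sub>1 \<and> (\<forall>x. 0 \<le> x \<and> fst x \<le> 2 * int N \<and> snd x \<le> 2 * int N \<longrightarrow>
      \<bar>b 0 x \<omega> - lin x\<bar> \<le> \<epsilon> / 2 * real N)" for N \<omega>
  have [measurable]: "Measurable.pred M (P N)" for N unfolding P_def by measurable
  have "\<exists>N0. \<forall>n\<ge>N0. 1 - q < prob {\<omega> \<in> space M. P n \<omega>}"
  proof (rule AE_eventually_imp_prob)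
    show "AE \<omega> in M. \<forall>\<^sub>F n in sequentially. P n \<omega>"
      using b_shape AE_good
    proof eventually_elim
      case (elim \<omega>)
      obtain N0 where "\<forall>N\<ge>N0. \<forall>x. 0 \<le> x \<and> fst x \<le> 2 * int N \<and> snd x \<le> 2 * int N \<longrightarrow>
          \<bar>b 0 x \<omega> - lin x\<bar> \<le> \<epsilon> / 2 * real N"
        using shape_bound_box[OF elim(1), of "\<epsilon> / 2"] assms unfolding lin_def by auto
      then show ?case using elim(2) by (auto simp: P_def eventually_sequentially)
    qed
  qed (use assms in auto)
  then obtain N0 where N0: "\<And>N. N \<ge> N0 \<Longrightarrow> 1 - q < prob {\<omega> \<in> space M. P N \<omega>}" by auto
  show ?thesis
  proof (intro exI[of _ N0] allI impI)
    fix N assume "N0 \<le> N"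
    let ?z = "(- int N, - int N) :: site" and ?v = "(int N, int N) :: site"
    let ?G = "{\<omega>\<in>\<Omega>\<^sub>1. \<forall>p\<in>box (int N).
      \<bar>b p ?v \<omega> - (of_int (int N - fst p) * a1 + of_int (int N - snd p) * a2)\<bar> \<le> \<epsilon> * real N}"
    have "T ?z -` {\<omega> \<in> space M. P N \<omega>} \<subseteq> ?G"
    proof safe
      fix \<omega> assume P: "P N (T ?z \<omega>)"
      then show good: "\<omega> \<in> \<Omega>\<^sub>1" by (simp add: P_def good_shift)
      have *: "\<bar>b ?z p \<omega> - lin (p - ?z)\<bar> \<le> \<epsilon> / 2 * real N" if "p \<in> box (int N)" for p
      proof -
        have "b ?z p \<omega> = b 0 (p - ?z) (T ?z \<omega>)"
          using b_shift[OF good, of 0 ?z "p - ?z"] by simp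
        moreover have "0 \<le> p - ?z" "fst (p - ?z) \<le> 2 * int N" "snd (p - ?z) \<le> 2 * int N"
          using that by (auto simp: box_def less_eq_prod_def)
        ultimately show ?thesis using P unfolding P_def by metis
      qed
      fix p assume p: "p \<in> box (int N)"
      have "?v \<in> box (int N)" by (auto simp: box_def)
      then have "\<bar>b ?z ?v \<omega> - lin (?v - ?z)\<bar> \<le> \<epsilon> / 2 * real N" by (rule *)
      moreover have "\<bar>b ?z p \<omega> - lin (p - ?z)\<bar> \<le> \<epsilon> / 2 * real N" using p by (rule *)
      moreover have "b ?z p \<omega> + b p ?v \<omega> = b ?z ?v \<omega>" by (rule b_add[OF good])
      moreover have "lin (?v - ?z) - lin (p - ?z) = of_int (int N - fst p) * a1 + of_int (int N - snd p) * a2"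
        by (simp add: lin_def algebra_simps)
      ultimately show "\<bar>b p ?v \<omega> - (of_int (int N - fst p) * a1 + of_int (int N - snd p) * a2)\<bar> \<le> \<epsilon> * real N"
        by linarith
    qed
    moreover have "?G \<in> events"
    proof -
      have "{\<omega>\<in>space M. \<omega> \<in> \<Omega>\<^sub>1 \<and> (\<forall>p. p \<in> box (int N) \<longrightarrow>
        \<bar>b p ?v \<omega> - (of_int (int N - fst p) * a1 + of_int (int N - snd p) * a2)\<bar> \<le> \<epsilon> * real N)} \<in> events"
        by measurable
      moreover have "{\<omega>\<in>space M. \<omega> \<in> \<Omega>\<^sub>1 \<and> (\<forall>p. p \<in> box (int N) \<longrightarrow>
        \<bar>b p ?v \<omega> - (of_int (int N - fst p) * a1 + of_int (int N - snd p) * a2)\<bar> \<le> \<epsilon> * real N)} = ?G"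
        by auto
      ultimately show ?thesis by simp
    qed
    ultimately have "prob (T ?z -` {\<omega> \<in> space M. P N \<omega>}) \<le> prob ?G"
      by (rule finite_measure_mono)
    moreover have "prob (T ?z -` {\<omega> \<in> space M. P N \<omega>}) = prob {\<omega> \<in> space M. P N \<omega>}"
      by (rule T_shift_prob) measurable
    ultimately show "1 - q < prob ?G" using N0[OF \<open>N0 \<le> N\<close>] by simp
  qed
qed

lemma pred_const_imp: "(C \<Longrightarrow> Measurable.pred N P) \<Longrightarrow> Measurable.pred N (\<lambda>\<omega>. C \<longrightarrow> P \<omega>)"
  by (cases C) auto

text \<open>There are countably many lists of sites, and each one that matters avoids
  \<open>R\<close> and ends on level 0. Hence neither its weight nor the Busemann value at its end
  involves the weights on \<open>R\<close>.\<close>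

lemma off_bound_measurable:
  "Measurable.pred (off_measure R)
    (\<lambda>\<omega>. off_bound R (int N) l c (\<lambda>z. w z \<omega>) (\<lambda>z. b z (int N, int N) \<omega>))"
  unfolding off_bound_def
proof (intro pred_intros_countable)
  fix ps and e :: site
  show "Measurable.pred (off_measure R) (\<lambda>\<omega>. chain (ps @ [e]) \<and> set ps \<inter> R = {} \<and>
       (\<forall>z\<in>set ps. level z < 0) \<and> level e = 0 \<and> set (ps @ [e]) \<subseteq> box (int N) \<longrightarrow>
      sum_list (map (\<lambda>z. w z \<omega>) ps) + b e (int N, int N) \<omega> \<le> l (hd (ps @ [e])) + c)"
  proof (rule pred_const_imp, elim conjE)
    assume *: "set ps \<inter> R = {}" "\<forall>z\<in>set ps. level z < 0" "level e = 0" "set (ps @ [e]) \<subseteq> box (int N)"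
    have "(\<lambda>\<omega>. sum_list (map (\<lambda>z. w z \<omega>) qs)) \<in> borel_measurable (off_measure R)"
      if "set qs \<subseteq> set ps" for qs
      using that
    proof (induction qs)
      case (Cons z qs)
      have "w z \<in> borel_measurable (off_measure R)"
        using Cons.prems * by (intro off_measurable) (auto simp: lower_sites_def)
      then show ?case using Cons by simp
    qed simp
    from this[of ps] have [measurable]:
      "(\<lambda>\<omega>. sum_list (map (\<lambda>z. w z \<omega>) ps)) \<in> borel_measurable (off_measure R)" by simp
    have [measurable]: "b e (int N, int N) \<in> borel_measurable (off_measure R)"
      using * by (intro off_measurable) (auto simp: box_def less_eq_prod_def)
    show "Measurable.pred (off_measure R) (\<lambda>\<omega>. sum_list (map (\<lambda>z. w z \<omega>) ps) + b e (int N, int N) \<omega>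
        \<le> l (hd (ps @ [e])) + c)" by measurable
  qed
qed

lemma low_bound_measurable:
  "Measurable.pred (off_measure R)
    (\<lambda>\<omega>. \<forall>e\<in>box (int N). level e = 0 \<longrightarrow> l e - c \<le> b e (int N, int N) \<omega>)"
  unfolding Ball_def
proof (intro pred_intros_countable)
  fix e :: site
  show "Measurable.pred (off_measure R)
    (\<lambda>\<omega>. e \<in> box (int N) \<longrightarrow> level e = 0 \<longrightarrow> l e - c \<le> b e (int N, int N) \<omega>)"
  proof (intro pred_const_imp)
    assume "e \<in> box (int N)" "level e = 0"
    then have [measurable]: "b e (int N, int N) \<in> borel_measurable (off_measure R)"
      by (intro off_measurable) (auto simp: box_def less_eq_prod_def)
    show "Measurable.pred (off_measure R) (\<lambda>\<omega>. l e - c \<le> b e (int N, int N) \<omega>)" by measurable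
  qed
qed

text \<open>\<open>A\<close> collects consequences of typical behaviour that do not look at
  \<open>R\<close>, so \<open>A\<close> and heavy weights on \<open>R\<close> occur together with
  positive probability. Then \<open>survivors\<close> sends a forest path into the gap, and
  \<open>shielding\<close> keeps it out.\<close>

theorem AE_merge: "AE \<omega> in M. \<forall>u v. level u = level v \<longrightarrow> sm.merge \<omega> u v"
proof (rule ccontr)
  assume contra: "\<not> ?thesis"
  define Bd where "Bd x = {\<omega>\<in>\<Omega>\<^sub>1. sm.bd \<omega> x}" for x
  have Bd_eq: "Bd x = {\<omega>\<in>space M. \<omega> \<in> \<Omega>\<^sub>1 \<and> sm.bd \<omega> x}" for x by (auto simp: Bd_def)
  have Bd_ev [measurable]: "Bd x \<in> events" for x unfolding Bd_eq by measurable
  have Bd_stat: "prob (Bd x) = prob (Bd 0)" for x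
    unfolding Bd_def using prob_stationary[of sm.bd x] via_shift[of _ x 0] by auto
  have pos: "0 < prob (Bd 0)"
  proof (rule ccontr)
    assume "\<not> 0 < prob (Bd 0)"
    then have 0: "prob (Bd x) = 0" for x
      using Bd_stat[of x] by (simp add: zero_less_measure_iff)
    have "AE \<omega> in M. \<forall>x. \<omega> \<notin> Bd x"
      unfolding AE_all_countable
    proof
      fix x show "AE \<omega> in M. \<omega> \<notin> Bd x"
        using 0[of x] by (intro AE_not_in) (auto simp: null_sets_def emeasure_eq_measure)
    qed
    then have "AE \<omega> in M. \<forall>u v. level u = level v \<longrightarrow> sm.merge \<omega> u v"
      using AE_good by eventually_elim (auto simp: Bd_def intro: sm.merge_if_no_bd)
    then show False using contra by contradiction
  qed
  \<comment> \<open>Sites of level -1: their upper neighbours have level 0, so their boundary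
    property involves only Busemann functions of nonnegative level.\<close>
  define zs where "zs k = (int k, - int k - 1)" for k
  obtain j k where jk: "j < k" and q: "0 < prob (Bd (zs j) \<inter> Bd (zs k))"
    using pair_positive[of "\<lambda>k. Bd (zs k)" "prob (Bd 0)"] pos Bd_stat by auto
  define q where "q = prob (Bd (zs j) \<inter> Bd (zs k))"
  obtain \<Lambda> where \<Lambda>: "0 < prob {\<omega>. \<Lambda> \<le> w 0 \<omega>}" "a1 < \<Lambda> \<or> a2 < \<Lambda>"
    using heavy_weights by blast
  obtain \<epsilon> N0 where \<epsilon>: "\<epsilon> > 0"
    and N0: "\<And>N. N \<ge> N0 \<Longrightarrow> \<exists>R. shielding a1 a2 \<Lambda> (int k) (int N) (\<epsilon> * real N) R"
    using shielding_ex[OF \<Lambda>(2), of "int k"] by auto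
  let ?G = "\<lambda>N. {\<omega>\<in>\<Omega>\<^sub>1. \<forall>p\<in>box (int N).
    \<bar>b p (int N, int N) \<omega> - (of_int (int N - fst p) * a1 + of_int (int N - snd p) * a2)\<bar> \<le> \<epsilon> * real N}"
  obtain N1 where N1: "\<And>N. N \<ge> N1 \<Longrightarrow> 1 - q < prob (?G N)"
    using AE_typical[OF \<epsilon>, of q] q by (auto simp: q_def)
  define N where "N = max N0 N1"
  define l where "l z = of_int (int N - fst z) * a1 + of_int (int N - snd z) * a2" for z :: site
  define v where "v = (int N, int N)"
  obtain R where R: "shielding a1 a2 \<Lambda> (int k) (int N) (\<epsilon> * real N) R"
    using N0[of N] by (auto simp: N_def)
  then have finR: "finite R" "R \<subseteq> lower_sites" by (auto simp: shielding_def lower_sites_def)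
  \<comment> \<open>The typical event itself involves Busemann functions below level 0 and hence the
    weights on \<open>R\<close>. Only two of its consequences are kept: the bound for paths off
    \<open>R\<close> and the lower bound on level 0.\<close>
  define A where "A = {\<omega>. sm.bd \<omega> (zs j) \<and> sm.bd \<omega> (zs k) \<and>
    off_bound R (int N) l (\<epsilon> * real N) (\<lambda>z. w z \<omega>) (\<lambda>z. b z v \<omega>) \<and>
    (\<forall>e\<in>box (int N). level e = 0 \<longrightarrow> l e - \<epsilon> * real N \<le> b e v \<omega>)}"
  define H where "H = {\<omega>. \<forall>x\<in>R. \<Lambda> \<le> w x \<omega>}"
  have "A \<in> sets (off_measure R)"
  proof -
    have [measurable]: "Measurable.pred (off_measure R) (\<lambda>\<omega>. sm.bd \<omega> (zs i))" for i
    proof (rule bd_measurable)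
      fix z :: site assume "level (zs i) < level z"
      then have "0 \<le> level z" by (simp add: zs_def level_def)
      then show "b z (z + e1) \<in> borel_measurable (off_measure R) \<and> b z (z + e2) \<in> borel_measurable (off_measure R)"
        by (auto intro!: off_measurable simp: less_eq_prod_def)
    qed
    note [measurable] = off_bound_measurable[where R = R and N = N and l = l and c = "\<epsilon> * real N", folded v_def]
      low_bound_measurable[where R = R and N = N and l = l and c = "\<epsilon> * real N", folded v_def]
    have "{\<omega> \<in> space (off_measure R). sm.bd \<omega> (zs j) \<and> sm.bd \<omega> (zs k) \<and>
      off_bound R (int N) l (\<epsilon> * real N) (\<lambda>z. w z \<omega>) (\<lambda>z. b z v \<omega>) \<and>
      (\<forall>e\<in>box (int N). level e = 0 \<longrightarrow> l e - \<epsilon> * real N \<le> b e v \<omega>)} \<in> sets (off_measure R)"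
      by measurable
    then show ?thesis by (simp add: A_def)
  qed
  note A = heavy_set_indep[OF finR this]
  have "Bd (zs j) \<inter> Bd (zs k) \<inter> ?G N \<subseteq> A"
  proof safe
    fix \<omega> assume *: "\<omega> \<in> Bd (zs j)" "\<omega> \<in> Bd (zs k)" "\<omega> \<in> \<Omega>\<^sub>1"
      "\<forall>p\<in>box (int N). \<bar>b p (int N, int N) \<omega> - (of_int (int N - fst p) * a1 + of_int (int N - snd p) * a2)\<bar> \<le> \<epsilon> * real N"
    interpret c: cocycle "\<lambda>z. w z \<omega>" "\<lambda>x y. b x y \<omega>" using * cocycle_at by simp
    have close: "\<bar>b p v \<omega> - l p\<bar> \<le> \<epsilon> * real N" if "p \<in> box (int N)" for p
      using *(4) that by (simp add: v_def l_def)
    have "off_bound R (int N) l (\<epsilon> * real N) (\<lambda>z. w z \<omega>) (\<lambda>z. b z v \<omega>)"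
      unfolding off_bound_def
    proof (intro allI impI, elim conjE)
      fix ps e assume ps: "chain (ps @ [e])" "set (ps @ [e]) \<subseteq> box (int N)"
      have "hd (ps @ [e]) \<in> box (int N)" using ps(2) by (cases ps) auto
      then show "sum_list (map (\<lambda>z. w z \<omega>) ps) + b e v \<omega> \<le> l (hd (ps @ [e])) + \<epsilon> * real N"
        using close[of "hd (ps @ [e])"] c.chain_weight_le[OF ps(1), of v] by linarith
    qed
    moreover have "l e - \<epsilon> * real N \<le> b e v \<omega>" if "e \<in> box (int N)" for e
      using close[OF that] by linarith
    ultimately show "\<omega> \<in> A" using * by (auto simp: A_def Bd_def)
  qed
  then have "prob (Bd (zs j) \<inter> Bd (zs k) \<inter> ?G N) \<le> prob A"
    using A by (intro finite_measure_mono) auto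
  moreover have "0 < prob (Bd (zs j) \<inter> Bd (zs k) \<inter> ?G N)"
  proof -
    have "N1 \<le> N" by (simp add: N_def)
    note N1N = N1[OF this]
    have G: "?G N \<in> events"
    proof (rule ccontr)
      assume "?G N \<notin> events"
      then have "prob (?G N) = 0" by (rule measure_notin_sets)
      moreover have "q \<le> 1" unfolding q_def by (rule prob_le_1)
      ultimately show False using N1N by linarith
    qed
    have "prob ((Bd (zs j) \<inter> Bd (zs k)) \<union> ?G N)
        = prob (Bd (zs j) \<inter> Bd (zs k)) + prob (?G N) - prob (Bd (zs j) \<inter> Bd (zs k) \<inter> ?G N)"
      using G Bd_ev by (intro measure_Un3) (auto simp: fmeasurable_eq_sets)
    moreover have "prob ((Bd (zs j) \<inter> Bd (zs k)) \<union> ?G N) \<le> 1" by (rule prob_le_1)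
    ultimately show ?thesis using N1N unfolding q_def by linarith
  qed
  ultimately have "0 < prob (A \<inter> H)"
    unfolding H_def A(2) using heavy_set_pos[OF finR(1) \<Lambda>(1)] by simp
  moreover have "AE \<omega> in M. \<omega> \<notin> A \<inter> H"
    using AE_good AE_one_child
  proof eventually_elim
    case (elim \<omega>)
    interpret c: cocycle "\<lambda>z. w z \<omega>" "\<lambda>x y. b x y \<omega>" using elim cocycle_at by simp
    show ?case
    proof
      assume AH: "\<omega> \<in> A \<inter> H"
      let ?n = "2 * N"
      obtain u where u: "level u = level (zs j) + 1 - int ?n" "fst (zs j) < fst ((st \<omega> ^^ ?n) u)"
        "fst ((st \<omega> ^^ ?n) u) \<le> fst (zs k)"
        using sm.survivors[of \<omega> "zs j" "zs k" ?n] elim(2) AH jk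
        by (auto simp: A_def zs_def level_def)
      let ?u = "\<lambda>i. (st \<omega> ^^ i) u"
      have "int k < \<bar>fst (?u ?n)\<bar>"
      proof (rule R[unfolded shielding_def, THEN conjunct2, THEN conjunct2, rule_format,
            of "\<lambda>z. w z \<omega>" "\<lambda>z. b z v \<omega>"], intro conjI allI impI ballI)
        show "superharmonic (\<lambda>z. w z \<omega>) (\<lambda>z. b z v \<omega>)"
        proof
          fix z
          show "w z \<omega> + b (z + e1) v \<omega> \<le> b z v \<omega>" "w z \<omega> + b (z + e2) v \<omega> \<le> b z v \<omega>"
            using c.weight_le[of z] c.add[of z "z + e1" v] c.add[of z "z + e2" v] by auto
        qed
        show "off_bound R (int N) (\<lambda>z. of_int (int N - fst z) * a1 + of_int (int N - snd z) * a2)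
            (\<epsilon> * real N) (\<lambda>z. w z \<omega>) (\<lambda>z. b z v \<omega>)"
          using AH unfolding A_def l_def[abs_def] by simp
        show "of_int (int N - fst e) * a1 + of_int (int N - snd e) * a2 - \<epsilon> * real N \<le> b e v \<omega>"
          if "e \<in> box (int N)" "level e = 0" for e
          using AH that unfolding A_def l_def by simp
        show "\<Lambda> \<le> w x \<omega>" if "x \<in> R" for x using AH that by (simp add: H_def)
        show "?u (Suc i) = ?u i + e1 \<or> ?u (Suc i) = ?u i + e2" for i
          using sm.s_cases[of \<omega> "?u i"] by simp
        show "b (?u i) v \<omega> = w (?u i) \<omega> + b (?u (Suc i)) v \<omega>" for i
          using c.step_weight[of "?u i" Plus] c.add[of "?u i" "?u (Suc i)" v]
          by (simp add: st_busemann)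
        show "level (?u 0) = - int ?n" using u by (simp add: zs_def level_def)
      qed simp
      then show False using u(2,3) by (auto simp: zs_def)
    qed
  qed
  moreover have "A \<inter> H \<in> events"
  proof -
    have "H = {\<omega> \<in> space M. \<forall>x\<in>R. \<Lambda> \<le> w x \<omega>}" by (simp add: H_def)
    also have "\<dots> \<in> events" using finR by measurable
    finally show ?thesis using A(1) by auto
  qed
  ultimately show False using prob_eq_0[of "A \<inter> H"] by simp
qed

end

section \<open>Directions as points of the unit interval\<close>

definition limit_pt :: "(int \<Rightarrow> site) \<Rightarrow> real \<Rightarrow> bool" where
  "limit_pt \<pi> u \<longleftrightarrow> (\<exists>r :: nat \<Rightarrow> nat. strict_mono r \<and>
     (\<lambda>j. of_int (fst (\<pi> (int (r j)))) / real (r j)) \<longlonglongrightarrow> u)"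

text \<open>The line through the graph of \<open>h\<close> at \<open>t\<close> with the one-sided
  slope. By homogeneity of \<open>g\<close> its values at 1 and 0 are the components of the
  one-sided gradient, so that its value at \<open>u\<close> is the growth rate of \<open>b\<close>
  in direction \<open>u\<close>.\<close>

definition tangent :: "(real \<Rightarrow> real) \<Rightarrow> (real \<Rightarrow> side \<Rightarrow> real) \<Rightarrow> real \<Rightarrow> side \<Rightarrow> real \<Rightarrow> real" where
  "tangent h d t \<sigma> u = h t + (u - t) * d t \<sigma>"

definition flat_part :: "(real \<Rightarrow> real) \<Rightarrow> (real \<Rightarrow> side \<Rightarrow> real) \<Rightarrow> real \<Rightarrow> real set" where
  "flat_part h d t = {s. 0 < s \<and> s < 1 \<and> (\<exists>\<sigma>. h s = tangent h d t \<sigma> s)}"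

section \<open>All directions simultaneously\<close>

text \<open>A realization of the Busemann process on an almost sure event. The direction \<open>(t, 1 - t)\<close> is
  represented by \<open>t\<close>, the function \<open>h\<close> is \<open>t \<mapsto> g (t, 1 - t)\<close>, and \<open>d\<close> are its one-sided
  derivatives. \<open>Q\<close> is a dense set of directions in which the almost sure statements about fixed
  directions hold.\<close>

locale busemann_config =
  fixes W :: "site \<Rightarrow> real" and b :: "real \<Rightarrow> side \<Rightarrow> site \<Rightarrow> site \<Rightarrow> real"
    and Q :: "real set" and h :: "real \<Rightarrow> real" and d :: "real \<Rightarrow> side \<Rightarrow> real"
  assumes cocycle: "0 < t \<Longrightarrow> t < 1 \<Longrightarrow> cocycle W (b t \<sigma>)"
    and mono1: "0 < s \<Longrightarrow> s < t \<Longrightarrow> t < 1 \<Longrightarrow> b t \<tau> x (x + e1) \<le> b s \<sigma> x (x + e1)"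
    and mono2: "0 < s \<Longrightarrow> s < t \<Longrightarrow> t < 1 \<Longrightarrow> b s \<sigma> x (x + e2) \<le> b t \<tau> x (x + e2)"
    and side1: "0 < t \<Longrightarrow> t < 1 \<Longrightarrow> b t Plus x (x + e1) \<le> b t Minus x (x + e1)"
    and side2: "0 < t \<Longrightarrow> t < 1 \<Longrightarrow> b t Minus x (x + e2) \<le> b t Plus x (x + e2)"
    and lim_left: "0 < t \<Longrightarrow> t < 1 \<Longrightarrow> ((\<lambda>s. b s \<sigma> x y) \<longlongrightarrow> b t Minus x y) (at_left t)"
    and lim_right: "0 < t \<Longrightarrow> t < 1 \<Longrightarrow> ((\<lambda>s. b s \<sigma> x y) \<longlongrightarrow> b t Plus x y) (at_right t)"
    and generic: "generic_weights W"
    and Q_subset: "Q \<subseteq> {0<..<1}"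
    and Q_dense: "0 \<le> s \<Longrightarrow> s < t \<Longrightarrow> t \<le> 1 \<Longrightarrow> \<exists>q\<in>Q. s < q \<and> q < t"
    and no_ties: "q \<in> Q \<Longrightarrow> b q \<sigma> x (x + e1) \<noteq> b q \<sigma> x (x + e2)"
    and coalesce_Q: "q \<in> Q \<Longrightarrow> coalesce (cocycle.gam (b q \<sigma>) \<sigma> x) (cocycle.gam (b q \<sigma>) \<sigma> y)"
    and asymp: "q \<in> Q \<Longrightarrow> 0 < \<epsilon> \<Longrightarrow> \<exists>n0. \<forall>y. x \<le> y \<and> n0 \<le> level y - level x \<longrightarrow>
      \<bar>b q \<sigma> x y - (of_int (fst y - fst x) * tangent h d q \<sigma> 1 + of_int (snd y - snd x) * tangent h d q \<sigma> 0)\<bar>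
        \<le> \<epsilon> * of_int (level y - level x)"
    and below_tangent: "0 < s \<Longrightarrow> s < 1 \<Longrightarrow> 0 < t \<Longrightarrow> t < 1 \<Longrightarrow> h s \<le> tangent h d t \<sigma> s"
    and deriv_right: "0 < t \<Longrightarrow> t < 1 \<Longrightarrow> ((\<lambda>s. (h s - h t) / (s - t)) \<longlongrightarrow> d t Plus) (at_right t)"
    and deriv_left: "0 < t \<Longrightarrow> t < 1 \<Longrightarrow> ((\<lambda>s. (h s - h t) / (s - t)) \<longlongrightarrow> d t Minus) (at_left t)"
    and steep_right: "0 < t \<Longrightarrow> t < 1 \<Longrightarrow> \<exists>q\<in>Q. t < q \<and> tangent h d t \<sigma> 0 < tangent h d q \<tau> 0"
    and steep_left: "0 < t \<Longrightarrow> t < 1 \<Longrightarrow> \<exists>q\<in>Q. q < t \<and> tangent h d t \<sigma> 1 < tangent h d q \<tau> 1"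
    and same_tangent: "0 < s \<Longrightarrow> s < 1 \<Longrightarrow> 0 < t \<Longrightarrow> t < 1 \<Longrightarrow> tangent h d s \<sigma> = tangent h d t \<sigma> \<Longrightarrow>
      b s \<sigma> = b t \<sigma>"
    and regular: "0 < t \<Longrightarrow> t < 1 \<Longrightarrow> flat_part h d t \<noteq> {t} \<Longrightarrow> d t Plus = d t Minus"
    and regular_Q: "q \<in> Q \<Longrightarrow> flat_part h d q \<noteq> {q} \<Longrightarrow> b q Plus = b q Minus"
    and locally_const: "0 < t \<Longrightarrow> t < 1 \<Longrightarrow>
      \<exists>s<t. \<exists>c. \<forall>u \<sigma>. s < u \<and> u < t \<longrightarrow> b u \<sigma> x y = c"
      "0 < t \<Longrightarrow> t < 1 \<Longrightarrow> \<exists>s>t. \<exists>c. \<forall>u \<sigma>. t < u \<and> u < s \<longrightarrow> b u \<sigma> x y = c"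
    and crosses: "\<exists>s. 0 < s \<and> s < 1 \<and> b s Plus z (z + e2) < b s Plus z (z + e1)"
      "\<exists>s. 0 < s \<and> s < 1 \<and> b s Plus z (z + e1) < b s Plus z (z + e2)"
begin

abbreviation "bgeo t \<sigma> \<equiv> cocycle.gam (b t \<sigma>) \<sigma>"
abbreviation "L \<equiv> tangent h d"
abbreviation "F \<equiv> flat_part h d"

lemma Q_bounds: "q \<in> Q \<Longrightarrow> 0 < q" "q \<in> Q \<Longrightarrow> q < 1"
  using Q_subset by auto

text \<open>By additivity this is \<open>b t \<sigma> (z + e1) (z + e2)\<close>. It increases with
  \<open>t\<close> and its sign decides the step at \<open>z\<close>, so it governs both the
  geodesics and the competition interface.\<close>

definition delta :: "real \<Rightarrow> side \<Rightarrow> site \<Rightarrow> real" where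
  "delta t \<sigma> z = b t \<sigma> z (z + e2) - b t \<sigma> z (z + e1)"

abbreviation "step t \<sigma> \<equiv> busemann_step (b t \<sigma>) \<sigma>"

lemma step_delta:
  "step t \<sigma> z = (if 0 < delta t \<sigma> z then z + e1 else if delta t \<sigma> z < 0 then z + e2 else z + e_side \<sigma>)"
  by (auto simp: busemann_step_def delta_def)

lemma delta_mono: "0 < s \<Longrightarrow> s < t \<Longrightarrow> t < 1 \<Longrightarrow> delta s \<sigma> z \<le> delta t \<tau> z"
  using mono1[of s t \<tau> z \<sigma>] mono2[of s t \<sigma> z \<tau>] by (simp add: delta_def)

lemma delta_side: "0 < t \<Longrightarrow> t < 1 \<Longrightarrow> delta t Minus z \<le> delta t Plus z"
  using side1[of t z] side2[of t z] by (simp add: delta_def)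

lemma delta_Q: "q \<in> Q \<Longrightarrow> delta q \<sigma> z \<noteq> 0"
  using no_ties[of q \<sigma> z] by (auto simp: delta_def)

text \<open>A rational direction in between has no tie, but monotonicity would force one.\<close>

lemma delta_zero_less: 
  assumes "0 < s" "s < t" "t < 1" shows "\<not> (delta s \<sigma> z = 0 \<and> delta t \<tau> z = 0)"
proof
  assume *: "delta s \<sigma> z = 0 \<and> delta t \<tau> z = 0"
  obtain q where q: "q \<in> Q" "s < q" "q < t" using Q_dense[of s t] assms by auto
  have "delta s \<sigma> z \<le> delta q Plus z" "delta q Plus z \<le> delta t \<tau> z"
    using q assms by (auto intro!: delta_mono)
  then show False using * delta_Q[OF q(1), of Plus z] by simp
qed

lemma step_mono:
  assumes "0 < s" "s < t" "t < 1" shows "fst (step s \<sigma> z) \<le> fst (step t \<tau> z)"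
  using delta_mono[OF assms, of \<sigma> z \<tau>] delta_zero_less[OF assms, of \<sigma> z \<tau>]
  by (cases \<sigma>; cases \<tau>) (auto simp: step_delta)

text \<open>At a common site the steps are ordered. At different sites of one level the first
  coordinates differ by at least one, and a single step can at most close this gap.\<close>

lemma path_less_mono:
  assumes st: "\<And>z. fst (step s \<sigma> z) \<le> fst (step t \<tau> z)"
    and "0 < s" "s < 1" "0 < t" "t < 1" "level x \<le> k"
  shows "fst (bgeo s \<sigma> x k) \<le> fst (bgeo t \<tau> x k)"
  using assms(6)
proof (induction k rule: int_ge_induct)
  case base
  interpret S: cocycle W "b s \<sigma>" using assms cocycle by auto
  interpret T: cocycle W "b t \<tau>" using assms cocycle by auto
  show ?case by simp
next
  case (step k)
  interpret S: cocycle W "b s \<sigma>" using assms cocycle by auto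
  interpret T: cocycle W "b t \<tau>" using assms cocycle by auto
  show ?case
  proof (cases "fst (bgeo s \<sigma> x k) = fst (bgeo t \<tau> x k)")
    case True
    then have "bgeo s \<sigma> x k = bgeo t \<tau> x k"
      using step.hyps by (intro site_eqI) (simp_all add: S.level_gam T.level_gam)
    then show ?thesis using step.hyps st by (simp add: S.gam_Suc T.gam_Suc)
  next
    case False
    then have "fst (bgeo s \<sigma> x k) + 1 \<le> fst (bgeo t \<tau> x k)" using step.IH by simp
    then show ?thesis
      using step.hyps S.step_cases[of \<sigma> "bgeo s \<sigma> x k"] T.step_cases[of \<tau> "bgeo t \<tau> x k"]
      by (auto simp: S.gam_Suc T.gam_Suc)
  qed
qed

lemma path_mono:
  "0 < s \<Longrightarrow> s < t \<Longrightarrow> t < 1 \<Longrightarrow> level x \<le> k \<Longrightarrow> fst (bgeo s \<sigma> x k) \<le> fst (bgeo t \<tau> x k)"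
  by (rule path_less_mono) (auto intro: step_mono)

lemma eventually_at_right_Ioo:
  "t < 1 \<Longrightarrow> eventually (\<lambda>s. t < s \<and> s < 1) (at_right (t::real))"
  by (auto simp: eventually_at_right_field)

text \<open>The delicate case is a tie at \<open>t\<close>. Strictly to the right of
  \<open>t\<close> the sign is then positive and the step is \<open>e1\<close>, which is how the
  \<open>Plus\<close> side breaks ties; the convention is made for this.\<close>

lemma step_right:
  assumes t: "0 < t" "t < 1"
  shows "eventually (\<lambda>s. \<forall>\<sigma>. step s \<sigma> z = step t Plus z) (at_right t)"
proof -
  have "eventually (\<lambda>s. step s \<sigma> z = step t Plus z) (at_right t)" for \<sigma>
  proof -
    have lim: "((\<lambda>s. delta s \<sigma> z) \<longlongrightarrow> delta t Plus z) (at_right t)"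
      unfolding delta_def using t by (intro tendsto_diff lim_right)
    consider "0 < delta t Plus z" | "delta t Plus z < 0" | "delta t Plus z = 0" by linarith
    then show ?thesis
    proof cases
      case 1
      from order_tendstoD(1)[OF lim 1] show ?thesis
        by eventually_elim (use 1 in \<open>simp add: step_delta\<close>)
    next
      case 2
      from order_tendstoD(2)[OF lim 2] show ?thesis
        by eventually_elim (use 2 in \<open>simp add: step_delta\<close>)
    next
      case 3
      from eventually_at_right_Ioo[OF t(2)] show ?thesis
      proof eventually_elim
        case (elim s)
        then have "0 < delta s \<sigma> z"
          using delta_mono[of t s Plus z \<sigma>] delta_zero_less[of t s Plus z \<sigma>] 3 t by auto
        then show ?case using 3 by (simp add: step_delta)
      qed
    qed
  qed
  from this[of Plus] this[of Minus] show ?thesis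
    by eventually_elim (metis side.exhaust)
qed

text \<open>Finitely many sites are visited up to a given level, so their steps stabilize
  simultaneously.\<close>

lemma path_right:
  assumes t: "0 < t" "t < 1"
  shows "eventually (\<lambda>s. \<forall>\<sigma> k. level x \<le> k \<and> k \<le> n \<longrightarrow> bgeo s \<sigma> x k = bgeo t Plus x k) (at_right t)"
proof -
  have "eventually (\<lambda>s. \<forall>z\<in>bgeo t Plus x ` {level x..n}. \<forall>\<sigma>. step s \<sigma> z = step t Plus z) (at_right t)"
    using step_right[OF t] by (intro eventually_ball_finite) auto
  then show ?thesis using eventually_at_right_Ioo[OF t(2)]
  proof eventually_elim
    case (elim s)
    show ?case
    proof (intro allI impI, elim conjE)
      fix \<sigma> k
      interpret S: cocycle W "b s \<sigma>" using elim t cocycle by auto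
      interpret T: cocycle W "b t Plus" using t cocycle by auto
      assume "level x \<le> k" "k \<le> n"
      then show "bgeo s \<sigma> x k = bgeo t Plus x k"
      proof (induction k rule: int_ge_induct)
        case (step k)
        then show ?case using elim(1) by (simp add: S.gam_Suc T.gam_Suc)
      qed simp
    qed
  qed
qed

lemma Q_right:
  assumes "0 < t" "t < 1" "eventually P (at_right t)"
  shows "\<exists>q\<in>Q. t < q \<and> P q"
proof -
  obtain s where s: "s > t" "\<And>u. t < u \<Longrightarrow> u < s \<Longrightarrow> P u"
    using assms(3) by (auto simp: eventually_at_right_field)
  obtain q where "q \<in> Q" "t < q" "q < min s 1" using Q_dense[of t "min s 1"] s assms by auto
  then show ?thesis using s(2)[of q] by auto
qed

text \<open>The coalescence point is determined by the value of the Busemann function: equal increments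
  yield two pairs of disjoint paths of equal total weight, and these coincide by genericity.\<close>

lemma coalescence_level:
  assumes q: "q \<in> Q"
  shows "\<exists>k. level x \<le> k \<and> level y \<le> k \<and>
    (\<forall>q'\<in>Q. \<forall>\<tau>. b q' \<tau> x y = b q \<sigma> x y \<longrightarrow> bgeo q' \<tau> x k = bgeo q' \<tau> y k)"
proof -
  define meet where "meet p \<rho> k \<longleftrightarrow> level x \<le> k \<and> level y \<le> k \<and> bgeo p \<rho> x k = bgeo p \<rho> y k" for p \<rho> k
  have first: "\<exists>k. meet p \<rho> k \<and> (\<forall>j<k. \<not> meet p \<rho> j)" if p: "p \<in> Q" for p \<rho>
  proof -
    interpret P: cocycle W "b p \<rho>" using Q_bounds[OF p] cocycle by auto
    let ?m = "max (level x) (level y)"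
    obtain k where k: "meet p \<rho> k" using coalesce_Q[OF p] P.coalesce_iff unfolding meet_def by blast
    \<comment> \<open>Sets of integers may lack a least element, so the first meeting is located by
      its height above the larger starting level.\<close>
    define n where "n = (LEAST n. meet p \<rho> (?m + int n))"
    have "meet p \<rho> (?m + int (nat (k - ?m)))" using k by (auto simp: meet_def)
    then have n: "meet p \<rho> (?m + int n)" unfolding n_def by (rule LeastI)
    have "\<not> meet p \<rho> j" if "j < ?m + int n" for j
    proof
      assume j: "meet p \<rho> j"
      then have "meet p \<rho> (?m + int (nat (j - ?m)))" by (auto simp: meet_def)
      then have "n \<le> nat (j - ?m)" unfolding n_def by (rule Least_le)
      then show False using that j by (auto simp: meet_def)
    qed
    then show ?thesis using n by blast
  qed
  obtain k where k: "meet q \<sigma> k" "\<And>j. j < k \<Longrightarrow> \<not> meet q \<sigma> j" using first[OF q] by blast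
  have "bgeo q' \<tau> x k = bgeo q' \<tau> y k" if q': "q' \<in> Q" and eq: "b q' \<tau> x y = b q \<sigma> x y" for q' \<tau>
  proof -
    interpret P: cocycle W "b q \<sigma>" using Q_bounds[OF q] cocycle by auto
    interpret P': cocycle W "b q' \<tau>" using Q_bounds[OF q'] cocycle by auto
    obtain k' where k': "meet q' \<tau> k'" "\<And>j. j < k' \<Longrightarrow> \<not> meet q' \<tau> j" using first[OF q'] by blast
    let ?A = "path_mset (bgeo q \<sigma> x) (level x) k" and ?B = "path_mset (bgeo q \<sigma> y) (level y) k"
    let ?A' = "path_mset (bgeo q' \<tau> x) (level x) k'" and ?B' = "path_mset (bgeo q' \<tau> y) (level y) k'"
    have "b q \<sigma> x y = (\<Sum>z\<in>#?A. W z) - (\<Sum>z\<in>#?B. W z)"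
      using k(1) P.coalesce_b[of x k y] by (simp add: meet_def path_weight_mset)
    moreover have "b q' \<tau> x y = (\<Sum>z\<in>#?A'. W z) - (\<Sum>z\<in>#?B'. W z)"
      using k'(1) P'.coalesce_b[of x k' y] by (simp add: meet_def path_weight_mset)
    \<comment> \<open>Moving terms across removes the subtractions, and genericity applies to the
      multisets.\<close>
    ultimately have "(\<Sum>z\<in>#?A + ?B'. W z) = (\<Sum>z\<in>#?A' + ?B. W z)" using eq by simp
    then have AB: "?A + ?B' = ?A' + ?B" using generic unfolding generic_weights_def by blast
    have disj: "z \<notin># ?B" if z: "z \<in># ?A" for z
    proof
      assume "z \<in># ?B"
      with z obtain i j where ij: "level x \<le> i" "i < k" "z = bgeo q \<sigma> x i"
        "level y \<le> j" "j < k" "z = bgeo q \<sigma> y j" by (auto simp: in_path_mset)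
      then have "i = j" using P.level_gam[of x i \<sigma>] P.level_gam[of y j \<sigma>] by simp
      then show False using k(2)[of i] ij by (auto simp: meet_def)
    qed
    have disj': "z \<notin># ?B'" if z: "z \<in># ?A'" for z
    proof
      assume "z \<in># ?B'"
      with z obtain i j where ij: "level x \<le> i" "i < k'" "z = bgeo q' \<tau> x i"
        "level y \<le> j" "j < k'" "z = bgeo q' \<tau> y j" by (auto simp: in_path_mset)
      then have "i = j" using P'.level_gam[of x i \<tau>] P'.level_gam[of y j \<tau>] by simp
      then show False using k'(2)[of i] ij by (auto simp: meet_def)
    qed
    \<comment> \<open>Before their first meeting the paths of one pair are disjoint, so no site can
      cancel within a pair and \<open>?A + ?B' = ?A' + ?B\<close> splits into two
      equalities.\<close>
    have "count ?A z = count ?A' z" for z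
    proof -
      have "count ?A z + count ?B' z = count ?A' z + count ?B z" using AB by (metis count_union)
      moreover have "count ?A z = 0 \<or> count ?B z = 0" using disj[of z] by (meson not_in_iff)
      moreover have "count ?A' z = 0 \<or> count ?B' z = 0" using disj'[of z] by (meson not_in_iff)
      ultimately show ?thesis by linarith
    qed
    then have A: "?A = ?A'" by (simp add: multiset_eq_iff)
    then have B: "?B = ?B'" using AB by (metis add.commute add_left_cancel)
    have "size ?A = nat (k - level x)" "size ?A' = nat (k' - level x)" by (auto simp: path_mset_def)
    then have kk': "k' = k" using A k(1) k'(1) by (auto simp: meet_def)
    have agree: "bgeo q \<sigma> x i = bgeo q' \<tau> x i" if "level x \<le> i" "i < k" for i
      using A that kk' by (intro path_mset_inj[of "level x" k])
        (auto intro: up_right_on_subset[OF P.up_right_gam] up_right_on_subset[OF P'.up_right_gam])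
    have agree': "bgeo q \<sigma> y i = bgeo q' \<tau> y i" if "level y \<le> i" "i < k" for i
      using B that kk' by (intro path_mset_inj[of "level y" k])
        (auto intro: up_right_on_subset[OF P.up_right_gam] up_right_on_subset[OF P'.up_right_gam])
    show ?thesis using k'(1) kk' by (simp add: meet_def)
  qed
  then show ?thesis using k(1) by (auto simp: meet_def)
qed

lemma coalesce_Plus:
  assumes t: "0 < t" "t < 1"
  shows "coalesce (bgeo t Plus x) (bgeo t Plus y)"
proof -
  obtain s c where s: "s > t" "\<And>u \<sigma>. t < u \<Longrightarrow> u < s \<Longrightarrow> b u \<sigma> x y = c"
    using locally_const(2)[OF t, of x y] by blast
  \<comment> \<open>The direction \<open>q0\<close> merely fixes the level \<open>k\<close>. Near
    \<open>t\<close> on the right \<open>b\<close> is constant, so the paths of all rational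
    directions there are joined at this \<open>k\<close>.\<close>
  obtain q0 where q0: "q0 \<in> Q" "t < q0" "q0 < min s 1" using Q_dense[of t "min s 1"] s t by auto
  obtain k where k: "level x \<le> k" "level y \<le> k"
    and meet: "\<And>q \<tau>. q \<in> Q \<Longrightarrow> b q \<tau> x y = b q0 Plus x y \<Longrightarrow> bgeo q \<tau> x k = bgeo q \<tau> y k"
    using coalescence_level[OF q0(1), of x y Plus] by blast
  have "eventually (\<lambda>u. u < s \<and> bgeo u Plus x k = bgeo t Plus x k \<and> bgeo u Plus y k = bgeo t Plus y k) (at_right t)"
  proof -
    have "eventually (\<lambda>u. u < s) (at_right t)" using s(1) by (auto simp: eventually_at_right_field)
    then show ?thesis using path_right[OF t, of x k] path_right[OF t, of y k]
      by eventually_elim (use k in auto)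
  qed
  from Q_right[OF t this] obtain q where q: "q \<in> Q" "t < q" "q < s"
    "bgeo q Plus x k = bgeo t Plus x k" "bgeo q Plus y k = bgeo t Plus y k" by auto
  have "bgeo q Plus x k = bgeo q Plus y k"
    using q q0 s(2)[of q Plus] s(2)[of q0 Plus] by (intro meet) auto
  interpret T: cocycle W "b t Plus" using t cocycle by auto
  show ?thesis unfolding T.coalesce_iff using q k \<open>bgeo q Plus x k = bgeo q Plus y k\<close> by auto
qed

section \<open>Tangents of the concave function \<open>h\<close>\<close>

lemma tangent_at [simp]: "L t \<sigma> t = h t"
  by (simp add: tangent_def)

lemma tangent_affine: "L t \<sigma> ((1 - \<theta>) * u + \<theta> * v) = (1 - \<theta>) * L t \<sigma> u + \<theta> * L t \<sigma> v"
  by (simp add: tangent_def algebra_simps)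

text \<open>The tangent at \<open>w\<close> lies above \<open>h\<close> at \<open>u\<close> and
  \<open>v\<close>, hence above the chord, and it passes through \<open>h w\<close>. Here the chord
  is a piece of the tangent at \<open>t\<close>.\<close>

lemma tangent_between:
  assumes "0 < u" "v < 1" "u \<le> w" "w \<le> v" "h u = L t \<sigma> u" "h v = L t \<sigma> v" "0 < t" "t < 1"
  shows "h w = L t \<sigma> w"
proof (cases "u = v")
  case False
  define \<theta> where "\<theta> = (w - u) / (v - u)"
  have \<theta>: "0 \<le> \<theta>" "\<theta> \<le> 1" using assms False by (auto simp: \<theta>_def field_simps)
  have "\<theta> * (v - u) = w - u" using assms False by (simp add: \<theta>_def)
  then have w: "w = (1 - \<theta>) * u + \<theta> * v" by (simp add: algebra_simps)
  have "0 < w" "w < 1" using assms by auto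
  then have "h u \<le> L w Plus u" "h v \<le> L w Plus v" 
    using \<open>0 < w\<close> \<open>w < 1\<close> assms(1-4) by (intro below_tangent; linarith)+
  then have "(1 - \<theta>) * h u + \<theta> * h v \<le> (1 - \<theta>) * L w Plus u + \<theta> * L w Plus v"
    using \<theta> by (intro add_mono mult_left_mono) auto
  also have "\<dots> = L w Plus w" using tangent_affine[of w Plus \<theta> u v] w by simp
  finally have "L t \<sigma> w \<le> h w" using tangent_affine[of t \<sigma> \<theta> u v] w assms by simp
  moreover have "h w \<le> L t \<sigma> w" using \<open>0 < w\<close> \<open>w < 1\<close> assms by (intro below_tangent)
  ultimately show ?thesis by simp
qed (use assms in auto)

lemma deriv_right_unique:
  assumes "0 < t" "t < s" "s \<le> 1" "\<And>u. t < u \<Longrightarrow> u < s \<Longrightarrow> h u = h t + (u - t) * c"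
  shows "d t Plus = c"
proof (rule tendsto_unique[OF _ deriv_right])
  have "eventually (\<lambda>u. c = (h u - h t) / (u - t)) (at_right t)"
    unfolding eventually_at_right_field using assms by (intro exI[of _ s]) auto
  then show "((\<lambda>u. (h u - h t) / (u - t)) \<longlongrightarrow> c) (at_right t)"
    by (rule Lim_transform_eventually[OF tendsto_const])
qed (use assms in auto)

lemma deriv_left_unique:
  assumes "0 \<le> s" "s < t" "t < 1" "\<And>u. s < u \<Longrightarrow> u < t \<Longrightarrow> h u = h t + (u - t) * c"
  shows "d t Minus = c"
proof (rule tendsto_unique[OF _ deriv_left])
  have "eventually (\<lambda>u. c = (h u - h t) / (u - t)) (at_left t)"
    unfolding eventually_at_left_field using assms by (intro exI[of _ s]) auto
  then show "((\<lambda>u. (h u - h t) / (u - t)) \<longlongrightarrow> c) (at_left t)"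
    by (rule Lim_transform_eventually[OF tendsto_const])
qed (use assms in auto)

lemma h_right: assumes "0 < t" "t < 1" shows "(h \<longlongrightarrow> h t) (at_right t)"
proof -
  have "((\<lambda>s. h t + (s - t) * ((h s - h t) / (s - t))) \<longlongrightarrow> h t + (t - t) * d t Plus) (at_right t)"
    using assms by (intro tendsto_intros deriv_right)
  moreover have "eventually (\<lambda>s. h t + (s - t) * ((h s - h t) / (s - t)) = h s) (at_right t)"
    by (auto simp: eventually_at_right_field intro: exI[of _ "t + 1"])
  ultimately show ?thesis by (auto dest: Lim_transform_eventually)
qed

lemma h_left: assumes "0 < t" "t < 1" shows "(h \<longlongrightarrow> h t) (at_left t)"
proof -
  have "((\<lambda>s. h t + (s - t) * ((h s - h t) / (s - t))) \<longlongrightarrow> h t + (t - t) * d t Minus) (at_left t)"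
    using assms by (intro tendsto_intros deriv_left)
  moreover have "eventually (\<lambda>s. h t + (s - t) * ((h s - h t) / (s - t)) = h s) (at_left t)"
    by (auto simp: eventually_at_left_field intro: exI[of _ "t - 1"])
  ultimately show ?thesis by (auto dest: Lim_transform_eventually)
qed

lemma deriv_le: assumes "0 < t" "t < 1" shows "d t Plus \<le> d t Minus"
proof (rule tendsto_upperbound[OF deriv_right])
  show "eventually (\<lambda>s. (h s - h t) / (s - t) \<le> d t Minus) (at_right t)"
    using eventually_at_right_Ioo[OF assms(2)]
  proof eventually_elim
    case (elim s)
    then show ?case using below_tangent[of s t Minus] assms by (simp add: tangent_def field_simps)
  qed
qed (use assms in auto)

text \<open>To the right of \<open>t\<close> the \<open>Plus\<close> tangent is the lower of the
  two, so a point on either tangent lies on this one.\<close>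

lemma touch_right_Plus:
  assumes "0 < t" "t < s" "s < 1" "h s = L t \<sigma> s"
  shows "h s = L t Plus s"
proof (cases \<sigma>)
  case Minus
  have "(s - t) * d t Plus \<le> (s - t) * d t Minus" using assms deriv_le[of t] by (intro mult_left_mono) auto
  then have "L t Plus s \<le> h s" using assms Minus by (simp add: tangent_def)
  then show ?thesis using below_tangent[of s t Plus] assms by simp
qed (use assms in auto)

text \<open>Touching the tangent of \<open>q\<close> at \<open>v\<close> makes \<open>h\<close>
  affine from \<open>v\<close> to \<open>q\<close>, an interval in which \<open>t\<close> has room
  on its right.\<close>

lemma touch_deriv_Plus:
  assumes "0 < v" "v \<le> t" "t < q" "q < 1" "h v = L q \<sigma> v"
  shows "d t Plus = d q \<sigma>" "h q = L t Plus q"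
proof -
  have touch: "h w = L q \<sigma> w" if "v \<le> w" "w \<le> q" for w
    by (rule tangent_between[OF assms(1,4) that assms(5) tangent_at[symmetric]]) (use assms in linarith)+
  show d: "d t Plus = d q \<sigma>"
  proof (rule deriv_right_unique[of t q])
    fix u assume "t < u" "u < q"
    then show "h u = h t + (u - t) * d q \<sigma>"
      using touch[of u] touch[of t] assms by (simp add: tangent_def algebra_simps)
  qed (use assms in auto)
  show "h q = L t Plus q" using touch[of t] assms d by (simp add: tangent_def algebra_simps)
qed

lemma touch_deriv_Minus:
  assumes "0 < t" "t < s" "s < 1" "h s = L t \<sigma> s"
  shows "d s Minus = d t \<sigma>" "L s Minus = L t \<sigma>"
proof -
  have touch: "h w = L t \<sigma> w" if "t \<le> w" "w \<le> s" for w
    by (rule tangent_between[OF assms(1,3) that tangent_at[symmetric] assms(4)]) (use assms in linarith)+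
  show d: "d s Minus = d t \<sigma>"
  proof (rule deriv_left_unique[of t s])
    fix u assume "t < u" "u < s"
    then show "h u = h s + (u - s) * d t \<sigma>"
      using touch[of u] assms by (simp add: tangent_def algebra_simps)
  qed (use assms in auto)
  show "L s Minus = L t \<sigma>" using assms d by (auto simp: tangent_def fun_eq_iff algebra_simps)
qed

text \<open>The difference of the two lines is affine, negative at 0, and nonnegative at
  \<open>q\<close> because the tangent at \<open>t\<close> lies above \<open>h q\<close>; so it is
  positive beyond \<open>q\<close>.\<close>

lemma above_tangent_right:
  assumes "0 < t" "t < 1" "q \<in> Q" "t < q" "L t \<sigma> 0 < L q \<tau> 0" "q < v"
  shows "L q \<tau> v < L t \<sigma> v"
proof -
  have q: "0 < q" "q < 1" using Q_bounds assms by auto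
  define f where "f u = L t \<sigma> u - L q \<tau> u" for u
  have "f 0 < 0" "0 \<le> f q" using assms below_tangent[of q t \<sigma>] q by (auto simp: f_def)
  moreover have "f u = f 0 + u * (d t \<sigma> - d q \<tau>)" for u by (simp add: f_def tangent_def algebra_simps)
  ultimately have "0 < q * (d t \<sigma> - d q \<tau>)" by (metis add_less_same_cancel2 not_less order_less_le_trans add.commute add_le_same_cancel1)
  then have "q * (d t \<sigma> - d q \<tau>) < v * (d t \<sigma> - d q \<tau>)"
    using q assms by (intro mult_strict_right_mono) (auto simp: zero_less_mult_iff)
  then have "f q < f v" using \<open>\<And>u. f u = f 0 + u * (d t \<sigma> - d q \<tau>)\<close> by (metis add_less_cancel_left)
  then show ?thesis using \<open>0 \<le> f q\<close> by (simp add: f_def)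
qed

end

section \<open>Asymptotic directions of geodesics\<close>

lemma up_right_bounds:
  assumes "up_right_on {level x..} \<pi>" "\<pi> (level x) = x" "level x \<le> k"
  shows "x \<le> \<pi> k" "level (\<pi> k) = k" "fst x \<le> fst (\<pi> k)" "fst (\<pi> k) \<le> fst x + (k - level x)"
proof -
  have "\<pi> (level x) \<le> \<pi> k" using assms(3) by (intro up_right_on_mono[OF assms(1)]) auto
  then show le: "x \<le> \<pi> k" using assms(2) by simp
  show lev: "level (\<pi> k) = k" using assms by (auto simp: up_right_on_def)
  show "fst x \<le> fst (\<pi> k)" "fst (\<pi> k) \<le> fst x + (k - level x)"
    using le lev by (auto simp: less_eq_prod_def level_def)
qed

lemma filterlim_real_subseq:
  assumes "strict_mono (r :: nat \<Rightarrow> nat)"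
  shows "filterlim (\<lambda>j. real (r j)) at_top sequentially"
  by (rule filterlim_compose[OF filterlim_real_sequentially filterlim_subseq[OF assms]])

lemma eventually_subseq_ge: "strict_mono (r :: nat \<Rightarrow> nat) \<Longrightarrow> eventually (\<lambda>j. c \<le> int (r j) \<and> 1 \<le> r j) sequentially"
proof -
  assume "strict_mono r"
  then have "filterlim r at_top sequentially" by (rule filterlim_subseq)
  then have "eventually (\<lambda>j. max 1 (nat c) \<le> r j) sequentially"
    unfolding filterlim_at_top by blast
  then show ?thesis by eventually_elim auto
qed

text \<open>The ratios are bounded once the level is positive and past the start of the path;
  compactness applies after a shift.\<close>

lemma ratio_subseq:
  assumes "up_right_on {level x..} \<pi>" "\<pi> (level x) = x" "strict_mono (r :: nat \<Rightarrow> nat)"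
  shows "\<exists>r' u. strict_mono (r' :: nat \<Rightarrow> nat) \<and>
    (\<lambda>j. of_int (fst (\<pi> (int (r (r' j))))) / real (r (r' j))) \<longlonglongrightarrow> u"
proof -
  let ?f = "\<lambda>j. of_int (fst (\<pi> (int (r j)))) / real (r j)"
  let ?C = "\<bar>of_int (fst x)\<bar> + \<bar>of_int (level x)\<bar> + (1::real)"
  obtain N where N: "\<And>j. j \<ge> N \<Longrightarrow> level x \<le> int (r j) \<and> 1 \<le> r j"
    using eventually_subseq_ge[OF assms(3), of "level x"] by (auto simp: eventually_sequentially)
  have bound: "?f (j + N) \<in> {- ?C..?C}" for j
  proof -
    have r: "level x \<le> int (r (j + N))" "1 \<le> r (j + N)" using N[of "j + N"] by auto
    define n where "n = real (r (j + N))"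
    have n: "n \<ge> 1" using r by (simp add: n_def)
    have *: "of_int (fst x) \<le> (of_int (fst (\<pi> (int (r (j + N))))) :: real)"
      "of_int (fst (\<pi> (int (r (j + N))))) \<le> of_int (fst x) + (n - of_int (level x))"
      using up_right_bounds(3,4)[OF assms(1,2) r(1)] by (simp_all add: n_def)
    have "?C * n \<ge> \<bar>of_int (fst x)\<bar> + \<bar>of_int (level x)\<bar> + n"
    proof -
      have "(\<bar>of_int (fst x)\<bar> + \<bar>of_int (level x)\<bar>) * 1 \<le> (\<bar>of_int (fst x)\<bar> + \<bar>of_int (level x)\<bar>) * n"
        using n by (intro mult_left_mono) auto
      then show ?thesis by (simp add: algebra_simps)
    qed
    then show ?thesis using * n unfolding n_def[symmetric]
      by (auto simp: field_simps)
  qed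
  have "seq_compact {- ?C..?C}" by (simp add: compact_imp_seq_compact)
  then obtain u s where s: "strict_mono s" "((\<lambda>j. ?f (j + N)) \<circ> s) \<longlonglongrightarrow> u"
    using bound unfolding seq_compact_def by (metis (no_types, lifting))
  have "strict_mono (\<lambda>j. s j + N)" using s(1) by (simp add: strict_mono_def)
  then show ?thesis using s(2) by (intro exI[of _ "\<lambda>j. s j + N"] exI[of _ u]) (simp add: o_def)
qed

context busemann_config begin

text \<open>Per unit of level the path moves by \<open>u\<close> and \<open>1 - u\<close> along the
  axes, and the affine function \<open>L q \<sigma>\<close> interpolates its values at 1 and 0 with
  these coefficients.\<close>

lemma asymp_limit:
  assumes q: "q \<in> Q" and \<pi>: "up_right_on {level x..} \<pi>" "\<pi> (level x) = x" and r: "strict_mono r"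
    and lim: "(\<lambda>j. of_int (fst (\<pi> (int (r j)))) / real (r j)) \<longlonglongrightarrow> u"
  shows "(\<lambda>j. b q \<sigma> x (\<pi> (int (r j))) / real (r j)) \<longlonglongrightarrow> L q \<sigma> u"
proof -
  define n where "n j = real (r j)" for j
  define I where "I j = of_int (fst (\<pi> (int (r j))) - fst x) / n j" for j
  define J where "J j = of_int (snd (\<pi> (int (r j))) - snd x) / n j" for j
  have inv: "(\<lambda>j. c / n j) \<longlonglongrightarrow> 0" for c
    unfolding n_def by (intro real_tendsto_divide_at_top[OF tendsto_const] filterlim_real_subseq r)
  have I: "I \<longlonglongrightarrow> u"
  proof -
    have "(\<lambda>j. of_int (fst (\<pi> (int (r j)))) / real (r j) - of_int (fst x) / n j) \<longlonglongrightarrow> u - 0"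
      by (intro tendsto_diff lim inv)
    then show ?thesis by (simp add: I_def[abs_def] n_def diff_divide_distrib)
  qed
  have ev: "eventually (\<lambda>j. level x \<le> int (r j) \<and> 1 \<le> r j) sequentially"
    by (rule eventually_subseq_ge[OF r])
  have J: "J \<longlonglongrightarrow> 1 - u"
  proof (rule Lim_transform_eventually)
    show "(\<lambda>j. 1 - I j - of_int (level x) / n j) \<longlonglongrightarrow> 1 - u"
      using tendsto_diff[OF tendsto_diff[OF tendsto_const[of 1] I] inv[of "of_int (level x)"]] by simp
    show "eventually (\<lambda>j. 1 - I j - of_int (level x) / n j = J j) sequentially"
      using ev
    proof eventually_elim
      case (elim j)
      have "level (\<pi> (int (r j))) = int (r j)" using up_right_bounds(2)[OF \<pi>] elim by blast
      then have "snd (\<pi> (int (r j))) - snd x = int (r j) - (fst (\<pi> (int (r j))) - fst x) - level x"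
        by (simp add: level_def)
      then have "(of_int (snd (\<pi> (int (r j))) - snd x) :: real)
          = n j - of_int (fst (\<pi> (int (r j))) - fst x) - of_int (level x)" by (simp add: n_def)
      moreover have "n j > 0" using elim by (simp add: n_def)
      ultimately show ?case unfolding I_def J_def by (simp add: diff_divide_distrib)
    qed
  qed
  have main: "(\<lambda>j. I j * L q \<sigma> 1 + J j * L q \<sigma> 0) \<longlonglongrightarrow> L q \<sigma> u"
  proof -
    have "(\<lambda>j. I j * L q \<sigma> 1 + J j * L q \<sigma> 0) \<longlonglongrightarrow> u * L q \<sigma> 1 + (1 - u) * L q \<sigma> 0"
      by (intro tendsto_intros I J)
    moreover have "u * L q \<sigma> 1 + (1 - u) * L q \<sigma> 0 = L q \<sigma> u" by (simp add: tangent_def algebra_simps)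
    ultimately show ?thesis by simp
  qed
  have "(\<lambda>j. b q \<sigma> x (\<pi> (int (r j))) / n j - (I j * L q \<sigma> 1 + J j * L q \<sigma> 0)) \<longlonglongrightarrow> 0"
  proof (rule LIMSEQ_I)
    fix \<epsilon> :: real assume "0 < \<epsilon>"
    have "0 < \<epsilon> / 4" using \<open>0 < \<epsilon>\<close> by simp
    from asymp[OF q this, where x = x and \<sigma> = \<sigma>] obtain n0
      where n0: "\<forall>y. x \<le> y \<and> n0 \<le> level y - level x \<longrightarrow>
        \<bar>b q \<sigma> x y - (of_int (fst y - fst x) * L q \<sigma> 1 + of_int (snd y - snd x) * L q \<sigma> 0)\<bar>
          \<le> \<epsilon> / 4 * of_int (level y - level x)" by (rule exE)
    have "(\<lambda>j. I j + J j) \<longlonglongrightarrow> u + (1 - u)" by (intro tendsto_add I J)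
    then have "eventually (\<lambda>j. I j + J j < 2) sequentially" by (intro order_tendstoD(2)) auto
    then have "eventually (\<lambda>j. norm (b q \<sigma> x (\<pi> (int (r j))) / n j - (I j * L q \<sigma> 1 + J j * L q \<sigma> 0) - 0) < \<epsilon>) sequentially"
      using ev eventually_subseq_ge[OF r, of "n0 + level x"]
    proof eventually_elim
      case (elim j)
      let ?y = "\<pi> (int (r j))"
      have y: "x \<le> ?y" "level ?y = int (r j)" using up_right_bounds(1,2)[OF \<pi>] elim by auto
      have npos: "n j > 0" using elim by (simp add: n_def)
      have lev: "of_int (level ?y - level x) = (I j + J j) * n j"
        using npos by (simp add: I_def J_def level_def field_simps)
      have "\<bar>b q \<sigma> x ?y - (of_int (fst ?y - fst x) * L q \<sigma> 1 + of_int (snd ?y - snd x) * L q \<sigma> 0)\<bar>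
        \<le> \<epsilon> / 4 * of_int (level ?y - level x)"
        using y elim by (intro n0[rule_format] conjI) auto
      also have "\<dots> \<le> \<epsilon> / 4 * (2 * n j)"
        unfolding lev using elim npos \<open>0 < \<epsilon>\<close> by (intro mult_left_mono mult_right_mono) auto
      finally have *: "\<bar>b q \<sigma> x ?y - (of_int (fst ?y - fst x) * L q \<sigma> 1 + of_int (snd ?y - snd x) * L q \<sigma> 0)\<bar>
        \<le> \<epsilon> / 2 * n j" by simp
      have "b q \<sigma> x ?y / n j - (I j * L q \<sigma> 1 + J j * L q \<sigma> 0)
        = (b q \<sigma> x ?y - (of_int (fst ?y - fst x) * L q \<sigma> 1 + of_int (snd ?y - snd x) * L q \<sigma> 0)) / n j"
        using npos by (simp add: I_def J_def field_simps)
      then have "\<bar>b q \<sigma> x ?y / n j - (I j * L q \<sigma> 1 + J j * L q \<sigma> 0)\<bar> \<le> \<epsilon> / 2"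
        using * npos by (simp add: abs_divide divide_le_eq)
      then show ?case using \<open>0 < \<epsilon>\<close> by simp
    qed
    then show "\<exists>no. \<forall>j\<ge>no. norm (b q \<sigma> x (\<pi> (int (r j))) / n j - (I j * L q \<sigma> 1 + J j * L q \<sigma> 0) - 0) < \<epsilon>"
      by (simp only: eventually_sequentially)
  qed
  from tendsto_add[OF this main] show ?thesis by (simp add: n_def)
qed

lemma up_right_bgeo:
  assumes "0 < t" "t < 1"
  shows "up_right_on {level x..} (bgeo t \<sigma> x)" "bgeo t \<sigma> x (level x) = x"
proof -
  interpret T: cocycle W "b t \<sigma>" using assms cocycle by auto
  show "up_right_on {level x..} (bgeo t \<sigma> x)" "bgeo t \<sigma> x (level x) = x"
    using T.up_right_gam by auto
qed

text \<open>Along its own geodesic \<open>b q \<sigma>\<close> equals the collected weight, while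
  \<open>b q' \<tau>\<close> is at least this weight. Dividing by the level compares the growth
  rates.\<close>

lemma limit_tangent_le:
  assumes q: "q \<in> Q" "q' \<in> Q" and r: "strict_mono r"
    and lim: "(\<lambda>j. of_int (fst (bgeo q \<sigma> x (int (r j)))) / real (r j)) \<longlonglongrightarrow> u"
  shows "L q \<sigma> u \<le> L q' \<tau> u"
proof (rule LIMSEQ_le)
  note geo = up_right_bgeo[OF Q_bounds[OF q(1)], where x = x and \<sigma> = \<sigma>]
  show "(\<lambda>j. b q \<sigma> x (bgeo q \<sigma> x (int (r j))) / real (r j)) \<longlonglongrightarrow> L q \<sigma> u"
    by (rule asymp_limit[OF q(1) geo r lim])
  show "(\<lambda>j. b q' \<tau> x (bgeo q \<sigma> x (int (r j))) / real (r j)) \<longlonglongrightarrow> L q' \<tau> u"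
    by (rule asymp_limit[OF q(2) geo r lim])
  interpret P: cocycle W "b q \<sigma>" using Q_bounds[OF q(1)] cocycle by auto
  interpret P': cocycle W "b q' \<tau>" using Q_bounds[OF q(2)] cocycle by auto
  obtain N where N: "\<And>j. j \<ge> N \<Longrightarrow> level x \<le> int (r j) \<and> 1 \<le> r j"
    using eventually_subseq_ge[OF r, of "level x"] by (auto simp: eventually_sequentially)
  show "\<exists>N. \<forall>j\<ge>N. b q \<sigma> x (bgeo q \<sigma> x (int (r j))) / real (r j) \<le> b q' \<tau> x (bgeo q \<sigma> x (int (r j))) / real (r j)"
  proof (intro exI[of _ N] allI impI divide_right_mono)
    fix j assume "N \<le> j"
    then have lev: "level x \<le> int (r j)" using N by blast
    have "b q \<sigma> x (bgeo q \<sigma> x (int (r j))) = path_weight W (bgeo q \<sigma> x) (level x) (int (r j))"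
      using P.path_weight_gam[of "level x" "int (r j)" x \<sigma>] lev by simp
    also have "\<dots> \<le> b q' \<tau> x (bgeo q \<sigma> x (int (r j)))"
      using P'.path_weight_le[OF lev up_right_on_subset[OF geo(1)]] geo(2) by auto
    finally show "b q \<sigma> x (bgeo q \<sigma> x (int (r j))) \<le> b q' \<tau> x (bgeo q \<sigma> x (int (r j)))" .
  qed simp
qed

lemma above_tangent_left:
  assumes "0 < t" "t < 1" "q \<in> Q" "q < t" "L t \<sigma> 1 < L q \<tau> 1" "v < q"
  shows "L q \<tau> v < L t \<sigma> v"
proof -
  have q: "0 < q" "q < 1" using Q_bounds assms by auto
  define D where "D = d t \<sigma> - d q \<tau>"
  define c where "c = L t \<sigma> 1 - L q \<tau> 1"
  have f: "L t \<sigma> u - L q \<tau> u = c - (1 - u) * D" for u by (simp add: c_def D_def tangent_def algebra_simps)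
  have "c < 0" "0 \<le> c - (1 - q) * D" using assms below_tangent[of q t \<sigma>] q f[of q] by (auto simp: c_def)
  then have "(1 - q) * D < 0" by linarith
  then have "D < 0" using q by (simp add: mult_less_0_iff)
  then have "(1 - v) * D < (1 - q) * D" using assms by (intro mult_strict_right_mono_neg) auto
  then show ?thesis using f[of v] \<open>0 \<le> c - (1 - q) * D\<close> by linarith
qed

lemma Q_left:
  assumes "0 < t" "t < 1" "eventually P (at_left t)"
  shows "\<exists>q\<in>Q. q < t \<and> P q"
proof -
  obtain s where s: "s < t" "\<And>u. s < u \<Longrightarrow> u < t \<Longrightarrow> P u"
    using assms(3) by (auto simp: eventually_at_left_field)
  obtain q where "q \<in> Q" "max s 0 < q" "q < t" using Q_dense[of "max s 0" t] s assms by auto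
  then show ?thesis using s(2)[of q] by auto
qed

text \<open>By \<open>limit_tangent_le\<close> the tangent of \<open>q\<close> is lowest at
  \<open>u\<close> among all rational tangents. Steep tangents near the end directions keep
  \<open>u\<close> away from 0 and 1, and in between \<open>h\<close> is the infimum of the rational
  tangents.\<close>

lemma limit_touch:
  assumes q: "q \<in> Q" and r: "strict_mono r"
    and lim: "(\<lambda>j. of_int (fst (bgeo q \<sigma> x (int (r j)))) / real (r j)) \<longlonglongrightarrow> u"
  shows "0 < u" "u < 1" "h u = L q \<sigma> u"
proof -
  note le = limit_tangent_le[OF q _ r lim]
  have q01: "0 < q" "q < 1" using Q_bounds q by auto
  show "u < 1"
  proof (rule ccontr)
    assume "\<not> u < 1"
    obtain q' where q': "q' \<in> Q" "q < q'" "L q \<sigma> 0 < L q' Plus 0" using steep_right[OF q01] by blast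
    then have "L q' Plus u < L q \<sigma> u"
      using Q_bounds[OF q'(1)] \<open>\<not> u < 1\<close> by (intro above_tangent_right[OF q01 q']) auto
    then show False using le[OF q'(1), of Plus] by simp
  qed
  show "0 < u"
  proof (rule ccontr)
    assume "\<not> 0 < u"
    obtain q' where q': "q' \<in> Q" "q' < q" "L q \<sigma> 1 < L q' Plus 1" using steep_left[OF q01] by blast
    then have "L q' Plus u < L q \<sigma> u"
      using Q_bounds[OF q'(1)] \<open>\<not> 0 < u\<close> by (intro above_tangent_left[OF q01 q']) auto
    then show False using le[OF q'(1), of Plus] by simp
  qed
  show "h u = L q \<sigma> u"
  proof (rule ccontr)
    assume "h u \<noteq> L q \<sigma> u"
    then have less: "h u < L q \<sigma> u"
      using below_tangent[OF \<open>0 < u\<close> \<open>u < 1\<close> q01, of \<sigma>] by simp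
    \<comment> \<open>A base point to the left of \<open>u\<close>. The chord slope from
      \<open>c\<close> to \<open>w\<close> bounds the slope of the tangent at \<open>w\<close>, so
      the value of this tangent at \<open>u\<close> is close to \<open>h u\<close> when
      \<open>w\<close> is just left of \<open>u\<close>.\<close>
    define c where "c = u / 2"
    have c: "0 < c" "c < u" using \<open>0 < u\<close> by (auto simp: c_def)
    have "((\<lambda>w. h w + (u - w) * ((h w - h c) / (w - c))) \<longlongrightarrow> h u + (u - u) * ((h u - h c) / (u - c))) (at_left u)"
      using c by (intro tendsto_intros h_left \<open>0 < u\<close> \<open>u < 1\<close>) auto
    then have "eventually (\<lambda>w. h w + (u - w) * ((h w - h c) / (w - c)) < L q \<sigma> u) (at_left u)"
      using less by (intro order_tendstoD(2)) auto
    moreover have "eventually (\<lambda>w. c < w) (at_left u)" using c by (auto simp: eventually_at_left_field)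
    ultimately have "eventually (\<lambda>w. c < w \<and> h w + (u - w) * ((h w - h c) / (w - c)) < L q \<sigma> u) (at_left u)"
      by eventually_elim auto
    from Q_left[OF \<open>0 < u\<close> \<open>u < 1\<close> this] obtain w where w: "w \<in> Q" "w < u" "c < w"
      "h w + (u - w) * ((h w - h c) / (w - c)) < L q \<sigma> u" by auto
    have "h c \<le> L w Plus c" using w c \<open>u < 1\<close> by (intro below_tangent) auto
    then have "d w Plus \<le> (h w - h c) / (w - c)" using w by (simp add: tangent_def field_simps)
    then have "(u - w) * d w Plus \<le> (u - w) * ((h w - h c) / (w - c))" using w by (intro mult_left_mono) auto
    then have "L w Plus u < L q \<sigma> u" using w(4) by (simp add: tangent_def)
    then show False using le[OF w(1), of Plus] by simp
  qed
qed

text \<open>The linear growth of \<open>b\<close> is available for rational directions only, so take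
  \<open>q\<close> between \<open>t\<close> and \<open>u\<close>. Its path lies further right and
  has a limit at or beyond \<open>u\<close>; by \<open>limit_touch\<close> the function
  \<open>h\<close> is affine from \<open>q\<close> to \<open>u\<close>, and letting \<open>q\<close>
  decrease extends this to \<open>t\<close>.\<close>

lemma limit_right:
  assumes t: "0 < t" "t < 1" and r: "strict_mono r" and "t < u"
    and lim: "(\<lambda>j. of_int (fst (bgeo t \<sigma> x (int (r j)))) / real (r j)) \<longlonglongrightarrow> u"
  shows "u < 1" "h u = L t Plus u"
proof -
  have touch: "u < 1 \<and> h u = L q Plus u" if q: "q \<in> Q" "t < q" "q < u" for q
  proof -
    have q01: "0 < q" "q < 1" using Q_bounds q by auto
    obtain r' v where r': "strict_mono r'"
      "(\<lambda>j. of_int (fst (bgeo q Plus x (int (r (r' j))))) / real (r (r' j))) \<longlonglongrightarrow> v"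
      using ratio_subseq[OF up_right_bgeo[OF q01] r] by blast
    have rr': "strict_mono (\<lambda>j. r (r' j))" using r r'(1) by (simp add: strict_mono_def)
    have "(\<lambda>j. of_int (fst (bgeo t \<sigma> x (int (r (r' j))))) / real (r (r' j))) \<longlonglongrightarrow> u"
      using LIMSEQ_subseq_LIMSEQ[OF lim r'(1)] by (simp add: o_def)
    then have "u \<le> v"
    proof (rule LIMSEQ_le[OF _ r'(2)])
      obtain N where N: "\<And>j. j \<ge> N \<Longrightarrow> level x \<le> int (r (r' j))"
        using eventually_subseq_ge[OF rr', of "level x"] by (auto simp: eventually_sequentially)
      show "\<exists>N. \<forall>j\<ge>N. of_int (fst (bgeo t \<sigma> x (int (r (r' j))))) / real (r (r' j))
          \<le> of_int (fst (bgeo q Plus x (int (r (r' j))))) / real (r (r' j))"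
        using path_mono[OF t(1) q(2) q01(2)] N
        by (intro exI[of _ N] allI impI divide_right_mono) auto
    qed
    note v = limit_touch[OF q(1) rr' r'(2)]
    have "h u = L q Plus u"
      using tangent_between[OF q01(1) v(2) less_imp_le[OF q(3)] \<open>u \<le> v\<close> tangent_at[symmetric] v(3) q01] .
    then show ?thesis using v(2) \<open>u \<le> v\<close> by simp
  qed
  obtain q0 where q0: "q0 \<in> Q" "t < q0" "q0 < min u 1" using Q_dense[of t "min u 1"] t \<open>t < u\<close> by auto
  then show u1: "u < 1" using touch[of q0] by auto
  define c where "c = d q0 Plus"
  have line: "h w = h u + (w - u) * c" if w: "t < w" "w < u" for w
  proof -
    obtain q where q: "q \<in> Q" "t < q" "q < min w q0" 
    proof -
      have "min w q0 \<le> 1" "t < min w q0" using w q0 u1 by auto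
      then show ?thesis using Q_dense[of t "min w q0"] t that by auto
    qed
    have q01: "0 < q" "q < 1" using Q_bounds q by auto
    have hu: "h u = L q Plus u" using touch[of q] q w by auto
    have on: "h v = L q Plus v" if "q \<le> v" "v \<le> u" for v
      by (rule tangent_between[OF q01(1) u1 that tangent_at[symmetric] hu q01])
    have "h u = L q0 Plus u" using touch[of q0] q0 by auto
    then have "(u - q0) * d q Plus = (u - q0) * c"
      using hu on[of q0] q q0 by (simp add: tangent_def c_def algebra_simps)
    then have "d q Plus = c" using q0 by simp
    then show ?thesis using hu on[of w] q w by (simp add: tangent_def algebra_simps)
  qed
  have ht: "h t = h u + (t - u) * c"
  proof (rule tendsto_unique[OF _ h_right[OF t]])
    have "((\<lambda>w. h u + (w - u) * c) \<longlongrightarrow> h u + (t - u) * c) (at_right t)" by (intro tendsto_intros)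
    moreover have "eventually (\<lambda>w. h u + (w - u) * c = h w) (at_right t)"
      unfolding eventually_at_right_field using line \<open>t < u\<close> by (intro exI[of _ u]) auto
    ultimately show "(h \<longlongrightarrow> h u + (t - u) * c) (at_right t)" by (rule Lim_transform_eventually)
  qed simp
  have "d t Plus = c"
  proof (rule deriv_right_unique[of t u])
    fix w assume "t < w" "w < u"
    then show "h w = h t + (w - t) * c" using line[of w] ht by (simp add: algebra_simps)
  qed (use t \<open>t < u\<close> u1 in auto)
  then show "h u = L t Plus u" using ht by (simp add: tangent_def algebra_simps)
qed

text \<open>Compare with a rational \<open>q\<close> just beyond the right end \<open>hi\<close> of
  the facet. If \<open>\<pi>\<close> were once right of the \<open>Plus\<close> path, it would be
  right of the path of \<open>q\<close> and stay there. The path of \<open>q\<close> would then have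
  a limit at most \<open>hi\<close>, which puts \<open>q\<close> itself on the facet.\<close>

lemma geodesic_le_Plus:
  assumes t: "0 < t" "t < 1"
    and geo: "semi_infinite_geodesic W x \<pi>" and dir: "\<And>u. limit_pt \<pi> u \<Longrightarrow> u \<in> F t"
    and k: "level x \<le> k"
  shows "fst (\<pi> k) \<le> fst (bgeo t Plus x k)"
proof (rule ccontr)
  assume less: "\<not> fst (\<pi> k) \<le> fst (bgeo t Plus x k)"
  have tF: "t \<in> F t" using t by (auto simp: flat_part_def)
  obtain q' where q': "q' \<in> Q" "t < q'" "L t Plus 0 < L q' Plus 0" using steep_right[OF t] by blast
  have F_Plus: "h s = L t Plus s" if "s \<in> F t" "t < s" for s
    using that t touch_right_Plus[of t s] by (auto simp: flat_part_def)
  \<comment> \<open>A steep rational tangent lies below the tangent of \<open>t\<close> beyond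
    \<open>q'\<close>, so the facet cannot extend past \<open>q'\<close> and its supremum is a
    direction in the interior.\<close>
  have F_le: "s \<le> q'" if "s \<in> F t" for s
  proof (rule ccontr)
    assume "\<not> s \<le> q'"
    then have "L q' Plus s < L t Plus s" using above_tangent_right[OF t q'] by simp
    moreover have "h s = L t Plus s" using F_Plus[OF that] \<open>\<not> s \<le> q'\<close> q' by simp
    moreover have "h s \<le> L q' Plus s"
      using that Q_bounds[OF q'(1)] by (intro below_tangent) (auto simp: flat_part_def)
    ultimately show False by simp
  qed
  define hi where "hi = Sup (F t)"
  have bdd: "bdd_above (F t)" using F_le by (auto simp: bdd_above_def)
  have hi: "t \<le> hi" "hi < 1" "0 < hi"
  proof -
    show "t \<le> hi" unfolding hi_def by (rule cSup_upper[OF tF bdd])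
    have "hi \<le> q'" unfolding hi_def using tF F_le by (intro cSup_least) auto
    then show "hi < 1" using Q_bounds[OF q'(1)] by simp
    show "0 < hi" using \<open>t \<le> hi\<close> t by simp
  qed
  have F_hi: "s \<le> hi" if "s \<in> F t" for s unfolding hi_def by (rule cSup_upper[OF that bdd])
  have h_hi: "h hi = L t Plus hi"
  proof (cases "hi = t")
    case False
    have on: "h w = L t Plus w" if w: "t < w" "w < hi" for w
    proof -
      obtain s where s: "s \<in> F t" "w < s" using w less_cSup_iff[OF _ bdd, of w] tF by (auto simp: hi_def)
      then have "t < s" using w by simp
      note hs = F_Plus[OF s(1) this]
      have "s < 1" using s(1) by (simp add: flat_part_def)
      show ?thesis
        by (rule tangent_between[OF t(1) \<open>s < 1\<close> _ _ tangent_at[symmetric] hs t]) (use s w in auto)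
    qed
    show ?thesis
    proof (rule tendsto_unique[OF _ h_left[OF hi(3,2)]])
      have "((\<lambda>w. L t Plus w) \<longlongrightarrow> L t Plus hi) (at_left hi)"
        unfolding tangent_def by (intro tendsto_intros)
      moreover have "eventually (\<lambda>w. L t Plus w = h w) (at_left hi)"
        unfolding eventually_at_left_field using on hi False by (intro exI[of _ t]) auto
      ultimately show "(h \<longlongrightarrow> L t Plus hi) (at_left hi)" by (rule Lim_transform_eventually)
    qed simp
  qed simp
  \<comment> \<open>This is where the regularity condition enters. If the facet extends beyond
    \<open>t\<close>, then \<open>h\<close> is not strictly concave at \<open>hi\<close>; so it has
    no corner there, and the \<open>Plus\<close> tangent at \<open>hi\<close> is still that of
    \<open>t\<close>.\<close>
  have L_hi: "L hi Plus = L t Plus"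
  proof (cases "hi = t")
    case False
    then have "t < hi" using hi by simp
    note Minus = touch_deriv_Minus[OF t(1) this hi(2) h_hi]
    have "h t = L hi Minus t" using Minus(2) by simp
    then have "t \<in> F hi" using t by (auto simp: flat_part_def)
    then have "F hi \<noteq> {hi}" using False by auto
    then have "d hi Plus = d hi Minus" by (rule regular[OF hi(3,2)])
    then have "L hi Plus = L hi Minus" by (auto simp: tangent_def fun_eq_iff)
    then show ?thesis using Minus by simp
  qed simp
  have b_hi: "b hi Plus = b t Plus" by (rule same_tangent[OF hi(3,2) t L_hi])
  from Q_right[OF hi(3,2) path_right[OF hi(3,2), of x k]] obtain q
    where q: "q \<in> Q" "hi < q" and agree: "bgeo q Plus x k = bgeo hi Plus x k" using k by auto
  have q01: "0 < q" "q < 1" using Q_bounds q by auto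
  let ?g = "bgeo q Plus x"
  interpret P: cocycle W "b q Plus" using q01 cocycle by auto
  have start: "fst (?g k) < fst (\<pi> k)" using less agree b_hi by simp
  have \<pi>: "up_right_on {level x..} \<pi>" "\<pi> (level x) = x" using geo by (auto simp: semi_infinite_geodesic_def)
  \<comment> \<open>Both are geodesics from \<open>x\<close>. A later common point would, by
    uniqueness, force them to agree at level \<open>k\<close>.\<close>
  have right: "fst (?g n) < fst (\<pi> n)" if "k \<le> n" for n
    using that
  proof (induction n rule: int_ge_induct)
    case (step n)
    then have xn: "level x \<le> n" using k by simp
    have "fst (?g (n + 1)) \<noteq> fst (\<pi> (n + 1))"
    proof
      assume eq: "fst (?g (n + 1)) = fst (\<pi> (n + 1))"
      have "?g (n + 1) = \<pi> (n + 1)"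
        using eq xn up_right_bounds(2)[OF \<pi>, of "n + 1"] P.level_gam[of x "n + 1" Plus]
        by (intro site_eqI) auto
      note end_n = this
      have start_x: "?g (level x) = \<pi> (level x)" using \<pi>(2) by simp
      have "?g k = \<pi> k"
      proof (rule geodesic_unique[OF generic, where k = "level x" and m = "n + 1"])
        show "up_right_on {level x..n + 1} ?g" by (rule up_right_on_subset[OF P.up_right_gam]) simp
        show "up_right_on {level x..n + 1} \<pi>" by (rule up_right_on_subset[OF \<pi>(1)]) simp
        show "?g (level x) = \<pi> (level x)" "?g (n + 1) = \<pi> (n + 1)" by fact+
        show "path_weight W ?g (level x) (n + 1) = LPP W (?g (level x)) (?g (n + 1))"
          by (rule P.gam_geodesic) (use xn in auto)
        show "path_weight W \<pi> (level x) (n + 1) = LPP W (?g (level x)) (?g (n + 1))"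
          unfolding start_x end_n
          using geo xn unfolding semi_infinite_geodesic_def by simp
      qed (use k step.hyps in auto)
      then show False using start by simp
    qed
    moreover have "fst (?g (n + 1)) \<le> fst (?g n) + 1"
      using P.step_cases[of Plus "?g n"] P.gam_Suc[OF xn, of Plus] by auto
    moreover have "fst (\<pi> n) \<le> fst (\<pi> (n + 1))"
      using up_right_on_step[OF \<pi>(1), of n] xn by auto
    ultimately show ?case using step.IH by linarith
  qed (rule start)
  obtain r u where r: "strict_mono r" "(\<lambda>j. of_int (fst (\<pi> (int (r j)))) / real (r j)) \<longlonglongrightarrow> u"
    using ratio_subseq[OF \<pi> strict_mono_id] by (auto simp: id_def)
  have "u \<in> F t" using r by (intro dir) (auto simp: limit_pt_def)
  then have "u \<le> hi" by (rule F_hi)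
  obtain r' v where r': "strict_mono r'"
    "(\<lambda>j. of_int (fst (?g (int (r (r' j))))) / real (r (r' j))) \<longlonglongrightarrow> v"
    using ratio_subseq[OF up_right_bgeo[OF q01] r(1)] by blast
  have rr': "strict_mono (\<lambda>j. r (r' j))" using r(1) r'(1) by (simp add: strict_mono_def)
  have "(\<lambda>j. of_int (fst (\<pi> (int (r (r' j))))) / real (r (r' j))) \<longlonglongrightarrow> u"
    using LIMSEQ_subseq_LIMSEQ[OF r(2) r'(1)] by (simp add: o_def)
  then have "v \<le> u"
  proof (rule LIMSEQ_le[OF r'(2)])
    obtain N where N: "\<And>j. j \<ge> N \<Longrightarrow> k \<le> int (r (r' j))"
      using eventually_subseq_ge[OF rr', of k] by (auto simp: eventually_sequentially)
    show "\<exists>N. \<forall>j\<ge>N. of_int (fst (?g (int (r (r' j))))) / real (r (r' j))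
        \<le> of_int (fst (\<pi> (int (r (r' j))))) / real (r (r' j))"
      using right N by (intro exI[of _ N] allI impI divide_right_mono) (auto intro: less_imp_le)
  qed
  note v = limit_touch[OF q(1) rr' r'(2)]
  have "v \<le> hi" using \<open>v \<le> u\<close> \<open>u \<le> hi\<close> by simp
  have "h q = L hi Plus q" by (rule touch_deriv_Plus(2)[OF v(1) \<open>v \<le> hi\<close> q(2) q01(2) v(3)])
  then have "q \<in> F t" using L_hi q01 by (auto simp: flat_part_def)
  then show False using F_hi q(2) by fastforce
qed

section \<open>Jumps lie outside flat pieces\<close>

definition jump :: "real \<Rightarrow> bool" where
  "jump t \<longleftrightarrow> (\<exists>x y. b t Minus x y \<noteq> b t Plus x y)"

text \<open>If the facet reached beyond \<open>t\<close>, a rational \<open>q\<close> inside it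
  would share both tangents with \<open>t\<close>. Equal tangents give equal Busemann functions, but
  in direction \<open>q\<close> the two sides agree.\<close>

lemma jump_flat_right:
  assumes t: "0 < t" "t < 1" and "jump t" "s \<in> F t"
  shows "s \<le> t"
proof (rule ccontr)
  assume "\<not> s \<le> t"
  have s: "t < s" "s < 1" using \<open>\<not> s \<le> t\<close> assms by (auto simp: flat_part_def)
  then have hs: "h s = L t Plus s" using assms touch_right_Plus[of t s] by (auto simp: flat_part_def)
  have "F t \<noteq> {t}" using assms(4) s by auto
  then have "d t Plus = d t Minus" by (rule regular[OF t])
  then have L_t: "L t Plus = L t Minus" by (auto simp: tangent_def fun_eq_iff)
  obtain q where q: "q \<in> Q" "t < q" "q < s" using Q_dense[of t s] t s by auto
  have q01: "0 < q" "q < 1" using Q_bounds q by auto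
  have "h q = L t Plus q"
    by (rule tangent_between[OF t(1) s(2) _ _ tangent_at[symmetric] hs t]) (use q in auto)
  note Minus = touch_deriv_Minus[OF t(1) q(2) q01(2) this]
  have "h t = L q Minus t" using Minus(2) by simp
  then have "t \<in> F q" using t by (auto simp: flat_part_def)
  then have nontriv: "F q \<noteq> {q}" using q by auto
  have "d q Plus = d q Minus" using regular[OF q01 nontriv] .
  then have "L q Plus = L q Minus" by (auto simp: tangent_def fun_eq_iff)
  then have "b q Plus = b t Plus" "b q Minus = b t Minus"
    using Minus(2) L_t q01 t by (auto intro!: same_tangent)
  then show False using regular_Q[OF q(1) nontriv] \<open>jump t\<close> by (auto simp: jump_def)
qed

end

section \<open>Transposition of the lattice\<close>

fun flip :: "side \<Rightarrow> side" where "flip Plus = Minus" | "flip Minus = Plus"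

lemma flip_flip [simp]: "flip (flip \<sigma>) = \<sigma>"
  by (cases \<sigma>) auto

lemma e_side_flip [simp]: "e_side (flip \<sigma>) = prod.swap (e_side \<sigma>)"
  by (cases \<sigma>) auto

lemma le_swap [simp]: "prod.swap x \<le> prod.swap y \<longleftrightarrow> x \<le> (y :: site)"
  by (auto simp: less_eq_prod_def)

lemma swap_diff: "prod.swap x - prod.swap y = prod.swap (x - (y :: site))"
  by (auto simp: prod_eq_iff)

lemma up_right_on_swap: "up_right_on I (\<lambda>k. prod.swap (\<pi> k)) \<longleftrightarrow> up_right_on I \<pi>"
proof -
  have "prod.swap z \<in> {e1, e2} \<longleftrightarrow> z \<in> {e1, e2}" for z :: site
    by (auto simp: e1_def e2_def prod_eq_iff)
  then show ?thesis by (simp add: up_right_on_def swap_diff)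
qed

lemma path_weight_swap: "path_weight (\<lambda>z. W (prod.swap z)) (\<lambda>k. prod.swap (\<pi> k)) k m = path_weight W \<pi> k m"
  by (simp add: path_weight_def)

lemma LPP_swap: "LPP (\<lambda>z. W (prod.swap z)) (prod.swap x) (prod.swap y) = LPP W x y"
proof -
  have "up_right_paths (prod.swap x) (prod.swap y) = (\<lambda>\<pi> k. prod.swap (\<pi> k)) ` up_right_paths x y"
  proof (intro set_eqI iffI)
    fix \<pi> assume "\<pi> \<in> up_right_paths (prod.swap x) (prod.swap y)"
    then have "(\<lambda>k. prod.swap (\<pi> k)) \<in> up_right_paths x y"
      by (auto simp: up_right_paths_def up_right_on_swap)
    then show "\<pi> \<in> (\<lambda>\<pi> k. prod.swap (\<pi> k)) ` up_right_paths x y"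
      by (intro image_eqI[where x = "\<lambda>k. prod.swap (\<pi> k)"]) simp_all
  qed (auto simp: up_right_paths_def up_right_on_swap)
  then show ?thesis by (simp add: LPP_def image_image path_weight_swap)
qed

lemma semi_infinite_geodesic_swap:
  "semi_infinite_geodesic W x \<pi> \<Longrightarrow>
    semi_infinite_geodesic (\<lambda>z. W (prod.swap z)) (prod.swap x) (\<lambda>k. prod.swap (\<pi> k))"
  by (simp add: semi_infinite_geodesic_def up_right_on_swap path_weight_swap LPP_swap)

lemma filterlim_reflect_left: "filterlim (\<lambda>s. 1 - s) (at_right (1 - t)) (at_left (t::real))"
  by (auto simp: filterlim_at eventually_at_left_field intro!: tendsto_eq_intros exI[of _ "t - 1"])

lemma filterlim_reflect_right: "filterlim (\<lambda>s. 1 - s) (at_left (1 - t)) (at_right (t::real))"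
  by (auto simp: filterlim_at eventually_at_right_field intro!: tendsto_eq_intros exI[of _ "t + 1"])

lemma busemann_step_swap:
  "busemann_step (\<lambda>x y. c (prod.swap x) (prod.swap y)) \<sigma> z
    = prod.swap (busemann_step c (flip \<sigma>) (prod.swap z))"
  by (cases \<sigma>) (auto simp: busemann_step_def)

lemma busemann_step_pow_swap:
  "(busemann_step (\<lambda>x y. c (prod.swap x) (prod.swap y)) \<sigma> ^^ n) z
    = prod.swap ((busemann_step c (flip \<sigma>) ^^ n) (prod.swap z))"
  by (induction n) (auto simp: busemann_step_swap)

lemma gam_swap:
  assumes "cocycle W c"
  shows "cocycle (\<lambda>z. W (prod.swap z)) (\<lambda>x y. c (prod.swap x) (prod.swap y))"
    "cocycle.gam (\<lambda>x y. c (prod.swap x) (prod.swap y)) \<sigma> x k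
      = prod.swap (cocycle.gam c (flip \<sigma>) (prod.swap x) k)"
proof -
  show *: "cocycle (\<lambda>z. W (prod.swap z)) (\<lambda>x y. c (prod.swap x) (prod.swap y))"
    using assms by (simp add: cocycle_def min.commute)
  show "cocycle.gam (\<lambda>x y. c (prod.swap x) (prod.swap y)) \<sigma> x k
      = prod.swap (cocycle.gam c (flip \<sigma>) (prod.swap x) k)"
    unfolding cocycle.gam_def[OF *] cocycle.gam_def[OF assms] by (simp add: busemann_step_pow_swap)
qed

lemma coalesce_swap: "coalesce (\<lambda>k. prod.swap (\<pi> k)) (\<lambda>k. prod.swap (\<pi>' k)) \<longleftrightarrow> coalesce \<pi> \<pi>'"
proof -
  have "prod.swap u = prod.swap v \<longleftrightarrow> u = v" for u v :: site by (auto simp: prod_eq_iff)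
  then show ?thesis by (simp add: coalesce_def)
qed

lemma generic_weights_swap:
  assumes "generic_weights W" shows "generic_weights (\<lambda>z. W (prod.swap z))"
  unfolding generic_weights_def
proof (intro allI impI)
  fix P Q :: "site multiset"
  assume "(\<Sum>x\<in>#P. W (prod.swap x)) = (\<Sum>x\<in>#Q. W (prod.swap x))"
  then have "(\<Sum>x\<in>#image_mset prod.swap P. W x) = (\<Sum>x\<in>#image_mset prod.swap Q. W x)"
    by (simp add: multiset.map_comp o_def)
  then have "image_mset prod.swap P = image_mset prod.swap Q"
    using assms by (simp add: generic_weights_def)
  then have "image_mset prod.swap (image_mset prod.swap P) = image_mset prod.swap (image_mset prod.swap Q)" by simp
  then show "P = Q" by (simp add: multiset.map_comp)
qed

lemma tangent_reflect:
  "tangent (\<lambda>t. h (1 - t)) (\<lambda>t \<sigma>. - d (1 - t) (flip \<sigma>)) t \<sigma> u = tangent h d (1 - t) (flip \<sigma>) (1 - u)"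
  by (simp add: tangent_def algebra_simps)

lemma flat_part_reflect:
  "s \<in> flat_part (\<lambda>t. h (1 - t)) (\<lambda>t \<sigma>. - d (1 - t) (flip \<sigma>)) t \<longleftrightarrow> 1 - s \<in> flat_part h d (1 - t)"
  unfolding flat_part_def tangent_reflect mem_Collect_eq by (auto intro: exI[of _ "flip _"] simp: tangent_def)

lemma limit_reflect:
  assumes \<pi>: "up_right_on {level x..} \<pi>" "\<pi> (level x) = x" and r: "strict_mono r"
    and lim: "(\<lambda>j. of_int (fst (\<pi> (int (r j)))) / real (r j)) \<longlonglongrightarrow> u"
  shows "(\<lambda>j. of_int (snd (\<pi> (int (r j)))) / real (r j)) \<longlonglongrightarrow> 1 - u"
proof (rule Lim_transform_eventually)
  show "(\<lambda>j. 1 - of_int (fst (\<pi> (int (r j)))) / real (r j)) \<longlonglongrightarrow> 1 - u"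
    by (intro tendsto_intros lim)
  from eventually_subseq_ge[OF r, of "level x"]
  show "eventually (\<lambda>j. 1 - of_int (fst (\<pi> (int (r j)))) / real (r j)
      = of_int (snd (\<pi> (int (r j)))) / real (r j)) sequentially"
  proof eventually_elim
    case (elim j)
    have "level (\<pi> (int (r j))) = int (r j)" using up_right_bounds(2)[OF \<pi>] elim by blast
    then have "(of_int (fst (\<pi> (int (r j)))) :: real) + of_int (snd (\<pi> (int (r j)))) = real (r j)"
      unfolding level_def by (metis of_int_add of_int_of_nat_eq)
    then show ?case using elim by (simp add: field_simps)
  qed
qed

context busemann_config begin

abbreviation "rW \<equiv> \<lambda>z. W (prod.swap z)"
abbreviation "rb \<equiv> \<lambda>t \<sigma> x y. b (1 - t) (flip \<sigma>) (prod.swap x) (prod.swap y)"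
abbreviation "rh \<equiv> \<lambda>t. h (1 - t)"
abbreviation "rd \<equiv> \<lambda>t \<sigma>. - d (1 - t) (flip \<sigma>)"

lemma flat_part_reflect_neq: "flat_part rh rd t \<noteq> {t} \<Longrightarrow> F (1 - t) \<noteq> {1 - t}"
proof
  assume neq: "flat_part rh rd t \<noteq> {t}" and eq: "F (1 - t) = {1 - t}"
  have "s \<in> flat_part rh rd t \<longleftrightarrow> s = t" for s
    unfolding flat_part_reflect eq by auto
  then show False using neq by blast
qed

lemma rgam:
  assumes "0 < t" "t < 1"
  shows "cocycle.gam (rb t \<sigma>) \<sigma> x = (\<lambda>k. prod.swap (bgeo (1 - t) (flip \<sigma>) (prod.swap x) k))"
  using gam_swap(2)[OF cocycle[of "1 - t" "flip \<sigma>"]] assms by (intro ext) simp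

text \<open>Transposition sends \<open>t\<close> to \<open>1 - t\<close> and exchanges
  \<open>e1\<close> with \<open>e2\<close> and \<open>Minus\<close> with \<open>Plus\<close>. The
  one-sided assumptions come in pairs that are interchanged, so each result for the right yields one
  for the left.\<close>

lemma reflect: "busemann_config rW rb ((-) 1 ` Q) rh rd"
proof (rule busemann_config.intro)
  show "cocycle rW (rb t \<sigma>)" if "0 < t" "t < 1" for t \<sigma>
    using that by (intro gam_swap(1) cocycle) auto
  show "rb t \<tau> x (x + e1) \<le> rb s \<sigma> x (x + e1)" if "0 < s" "s < t" "t < 1" for s t \<sigma> \<tau> x
    using mono2[of "1 - t" "1 - s" "flip \<tau>" "prod.swap x" "flip \<sigma>"] that by simp
  show "rb s \<sigma> x (x + e2) \<le> rb t \<tau> x (x + e2)" if "0 < s" "s < t" "t < 1" for s t \<sigma> \<tau> x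
    using mono1[of "1 - t" "1 - s" "flip \<sigma>" "prod.swap x" "flip \<tau>"] that by simp
  show "rb t Plus x (x + e1) \<le> rb t Minus x (x + e1)" if "0 < t" "t < 1" for t x
    using side2[of "1 - t" "prod.swap x"] that by simp
  show "rb t Minus x (x + e2) \<le> rb t Plus x (x + e2)" if "0 < t" "t < 1" for t x
    using side1[of "1 - t" "prod.swap x"] that by simp
  show "((\<lambda>s. rb s \<sigma> x y) \<longlongrightarrow> rb t Minus x y) (at_left t)" if "0 < t" "t < 1" for t \<sigma> x y
    using filterlim_compose[OF lim_right filterlim_reflect_left[of t]] that by simp
  show "((\<lambda>s. rb s \<sigma> x y) \<longlongrightarrow> rb t Plus x y) (at_right t)" if "0 < t" "t < 1" for t \<sigma> x y
    using filterlim_compose[OF lim_left filterlim_reflect_right[of t]] that by simp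
  show "generic_weights rW" by (rule generic_weights_swap[OF generic])
  show "(-) 1 ` Q \<subseteq> {0<..<1}" using Q_subset by auto
  show "\<exists>q\<in>(-) 1 ` Q. s < q \<and> q < t" if st: "0 \<le> s" "s < t" "t \<le> 1" for s t
  proof -
    obtain q where "q \<in> Q" "1 - t < q" "q < 1 - s" using Q_dense[of "1 - t" "1 - s"] st by auto
    then show ?thesis by (intro bexI[of _ "1 - q"]) auto
  qed
  show "rb q \<sigma> x (x + e1) \<noteq> rb q \<sigma> x (x + e2)" if "q \<in> (-) 1 ` Q" for q \<sigma> x
    using no_ties[of "1 - q" "flip \<sigma>" "prod.swap x"] that by auto
  show "coalesce (cocycle.gam (rb q \<sigma>) \<sigma> x) (cocycle.gam (rb q \<sigma>) \<sigma> y)" if q: "q \<in> (-) 1 ` Q" for q \<sigma> x y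
  proof -
    have "1 - q \<in> Q" using q by auto
    moreover have "0 < q" "q < 1" using q Q_bounds by auto
    ultimately show ?thesis by (simp add: rgam coalesce_swap coalesce_Q)
  qed
  show "\<exists>n0. \<forall>y. x \<le> y \<and> n0 \<le> level y - level x \<longrightarrow>
      \<bar>rb q \<sigma> x y - (of_int (fst y - fst x) * tangent rh rd q \<sigma> 1 + of_int (snd y - snd x) * tangent rh rd q \<sigma> 0)\<bar>
        \<le> \<epsilon> * of_int (level y - level x)" if q: "q \<in> (-) 1 ` Q" and "0 < \<epsilon>" for q \<epsilon> x \<sigma>
  proof -
    have "1 - q \<in> Q" using q by auto
    from asymp[OF this \<open>0 < \<epsilon>\<close>, where x = "prod.swap x" and \<sigma> = "flip \<sigma>"] obtain n0
      where n0: "\<forall>y. prod.swap x \<le> y \<and> n0 \<le> level y - level (prod.swap x) \<longrightarrow>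
      \<bar>b (1 - q) (flip \<sigma>) (prod.swap x) y - (of_int (fst y - fst (prod.swap x)) * L (1 - q) (flip \<sigma>) 1
        + of_int (snd y - snd (prod.swap x)) * L (1 - q) (flip \<sigma>) 0)\<bar>
        \<le> \<epsilon> * of_int (level y - level (prod.swap x))" by (rule exE)
    show ?thesis
    proof (intro exI[of _ n0] allI impI)
      fix y assume "x \<le> y \<and> n0 \<le> level y - level x"
      then show "\<bar>rb q \<sigma> x y - (of_int (fst y - fst x) * tangent rh rd q \<sigma> 1 + of_int (snd y - snd x) * tangent rh rd q \<sigma> 0)\<bar>
        \<le> \<epsilon> * of_int (level y - level x)"
        using n0[rule_format, of "prod.swap y"] unfolding tangent_reflect by (simp add: add.commute)
    qed
  qed
  show "rh s \<le> tangent rh rd t \<sigma> s" if "0 < s" "s < 1" "0 < t" "t < 1" for s t \<sigma>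
    unfolding tangent_reflect using that by (intro below_tangent) auto
  show "((\<lambda>s. (rh s - rh t) / (s - t)) \<longlongrightarrow> rd t Plus) (at_right t)" if "0 < t" "t < 1" for t
  proof -
    have "((\<lambda>s. - ((h (1 - s) - h (1 - t)) / ((1 - s) - (1 - t)))) \<longlongrightarrow> - d (1 - t) Minus) (at_right t)"
      using that by (intro tendsto_minus filterlim_compose[OF deriv_left filterlim_reflect_right]) auto
    moreover have "- ((h (1 - s) - h (1 - t)) / ((1 - s) - (1 - t))) = (rh s - rh t) / (s - t)" for s
    proof -
      have "(1 - s) - (1 - t) = - (s - t)" by simp
      then show ?thesis by (simp only: divide_minus_right minus_minus)
    qed
    ultimately show ?thesis by simp
  qed
  show "((\<lambda>s. (rh s - rh t) / (s - t)) \<longlongrightarrow> rd t Minus) (at_left t)" if "0 < t" "t < 1" for t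
  proof -
    have "((\<lambda>s. - ((h (1 - s) - h (1 - t)) / ((1 - s) - (1 - t)))) \<longlongrightarrow> - d (1 - t) Plus) (at_left t)"
      using that by (intro tendsto_minus filterlim_compose[OF deriv_right filterlim_reflect_left]) auto
    moreover have "- ((h (1 - s) - h (1 - t)) / ((1 - s) - (1 - t))) = (rh s - rh t) / (s - t)" for s
    proof -
      have "(1 - s) - (1 - t) = - (s - t)" by simp
      then show ?thesis by (simp only: divide_minus_right minus_minus)
    qed
    ultimately show ?thesis by simp
  qed
  show "\<exists>q\<in>(-) 1 ` Q. t < q \<and> tangent rh rd t \<sigma> 0 < tangent rh rd q \<tau> 0" if "0 < t" "t < 1" for t \<sigma> \<tau>
  proof -
    obtain q where "q \<in> Q" "q < 1 - t" "L (1 - t) (flip \<sigma>) 1 < L q (flip \<tau>) 1"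
      using steep_left[of "1 - t" "flip \<sigma>" "flip \<tau>"] \<open>0 < t\<close> \<open>t < 1\<close> by auto
    then show ?thesis unfolding tangent_reflect by (intro bexI[of _ "1 - q"]) auto
  qed
  show "\<exists>q\<in>(-) 1 ` Q. q < t \<and> tangent rh rd t \<sigma> 1 < tangent rh rd q \<tau> 1" if "0 < t" "t < 1" for t \<sigma> \<tau>
  proof -
    obtain q where "q \<in> Q" "1 - t < q" "L (1 - t) (flip \<sigma>) 0 < L q (flip \<tau>) 0"
      using steep_right[of "1 - t" "flip \<sigma>" "flip \<tau>"] \<open>0 < t\<close> \<open>t < 1\<close> by auto
    then show ?thesis unfolding tangent_reflect by (intro bexI[of _ "1 - q"]) auto
  qed
  show "rb s \<sigma> = rb t \<sigma>" if st: "0 < s" "s < 1" "0 < t" "t < 1" "tangent rh rd s \<sigma> = tangent rh rd t \<sigma>" for s t \<sigma>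
  proof -
    have "L (1 - s) (flip \<sigma>) u = L (1 - t) (flip \<sigma>) u" for u
      using fun_cong[OF st(5), of "1 - u"] unfolding tangent_reflect by simp
    then have "b (1 - s) (flip \<sigma>) = b (1 - t) (flip \<sigma>)"
      using st by (intro same_tangent ext) auto
    then show ?thesis by simp
  qed
  show "rd t Plus = rd t Minus" if "0 < t" "t < 1" "flat_part rh rd t \<noteq> {t}" for t
    using regular[of "1 - t"] flat_part_reflect_neq[OF that(3)] that by simp
  show "rb q Plus = rb q Minus" if "q \<in> (-) 1 ` Q" "flat_part rh rd q \<noteq> {q}" for q
    using regular_Q[of "1 - q"] flat_part_reflect_neq[OF that(2)] that by auto
  show "\<exists>s<t. \<exists>c. \<forall>u \<sigma>. s < u \<and> u < t \<longrightarrow> rb u \<sigma> x y = c" if t: "0 < t" "t < 1" for t x y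
  proof -
    obtain s c where "s > 1 - t" "\<forall>u \<sigma>. 1 - t < u \<and> u < s \<longrightarrow> b u \<sigma> (prod.swap x) (prod.swap y) = c"
      using locally_const(2)[of "1 - t" "prod.swap x" "prod.swap y"] t by auto
    then show ?thesis by (intro exI[of _ "1 - s"] conjI exI[of _ c]) auto
  qed
  show "\<exists>s>t. \<exists>c. \<forall>u \<sigma>. t < u \<and> u < s \<longrightarrow> rb u \<sigma> x y = c" if t: "0 < t" "t < 1" for t x y
  proof -
    obtain s c where "s < 1 - t" "\<forall>u \<sigma>. s < u \<and> u < 1 - t \<longrightarrow> b u \<sigma> (prod.swap x) (prod.swap y) = c"
      using locally_const(1)[of "1 - t" "prod.swap x" "prod.swap y"] t by auto
    then show ?thesis by (intro exI[of _ "1 - s"] conjI exI[of _ c]) auto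
  qed
  \<comment> \<open>The assumption \<open>crosses\<close> speaks of \<open>Plus\<close>, whereas the
    transposed one asks for \<open>Minus\<close>. Moving further towards the end direction,
    monotonicity gives both.\<close>
  have cross: "\<exists>s. 0 < s \<and> s < 1 \<and> delta s \<sigma> z < 0" "\<exists>s. 0 < s \<and> s < 1 \<and> 0 < delta s \<sigma> z" for \<sigma> z
  proof -
    obtain s where s: "0 < s" "s < 1" "delta s Plus z < 0" using crosses(1)[of z] by (auto simp: delta_def)
    then have "delta (s / 2) \<sigma> z \<le> delta s Plus z" by (intro delta_mono) auto
    then show "\<exists>s. 0 < s \<and> s < 1 \<and> delta s \<sigma> z < 0" using s by (intro exI[of _ "s / 2"]) auto
    obtain s where s: "0 < s" "s < 1" "0 < delta s Plus z" using crosses(2)[of z] by (auto simp: delta_def)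
    then have "delta s Plus z \<le> delta ((s + 1) / 2) \<sigma> z" by (intro delta_mono) auto
    then show "\<exists>s. 0 < s \<and> s < 1 \<and> 0 < delta s \<sigma> z" using s by (intro exI[of _ "(s + 1) / 2"]) auto
  qed
  show "\<exists>s. 0 < s \<and> s < 1 \<and> rb s Plus z (z + e2) < rb s Plus z (z + e1)" for z
  proof -
    obtain s where "0 < s" "s < 1" "0 < delta s Minus (prod.swap z)" using cross(2) by blast
    then show ?thesis by (intro exI[of _ "1 - s"]) (auto simp: delta_def)
  qed
  show "\<exists>s. 0 < s \<and> s < 1 \<and> rb s Plus z (z + e1) < rb s Plus z (z + e2)" for z
  proof -
    obtain s where "0 < s" "s < 1" "delta s Minus (prod.swap z) < 0" using cross(1) by blast
    then show ?thesis by (intro exI[of _ "1 - s"]) (auto simp: delta_def)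
  qed
qed

lemma coalesce_path:
  assumes "0 < t" "t < 1"
  shows "coalesce (bgeo t \<sigma> x) (bgeo t \<sigma> y)"
proof (cases \<sigma>)
  case Minus
  interpret R: busemann_config rW rb "(-) 1 ` Q" rh rd by (rule reflect)
  have "coalesce (cocycle.gam (rb (1 - t) Plus) Plus (prod.swap x)) (cocycle.gam (rb (1 - t) Plus) Plus (prod.swap y))"
    using assms by (intro R.coalesce_Plus) auto
  then show ?thesis using rgam[of "1 - t" Plus] assms Minus by (simp add: coalesce_swap)
qed (use coalesce_Plus assms in auto)

lemma limit_in_flat_part:
  assumes t: "0 < t" "t < 1" and "limit_pt (bgeo t \<sigma> x) u"
  shows "u \<in> F t"
proof -
  obtain r where r: "strict_mono r" "(\<lambda>j. of_int (fst (bgeo t \<sigma> x (int (r j)))) / real (r j)) \<longlonglongrightarrow> u"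
    using assms by (auto simp: limit_pt_def)
  consider "t < u" | "u = t" | "u < t" by linarith
  then show ?thesis
  proof cases
    case 1
    show ?thesis using limit_right[OF t r(1) 1 r(2)] 1 t unfolding flat_part_def by auto
  next
    case 2
    then show ?thesis using t by (auto simp: flat_part_def)
  next
    case 3
    interpret R: busemann_config rW rb "(-) 1 ` Q" rh rd by (rule reflect)
    have t': "0 < 1 - t" "1 - t < 1" using t by auto
    have geo: "cocycle.gam (rb (1 - t) (flip \<sigma>)) (flip \<sigma>) (prod.swap x) = (\<lambda>k. prod.swap (bgeo t \<sigma> x k))"
      using rgam[OF t', of "flip \<sigma>" "prod.swap x"] by simp
    have "(\<lambda>j. of_int (snd (bgeo t \<sigma> x (int (r j)))) / real (r j)) \<longlonglongrightarrow> 1 - u"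
      by (rule limit_reflect[OF up_right_bgeo[OF t] r])
    then have lim: "(\<lambda>j. of_int (fst (cocycle.gam (rb (1 - t) (flip \<sigma>)) (flip \<sigma>) (prod.swap x) (int (r j)))) / real (r j))
        \<longlonglongrightarrow> 1 - u"
      unfolding geo by simp
    have "1 - u < 1" "rh (1 - u) = tangent rh rd (1 - t) Plus (1 - u)"
      using R.limit_right[OF t' r(1) _ lim] 3 by auto
    then have "0 < u" "h u = L t Minus u" unfolding tangent_reflect by auto
    then show ?thesis using 3 t unfolding flat_part_def by auto
  qed
qed

text \<open>The transposed form of \<open>geodesic_le_Plus\<close>; an upper bound for second
  coordinates is a lower bound for first ones on the same level.\<close>

lemma geodesic_ge_Minus:
  assumes t: "0 < t" "t < 1"
    and geo: "semi_infinite_geodesic W x \<pi>" and dir: "\<And>u. limit_pt \<pi> u \<Longrightarrow> u \<in> F t"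
    and k: "level x \<le> k"
  shows "fst (bgeo t Minus x k) \<le> fst (\<pi> k)"
proof -
  interpret R: busemann_config rW rb "(-) 1 ` Q" rh rd by (rule reflect)
  have t': "0 < 1 - t" "1 - t < 1" using t by auto
  have \<pi>: "up_right_on {level x..} \<pi>" "\<pi> (level x) = x" using geo by (auto simp: semi_infinite_geodesic_def)
  have \<pi>': "up_right_on {level (prod.swap x)..} (\<lambda>k. prod.swap (\<pi> k))"
    "prod.swap (\<pi> (level (prod.swap x))) = prod.swap x"
    using \<pi> by (simp_all add: up_right_on_swap)
  have dir': "u \<in> flat_part rh rd (1 - t)" if "limit_pt (\<lambda>k. prod.swap (\<pi> k)) u" for u
  proof -
    obtain r where r: "strict_mono r" "(\<lambda>j. of_int (fst (prod.swap (\<pi> (int (r j))))) / real (r j)) \<longlonglongrightarrow> u"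
      using \<open>limit_pt _ u\<close> by (auto simp: limit_pt_def)
    have "limit_pt \<pi> (1 - u)"
      using limit_reflect[OF \<pi>' r] r(1) by (auto simp: limit_pt_def)
    then show ?thesis using dir by (simp add: flat_part_reflect)
  qed
  have "fst (prod.swap (\<pi> k)) \<le> fst (cocycle.gam (rb (1 - t) Plus) Plus (prod.swap x) k)"
    using k by (intro R.geodesic_le_Plus[OF t' semi_infinite_geodesic_swap[OF geo] dir']) auto
  then have "snd (\<pi> k) \<le> snd (bgeo t Minus x k)" using rgam[OF t', of Plus "prod.swap x"] by simp
  moreover have "level (\<pi> k) = k" "level (bgeo t Minus x k) = k"
    using up_right_bounds(2)[OF \<pi> k] up_right_bounds(2)[OF up_right_bgeo[OF t] k] by auto
  ultimately show ?thesis by (simp add: level_def)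
qed

lemma jump_flat_part:
  assumes t: "0 < t" "t < 1" and "jump t"
  shows "F t = {t}"
proof -
  interpret R: busemann_config rW rb "(-) 1 ` Q" rh rd by (rule reflect)
  have "R.jump (1 - t)"
  proof -
    obtain x y where "b t Minus x y \<noteq> b t Plus x y" using assms by (auto simp: jump_def)
    then show ?thesis unfolding R.jump_def
      by (intro exI[of _ "prod.swap x"] exI[of _ "prod.swap y"]) auto
  qed
  have "s = t" if "s \<in> F t" for s
  proof -
    have "1 - s \<in> flat_part rh rd (1 - t)" using that by (simp add: flat_part_reflect)
    then have "1 - s \<le> 1 - t" using R.jump_flat_right[OF _ _ \<open>R.jump (1 - t)\<close>] t by simp
    moreover have "s \<le> t" using jump_flat_right[OF t \<open>jump t\<close> that] .
    ultimately show ?thesis by simp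
  qed
  moreover have "t \<in> F t" using t by (auto simp: flat_part_def)
  ultimately show ?thesis by blast
qed

section \<open>Competition interface directions\<close>

definition crossing :: "site \<Rightarrow> real \<Rightarrow> bool" where
  "crossing z t \<longleftrightarrow> 0 < t \<and> t < 1 \<and>
    (\<forall>s \<sigma>. 0 < s \<and> s < 1 \<longrightarrow> (s < t \<longrightarrow> delta s \<sigma> z < 0) \<and> (t < s \<longrightarrow> 0 < delta s \<sigma> z))"

lemma crossing_unique:
  assumes "crossing z s" "crossing z t" shows "s = t"
proof -
  have *: "\<not> s < t" if "crossing z s" "crossing z t" for s t
  proof
    assume "s < t"
    then have "0 < delta ((s + t) / 2) Plus z" "delta ((s + t) / 2) Plus z < 0"
      using that unfolding crossing_def by (auto dest!: spec[of _ "(s + t) / 2"])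
    then show False by simp
  qed
  show ?thesis using *[OF assms] *[OF assms(2,1)] by linarith
qed

text \<open>The crossing is the supremum of the directions with nonpositive \<open>delta\<close>;
  both signs occur, by \<open>crosses\<close>. To the left of it strictness comes from the
  impossibility of ties in two directions.\<close>

lemma crossing_ex: "\<exists>t. crossing z t"
proof -
  define S where "S = {s. 0 < s \<and> s < 1 \<and> delta s Plus z \<le> 0}"
  obtain s0 where s0: "0 < s0" "s0 < 1" "delta s0 Plus z < 0" using crosses(1)[of z] by (auto simp: delta_def)
  obtain s1 where s1: "0 < s1" "s1 < 1" "0 < delta s1 Plus z" using crosses(2)[of z] by (auto simp: delta_def)
  have "s0 \<in> S" using s0 by (simp add: S_def)
  have S_le: "s \<le> s1" if "s \<in> S" for s
  proof (rule ccontr)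
    assume "\<not> s \<le> s1"
    then show False using delta_mono[of s1 s Plus z Plus] that s1 by (auto simp: S_def)
  qed
  then have bdd: "bdd_above S" by (auto simp: bdd_above_def)
  define t where "t = Sup S"
  have t: "0 < t" "t < 1"
  proof -
    have "s0 \<le> t" unfolding t_def by (rule cSup_upper[OF \<open>s0 \<in> S\<close> bdd])
    then show "0 < t" using s0 by simp
    have "t \<le> s1" unfolding t_def using \<open>s0 \<in> S\<close> S_le by (intro cSup_least) auto
    then show "t < 1" using s1 by simp
  qed
  have "delta s \<sigma> z < 0" if s: "0 < s" "s < t" for s \<sigma>
  proof -
    obtain s' where s': "s' \<in> S" "s < s'"
      using less_cSup_iff[OF _ bdd, of s] \<open>s0 \<in> S\<close> s by (auto simp: t_def)
    have *: "s' < 1" "delta s' Plus z \<le> 0" using s'(1) by (auto simp: S_def)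
    then have "delta s \<sigma> z \<le> delta s' Plus z" using s s' by (intro delta_mono)
    then show ?thesis using delta_zero_less[OF s(1) s'(2) *(1), of \<sigma> z Plus] * by linarith
  qed
  moreover have "0 < delta s \<sigma> z" if s: "t < s" "s < 1" for s \<sigma>
  proof -
    define s' where "s' = (t + s) / 2"
    have s': "t < s'" "s' < s" using s by (auto simp: s'_def)
    then have "s' \<notin> S" using cSup_upper[OF _ bdd, of s'] by (auto simp: t_def)
    then have "0 < delta s' Plus z" using s' s t by (auto simp: S_def)
    also have "\<dots> \<le> delta s \<sigma> z" using s' s t by (intro delta_mono) auto
    finally show ?thesis .
  qed
  ultimately show ?thesis using t unfolding crossing_def by blast
qed

lemma crossing_iff:
  assumes t: "0 < t" "t < 1"
  shows "crossing z t \<longleftrightarrow> delta t Minus z \<le> 0 \<and> 0 \<le> delta t Plus z"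
proof
  assume c: "crossing z t"
  have left: "((\<lambda>s. delta s Plus z) \<longlongrightarrow> delta t Minus z) (at_left t)"
    unfolding delta_def by (intro tendsto_diff lim_left t)
  have right: "((\<lambda>s. delta s Plus z) \<longlongrightarrow> delta t Plus z) (at_right t)"
    unfolding delta_def by (intro tendsto_diff lim_right t)
  have "delta t Minus z \<le> 0"
  proof (rule tendsto_upperbound[OF left])
    show "eventually (\<lambda>s. delta s Plus z \<le> 0) (at_left t)"
      unfolding eventually_at_left_field using c t
      by (intro exI[of _ 0]) (auto simp: crossing_def intro: less_imp_le)
  qed simp
  moreover have "0 \<le> delta t Plus z"
  proof (rule tendsto_lowerbound[OF right])
    show "eventually (\<lambda>s. 0 \<le> delta s Plus z) (at_right t)"
      unfolding eventually_at_right_field using c t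
      by (intro exI[of _ 1]) (auto simp: crossing_def intro: less_imp_le)
  qed simp
  ultimately show "delta t Minus z \<le> 0 \<and> 0 \<le> delta t Plus z" by simp
next
  assume *: "delta t Minus z \<le> 0 \<and> 0 \<le> delta t Plus z"
  have "delta s \<sigma> z < 0" if s: "0 < s" "s < t" for s \<sigma>
  proof -
    obtain q where q: "q \<in> Q" "s < q" "q < t" using Q_dense[of s t] s t by auto
    have "delta s \<sigma> z \<le> delta q Plus z" "delta q Plus z \<le> delta t Minus z"
      using q s t by (auto intro!: delta_mono)
    then show ?thesis using * delta_Q[OF q(1), of Plus z] by linarith
  qed
  moreover have "0 < delta s \<sigma> z" if s: "t < s" "s < 1" for s \<sigma>
  proof -
    obtain q where q: "q \<in> Q" "t < q" "q < s" using Q_dense[of t s] s t by auto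
    have "delta q Plus z \<le> delta s \<sigma> z" "delta t Plus z \<le> delta q Plus z"
      using q s t by (auto intro!: delta_mono)
    then show ?thesis using * delta_Q[OF q(1), of Plus z] by linarith
  qed
  ultimately show "crossing z t" using t unfolding crossing_def by blast
qed

lemma not_crossing_step:
  assumes "0 < t" "t < 1" "\<not> crossing z t" shows "step t Minus z = step t Plus z"
  using assms delta_side[of t z] by (auto simp: crossing_iff step_delta)

lemma bgeo_eq_if_no_crossing:
  assumes t: "0 < t" "t < 1" and no: "\<And>z. \<not> crossing z t"
  shows "bgeo t Minus = bgeo t Plus"
proof -
  have eq: "step t Minus = step t Plus" using not_crossing_step[OF t no] by (rule ext)
  show ?thesis
    by (intro ext) (simp only: cocycle.gam_def[OF cocycle[OF t]] eq)
qed

text \<open>Without a crossing the two geodesics from every site are equal, and \<open>b\<close> is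
  a difference of weights along them. A crossing without a jump would be a tie on both sides, which
  local constancy carries over to a rational direction.\<close>

theorem jump_iff_crossing:
  assumes t: "0 < t" "t < 1"
  shows "jump t \<longleftrightarrow> (\<exists>z. crossing z t)"
proof
  assume "jump t"
  show "\<exists>z. crossing z t"
  proof (rule ccontr)
    assume "\<nexists>z. crossing z t"
    then have eq: "bgeo t Minus = bgeo t Plus" using bgeo_eq_if_no_crossing[OF t] by blast
    have "b t Minus x y = b t Plus x y" for x y
    proof -
      interpret P: cocycle W "b t Plus" using t cocycle by auto
      interpret N: cocycle W "b t Minus" using t cocycle by auto
      obtain k where k: "level x \<le> k" "level y \<le> k" "bgeo t Plus x k = bgeo t Plus y k"
        using coalesce_path[OF t, of Plus x y] P.coalesce_iff by blast
      then show ?thesis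
        using P.coalesce_b[OF k] N.coalesce_b[of x k y Minus] eq by simp
    qed
    then show False using \<open>jump t\<close> by (auto simp: jump_def)
  qed
next
  assume "\<exists>z. crossing z t"
  then obtain z where c: "crossing z t" by blast
  show "jump t"
  proof (rule ccontr)
    assume "\<not> jump t"
    then have "b t Minus x y = b t Plus x y" for x y unfolding jump_def by blast
    then have "delta t Minus z = delta t Plus z" by (simp only: delta_def)
    then have 0: "delta t Plus z = 0" using c crossing_iff[OF t] by auto
    obtain s c1 where s: "s > t" "\<And>u \<sigma>. t < u \<Longrightarrow> u < s \<Longrightarrow> b u \<sigma> (z + e1) (z + e2) = c1"
      using locally_const(2)[OF t, of "z + e1" "z + e2"] by blast
    have delta: "delta u \<sigma> z = b u \<sigma> (z + e1) (z + e2)" if "0 < u" "u < 1" for u \<sigma>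
    proof -
      interpret U: cocycle W "b u \<sigma>" using that cocycle by auto
      show ?thesis using U.add[of z "z + e1" "z + e2"] by (simp add: delta_def)
    qed
    have "((\<lambda>u. b u Plus (z + e1) (z + e2)) \<longlongrightarrow> c1) (at_right t)"
    proof (rule Lim_transform_eventually[OF tendsto_const])
      show "eventually (\<lambda>u. c1 = b u Plus (z + e1) (z + e2)) (at_right t)"
        unfolding eventually_at_right_field using s by (intro exI[of _ s]) auto
    qed
    then have "c1 = 0"
      using tendsto_unique[OF _ lim_right[OF t, of Plus "z + e1" "z + e2"]] delta[OF t, of Plus] 0 by auto
    obtain q where q: "q \<in> Q" "t < q" "q < min s 1" using Q_dense[of t "min s 1"] s t by auto
    then have "delta q Plus z = 0" using s(2)[of q Plus] delta[of q Plus] Q_bounds[OF q(1)] \<open>c1 = 0\<close> by simp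
    then show False using delta_Q[OF q(1)] by blast
  qed
qed

theorem unique_geodesic:
  assumes t: "0 < t" "t < 1" and "\<not> jump t"
    and geo: "semi_infinite_geodesic W x \<pi>" and dir: "\<And>u. limit_pt \<pi> u \<Longrightarrow> u \<in> F t"
    and k: "level x \<le> k"
  shows "\<pi> k = bgeo t Plus x k"
proof -
  have \<pi>: "up_right_on {level x..} \<pi>" "\<pi> (level x) = x" using geo by (auto simp: semi_infinite_geodesic_def)
  have "bgeo t Minus = bgeo t Plus"
    using bgeo_eq_if_no_crossing[OF t] jump_iff_crossing[OF t] \<open>\<not> jump t\<close> by blast
  then have "fst (\<pi> k) = fst (bgeo t Plus x k)"
    using geodesic_le_Plus[OF t geo dir k] geodesic_ge_Minus[OF t geo dir k] by simp
  then show ?thesis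
    using up_right_bounds(2)[OF \<pi> k] up_right_bounds(2)[OF up_right_bgeo[OF t] k] by (intro site_eqI) auto
qed

text \<open>From a crossing site the two paths part at the first step and never meet again, by
  uniqueness of geodesics. The paths from any other site eventually follow these two.\<close>

theorem separate:
  assumes t: "0 < t" "t < 1" and "jump t"
  shows "separate_eventually (bgeo t Minus x) (bgeo t Plus x)"
proof -
  interpret P: cocycle W "b t Plus" using t cocycle by auto
  interpret N: cocycle W "b t Minus" using t cocycle by auto
  obtain z where z: "delta t Minus z \<le> 0" "0 \<le> delta t Plus z"
    using jump_iff_crossing[OF t] \<open>jump t\<close> crossing_iff[OF t] by blast
  then have first: "bgeo t Minus z (level z + 1) = z + e2" "bgeo t Plus z (level z + 1) = z + e1"
    by (auto simp: N.gam_Suc P.gam_Suc step_delta)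
  have apart: "bgeo t Minus z n \<noteq> bgeo t Plus z n" if n: "level z + 1 \<le> n" for n
  proof
    assume eq: "bgeo t Minus z n = bgeo t Plus z n"
    have start: "bgeo t Minus z (level z) = bgeo t Plus z (level z)" by simp
    have "bgeo t Minus z (level z + 1) = bgeo t Plus z (level z + 1)"
    proof (rule geodesic_unique[OF generic, where k = "level z" and m = n])
      show "up_right_on {level z..n} (bgeo t Minus z)" by (rule up_right_on_subset[OF N.up_right_gam]) simp
      show "up_right_on {level z..n} (bgeo t Plus z)" by (rule up_right_on_subset[OF P.up_right_gam]) simp
      show "path_weight W (bgeo t Minus z) (level z) n = LPP W (bgeo t Minus z (level z)) (bgeo t Minus z n)"
        by (rule N.gam_geodesic) (use n in auto)
      show "path_weight W (bgeo t Plus z) (level z) n = LPP W (bgeo t Minus z (level z)) (bgeo t Minus z n)"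
        unfolding start eq by (rule P.gam_geodesic) (use n in auto)
    qed (use n start eq in auto)
    then show False using first by simp
  qed
  obtain k1 where k1: "\<forall>n\<ge>k1. bgeo t Minus x n = bgeo t Minus z n"
    using coalesce_path[OF t] unfolding coalesce_def by blast
  obtain k2 where k2: "\<forall>n\<ge>k2. bgeo t Plus x n = bgeo t Plus z n"
    using coalesce_path[OF t] unfolding coalesce_def by blast
  show ?thesis
    unfolding separate_eventually_def
    using k1 k2 apart by (intro exI[of _ "max (level z + 1) (max k1 k2)"]) auto
qed

end

section \<open>Directedness in terms of first coordinates\<close>

lemma directed_into_iff:
  assumes \<pi>: "up_right_on {level x..} \<pi>" "\<pi> (level x) = x"
  shows "directed_into \<pi> ((\<lambda>u. (u, 1 - u)) ` A) \<longleftrightarrow> (\<forall>u. limit_pt \<pi> u \<longrightarrow> u \<in> A)"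
proof -
  have eq: "real_site (\<pi> (int n)) /\<^sub>R real n = (of_int (fst (\<pi> (int n))) / real n, of_int (snd (\<pi> (int n))) / real n)" for n
    by (simp add: real_site_def scaleR_prod_def divide_inverse mult.commute)
  have lim: "(\<lambda>n. real_site (\<pi> (int (r n))) /\<^sub>R real (r n)) \<longlonglongrightarrow> l \<longleftrightarrow>
    (\<lambda>j. of_int (fst (\<pi> (int (r j)))) / real (r j)) \<longlonglongrightarrow> fst l \<and> snd l = 1 - fst l"
    if r: "strict_mono r" for r l
  proof
    assume *: "(\<lambda>n. real_site (\<pi> (int (r n))) /\<^sub>R real (r n)) \<longlonglongrightarrow> l"
    have 1: "(\<lambda>j. of_int (fst (\<pi> (int (r j)))) / real (r j)) \<longlonglongrightarrow> fst l"
      and 2: "(\<lambda>j. of_int (snd (\<pi> (int (r j)))) / real (r j)) \<longlonglongrightarrow> snd l"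
      using tendsto_fst[OF *] tendsto_snd[OF *] by (simp_all add: eq)
    have "snd l = 1 - fst l"
      using LIMSEQ_unique[OF 2 limit_reflect[OF \<pi> r 1]] .
    then show "(\<lambda>j. of_int (fst (\<pi> (int (r j)))) / real (r j)) \<longlonglongrightarrow> fst l \<and> snd l = 1 - fst l"
      using 1 by simp
  next
    assume *: "(\<lambda>j. of_int (fst (\<pi> (int (r j)))) / real (r j)) \<longlonglongrightarrow> fst l \<and> snd l = 1 - fst l"
    then have "(\<lambda>j. (of_int (fst (\<pi> (int (r j)))) / real (r j), of_int (snd (\<pi> (int (r j)))) / real (r j)))
        \<longlonglongrightarrow> (fst l, 1 - fst l)"
      by (intro tendsto_Pair limit_reflect[OF \<pi> r]) auto
    then show "(\<lambda>n. real_site (\<pi> (int (r n))) /\<^sub>R real (r n)) \<longlonglongrightarrow> l"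
      using * unfolding eq by (metis prod.collapse)
  qed
  show ?thesis
  proof
    assume *: "directed_into \<pi> ((\<lambda>u. (u, 1 - u)) ` A)"
    show "\<forall>u. limit_pt \<pi> u \<longrightarrow> u \<in> A"
    proof (intro allI impI)
      fix u assume "limit_pt \<pi> u"
      then obtain r where r: "strict_mono r" "(\<lambda>j. of_int (fst (\<pi> (int (r j)))) / real (r j)) \<longlonglongrightarrow> u"
        by (auto simp: limit_pt_def)
      then have "(\<lambda>n. real_site (\<pi> (int (r n))) /\<^sub>R real (r n)) \<longlonglongrightarrow> (u, 1 - u)" using lim[of r "(u, 1 - u)"] by simp
      then have "(u, 1 - u) \<in> (\<lambda>u. (u, 1 - u)) ` A" using * r(1) unfolding directed_into_def by blast
      then show "u \<in> A" by auto
    qed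
  next
    assume *: "\<forall>u. limit_pt \<pi> u \<longrightarrow> u \<in> A"
    show "directed_into \<pi> ((\<lambda>u. (u, 1 - u)) ` A)"
      unfolding directed_into_def
    proof (intro allI impI, elim conjE)
      fix r l assume r: "strict_mono (r :: nat \<Rightarrow> nat)" "(\<lambda>n. real_site (\<pi> (int (r n))) /\<^sub>R real (r n)) \<longlonglongrightarrow> l"
      have "limit_pt \<pi> (fst l)" "snd l = 1 - fst l" using lim[OF r(1)] r by (auto simp: limit_pt_def)
      then show "l \<in> (\<lambda>u. (u, 1 - u)) ` A" using * by (intro image_eqI[of _ _ "fst l"]) (auto simp: prod_eq_iff)
    qed
  qed
qed

text \<open>If the ratios stayed away from \<open>t\<close> along a subsequence, compactness would
  produce another limit point.\<close>

lemma directed_toI: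
  assumes \<pi>: "up_right_on {level x..} \<pi>" "\<pi> (level x) = x" and "\<And>u. limit_pt \<pi> u \<Longrightarrow> u = t"
  shows "directed_to \<pi> (t, 1 - t)"
proof -
  let ?f = "\<lambda>n. of_int (fst (\<pi> (int n))) / real n"
  have lim: "?f \<longlonglongrightarrow> t"
  proof (rule ccontr)
    assume "\<not> ?f \<longlonglongrightarrow> t"
    then obtain \<epsilon> where \<epsilon>: "\<epsilon> > 0" "\<And>N. \<exists>n\<ge>N. \<epsilon> \<le> dist (?f n) t"
      unfolding lim_sequentially by (meson not_le)
    then have "infinite {n. \<epsilon> \<le> dist (?f n) t}" unfolding infinite_nat_iff_unbounded_le by auto
    from infinite_enumerate[OF this] obtain r :: "nat \<Rightarrow> nat"
      where r: "strict_mono r" "\<And>j. r j \<in> {n. \<epsilon> \<le> dist (?f n) t}" by blast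
    obtain r' u where r': "strict_mono r'" "(\<lambda>j. ?f (r (r' j))) \<longlonglongrightarrow> u"
      using ratio_subseq[OF \<pi> r(1)] by blast
    have "strict_mono (\<lambda>j. r (r' j))" using r(1) r'(1) by (simp add: strict_mono_def)
    then have "u = t" using r' assms(3)[of u] by (auto simp: limit_pt_def)
    then have "eventually (\<lambda>j. dist (?f (r (r' j))) t < \<epsilon>) sequentially"
      using r'(2) \<epsilon>(1) by (auto dest: tendstoD)
    then obtain j where "dist (?f (r (r' j))) t < \<epsilon>" by (auto simp: eventually_sequentially)
    then show False using r(2)[of "r' j"] by simp
  qed
  have "(\<lambda>n. of_int (snd (\<pi> (int n))) / real n) \<longlonglongrightarrow> 1 - t"
    using limit_reflect[OF \<pi> strict_mono_id] lim by (simp add: id_def)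
  from tendsto_Pair[OF lim this] show ?thesis
    unfolding directed_to_def
    by (simp add: real_site_def scaleR_prod_def divide_inverse mult.commute)
qed

section \<open>Supports of Busemann measures\<close>

definition dir :: "real \<Rightarrow> vec" where "dir t = (t, 1 - t)"

lemma fst_dir [simp]: "fst (dir t) = t"
  by (simp add: dir_def)

lemma dir_inject [simp]: "dir s = dir t \<longleftrightarrow> s = t"
  by (auto simp: dir_def)

lemma dirs_eq: "dirs = dir ` {0..1}"
  by (auto simp: dirs_def dir_def e1_def e2_def image_iff)

lemma ri_dirs_eq: "ri_dirs = dir ` {0<..<1}"
proof -
  have "e1 = dir 1" "e2 = dir 0" by (auto simp: dir_def e1_def e2_def)
  then have "ri_dirs = dir ` {0..1} - {dir 1, dir 0}" by (simp only: ri_dirs_def dirs_eq)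
  also have "\<dots> = dir ` ({0..1} - {1, 0})" by auto
  also have "{0..1} - {1, 0} = {0<..<(1::real)}" by auto
  finally show ?thesis .
qed

lemma dir_in_ri_dirs [simp]: "dir t \<in> ri_dirs \<longleftrightarrow> 0 < t \<and> t < 1"
  by (auto simp: ri_dirs_eq)

lemma inner_dir: "dir s \<bullet> e1 = s" "dir s \<bullet> (e1 + e2) = 1"
  by (auto simp: dir_def e1_def e2_def)

lemma dir_less [simp]: "dir s \<prec> dir t \<longleftrightarrow> s < t"
  by (simp add: dir_less_def inner_dir)

lemma dir_le [simp]: "dir s \<preceq> dir t \<longleftrightarrow> s \<le> t"
  by (simp add: dir_le_def inner_dir)

lemma dir_intervals:
  assumes "0 \<le> s" "t \<le> 1"
  shows "dir_Icc (dir s) (dir t) = dir ` {s..t}" "dir_Ioc (dir s) (dir t) = dir ` {s<..t}"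
    "dir_Ico (dir s) (dir t) = dir ` {s..<t}"
  using assms by (auto simp: dir_Icc_def dir_Ioc_def dir_Ico_def dirs_eq)

lemma continuous_dir: "continuous_on A dir"
  unfolding dir_def by (intro continuous_intros)

lemma dir_measurable [measurable]: "dir \<in> borel_measurable borel"
  by (intro borel_measurable_continuous_onI continuous_dir)

lemma fst_vec_measurable [measurable]: "(fst :: vec \<Rightarrow> real) \<in> borel_measurable borel"
  by (intro borel_measurable_continuous_onI continuous_intros)

lemma segment_borel [simp]: "dir ` {a..b} \<in> sets borel"
  by (intro borel_compact compact_continuous_image continuous_dir) auto

lemma segment_part:
  "A \<in> sets borel \<Longrightarrow> dir ` ({a..b} \<inter> A) \<in> sets (restrict_space borel (dir ` {a..b}))"
proof -
  assume "A \<in> sets borel"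
  then have "fst -` A \<in> sets (borel :: vec measure)"
    using measurable_sets[OF fst_vec_measurable, of A] by simp
  moreover have "dir ` ({a..b} \<inter> A) = fst -` A \<inter> dir ` {a..b}" by auto
  ultimately show ?thesis by (auto simp: sets_restrict_space_iff)
qed

lemma segment_sets:
  assumes "C \<in> sets (restrict_space borel (dir ` {a..b}))"
  shows "dir -` C \<in> sets borel" "C = dir ` ({a..b} \<inter> dir -` C)"
proof -
  have C: "C \<in> sets borel" "C \<subseteq> dir ` {a..b}" using assms by (auto simp: sets_restrict_space_iff)
  show "dir -` C \<in> sets borel" using measurable_sets[OF dir_measurable C(1)] by simp
  show "C = dir ` ({a..b} \<inter> dir -` C)" using C(2) by auto
qed

text \<open>The conditions under which \<open>busemann_measure\<close> chooses, written in the
  coordinate \<open>t\<close>. As a predicate they are stable under sums and sign changes, which is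
  how existence is obtained.\<close>

definition increments :: "(vec \<Rightarrow> side \<Rightarrow> real) \<Rightarrow> real \<Rightarrow> real \<Rightarrow> (vec set \<Rightarrow> real) \<Rightarrow> bool" where
  "increments f a b m \<longleftrightarrow> signed_measure (restrict_space borel (dir ` {a..b})) m \<and>
    (\<forall>s t. a \<le> s \<and> s < t \<and> t \<le> b \<longrightarrow>
       m (dir ` {s<..t}) = f (dir t) Plus - f (dir s) Plus \<and>
       m (dir ` {s..<t}) = f (dir t) Minus - f (dir s) Minus)"

lemma busemann_measure_increments:
  assumes "0 < a" "a < b" "b < 1" "increments f a b m0"
  shows "increments f a b (busemann_measure f (dir_Icc (dir a) (dir b)))"
proof -
  have K: "dir_Icc (dir a) (dir b) = dir ` {a..b}" using assms by (simp add: dir_intervals)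
  define P where "P m \<longleftrightarrow> signed_measure (restrict_space borel (dir ` {a..b})) m \<and>
    (\<forall>\<zeta>\<in>dir ` {a..b}. \<forall>\<eta>\<in>dir ` {a..b}. \<zeta> \<prec> \<eta> \<longrightarrow>
       m (dir_Ioc \<zeta> \<eta>) = f \<eta> Plus - f \<zeta> Plus \<and> m (dir_Ico \<zeta> \<eta>) = f \<eta> Minus - f \<zeta> Minus)" for m
  have eq: "increments f a b m \<longleftrightarrow> P m" for m
    using assms by (auto simp: P_def increments_def dir_intervals)
  have "P m0" using assms(4) unfolding eq .
  from someI[of P, OF this] show ?thesis unfolding eq busemann_measure_def K P_def .
qed

lemma signed_measure_add:
  "signed_measure N m \<Longrightarrow> signed_measure N m' \<Longrightarrow> signed_measure N (\<lambda>A. m A + m' A)"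
  by (auto simp: signed_measure_def intro!: sums_add)

lemma signed_measure_uminus: "signed_measure N m \<Longrightarrow> signed_measure N (\<lambda>A. - m A)"
  by (auto simp: signed_measure_def intro!: sums_minus)

lemma increments_add:
  "increments f a b m \<Longrightarrow> increments f' a b m' \<Longrightarrow> increments (\<lambda>\<xi> \<sigma>. f \<xi> \<sigma> + f' \<xi> \<sigma>) a b (\<lambda>A. m A + m' A)"
  unfolding increments_def by (auto intro: signed_measure_add)

lemma increments_uminus:
  "increments f a b m \<Longrightarrow> increments (\<lambda>\<xi> \<sigma>. - f \<xi> \<sigma>) a b (\<lambda>A. - m A)"
  unfolding increments_def by (auto intro: signed_measure_uminus)

lemma increments_cong:
  assumes "\<And>t \<sigma>. a \<le> t \<Longrightarrow> t \<le> b \<Longrightarrow> f (dir t) \<sigma> = f' (dir t) \<sigma>" "increments f a b m"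
  shows "increments f' a b m"
  using assms unfolding increments_def by auto

text \<open>The Lebesgue-Stieltjes measure of the right-continuous \<open>Plus\<close> values. Their
  left limits are the \<open>Minus\<close> values, which gives the intervals closed on the
  left.\<close>

lemma increments_mono:
  assumes ab: "0 < a" "a < b" "b < 1"
    and mono: "\<And>s t. a \<le> s \<Longrightarrow> s < t \<Longrightarrow> t \<le> b \<Longrightarrow> f (dir s) Plus \<le> f (dir t) Plus"
    and jump: "f (dir a) Minus \<le> f (dir a) Plus"
    and lim_left: "\<And>t. a \<le> t \<Longrightarrow> t \<le> b \<Longrightarrow> ((\<lambda>s. f (dir s) Plus) \<longlongrightarrow> f (dir t) Minus) (at_left t)"
    and lim_right: "\<And>t. a \<le> t \<Longrightarrow> t \<le> b \<Longrightarrow> ((\<lambda>s. f (dir s) Plus) \<longlongrightarrow> f (dir t) Plus) (at_right t)"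
  shows "\<exists>m. increments f a b m"
proof -
  define c where "c = f (dir a) Minus"
  \<comment> \<open>Vanishing before \<open>a\<close> puts an atom of size
    \<open>f (dir a) Plus - f (dir a) Minus\<close> at the left end, so that intervals closed at
    \<open>a\<close> receive the correct \<open>Minus\<close> increment.\<close>
  define G where "G s = (if s < a then 0 else if s < b then f (dir s) Plus - c else f (dir b) Plus - c)" for s
  have mono': "f (dir s) Plus \<le> f (dir t) Plus" if "a \<le> s" "s \<le> t" "t \<le> b" for s t
    using mono[of s t] that by (cases "s = t") auto
  have G_mono: "G x \<le> G y" if "x \<le> y" for x y
    using that ab jump mono'[of a y] mono'[of a b] mono'[of x y] mono'[of x b]
    by (auto simp: G_def c_def)
  have G_right: "continuous (at_right x) G" for x
    unfolding continuous_within
  proof (rule Lim_transform_eventually)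
    consider "x < a" | "a \<le> x" "x < b" | "b \<le> x" by linarith
    note cs = this
    show "((\<lambda>s. if x < a then 0 else if x < b then f (dir s) Plus - c else f (dir b) Plus - c) \<longlongrightarrow> G x) (at_right x)"
      by (rule cs) (auto simp: G_def intro!: tendsto_diff lim_right)
    show "eventually (\<lambda>s. (if x < a then 0 else if x < b then f (dir s) Plus - c else f (dir b) Plus - c) = G s) (at_right x)"
      unfolding eventually_at_right_field
      by (rule cs; rule exI[of _ "if x < a then a else if x < b then b else x + 1"]) (auto simp: G_def)
  qed
  have G_bot: "(G \<longlongrightarrow> 0) at_bot"
  proof (rule Lim_transform_eventually[OF tendsto_const])
    show "eventually (\<lambda>s. 0 = G s) at_bot"
      unfolding eventually_at_bot_dense by (intro exI[of _ a]) (auto simp: G_def)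
  qed
  have G_top: "(G \<longlongrightarrow> f (dir b) Plus - c) at_top"
  proof (rule Lim_transform_eventually[OF tendsto_const])
    show "eventually (\<lambda>s. f (dir b) Plus - c = G s) at_top"
      unfolding eventually_at_top_dense using ab by (intro exI[of _ b]) (auto simp: G_def)
  qed
  have "0 \<le> f (dir b) Plus - c" using jump mono'[of a b] ab by (simp add: c_def)
  from finite_borel_measure_interval_measure[OF G_mono G_right G_bot G_top this]
  interpret I: finite_borel_measure "interval_measure G" .
  have Iic: "measure (interval_measure G) {..x} = G x" for x
    by (rule measure_interval_measure_Iic[OF G_mono G_right G_bot])
  have cdf: "cdf (interval_measure G) = G" by (auto simp: cdf_def Iic)
  have Iio: "measure (interval_measure G) {..<x} = f (dir x) Minus - c" if x: "a \<le> x" "x \<le> b" for x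
  proof -
    have "(G \<longlongrightarrow> f (dir x) Minus - c) (at_left x)"
    proof (cases "x = a")
      case True
      have "eventually (\<lambda>s. 0 = G s) (at_left x)"
        unfolding eventually_at_left_field by (intro exI[of _ "x - 1"]) (auto simp: G_def True)
      then have "(G \<longlongrightarrow> 0) (at_left x)" by (rule Lim_transform_eventually[OF tendsto_const])
      then show ?thesis using True by (simp add: c_def)
    next
      case False
      have "eventually (\<lambda>s. f (dir s) Plus - c = G s) (at_left x)"
        unfolding eventually_at_left_field using x False by (intro exI[of _ a]) (auto simp: G_def)
      moreover have "((\<lambda>s. f (dir s) Plus - c) \<longlongrightarrow> f (dir x) Minus - c) (at_left x)"
        using x by (intro tendsto_diff lim_left tendsto_const)
      ultimately show ?thesis by (rule Lim_transform_eventually[rotated])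
    qed
    then show ?thesis using tendsto_unique[OF _ I.cdf_at_left[of x]] by (simp add: cdf)
  qed
  define m where "m A = measure (interval_measure G) (dir -` A)" for A
  have "signed_measure (restrict_space borel (dir ` {a..b})) m"
    unfolding signed_measure_def
  proof (intro conjI allI impI)
    show "m {} = 0" by (simp add: m_def)
    fix A :: "nat \<Rightarrow> vec set"
    assume A: "range A \<subseteq> sets (restrict_space borel (dir ` {a..b})) \<and> disjoint_family A"
    have "(\<lambda>n. measure (interval_measure G) (dir -` A n)) sums measure (interval_measure G) (\<Union>n. dir -` A n)"
    proof (rule I.finite_measure_UNION)
      show "range (\<lambda>n. dir -` A n) \<subseteq> sets (interval_measure G)"
      proof safe
        fix n
        have "A n \<in> sets (restrict_space borel (dir ` {a..b}))" using A by blast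
        then show "dir -` A n \<in> sets (interval_measure G)" using segment_sets(1) by simp
      qed
      show "disjoint_family (\<lambda>n. dir -` A n)" 
        using A by (simp add: disjoint_family_on_def flip: vimage_Int)
    qed
    then show "(\<lambda>n. m (A n)) sums m (\<Union>n. A n)" by (simp add: m_def vimage_UN)
  qed
  moreover have "m (dir ` {s<..t}) = f (dir t) Plus - f (dir s) Plus \<and>
       m (dir ` {s..<t}) = f (dir t) Minus - f (dir s) Minus" if st: "a \<le> s" "s < t" "t \<le> b" for s t
  proof
    have inj: "dir -` (dir ` X) = X" for X by (auto simp: dir_def)
    have "measure (interval_measure G) {s<..t} = G t - G s"
      using measure_interval_measure_Ioc[OF _ G_mono G_right, of s t] st by simp
    then show "m (dir ` {s<..t}) = f (dir t) Plus - f (dir s) Plus"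
      using st by (auto simp: m_def inj G_def)
    have eq: "{s..<t} = {..<t} - {..<s}" by auto
    have "measure (interval_measure G) {s..<t} = measure (interval_measure G) {..<t} - measure (interval_measure G) {..<s}"
      unfolding eq using st by (intro I.finite_measure_Diff) auto
    then show "m (dir ` {s..<t}) = f (dir t) Minus - f (dir s) Minus"
      using st Iio[of s] Iio[of t] by (simp add: m_def inj)
  qed
  ultimately have "increments f a b m" by (simp add: increments_def)
  then show ?thesis by (rule exI[of "increments f a b" m])
qed

lemma signed_measure_Un:
  assumes m: "signed_measure N m" and AB: "A \<in> sets N" "B \<in> sets N" "A \<inter> B = {}"
  shows "m (A \<union> B) = m A + m B"
proof -
  have "(\<lambda>n. m (binaryset A B n)) sums m (\<Union>n. binaryset A B n)"
  proof -
    have "disjoint_family (binaryset A B)" using AB(3) by (auto simp: disjoint_family_on_def binaryset_def)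
    moreover have "range (binaryset A B) \<subseteq> sets N" using AB by (auto simp: range_binaryset_eq)
    ultimately show ?thesis using m unfolding signed_measure_def by blast
  qed
  moreover have "(\<lambda>n. m (binaryset A B n)) sums (m A + m B)"
    using m by (intro binaryset_sums) (simp add: signed_measure_def)
  ultimately show ?thesis by (simp add: UN_binaryset_eq sums_unique2)
qed

text \<open>The partition into \<open>A\<close> and \<open>C - A\<close> tests an arbitrary
  measurable part \<open>A\<close>; conversely all members of a partition are such parts.\<close>

lemma total_variation_eq_0_iff:
  assumes m: "signed_measure N m" and C: "C \<in> sets N"
  shows "total_variation N m C = 0 \<longleftrightarrow> (\<forall>A\<in>sets N. A \<subseteq> C \<longrightarrow> m A = 0)"
proof
  assume 0: "total_variation N m C = 0"
  show "\<forall>A\<in>sets N. A \<subseteq> C \<longrightarrow> m A = 0"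
  proof (intro ballI impI)
    fix A assume A: "A \<in> sets N" "A \<subseteq> C"
    let ?P = "{A, C - A}"
    have "?P \<in> {P. finite P \<and> disjoint P \<and> P \<subseteq> sets N \<and> \<Union>P = C}"
      using A C by (auto simp: disjoint_def)
    then have "(\<Sum>E\<in>?P. ennreal \<bar>m E\<bar>) \<le> total_variation N m C"
      unfolding total_variation_def by (rule SUP_upper)
    moreover have "ennreal \<bar>m A\<bar> \<le> (\<Sum>E\<in>?P. ennreal \<bar>m E\<bar>)" by (intro member_le_sum) auto
    ultimately have "ennreal \<bar>m A\<bar> \<le> 0" using 0 by simp
    then show "m A = 0" by (simp add: ennreal_eq_0_iff)
  qed
next
  assume *: "\<forall>A\<in>sets N. A \<subseteq> C \<longrightarrow> m A = 0"
  have "total_variation N m C \<le> 0"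
    unfolding total_variation_def
  proof (rule SUP_least)
    fix P assume P: "P \<in> {P. finite P \<and> disjoint P \<and> P \<subseteq> sets N \<and> \<Union>P = C}"
    have "m E = 0" if "E \<in> P" for E
    proof -
      have "E \<in> sets N" "E \<subseteq> C" using P that by auto
      then show ?thesis using * by blast
    qed
    then show "(\<Sum>E\<in>P. ennreal \<bar>m E\<bar>) \<le> 0" by simp
  qed
  then show "total_variation N m C = 0" by simp
qed

text \<open>A signed measure is not monotone, so vanishing on a set does not pass to its parts. It
  passes from an intersection-stable generator to all Borel sets by Dynkin's argument, here
  localized to \<open>V\<close>.\<close>

lemma signed_measure_null:
  fixes a b :: real
  assumes m: "signed_measure (restrict_space borel (dir ` {a..b})) m"
    and G: "Int_stable G" "sets borel = sigma_sets UNIV G"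
    and V: "V \<in> sets borel" "m (dir ` ({a..b} \<inter> V)) = 0"
    and null: "\<And>E. E \<in> G \<Longrightarrow> m (dir ` ({a..b} \<inter> (E \<inter> V))) = 0"
    and A: "A \<in> sets borel"
  shows "m (dir ` ({a..b} \<inter> (A \<inter> V))) = 0"
proof -
  let ?S = "\<lambda>A. dir ` ({a..b} \<inter> (A \<inter> V))"
  have S: "?S A \<in> sets (restrict_space borel (dir ` {a..b}))" if "A \<in> sets borel" for A
    using that V by (intro segment_part) auto
  have "G \<subseteq> Pow UNIV" "A \<in> sigma_sets UNIV G" using A G(2) by simp_all
  with G(1) show ?thesis
  proof (induction rule: sigma_sets_induct_disjoint)
    case empty
    then show ?case using m by (simp add: signed_measure_def)
  next
    case (compl A)
    then have A: "A \<in> sets borel" using G(2) by simp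
    have "dir ` ({a..b} \<inter> V) = ?S A \<union> ?S (UNIV - A)" by auto
    moreover have "m (?S A \<union> ?S (UNIV - A)) = m (?S A) + m (?S (UNIV - A))"
      using A by (intro signed_measure_Un[OF m] S) auto
    ultimately show ?case using compl V by simp
  next
    case (union A)
    then have A: "\<And>n. A n \<in> sets borel" using G(2) by auto
    have "(\<lambda>n. m (?S (A n))) sums m (\<Union>n. ?S (A n))"
    proof -
      have "disjoint_family (\<lambda>n. ?S (A n))"
        unfolding disjoint_family_on_def
      proof (intro ballI impI)
        fix i j :: nat assume "i \<noteq> j"
        then have "A i \<inter> A j = {}" using union(1) by (auto simp: disjoint_family_on_def)
        then have "({a..b} \<inter> (A i \<inter> V)) \<inter> ({a..b} \<inter> (A j \<inter> V)) = {}" by blast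
        then show "?S (A i) \<inter> ?S (A j) = {}"
          by (subst image_Int[symmetric]) (auto intro: injI)
      qed
      moreover have "range (\<lambda>n. ?S (A n)) \<subseteq> sets (restrict_space borel (dir ` {a..b}))"
        by (intro image_subsetI S A)
      ultimately show ?thesis using m unfolding signed_measure_def by blast
    qed
    moreover have "(\<Union>n. ?S (A n)) = ?S (\<Union>n. A n)" by auto
    ultimately have "(\<lambda>n. 0::real) sums m (?S (\<Union>n. A n))" using union(3) by simp
    then show ?case using sums_unique2[OF _ sums_zero] by metis
  qed (auto intro: null)
qed

lemma Int_stable_Ioc: "Int_stable (range (\<lambda>(a, b). {a<..b::real}))"
  unfolding Int_stable_def
proof (intro ballI)
  fix A B assume "A \<in> range (\<lambda>(a, b). {a<..b::real})" "B \<in> range (\<lambda>(a, b). {a<..b::real})"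
  then obtain a b c d where "A = {a<..b}" "B = {c<..d}" by auto
  then have "A \<inter> B = (\<lambda>(a, b). {a<..b}) (max a c, min b d)" by auto
  then show "A \<inter> B \<in> range (\<lambda>(a, b). {a<..b::real})" by blast
qed

lemma Int_stable_Ico: "Int_stable (range (\<lambda>(a, b). {a..<b::real}))"
  unfolding Int_stable_def
proof (intro ballI)
  fix A B assume "A \<in> range (\<lambda>(a, b). {a..<b::real})" "B \<in> range (\<lambda>(a, b). {a..<b::real})"
  then obtain a b c d where "A = {a..<b}" "B = {c..<d}" by auto
  then have "A \<inter> B = (\<lambda>(a, b). {a..<b}) (max a c, min b d)" by auto
  then show "A \<inter> B \<in> range (\<lambda>(a, b). {a..<b::real})" by blast
qed

definition loc_const :: "(vec \<Rightarrow> side \<Rightarrow> real) \<Rightarrow> real \<Rightarrow> bool" where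
  "loc_const f t \<longleftrightarrow> (\<exists>s u c. s < t \<and> t < u \<and> (\<forall>v \<sigma>. s < v \<and> v < u \<longrightarrow> f (dir v) \<sigma> = c))"

text \<open>Constancy near \<open>t\<close> makes the increments vanish, hence the variation. The
  half-open intervals must fit the ends of \<open>{a..b}\<close>: open on the left and using
  \<open>Plus\<close> if \<open>a < t\<close>, closed on the left and using \<open>Minus\<close> if
  \<open>t = a\<close>.\<close>

lemma not_in_support_if_loc_const:
  assumes ab: "0 < a" "a < b" "b < 1" "a \<le> t" "t \<le> b" and inc: "increments f a b m" and lc: "loc_const f t"
  shows "dir t \<notin> signed_support (dir ` {a..b}) m"
proof -
  let ?K = "dir ` {a..b}"
  have m: "signed_measure (restrict_space borel ?K) m" using inc by (simp add: increments_def)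
  have Ioc: "m (dir ` {s<..u}) = f (dir u) Plus - f (dir s) Plus"
    and Ico: "m (dir ` {s..<u}) = f (dir u) Minus - f (dir s) Minus" if "a \<le> s" "s < u" "u \<le> b" for s u
    using inc that by (auto simp: increments_def)
  have empty: "m {} = 0" using m by (simp add: signed_measure_def)
  obtain s u c where su: "s < t" "t < u" and const: "\<And>v \<sigma>. s < v \<Longrightarrow> v < u \<Longrightarrow> f (dir v) \<sigma> = c"
    using lc by (auto simp: loc_const_def)
  have "\<exists>U V. open U \<and> t \<in> U \<and> {a..b} \<inter> U \<subseteq> V \<and> V \<in> sets borel \<and>
    (\<forall>A\<in>sets borel. m (dir ` ({a..b} \<inter> (A \<inter> V))) = 0)"
  proof (cases "a < t")
    case True
    define p where "p = (max s a + t) / 2"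
    \<comment> \<open>The minimum lets the interval include the end \<open>b\<close> when
      \<open>t = b\<close>.\<close>
    define r where "r = min ((t + u) / 2) b"
    have pr: "s < p" "a < p" "p < t" "t \<le> r" "r \<le> b" "r < u" using True su ab by (auto simp: p_def r_def min_def max_def)
    have null: "m (dir ` {x<..y}) = 0" if "p \<le> x" "y \<le> r" for x y
    proof (cases "x < y")
      case True
      then show ?thesis using Ioc[of x y] const[of x Plus] const[of y Plus] that pr by auto
    qed (use empty in simp)
    have "m (dir ` ({a..b} \<inter> (A \<inter> {p<..r}))) = 0" if "A \<in> sets borel" for A
    proof (rule signed_measure_null[OF m Int_stable_Ioc _ _ _ _ that])
      show "sets borel = sigma_sets UNIV (range (\<lambda>(a, b). {a<..b::real}))"
        by (subst borel_sigma_sets_Ioc) simp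
      have "{a..b} \<inter> {p<..r} = {p<..r}" using pr by auto
      then show "m (dir ` ({a..b} \<inter> {p<..r})) = 0" using null[of p r] by simp
      fix E assume "E \<in> range (\<lambda>(a, b). {a<..b::real})"
      then obtain x y where E: "E = {x<..y}" by auto
      have "{a..b} \<inter> (E \<inter> {p<..r}) = {max x p<..min y r}" using pr by (auto simp: E)
      then show "m (dir ` ({a..b} \<inter> (E \<inter> {p<..r}))) = 0" using null[of "max x p" "min y r"] by simp
    qed simp
    moreover have "{a..b} \<inter> {p<..<(t + u) / 2} \<subseteq> {p<..r}" by (auto simp: r_def)
    ultimately show ?thesis using pr su
      by (intro exI[of _ "{p<..<(t + u) / 2}"] exI[of _ "{p<..r}"]) auto
  next
    case False
    then have "t = a" using ab by simp
    define r where "r = (a + min u b) / 2"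
    have r: "a < r" "r < b" "r < u" using ab su \<open>t = a\<close> by (auto simp: r_def min_def)
    have null: "m (dir ` {x..<y}) = 0" if "a \<le> x" "y \<le> r" for x y
    proof (cases "x < y")
      case True
      then show ?thesis using Ico[of x y] const[of x Minus] const[of y Minus] that r su \<open>t = a\<close> by auto
    qed (use empty in simp)
    have "m (dir ` ({a..b} \<inter> (A \<inter> {a..<r}))) = 0" if "A \<in> sets borel" for A
    proof (rule signed_measure_null[OF m Int_stable_Ico _ _ _ _ that])
      show "sets borel = sigma_sets UNIV (range (\<lambda>(a, b). {a..<b::real}))"
        by (subst borel_eq_atLeastLessThan) simp
      have "{a..b} \<inter> {a..<r} = {a..<r}" using r by auto
      then show "m (dir ` ({a..b} \<inter> {a..<r})) = 0" using null[of a r] by simp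
      fix E assume "E \<in> range (\<lambda>(a, b). {a..<b::real})"
      then obtain x y where E: "E = {x..<y}" by auto
      have "{a..b} \<inter> (E \<inter> {a..<r}) = {max x a..<min y r}" using r by (auto simp: E)
      then show "m (dir ` ({a..b} \<inter> (E \<inter> {a..<r}))) = 0" using null[of "max x a" "min y r"] by simp
    qed simp
    moreover have "{a..b} \<inter> {..<r} \<subseteq> {a..<r}" by auto
    ultimately show ?thesis using r \<open>t = a\<close>
      by (intro exI[of _ "{..<r}"] exI[of _ "{a..<r}"]) auto
  qed
  then obtain U V where U: "open U" "t \<in> U" "{a..b} \<inter> U \<subseteq> V"
    and null: "\<And>A. A \<in> sets borel \<Longrightarrow> m (dir ` ({a..b} \<inter> (A \<inter> V))) = 0" by blast
  define C where "C = ?K - fst -` U"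
  have "open (fst -` U :: vec set)" by (rule open_vimage[OF U(1)]) (intro continuous_intros)
  then have closed: "closedin (top_of_set ?K) C"
    unfolding C_def by (metis Diff_eq closed_Compl closedin_closed_Int)
  have KC: "?K - C = dir ` ({a..b} \<inter> U)" by (auto simp: C_def)
  have sets_KC: "?K - C \<in> sets (restrict_space borel ?K)"
    unfolding KC using U(1) by (intro segment_part) auto
  have "total_variation (restrict_space borel ?K) m (?K - C) = 0"
    unfolding total_variation_eq_0_iff[OF m sets_KC]
  proof (intro ballI impI)
    fix A assume A: "A \<in> sets (restrict_space borel ?K)" "A \<subseteq> ?K - C"
    have "x \<in> V" if "dir x \<in> A" for x
    proof -
      have "dir x \<in> dir ` ({a..b} \<inter> U)" using A(2) that unfolding KC by (rule subsetD)
      then obtain y where "dir x = dir y" "y \<in> {a..b} \<inter> U" by (rule imageE)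
      then show ?thesis using U(3) by auto
    qed
    then have "{a..b} \<inter> dir -` A = {a..b} \<inter> (dir -` A \<inter> V)" by auto
    then have "A = dir ` ({a..b} \<inter> (dir -` A \<inter> V))" using segment_sets(2)[OF A(1)] by simp
    then show "m A = 0" using null[OF segment_sets(1)[OF A(1)]] by simp
  qed
  moreover have "dir t \<notin> C" using U(2) by (simp add: C_def)
  ultimately show ?thesis using closed unfolding signed_support_def by blast
qed

text \<open>Zero variation near \<open>t\<close> makes the \<open>Plus\<close> increments vanish
  there, and the \<open>Minus\<close> values follow as left limits.\<close>

lemma loc_const_if_not_in_support:
  assumes ab: "0 < a" "a < t" "t < b" "b < 1" and inc: "increments f a b m"
    and left: "\<And>t. a < t \<Longrightarrow> t < b \<Longrightarrow> ((\<lambda>s. f (dir s) Plus) \<longlongrightarrow> f (dir t) Minus) (at_left t)"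
    and not: "dir t \<notin> signed_support (dir ` {a..b}) m"
  shows "loc_const f t"
proof -
  let ?K = "dir ` {a..b}"
  have m: "signed_measure (restrict_space borel ?K) m" using inc by (simp add: increments_def)
  obtain C where C: "closedin (top_of_set ?K) C"
    "total_variation (restrict_space borel ?K) m (?K - C) = 0" "dir t \<notin> C"
    using not unfolding signed_support_def by auto
  obtain C' where C': "closed C'" "C = ?K \<inter> C'" using C(1) by (auto simp: closedin_closed)
  have U: "open (- (dir -` C'))" by (intro open_Compl closed_vimage C' continuous_dir)
  have "t \<in> - (dir -` C') \<inter> {a<..<b}" using C(3) C'(2) ab by auto
  then obtain e where e: "e > 0" "\<And>v. dist v t < e \<Longrightarrow> v \<in> - (dir -` C') \<inter> {a<..<b}"
    using open_Int[OF U open_greaterThanLessThan] unfolding open_dist by blast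
  have KC: "?K - C = dir ` ({a..b} \<inter> - (dir -` C'))" using C' by auto
  have sets_KC: "?K - C \<in> sets (restrict_space borel ?K)"
    unfolding KC using U by (intro segment_part) auto
  have null: "m A = 0" if "A \<in> sets (restrict_space borel ?K)" "A \<subseteq> ?K - C" for A
    using C(2) that unfolding total_variation_eq_0_iff[OF m sets_KC] by blast
  have near: "a < v \<and> v < b \<and> dir v \<in> ?K - C" if "t - e < v" "v < t + e" for v
  proof -
    have "dist v t < e" using that by (auto simp: dist_real_def)
    then show ?thesis using e(2)[of v] unfolding KC by auto
  qed
  have Plus: "f (dir y) Plus = f (dir x) Plus" if xy: "t - e < x" "x < y" "y < t + e" for x y
  proof -
    have "m (dir ` {x<..y}) = 0"
    proof (rule null)
      have "{a..b} \<inter> {x<..y} = {x<..y}" using near[of x] near[of y] xy by auto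
      then show "dir ` {x<..y} \<in> sets (restrict_space borel ?K)" using segment_part[of "{x<..y}" a b] by simp
      show "dir ` {x<..y} \<subseteq> ?K - C" using near xy by auto
    qed
    moreover have "a \<le> x" "y \<le> b" using near[of x] near[of y] xy by auto
    ultimately show ?thesis using inc xy by (auto simp: increments_def)
  qed
  define c where "c = f (dir t) Plus"
  have P: "f (dir v) Plus = c" if "t - e < v" "v < t + e" for v
    using Plus[of v t] Plus[of t v] that e(1) by (cases v t rule: linorder_cases) (auto simp: c_def)
  have M: "f (dir v) Minus = c" if v: "t - e < v" "v < t + e" for v
  proof (rule tendsto_unique[OF _ left])
    have "eventually (\<lambda>s. c = f (dir s) Plus) (at_left v)"
      unfolding eventually_at_left_field using P v by (intro exI[of _ "t - e"]) auto
    then show "((\<lambda>s. f (dir s) Plus) \<longlongrightarrow> c) (at_left v)"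
      by (rule Lim_transform_eventually[OF tendsto_const])
  qed (use near[OF v] in auto)
  have "f (dir v) \<sigma> = c" if "t - e < v" "v < t + e" for v \<sigma>
    using P[OF that] M[OF that] by (cases \<sigma>) auto
  then show ?thesis
    unfolding loc_const_def using e(1) by (intro exI[of _ "t - e"] exI[of _ "t + e"] exI[of _ c]) auto
qed

lemma tendsto_dir_at_left:
  assumes "0 < t" "t < 1" "(F \<longlongrightarrow> c) (dir_at_left (dir t))"
  shows "((\<lambda>s. F (dir s)) \<longlongrightarrow> c) (at_left t)"
proof (rule filterlim_compose[OF assms(3)])
  have "eventually (\<lambda>s. dir s \<in> {\<zeta> \<in> ri_dirs. \<zeta> \<prec> dir t} \<and> dir s \<noteq> dir t) (at_left t)"
    unfolding eventually_at_left_field using assms by (intro exI[of _ 0]) auto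
  moreover have "(dir \<longlongrightarrow> dir t) (at_left t)"
    unfolding dir_def by (intro tendsto_intros)
  ultimately show "filterlim dir (dir_at_left (dir t)) (at_left t)"
    unfolding dir_at_left_def filterlim_at by (auto elim: eventually_mono)
qed

lemma tendsto_dir_at_right:
  assumes "0 < t" "t < 1" "(F \<longlongrightarrow> c) (dir_at_right (dir t))"
  shows "((\<lambda>s. F (dir s)) \<longlongrightarrow> c) (at_right t)"
proof (rule filterlim_compose[OF assms(3)])
  have "eventually (\<lambda>s. dir s \<in> {\<zeta> \<in> ri_dirs. dir t \<prec> \<zeta>} \<and> dir s \<noteq> dir t) (at_right t)"
    unfolding eventually_at_right_field using assms by (intro exI[of _ 1]) auto
  moreover have "(dir \<longlongrightarrow> dir t) (at_right t)"
    unfolding dir_def by (intro tendsto_intros)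
  ultimately show "filterlim dir (dir_at_right (dir t)) (at_right t)"
    unfolding dir_at_right_def filterlim_at by (auto elim: eventually_mono)
qed

section \<open>One-sided derivatives of concave functions\<close>

lemma concave_slope_antimono:
  fixes h :: "real \<Rightarrow> real"
  assumes conc: "concave_on {0..1} h" and xyz: "0 \<le> x" "x < y" "y < z" "z \<le> 1"
  shows "(h z - h y) / (z - y) \<le> (h y - h x) / (y - x)" "(h z - h x) / (z - x) \<le> (h y - h x) / (y - x)"
    "(h z - h y) / (z - y) \<le> (h z - h x) / (z - x)"
proof -
  define \<theta> where "\<theta> = (y - x) / (z - x)"
  have \<theta>: "0 \<le> \<theta>" "\<theta> \<le> 1" "\<theta> * (z - x) = y - x" using xyz by (auto simp: \<theta>_def field_simps)
  have y: "(1 - \<theta>) *\<^sub>R x + \<theta> *\<^sub>R z = y" using \<theta>(3) by (simp add: algebra_simps)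
  have "(1 - \<theta>) * h x + \<theta> * h z \<le> h y"
    using concave_onD[OF conc \<theta>(1,2), of x z] xyz unfolding y by simp
  then have "(1 - \<theta>) * h x * (z - x) + \<theta> * h z * (z - x) \<le> h y * (z - x)"
    using xyz mult_right_mono[of "(1 - \<theta>) * h x + \<theta> * h z" "h y" "z - x"] by (simp add: distrib_right)
  moreover have "(1 - \<theta>) * h x * (z - x) + \<theta> * h z * (z - x) = h x * (z - x) + (h z - h x) * (\<theta> * (z - x))"
    by (simp add: algebra_simps)
  ultimately have *: "h x * (z - x) + (h z - h x) * (y - x) \<le> h y * (z - x)" using \<theta>(3) by simp
  show "(h z - h y) / (z - y) \<le> (h y - h x) / (y - x)"
    using * xyz by (simp add: divide_simps) (simp add: algebra_simps)
  show "(h z - h x) / (z - x) \<le> (h y - h x) / (y - x)"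
    using * xyz by (simp add: divide_simps) (simp add: algebra_simps)
  show "(h z - h y) / (z - y) \<le> (h z - h x) / (z - x)"
    using * xyz by (simp add: divide_simps) (simp add: algebra_simps)
qed

text \<open>The difference quotients increase as \<open>s\<close> decreases to \<open>t\<close>, so
  their supremum is the limit; the quotients from the left bound it above.\<close>

lemma concave_right_deriv:
  fixes h :: "real \<Rightarrow> real"
  assumes conc: "concave_on {0..1} h" and t: "0 < t" "t < 1"
  shows "\<exists>l. ((\<lambda>s. (h s - h t) / (s - t)) \<longlongrightarrow> l) (at_right t) \<and>
    (\<forall>s. t < s \<and> s \<le> 1 \<longrightarrow> (h s - h t) / (s - t) \<le> l) \<and> (\<forall>s. 0 \<le> s \<and> s < t \<longrightarrow> l \<le> (h s - h t) / (s - t))"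
proof -
  define \<phi> where "\<phi> s = (h s - h t) / (s - t)" for s
  have flip: "\<phi> s = (h t - h s) / (t - s)" for s 
    unfolding \<phi>_def by (metis minus_diff_eq minus_divide_divide)
  define S where "S = \<phi> ` {t<..1}"
  have mono: "\<phi> v \<le> \<phi> u" if "t < u" "u < v" "v \<le> 1" for u v
    using concave_slope_antimono(2)[OF conc, of t u v] that t by (simp add: \<phi>_def)
  have cross: "\<phi> v \<le> \<phi> u" if "0 \<le> u" "u < t" "t < v" "v \<le> 1" for u v
    using concave_slope_antimono(1)[OF conc, of u t v] that unfolding flip[of u] by (simp add: \<phi>_def)
  have ne: "S \<noteq> {}" using t by (auto simp: S_def)
  have bdd: "bdd_above S" unfolding bdd_above_def S_def
    using cross[of 0] t by (intro exI[of _ "\<phi> 0"]) auto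
  define l where "l = Sup S"
  have up: "\<phi> s \<le> l" if "t < s" "s \<le> 1" for s
    unfolding l_def using that by (intro cSup_upper bdd) (auto simp: S_def)
  have low: "l \<le> \<phi> s" if "0 \<le> s" "s < t" for s
    unfolding l_def using cross that by (intro cSup_least ne) (auto simp: S_def)
  have "(\<phi> \<longlongrightarrow> l) (at_right t)"
  proof (rule order_tendstoI)
    fix c assume "c < l"
    then obtain s where s: "t < s" "s \<le> 1" "c < \<phi> s"
      using less_cSup_iff[OF ne bdd] unfolding l_def S_def by auto
    show "eventually (\<lambda>x. c < \<phi> x) (at_right t)"
      unfolding eventually_at_right_field using s mono[of _ s] by (intro exI[of _ s]) force
  next
    fix c assume "l < c"
    show "eventually (\<lambda>x. \<phi> x < c) (at_right t)"
      unfolding eventually_at_right_field using up t \<open>l < c\<close> by (intro exI[of _ 1]) force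
  qed
  then show ?thesis using up low unfolding \<phi>_def by blast
qed

lemma concave_left_deriv:
  fixes h :: "real \<Rightarrow> real"
  assumes conc: "concave_on {0..1} h" and t: "0 < t" "t < 1"
  shows "\<exists>l. ((\<lambda>s. (h s - h t) / (s - t)) \<longlongrightarrow> l) (at_left t) \<and>
    (\<forall>s. t < s \<and> s \<le> 1 \<longrightarrow> (h s - h t) / (s - t) \<le> l) \<and> (\<forall>s. 0 \<le> s \<and> s < t \<longrightarrow> l \<le> (h s - h t) / (s - t))"
proof -
  have conc': "concave_on {0..1} (\<lambda>s. h (1 - s))"
    unfolding concave_on_iff
  proof (intro conjI ballI allI impI)
    fix x y u v :: real
    assume *: "x \<in> {0..1}" "y \<in> {0..1}" "0 \<le> u" "0 \<le> v" "u + v = 1"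
    have "u * h (1 - x) + v * h (1 - y) \<le> h (u *\<^sub>R (1 - x) + v *\<^sub>R (1 - y))"
      using conc * unfolding concave_on_iff by auto
    moreover have "u *\<^sub>R (1 - x) + v *\<^sub>R (1 - y) = 1 - (u *\<^sub>R x + v *\<^sub>R y)"
      using *(5) by (simp add: algebra_simps)
    ultimately show "u * h (1 - x) + v * h (1 - y) \<le> h (1 - (u *\<^sub>R x + v *\<^sub>R y))" by simp
  qed simp
  obtain l where l: "((\<lambda>s. (h (1 - s) - h (1 - (1 - t))) / (s - (1 - t))) \<longlongrightarrow> l) (at_right (1 - t))"
    "\<And>s. 1 - t < s \<Longrightarrow> s \<le> 1 \<Longrightarrow> (h (1 - s) - h (1 - (1 - t))) / (s - (1 - t)) \<le> l"
    "\<And>s. 0 \<le> s \<Longrightarrow> s < 1 - t \<Longrightarrow> l \<le> (h (1 - s) - h (1 - (1 - t))) / (s - (1 - t))"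
    using concave_right_deriv[OF conc', of "1 - t"] t by auto
  have eq: "(h s - h t) / (t - s) = - ((h s - h t) / (s - t))" for s
    by (metis divide_minus_right minus_diff_eq)
  have "((\<lambda>s. - ((h (1 - (1 - s)) - h (1 - (1 - t))) / ((1 - s) - (1 - t)))) \<longlongrightarrow> - l) (at_left t)"
    by (intro tendsto_minus filterlim_compose[OF l(1) filterlim_reflect_left])
  then have "((\<lambda>s. (h s - h t) / (s - t)) \<longlongrightarrow> - l) (at_left t)" by (simp add: eq)
  moreover have "(h s - h t) / (s - t) \<le> - l" if "t < s" "s \<le> 1" for s
    using l(3)[of "1 - s"] that by (simp add: eq)
  moreover have "- l \<le> (h s - h t) / (s - t)" if "0 \<le> s" "s < t" for s
    using l(2)[of "1 - s"] that by (simp add: eq)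
  ultimately show ?thesis by blast
qed

section \<open>The shape function\<close>

definition at_side :: "side \<Rightarrow> real \<Rightarrow> real filter" where
  "at_side \<sigma> t = (case \<sigma> of Plus \<Rightarrow> at_right t | Minus \<Rightarrow> at_left t)"

definition radial :: "(vec \<Rightarrow> real) \<Rightarrow> real \<Rightarrow> real" where "radial g t = g (dir t)"

definition side_slope :: "(vec \<Rightarrow> real) \<Rightarrow> real \<Rightarrow> side \<Rightarrow> real" where
  "side_slope g t \<sigma> = Lim (at_side \<sigma> t) (\<lambda>s. (radial g s - radial g t) / (s - t))"

context
  fixes g :: "vec \<Rightarrow> real"
  assumes concave: "concave_on {0..} g"
    and homogeneous: "\<And>p c. 0 \<le> p \<Longrightarrow> 0 < c \<Longrightarrow> g (c *\<^sub>R p) = c * g p"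
begin

lemma radial_concave: "concave_on {0..1} (radial g)"
  unfolding concave_on_iff
proof (intro conjI ballI allI impI)
  fix x y u v :: real
  assume *: "x \<in> {0..1}" "y \<in> {0..1}" "0 \<le> u" "0 \<le> v" "u + v = 1"
  have "dir x \<in> {0..}" "dir y \<in> {0..}" using * by (auto simp: dir_def less_eq_prod_def)
  then have "u * g (dir x) + v * g (dir y) \<le> g (u *\<^sub>R dir x + v *\<^sub>R dir y)"
    using concave * unfolding concave_on_iff by blast
  moreover have "u *\<^sub>R dir x + v *\<^sub>R dir y = dir (u *\<^sub>R x + v *\<^sub>R y)"
    using *(5) by (simp add: dir_def algebra_simps)
  ultimately show "u * radial g x + v * radial g y \<le> radial g (u *\<^sub>R x + v *\<^sub>R y)"
    by (simp add: radial_def)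
qed simp

lemma side_slope:
  assumes t: "0 < t" "t < 1"
  shows "((\<lambda>s. (radial g s - radial g t) / (s - t)) \<longlongrightarrow> side_slope g t \<sigma>) (at_side \<sigma> t)"
    "\<And>s. 0 < s \<Longrightarrow> s < 1 \<Longrightarrow> radial g s \<le> tangent (radial g) (side_slope g) t \<sigma> s"
proof -
  obtain l where l: "((\<lambda>s. (radial g s - radial g t) / (s - t)) \<longlongrightarrow> l) (at_side \<sigma> t)"
    "\<And>s. t < s \<Longrightarrow> s \<le> 1 \<Longrightarrow> (radial g s - radial g t) / (s - t) \<le> l"
    "\<And>s. 0 \<le> s \<Longrightarrow> s < t \<Longrightarrow> l \<le> (radial g s - radial g t) / (s - t)"
    using concave_right_deriv[OF radial_concave t] concave_left_deriv[OF radial_concave t]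
    by (cases \<sigma>) (auto simp: at_side_def)
  have "at_side \<sigma> t \<noteq> bot" by (cases \<sigma>) (auto simp: at_side_def)
  from tendsto_Lim[OF this l(1)] have d: "side_slope g t \<sigma> = l" by (simp add: side_slope_def)
  show "((\<lambda>s. (radial g s - radial g t) / (s - t)) \<longlongrightarrow> side_slope g t \<sigma>) (at_side \<sigma> t)" using l(1) d by simp
  show "radial g s \<le> tangent (radial g) (side_slope g) t \<sigma> s" if s: "0 < s" "s < 1" for s
  proof (cases s t rule: linorder_cases)
    case less
    then show ?thesis using l(3)[of s] s d by (simp add: tangent_def field_simps)
  next
    case greater
    then show ?thesis using l(2)[of s] s d by (simp add: tangent_def field_simps)
  qed (simp add: tangent_def)
qed

lemma filterlim_at_side:
  assumes u: "u 0 = t" "isCont u 0" and s: "\<And>\<epsilon>. 0 < \<epsilon> \<Longrightarrow> \<epsilon> < \<delta> \<Longrightarrow> 0 < side_sign \<sigma> * (u \<epsilon> - t)" and "0 < \<delta>"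
  shows "filterlim u (at_side \<sigma> t) (at_right (0::real))"
proof -
  have lim: "(u \<longlongrightarrow> t) (at_right 0)"
    using u by (auto simp: isCont_def intro: filterlim_mono[OF _ order_refl at_le])
  have ev: "eventually (\<lambda>\<epsilon>. 0 < side_sign \<sigma> * (u \<epsilon> - t)) (at_right 0)"
    unfolding eventually_at_right_field using s \<open>0 < \<delta>\<close> by auto
  show ?thesis
  proof (cases \<sigma>)
    case Plus
    then show ?thesis using lim ev by (auto simp: at_side_def filterlim_at elim: eventually_mono)
  next
    case Minus
    then show ?thesis using lim ev by (auto simp: at_side_def filterlim_at elim: eventually_mono)
  qed
qed

lemma radial_tendsto: assumes t: "0 < t" "t < 1" shows "(radial g \<longlongrightarrow> radial g t) (at_side \<sigma> t)"
proof -
  have id: "((\<lambda>s. s) \<longlongrightarrow> t) (at_side \<sigma> t)" by (cases \<sigma>) (auto simp: at_side_def)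
  have "((\<lambda>s. radial g t + (s - t) * ((radial g s - radial g t) / (s - t))) \<longlongrightarrow> radial g t + (t - t) * side_slope g t \<sigma>) (at_side \<sigma> t)"
    by (intro tendsto_intros id side_slope t)
  moreover have "eventually (\<lambda>s. radial g t + (s - t) * ((radial g s - radial g t) / (s - t)) = radial g s) (at_side \<sigma> t)"
    by (cases \<sigma>) (auto simp: at_side_def eventually_at_filter)
  ultimately show ?thesis by (auto dest: Lim_transform_eventually)
qed

text \<open>Moving along \<open>e1\<close> leaves the segment of directions, and homogeneity scales
  the point back to \<open>dir (u \<epsilon>)\<close>. The derivative combines the value at
  \<open>t\<close> with \<open>1 - t\<close> times the slope, that is, the tangent at 1; along
  \<open>e2\<close> the same computation gives the tangent at 0.\<close>

lemma side_grad_eq: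
  assumes t: "0 < t" "t < 1"
  shows "side_grad g (dir t) \<sigma>
    = (tangent (radial g) (side_slope g) t \<sigma> 1, tangent (radial g) (side_slope g) t \<sigma> 0)"
proof -
  define s where "s = side_sign \<sigma>"
  have s: "s = 1 \<or> s = -1" by (cases \<sigma>) (auto simp: s_def)
  \<comment> \<open>Small enough that \<open>1 + s * \<epsilon>\<close> and
    \<open>1 - s * \<epsilon>\<close> are positive and the rescaled directions stay between 0 and 1,
    for both signs.\<close>
  define \<delta> where "\<delta> = min (t / 2) ((1 - t) / 2)"
  have "0 < \<delta>" using t by (simp add: \<delta>_def)
  moreover have "\<delta> \<le> t / 2" unfolding \<delta>_def by (rule min.cobounded1)
  moreover have "\<delta> \<le> (1 - t) / 2" unfolding \<delta>_def by (rule min.cobounded2)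
  ultimately have \<delta>: "0 < \<delta>" "\<delta> \<le> t / 2" "\<delta> \<le> (1 - t) / 2" by blast+
  let ?\<phi> = "\<lambda>v. (radial g v - radial g t) / (v - t)"
  have cancel: "x / (\<kappa> * r) * r = x / \<kappa>" if "r \<noteq> 0" for x \<kappa> r :: real using that by simp
  have scale: "g p = c * radial g v" if "p = c *\<^sub>R dir v" "0 < c" "0 \<le> v" "v \<le> 1" for p c v
    using homogeneous[of "dir v" c] that by (simp add: radial_def dir_def less_eq_prod_def)
  have "((\<lambda>\<epsilon>. (g (dir t + (s * \<epsilon>) *\<^sub>R e1) - g (dir t)) / (s * \<epsilon>)) \<longlongrightarrow> radial g t + side_slope g t \<sigma> * ((1 - t) / (1 + s * 0))) (at_right 0)"
  proof (rule Lim_transform_eventually)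
    define u where "u \<epsilon> = (t + s * \<epsilon>) / (1 + s * \<epsilon>)" for \<epsilon>
    have diff: "u \<epsilon> - t = s * \<epsilon> * ((1 - t) / (1 + s * \<epsilon>))" if "0 < \<epsilon>" "\<epsilon> < \<delta>" for \<epsilon>
    proof -
      have "1 + s * \<epsilon> \<noteq> 0" using s that \<delta> t by auto
      then show ?thesis by (simp add: u_def field_simps)
    qed
    have lim: "filterlim u (at_side \<sigma> t) (at_right 0)"
    proof (rule filterlim_at_side[of u t \<delta>])
      show "isCont u 0" unfolding u_def by (intro continuous_intros) auto
      show "0 < side_sign \<sigma> * (u \<epsilon> - t)" if "0 < \<epsilon>" "\<epsilon> < \<delta>" for \<epsilon>
        unfolding diff[OF that] s_def[symmetric] using s that \<delta> t by auto
    qed (use \<delta> in \<open>auto simp: u_def\<close>)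
    show "((\<lambda>\<epsilon>. radial g (u \<epsilon>) + ?\<phi> (u \<epsilon>) * ((1 - t) / (1 + s * \<epsilon>))) \<longlongrightarrow> radial g t + side_slope g t \<sigma> * ((1 - t) / (1 + s * 0))) (at_right 0)"
      by (intro tendsto_intros filterlim_compose[OF radial_tendsto[OF t] lim] filterlim_compose[OF side_slope(1)[OF t] lim]) auto
    show "eventually (\<lambda>\<epsilon>. radial g (u \<epsilon>) + ?\<phi> (u \<epsilon>) * ((1 - t) / (1 + s * \<epsilon>))
        = (g (dir t + (s * \<epsilon>) *\<^sub>R e1) - g (dir t)) / (s * \<epsilon>)) (at_right 0)"
      unfolding eventually_at_right_field
    proof (intro exI[of _ \<delta>] conjI allI impI)
      fix \<epsilon> assume "0 < \<epsilon>" "\<epsilon> < \<delta>"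
      note e = this
      have pos: "0 < 1 + s * \<epsilon>" "0 \<le> u \<epsilon>" "u \<epsilon> \<le> 1" "s * \<epsilon> \<noteq> 0" using s e \<delta> t by (auto simp: u_def field_simps)
      have "dir t + (s * \<epsilon>) *\<^sub>R e1 = (1 + s * \<epsilon>) *\<^sub>R dir (u \<epsilon>)"
        using pos(1) by (simp add: dir_def e1_def u_def field_simps)
      from scale[OF this pos(1-3)] have g1: "g (dir t + (s * \<epsilon>) *\<^sub>R e1) = (1 + s * \<epsilon>) * radial g (u \<epsilon>)" .
      have ne: "u \<epsilon> - t \<noteq> 0" unfolding diff[OF e] using pos t by auto
      have "?\<phi> (u \<epsilon>) * ((1 - t) / (1 + s * \<epsilon>)) = (radial g (u \<epsilon>) - radial g t) / (s * \<epsilon>)"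
        unfolding diff[OF e] by (rule cancel) (use pos t in auto)
      then show "radial g (u \<epsilon>) + ?\<phi> (u \<epsilon>) * ((1 - t) / (1 + s * \<epsilon>)) = (g (dir t + (s * \<epsilon>) *\<^sub>R e1) - g (dir t)) / (s * \<epsilon>)"
        unfolding g1 using pos(4) by (simp add: radial_def[of g t, symmetric]) (simp add: field_simps)
    qed (use \<delta> in auto)
  qed
  from tendsto_Lim[OF _ this] have 1: "Lim (at_right 0) (\<lambda>\<epsilon>. (g (dir t + (s * \<epsilon>) *\<^sub>R e1) - g (dir t)) / (s * \<epsilon>))
      = tangent (radial g) (side_slope g) t \<sigma> 1"
    by (simp add: tangent_def mult.commute)
  have "((\<lambda>\<epsilon>. (g (dir t - (s * \<epsilon>) *\<^sub>R e2) - g (dir t)) / (- (s * \<epsilon>))) \<longlongrightarrow> radial g t - side_slope g t \<sigma> * (t / (1 - s * 0))) (at_right 0)"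
  proof (rule Lim_transform_eventually)
    define u where "u \<epsilon> = t / (1 - s * \<epsilon>)" for \<epsilon>
    have diff: "u \<epsilon> - t = s * \<epsilon> * (t / (1 - s * \<epsilon>))" if "0 < \<epsilon>" "\<epsilon> < \<delta>" for \<epsilon>
    proof -
      have "1 - s * \<epsilon> \<noteq> 0" using s that \<delta> t by auto
      then show ?thesis by (simp add: u_def field_simps)
    qed
    have lim: "filterlim u (at_side \<sigma> t) (at_right 0)"
    proof (rule filterlim_at_side[of u t \<delta>])
      show "isCont u 0" unfolding u_def by (intro continuous_intros) auto
      show "0 < side_sign \<sigma> * (u \<epsilon> - t)" if "0 < \<epsilon>" "\<epsilon> < \<delta>" for \<epsilon>
        unfolding diff[OF that] s_def[symmetric] using s that \<delta> t by auto
    qed (use \<delta> in \<open>auto simp: u_def\<close>)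
    show "((\<lambda>\<epsilon>. radial g (u \<epsilon>) - ?\<phi> (u \<epsilon>) * (t / (1 - s * \<epsilon>))) \<longlongrightarrow> radial g t - side_slope g t \<sigma> * (t / (1 - s * 0))) (at_right 0)"
      by (intro tendsto_intros filterlim_compose[OF radial_tendsto[OF t] lim] filterlim_compose[OF side_slope(1)[OF t] lim]) auto
    show "eventually (\<lambda>\<epsilon>. radial g (u \<epsilon>) - ?\<phi> (u \<epsilon>) * (t / (1 - s * \<epsilon>))
        = (g (dir t - (s * \<epsilon>) *\<^sub>R e2) - g (dir t)) / (- (s * \<epsilon>))) (at_right 0)"
      unfolding eventually_at_right_field
    proof (intro exI[of _ \<delta>] conjI allI impI)
      fix \<epsilon> assume "0 < \<epsilon>" "\<epsilon> < \<delta>"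
      note e = this
      have pos: "0 < 1 - s * \<epsilon>" "0 \<le> u \<epsilon>" "u \<epsilon> \<le> 1" "s * \<epsilon> \<noteq> 0" using s e \<delta> t by (auto simp: u_def field_simps)
      have "dir t - (s * \<epsilon>) *\<^sub>R e2 = (1 - s * \<epsilon>) *\<^sub>R dir (u \<epsilon>)"
        using pos(1) by (simp add: dir_def e2_def u_def field_simps)
      from scale[OF this pos(1-3)] have g1: "g (dir t - (s * \<epsilon>) *\<^sub>R e2) = (1 - s * \<epsilon>) * radial g (u \<epsilon>)" .
      have "?\<phi> (u \<epsilon>) * (t / (1 - s * \<epsilon>)) = (radial g (u \<epsilon>) - radial g t) / (s * \<epsilon>)"
        unfolding diff[OF e] by (rule cancel) (use pos t in auto)
      then show "radial g (u \<epsilon>) - ?\<phi> (u \<epsilon>) * (t / (1 - s * \<epsilon>)) = (g (dir t - (s * \<epsilon>) *\<^sub>R e2) - g (dir t)) / (- (s * \<epsilon>))"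
        unfolding g1 using pos(4) by (simp add: radial_def[of g t, symmetric]) (simp add: field_simps)
    qed (use \<delta> in auto)
  qed
  from tendsto_Lim[OF _ this] have 2: "Lim (at_right 0) (\<lambda>\<epsilon>. (g (dir t - (s * \<epsilon>) *\<^sub>R e2) - g (dir t)) / (- (s * \<epsilon>)))
      = tangent (radial g) (side_slope g) t \<sigma> 0"
    by (simp add: tangent_def mult.commute)
  show ?thesis unfolding side_grad_def Let_def s_def[symmetric] using 1 2 by simp
qed

lemma facet_eq:
  assumes t: "0 < t" "t < 1"
  shows "facet g (dir t) = dir ` flat_part (radial g) (side_slope g) t"
proof -
  have "side_facet g (dir t) \<sigma> = dir ` {s. 0 < s \<and> s < 1 \<and> radial g s = tangent (radial g) (side_slope g) t \<sigma> s}" for \<sigma>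
  proof -
    have "g (dir s) - g (dir t) = side_grad g (dir t) \<sigma> \<bullet> (dir s - dir t)
        \<longleftrightarrow> radial g s = tangent (radial g) (side_slope g) t \<sigma> s" for s
    proof -
      have "side_grad g (dir t) \<sigma> \<bullet> (dir s - dir t) = (s - t) * side_slope g t \<sigma>"
        unfolding side_grad_eq[OF t] by (simp add: dir_def tangent_def algebra_simps)
      then show ?thesis by (auto simp: radial_def tangent_def)
    qed
    then show ?thesis unfolding side_facet_def ri_dirs_eq by auto
  qed
  then have "facet g (dir t) = dir ` ({s. 0 < s \<and> s < 1 \<and> radial g s = tangent (radial g) (side_slope g) t Minus s}
      \<union> {s. 0 < s \<and> s < 1 \<and> radial g s = tangent (radial g) (side_slope g) t Plus s})"
    by (simp add: facet_def image_Un)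
  also have "{s. 0 < s \<and> s < 1 \<and> radial g s = tangent (radial g) (side_slope g) t Minus s}
      \<union> {s. 0 < s \<and> s < 1 \<and> radial g s = tangent (radial g) (side_slope g) t Plus s}
      = flat_part (radial g) (side_slope g) t"
    unfolding flat_part_def by (auto, metis side.exhaust)
  finally show ?thesis .
qed

lemma diff_dirs_slope:
  assumes "dir t \<in> diff_dirs g"
  shows "side_slope g t Plus = side_slope g t Minus"
proof -
  have t: "0 < t" "t < 1" and "g differentiable (at (dir t))" using assms by (auto simp: diff_dirs_def)
  then obtain g' where g': "(g has_derivative g') (at (dir t))" by (auto simp: differentiable_def)
  have "((\<lambda>s. dir s) has_derivative (\<lambda>x. (x, - x))) (at t)"
    unfolding dir_def by (auto intro!: derivative_eq_intros)
  from has_derivative_compose[OF this g'] have "(radial g has_derivative (\<lambda>x. g' (x, - x))) (at t)"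
    by (simp add: radial_def[abs_def])
  then have "radial g differentiable (at t)" by (auto simp: differentiable_def)
  then obtain c where "(radial g has_real_derivative c) (at t)" by (auto simp: real_differentiable_def)
  then have lim: "((\<lambda>s. (radial g s - radial g t) / (s - t)) \<longlongrightarrow> c) (at t)"
    by (simp add: has_field_derivative_iff)
  have "side_slope g t \<sigma> = c" for \<sigma>
  proof (rule tendsto_unique[OF _ side_slope(1)[OF t]])
    show "at_side \<sigma> t \<noteq> bot" by (cases \<sigma>) (auto simp: at_side_def)
    show "((\<lambda>s. (radial g s - radial g t) / (s - t)) \<longlongrightarrow> c) (at_side \<sigma> t)"
      using lim by (cases \<sigma>) (auto simp: at_side_def intro: filterlim_mono[OF _ order_refl at_le])
  qed
  then show ?thesis by simp
qed

end

section \<open>The Busemann process\<close>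

definition rational_dirs :: "real set" where "rational_dirs = \<rat> \<inter> {0<..<1}"

lemma countable_rational_dirs: "countable rational_dirs"
  unfolding rational_dirs_def by (intro countable_Int1 countable_rat)

lemma rational_dirs_dense:
  assumes "0 \<le> s" "s < t" "t \<le> 1" shows "\<exists>q\<in>rational_dirs. s < q \<and> q < t"
proof -
  obtain q where "q \<in> \<rat>" "s < q" "q < t" using Rats_dense_in_real[OF assms(2)] by blast
  then show ?thesis using assms by (intro bexI[of _ q]) (auto simp: rational_dirs_def)
qed

text \<open>An open interval is connected, so a locally constant function is constant on it.\<close>

lemma loc_const_interval:
  assumes "\<And>v. p < v \<Longrightarrow> v < q \<Longrightarrow> loc_const f v"
  shows "\<exists>c. \<forall>v \<sigma>. p < v \<and> v < q \<longrightarrow> f (dir v) \<sigma> = c"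
proof (cases "p < q")
  case True
  have near: "eventually (\<lambda>w. \<forall>\<sigma> \<tau>. f (dir v) \<sigma> = f (dir w) \<tau>) (at v within {p<..<q})" if v: "v \<in> {p<..<q}" for v
  proof -
    obtain s u c where *: "s < v" "v < u" "\<And>w \<sigma>. s < w \<Longrightarrow> w < u \<Longrightarrow> f (dir w) \<sigma> = c"
      using assms[of v] v by (auto simp: loc_const_def)
    have "eventually (\<lambda>w. w \<in> {s<..<u}) (at v within {p<..<q})"
      unfolding eventually_at_topological using * by (intro exI[of _ "{s<..<u}"]) auto
    then show ?thesis using * by (auto elim: eventually_mono)
  qed
  define m where "m = (p + q) / 2"
  have m: "m \<in> {p<..<q}" using True by (auto simp: m_def)
  have "f (dir v) \<sigma> = f (dir m) Plus" if "v \<in> {p<..<q}" for v \<sigma>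
  proof -
    have "f (dir m) Plus = f (dir v) Plus"
    proof (rule connected_local_const[of "{p<..<q}" m v "\<lambda>v. f (dir v) Plus"])
      show "\<forall>a\<in>{p<..<q}. eventually (\<lambda>b. f (dir a) Plus = f (dir b) Plus) (at a within {p<..<q})"
      proof
        fix a assume "a \<in> {p<..<q}"
        from near[OF this] show "eventually (\<lambda>b. f (dir a) Plus = f (dir b) Plus) (at a within {p<..<q})"
          by eventually_elim blast
      qed
    qed (use m that in auto)
    moreover have "f (dir v) \<sigma> = f (dir v) Plus"
      using assms[of v] that by (auto simp: loc_const_def)
    ultimately show ?thesis by simp
  qed
  then show ?thesis by auto
qed auto

lemma (in prob_space) expectation_pos:
  fixes X :: "'a \<Rightarrow> real"
  assumes X: "integrable M X" and nonneg: "AE \<omega> in M. 0 \<le> X \<omega>" and P: "0 < prob {\<omega> \<in> space M. 1 \<le> X \<omega>}"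
  shows "0 < expectation X"
proof -
  have [measurable]: "X \<in> borel_measurable M" using X by simp
  have "prob {\<omega> \<in> space M. 1 \<le> X \<omega>} = (\<integral>\<omega>. indicator {\<omega> \<in> space M. 1 \<le> X \<omega>} \<omega> \<partial>M)"
    by (simp add: Int_absorb2)
  also have "\<dots> \<le> expectation X"
  proof (rule integral_mono_AE[OF _ X])
    show "integrable M (indicat_real {\<omega> \<in> space M. 1 \<le> X \<omega>})"
      by (rule integrable_real_indicator) (auto simp: emeasure_eq_measure)
    show "AE \<omega> in M. indicat_real {\<omega> \<in> space M. 1 \<le> X \<omega>} \<omega> \<le> X \<omega>"
      using nonneg by eventually_elim (auto simp: indicator_def)
  qed
  finally show ?thesis using P by simp
qed

lemma all_side: "(\<forall>\<sigma>. P \<sigma>) \<longleftrightarrow> P Plus \<and> P Minus"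
  by (metis side.exhaust)

lemma generated_events_mono: "F \<subseteq> F' \<Longrightarrow> generated_events M F \<subseteq> generated_events M F'"
  unfolding generated_events_def by (intro sigma_sets_mono') blast

lemma coalesce_if_merge:
  assumes c: "cocycle W b" and s: "\<And>z. s z = busemann_step b \<sigma> z" and sm: "step_map s"
    and merge: "\<And>u v. level u = level v \<Longrightarrow> step_map.merge s u v"
  shows "coalesce (cocycle.gam b \<sigma> x) (cocycle.gam b \<sigma> y)"
proof -
  interpret cocycle W b by (rule c)
  define k where "k = max (level x) (level y)"
  have k: "level x \<le> k" "level y \<le> k" by (auto simp: k_def)
  have "step_map.merge s (gam \<sigma> x k) (gam \<sigma> y k)" using k by (intro merge) (simp add: level_gam)
  then obtain n where n: "(s ^^ n) (gam \<sigma> x k) = (s ^^ n) (gam \<sigma> y k)"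
    using step_map.merge_def[OF sm] by blast
  have "s = busemann_step b \<sigma>" using s by (rule ext)
  then have "gam \<sigma> z (k + int n) = (s ^^ n) (gam \<sigma> z k)" if "level z \<le> k" for z
    using gam_restart[OF that, of "k + int n" \<sigma>] level_gam[OF that, of \<sigma>] by (simp add: gam_def)
  then have "gam \<sigma> x (k + int n) = gam \<sigma> y (k + int n)" using n k by simp
  then show ?thesis unfolding coalesce_iff using k by (intro exI[of _ "k + int n"]) auto
qed

context busemann_process begin

abbreviation "b t \<sigma> x y \<omega> \<equiv> B (dir t) \<sigma> x y \<omega>"

text \<open>\<open>B_regular\<close> read in the coordinate \<open>t\<close> and for a single
  \<open>\<omega>\<close>, so that pathwise arguments need not mention the event.\<close>

definition basic :: "'w \<Rightarrow> bool" where
  "basic \<omega> \<longleftrightarrow>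
    (\<forall>t \<sigma>. 0 < t \<and> t < 1 \<longrightarrow> cocycle (\<lambda>z. w z \<omega>) (\<lambda>x y. b t \<sigma> x y \<omega>) \<and>
      (\<forall>x y z. b t \<sigma> (x + z) (y + z) \<omega> = b t \<sigma> x y (T z \<omega>)) \<and>
      (\<forall>x y. ((\<lambda>s. b s \<sigma> x y \<omega>) \<longlongrightarrow> b t Minus x y \<omega>) (at_left t)) \<and>
      (\<forall>x y. ((\<lambda>s. b s \<sigma> x y \<omega>) \<longlongrightarrow> b t Plus x y \<omega>) (at_right t))) \<and>
    (\<forall>s t \<sigma> \<tau> x. 0 < s \<and> s < t \<and> t < 1 \<longrightarrow>
      b t \<tau> x (x + e1) \<omega> \<le> b s \<sigma> x (x + e1) \<omega> \<and> b s \<sigma> x (x + e2) \<omega> \<le> b t \<tau> x (x + e2) \<omega>) \<and>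
    (\<forall>t x. 0 < t \<and> t < 1 \<longrightarrow>
      b t Plus x (x + e1) \<omega> \<le> b t Minus x (x + e1) \<omega> \<and> b t Minus x (x + e2) \<omega> \<le> b t Plus x (x + e2) \<omega>) \<and>
    (\<forall>\<sigma> x. filterlim (\<lambda>t. b t \<sigma> x (x + e1) \<omega>) at_top (at_right 0) \<and>
      filterlim (\<lambda>t. b t \<sigma> x (x + e2) \<omega>) at_top (at_left 1))"

lemma filterlim_dir_end:
  "filterlim dir (at e2 within ri_dirs) (at_right 0)" "filterlim dir (at e1 within ri_dirs) (at_left 1)"
proof -
  have e: "e2 = dir 0" "e1 = dir 1" by (auto simp: dir_def e1_def e2_def)
  have "eventually (\<lambda>t. 0 < t \<and> t < 1) (at_right (0::real))"
    unfolding eventually_at_right_field by (intro exI[of _ 1]) auto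
  moreover have "(dir \<longlongrightarrow> dir 0) (at_right 0)" unfolding dir_def by (intro tendsto_intros)
  ultimately show "filterlim dir (at e2 within ri_dirs) (at_right 0)"
    unfolding e filterlim_at by (auto elim: eventually_mono)
  have "eventually (\<lambda>t. 0 < t \<and> t < 1) (at_left (1::real))"
    unfolding eventually_at_left_field by (intro exI[of _ 0]) auto
  moreover have "(dir \<longlongrightarrow> dir 1) (at_left 1)" unfolding dir_def by (intro tendsto_intros)
  ultimately show "filterlim dir (at e1 within ri_dirs) (at_left 1)"
    unfolding e filterlim_at by (auto elim: eventually_mono)
qed

lemma basic_event:
  obtains \<Omega>\<^sub>0 where "\<Omega>\<^sub>0 \<in> events" "prob \<Omega>\<^sub>0 = 1" "\<And>z \<omega>. T z \<omega> \<in> \<Omega>\<^sub>0 \<longleftrightarrow> \<omega> \<in> \<Omega>\<^sub>0" "\<And>\<omega>. \<omega> \<in> \<Omega>\<^sub>0 \<Longrightarrow> basic \<omega>"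
proof -
  obtain \<Omega>\<^sub>0 where ev: "\<Omega>\<^sub>0 \<in> events" "prob \<Omega>\<^sub>0 = 1" and inv: "\<forall>z. T z -` \<Omega>\<^sub>0 = \<Omega>\<^sub>0"
    and dirs: "\<forall>\<omega>\<in>\<Omega>\<^sub>0. \<forall>\<xi>\<in>ri_dirs.
        (\<forall>\<sigma> x y z. B \<xi> \<sigma> (x + z) (y + z) \<omega> = B \<xi> \<sigma> x y (T z \<omega>)) \<and>
        (\<forall>\<sigma> x y z. B \<xi> \<sigma> x y \<omega> + B \<xi> \<sigma> y z \<omega> = B \<xi> \<sigma> x z \<omega>) \<and>
        (\<forall>\<sigma> x. min (B \<xi> \<sigma> x (x + e1) \<omega>) (B \<xi> \<sigma> x (x + e2) \<omega>) = w x \<omega>) \<and>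
        (\<forall>\<xi>'\<in>ri_dirs. \<xi> \<prec> \<xi>' \<longrightarrow> (\<forall>x.
           B \<xi> Minus x (x + e1) \<omega> \<ge> B \<xi> Plus x (x + e1) \<omega> \<and>
           B \<xi> Plus x (x + e1) \<omega> \<ge> B \<xi>' Minus x (x + e1) \<omega> \<and>
           B \<xi>' Minus x (x + e1) \<omega> \<ge> B \<xi>' Plus x (x + e1) \<omega> \<and>
           B \<xi> Minus x (x + e2) \<omega> \<le> B \<xi> Plus x (x + e2) \<omega> \<and>
           B \<xi> Plus x (x + e2) \<omega> \<le> B \<xi>' Minus x (x + e2) \<omega> \<and>
           B \<xi>' Minus x (x + e2) \<omega> \<le> B \<xi>' Plus x (x + e2) \<omega>)) \<and>
        (\<forall>\<sigma> x y. ((\<lambda>\<zeta>. B \<zeta> \<sigma> x y \<omega>) \<longlongrightarrow> B \<xi> Minus x y \<omega>) (dir_at_left \<xi>)) \<and>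
        (\<forall>\<sigma> x y. ((\<lambda>\<zeta>. B \<zeta> \<sigma> x y \<omega>) \<longlongrightarrow> B \<xi> Plus x y \<omega>) (dir_at_right \<xi>))"
    and ends: "\<forall>\<omega>\<in>\<Omega>\<^sub>0. \<forall>\<sigma> x.
        filterlim (\<lambda>\<xi>. B \<xi> \<sigma> x (x + e1) \<omega>) at_top (at e2 within ri_dirs) \<and>
        filterlim (\<lambda>\<xi>. B \<xi> \<sigma> x (x + e2) \<omega>) at_top (at e1 within ri_dirs)"
    using B_regular by (elim bexE conjE)
  have "basic \<omega>" if \<omega>: "\<omega> \<in> \<Omega>\<^sub>0" for \<omega>
    unfolding basic_def
  proof (intro conjI allI impI; (elim conjE)?)
    fix t \<sigma> assume t: "0 < t" "t < (1::real)"
    have "dir t \<in> ri_dirs" using t by simp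
    note D = dirs[THEN bspec, OF \<omega>, THEN bspec, OF this]
    show "cocycle (\<lambda>z. w z \<omega>) (\<lambda>x y. b t \<sigma> x y \<omega>)"
      unfolding cocycle_def using D by blast
    show "b t \<sigma> (x + z) (y + z) \<omega> = b t \<sigma> x y (T z \<omega>)" for x y z
      using D by blast
    show "((\<lambda>s. b s \<sigma> x y \<omega>) \<longlongrightarrow> b t Minus x y \<omega>) (at_left t)" for x y
      by (rule tendsto_dir_at_left[OF t]) (use D in blast)
    show "((\<lambda>s. b s \<sigma> x y \<omega>) \<longlongrightarrow> b t Plus x y \<omega>) (at_right t)" for x y
      by (rule tendsto_dir_at_right[OF t]) (use D in blast)
  next
    have le: "B (dir s) Minus x (x + e1) \<omega> \<ge> B (dir s) Plus x (x + e1) \<omega> \<and>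
           B (dir s) Plus x (x + e1) \<omega> \<ge> B (dir t) Minus x (x + e1) \<omega> \<and>
           B (dir t) Minus x (x + e1) \<omega> \<ge> B (dir t) Plus x (x + e1) \<omega> \<and>
           B (dir s) Minus x (x + e2) \<omega> \<le> B (dir s) Plus x (x + e2) \<omega> \<and>
           B (dir s) Plus x (x + e2) \<omega> \<le> B (dir t) Minus x (x + e2) \<omega> \<and>
           B (dir t) Minus x (x + e2) \<omega> \<le> B (dir t) Plus x (x + e2) \<omega>"
      if "0 < s" "s < t" "t < 1" for s t x
    proof -
      have "dir s \<in> ri_dirs" "dir t \<in> ri_dirs" "dir s \<prec> dir t" using that by auto
      then show ?thesis using dirs \<omega> by blast
    qed
    show "b t \<tau> x (x + e1) \<omega> \<le> b s \<sigma> x (x + e1) \<omega>" "b s \<sigma> x (x + e2) \<omega> \<le> b t \<tau> x (x + e2) \<omega>"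
      if "0 < s" "s < t" "t < 1" for s t \<sigma> \<tau> x
      using le[OF that, of x] by (cases \<sigma>; cases \<tau>; simp)+
    show "b t Plus x (x + e1) \<omega> \<le> b t Minus x (x + e1) \<omega>" "b t Minus x (x + e2) \<omega> \<le> b t Plus x (x + e2) \<omega>"
      if "0 < t" "t < 1" for t x
      \<comment> \<open>\<open>B_regular\<close> compares the two sides of one direction only
        alongside a larger direction; this one is an arbitrary choice.\<close>
      using le[of t "(t + 1) / 2" x] that by auto
  next
    fix \<sigma> x
    show "filterlim (\<lambda>t. b t \<sigma> x (x + e1) \<omega>) at_top (at_right 0)"
    proof -
      have "filterlim (\<lambda>\<xi>. B \<xi> \<sigma> x (x + e1) \<omega>) at_top (at e2 within ri_dirs)" using ends \<omega> by blast
      from filterlim_compose[OF this filterlim_dir_end(1)] show ?thesis .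
    qed
    show "filterlim (\<lambda>t. b t \<sigma> x (x + e2) \<omega>) at_top (at_left 1)"
    proof -
      have "filterlim (\<lambda>\<xi>. B \<xi> \<sigma> x (x + e2) \<omega>) at_top (at e1 within ri_dirs)" using ends \<omega> by blast
      from filterlim_compose[OF this filterlim_dir_end(2)] show ?thesis .
    qed
  qed
  moreover have "T z \<omega> \<in> \<Omega>\<^sub>0 \<longleftrightarrow> \<omega> \<in> \<Omega>\<^sub>0" for z \<omega> using inv by blast
  ultimately show thesis by (intro that[OF ev])
qed

lemma AE_basic: "AE \<omega> in M. basic \<omega>"
proof -
  obtain \<Omega>\<^sub>0 where "prob \<Omega>\<^sub>0 = 1" "\<And>\<omega>. \<omega> \<in> \<Omega>\<^sub>0 \<Longrightarrow> basic \<omega>" using basic_event by metis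
  then show ?thesis using AE_prob_1[of \<Omega>\<^sub>0] by (auto elim: eventually_mono)
qed

lemma basicD:
  assumes "basic \<omega>"
  shows "0 < t \<Longrightarrow> t < 1 \<Longrightarrow> cocycle (\<lambda>z. w z \<omega>) (\<lambda>x y. b t \<sigma> x y \<omega>)"
    "0 < t \<Longrightarrow> t < 1 \<Longrightarrow> b t \<sigma> (x + z) (y + z) \<omega> = b t \<sigma> x y (T z \<omega>)"
    "0 < t \<Longrightarrow> t < 1 \<Longrightarrow> ((\<lambda>s. b s \<sigma> x y \<omega>) \<longlongrightarrow> b t Minus x y \<omega>) (at_left t)"
    "0 < t \<Longrightarrow> t < 1 \<Longrightarrow> ((\<lambda>s. b s \<sigma> x y \<omega>) \<longlongrightarrow> b t Plus x y \<omega>) (at_right t)"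
    "0 < s \<Longrightarrow> s < t \<Longrightarrow> t < 1 \<Longrightarrow> b t \<tau> x (x + e1) \<omega> \<le> b s \<sigma> x (x + e1) \<omega>"
    "0 < s \<Longrightarrow> s < t \<Longrightarrow> t < 1 \<Longrightarrow> b s \<sigma> x (x + e2) \<omega> \<le> b t \<tau> x (x + e2) \<omega>"
    "0 < t \<Longrightarrow> t < 1 \<Longrightarrow> b t Plus x (x + e1) \<omega> \<le> b t Minus x (x + e1) \<omega>"
    "0 < t \<Longrightarrow> t < 1 \<Longrightarrow> b t Minus x (x + e2) \<omega> \<le> b t Plus x (x + e2) \<omega>"
    "filterlim (\<lambda>t. b t \<sigma> x (x + e1) \<omega>) at_top (at_right 0)"
    "filterlim (\<lambda>t. b t \<sigma> x (x + e2) \<omega>) at_top (at_left 1)"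
  using assms unfolding basic_def by blast+

abbreviation "hg \<equiv> radial g"
abbreviation "dg \<equiv> side_slope g"
abbreviation "Lg \<equiv> tangent hg dg"

lemmas g_facts = g_concave g_homogeneous

lemma side_grad_dir: "0 < t \<Longrightarrow> t < 1 \<Longrightarrow> side_grad g (dir t) \<sigma> = (Lg t \<sigma> 1, Lg t \<sigma> 0)"
  by (rule side_grad_eq[OF g_facts])

lemma mean_dir:
  assumes "0 < t" "t < 1"
  shows "expectation (b t \<sigma> x (x + e1)) = Lg t \<sigma> 1" "expectation (b t \<sigma> x (x + e2)) = Lg t \<sigma> 0"
  using B_mean[of "dir t" \<sigma> x] assms by (simp_all add: side_grad_dir e1_def e2_def)

lemma b_integrable: "0 < t \<Longrightarrow> t < 1 \<Longrightarrow> integrable M (b t \<sigma> x y)"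
  by (rule B_integrable) simp

text \<open>The gradient components are means of increments. The increment along \<open>e2\<close>
  grows monotonically to infinity as the direction tends to \<open>e1\<close>, so eventually it
  exceeds its value at \<open>t\<close> by 1 with positive probability and its mean is strictly
  larger. The other end is symmetric.\<close>

lemma steep:
  assumes t: "0 < t" "t < 1"
  shows "\<exists>q\<in>rational_dirs. t < q \<and> Lg t \<sigma> 0 < Lg q \<tau> 0"
    "\<exists>q\<in>rational_dirs. q < t \<and> Lg t \<sigma> 1 < Lg q \<tau> 1"
proof -
  define q where "q n = 1 - 1 / real (n + 2)" for n :: nat
  have q: "0 < q n" "q n < 1" "q n \<in> \<rat>" "1 - q n \<in> \<rat>" for n by (auto simp: q_def field_simps)
  have lim: "filterlim q (at_left 1) sequentially"
  proof -
    have "(\<lambda>n. 1 / real (n + 2)) \<longlonglongrightarrow> 0"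
      using LIMSEQ_ignore_initial_segment[OF lim_1_over_n, of 2] by simp
    from tendsto_diff[OF tendsto_const[of 1] this] have "q \<longlonglongrightarrow> 1" by (simp add: q_def[abs_def])
    then show ?thesis using q by (auto simp: filterlim_at less_imp_neq)
  qed
  have lim': "filterlim (\<lambda>n. 1 - q n) (at_right 0) sequentially"
  proof -
    have "filterlim (\<lambda>s. 1 - s) (at_right (0::real)) (at_left 1)"
      using filterlim_reflect_left[of 1] by simp
    from filterlim_compose[OF this lim] show ?thesis .
  qed
  have prob_pos: "\<exists>N. \<forall>n\<ge>N. 0 < prob {\<omega> \<in> space M. 1 \<le> X n \<omega>}"
    if [measurable]: "\<And>n. X n \<in> borel_measurable M" and "AE \<omega> in M. filterlim (\<lambda>n. X n \<omega>) at_top sequentially"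
    for X :: "nat \<Rightarrow> 'w \<Rightarrow> real"
  proof -
    have "AE \<omega> in M. eventually (\<lambda>n. 1 \<le> X n \<omega>) sequentially"
      using that(2) by eventually_elim (simp add: filterlim_at_top)
    from AE_eventually_imp_prob[of "\<lambda>n \<omega>. 1 \<le> X n \<omega>" 1, OF _ this] show ?thesis by auto
  qed
  have [measurable]: "b s \<rho> x y \<in> borel_measurable M" if "0 < s" "s < 1" for s \<rho> x y
    using b_integrable[OF that] by simp
  show "\<exists>q\<in>rational_dirs. t < q \<and> Lg t \<sigma> 0 < Lg q \<tau> 0"
  proof -
    define X where "X n \<omega> = b (q n) \<tau> 0 (0 + e2) \<omega> - b t \<sigma> 0 (0 + e2) \<omega>" for n \<omega>
    have "AE \<omega> in M. filterlim (\<lambda>n. X n \<omega>) at_top sequentially"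
      using AE_basic
    proof eventually_elim
      case (elim \<omega>)
      have "filterlim (\<lambda>n. b (q n) \<tau> 0 (0 + e2) \<omega>) at_top sequentially"
        by (rule filterlim_compose[OF basicD(10)[OF elim] lim])
      from filterlim_tendsto_add_at_top[OF tendsto_const[of "- b t \<sigma> 0 (0 + e2) \<omega>"] this]
      show ?case by (simp add: X_def)
    qed
    moreover have "X n \<in> borel_measurable M" for n
      unfolding X_def using q t by (intro borel_measurable_diff) auto
    ultimately obtain N where N: "\<And>n. n \<ge> N \<Longrightarrow> 0 < prob {\<omega> \<in> space M. 1 \<le> X n \<omega>}"
      using prob_pos[of X] by blast
    have "eventually (\<lambda>s. t < s) (at_left 1)" using t by (auto simp: eventually_at_left_field)
    then have "eventually (\<lambda>n. t < q n) sequentially" using lim by (rule eventually_compose_filterlim)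
    then obtain n where n: "n \<ge> N" "t < q n"
      unfolding eventually_sequentially by (metis nle_le)
    have "0 < expectation (X n)"
    proof (rule expectation_pos[OF _ _ N[OF n(1)]])
      show "integrable M (X n)" unfolding X_def using q t by (intro Bochner_Integration.integrable_diff b_integrable) auto
      show "AE \<omega> in M. 0 \<le> X n \<omega>"
        using AE_basic
      proof eventually_elim
        case (elim \<omega>)
        show ?case using basicD(6)[OF elim t(1) n(2) q(2), of \<sigma> 0 \<tau>] by (simp add: X_def)
      qed
    qed
    also have "expectation (X n) = Lg (q n) \<tau> 0 - Lg t \<sigma> 0"
      unfolding X_def using q t
      by (subst Bochner_Integration.integral_diff) (auto simp only: mean_dir intro!: b_integrable)
    finally show ?thesis using n(2) q by (intro bexI[of _ "q n"]) (auto simp: rational_dirs_def)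
  qed
  show "\<exists>q\<in>rational_dirs. q < t \<and> Lg t \<sigma> 1 < Lg q \<tau> 1"
  proof -
    define X where "X n \<omega> = b (1 - q n) \<tau> 0 (0 + e1) \<omega> - b t \<sigma> 0 (0 + e1) \<omega>" for n \<omega>
    have q': "0 < 1 - q n" "1 - q n < 1" for n using q by auto
    have "AE \<omega> in M. filterlim (\<lambda>n. X n \<omega>) at_top sequentially"
      using AE_basic
    proof eventually_elim
      case (elim \<omega>)
      have "filterlim (\<lambda>n. b (1 - q n) \<tau> 0 (0 + e1) \<omega>) at_top sequentially"
        by (rule filterlim_compose[OF basicD(9)[OF elim] lim'])
      from filterlim_tendsto_add_at_top[OF tendsto_const[of "- b t \<sigma> 0 (0 + e1) \<omega>"] this]
      show ?case by (simp add: X_def)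
    qed
    moreover have "X n \<in> borel_measurable M" for n
      unfolding X_def using q' t by (intro borel_measurable_diff) auto
    ultimately obtain N where N: "\<And>n. n \<ge> N \<Longrightarrow> 0 < prob {\<omega> \<in> space M. 1 \<le> X n \<omega>}"
      using prob_pos[of X] by blast
    have "eventually (\<lambda>s. s < t) (at_right 0)" using t by (auto simp: eventually_at_right_field)
    then have "eventually (\<lambda>n. 1 - q n < t) sequentially" using lim' by (rule eventually_compose_filterlim)
    then obtain n where n: "n \<ge> N" "1 - q n < t"
      unfolding eventually_sequentially by (metis nle_le)
    have "0 < expectation (X n)"
    proof (rule expectation_pos[OF _ _ N[OF n(1)]])
      show "integrable M (X n)" unfolding X_def using q' t by (intro Bochner_Integration.integrable_diff b_integrable) auto
      show "AE \<omega> in M. 0 \<le> X n \<omega>"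
        using AE_basic
      proof eventually_elim
        case (elim \<omega>)
        show ?case using basicD(5)[OF elim q'(1) n(2) t(2), of \<sigma> 0 \<tau>] by (simp add: X_def)
      qed
    qed
    also have "expectation (X n) = Lg (1 - q n) \<tau> 1 - Lg t \<sigma> 1"
      unfolding X_def using q' t
      by (subst Bochner_Integration.integral_diff) (auto simp only: mean_dir intro!: b_integrable)
    finally show ?thesis using n(2) q q' by (intro bexI[of _ "1 - q n"]) (auto simp: rational_dirs_def)
  qed
qed

lemma AE_coalesce:
  assumes t: "0 < t" "t < 1"
  shows "AE \<omega> in M. \<forall>x y. coalesce (cocycle.gam (\<lambda>x y. b t \<sigma> x y \<omega>) \<sigma> x) (cocycle.gam (\<lambda>x y. b t \<sigma> x y \<omega>) \<sigma> y)"
proof -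
  obtain \<Omega>\<^sub>0 where ev: "\<Omega>\<^sub>0 \<in> events" "prob \<Omega>\<^sub>0 = 1" and inv: "\<And>z \<omega>. T z \<omega> \<in> \<Omega>\<^sub>0 \<longleftrightarrow> \<omega> \<in> \<Omega>\<^sub>0"
    and basic: "\<And>\<omega>. \<omega> \<in> \<Omega>\<^sub>0 \<Longrightarrow> basic \<omega>" using basic_event by metis
  have fixed: "AE \<omega> in M. (\<forall>x. b t \<sigma> x (x + e1) \<omega> \<noteq> b t \<sigma> x (x + e2) \<omega>) \<and>
      (\<lambda>n. Max ((\<lambda>x. \<bar>b t \<sigma> 0 x \<omega> - real_site x \<bullet> side_grad g (dir t) \<sigma>\<bar>) ` quadrant_layer n) / real n) \<longlonglongrightarrow> 0"
    using B_fixed_dir[of "dir t"] t by (auto elim: eventually_mono)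
  have inner: "real_site x \<bullet> side_grad g (dir t) \<sigma> = of_int (fst x) * Lg t \<sigma> 1 + of_int (snd x) * Lg t \<sigma> 0" for x
    using t by (simp add: side_grad_dir real_site_def)
  interpret S: stationary_cocycle M T w "b t \<sigma>" "Lg t \<sigma> 1" "Lg t \<sigma> 0" \<Omega>\<^sub>0
  proof
    show "b t \<sigma> x y \<in> borel_measurable M" for x y using b_integrable[OF t] by simp
    show "\<Omega>\<^sub>0 \<in> events" "prob \<Omega>\<^sub>0 = 1" by fact+
    show "T z \<omega> \<in> \<Omega>\<^sub>0 \<longleftrightarrow> \<omega> \<in> \<Omega>\<^sub>0" for z \<omega> by (rule inv)
    show "b t \<sigma> (x + z) (y + z) \<omega> = b t \<sigma> x y (T z \<omega>)" if "\<omega> \<in> \<Omega>\<^sub>0" for x y z \<omega>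
      by (rule basicD(2)[OF basic[OF that] t])
    show "b t \<sigma> x y \<omega> + b t \<sigma> y z \<omega> = b t \<sigma> x z \<omega>" if "\<omega> \<in> \<Omega>\<^sub>0" for x y z \<omega>
      using cocycle.add[OF basicD(1)[OF basic[OF that] t]] .
    show "min (b t \<sigma> x (x + e1) \<omega>) (b t \<sigma> x (x + e2) \<omega>) = w x \<omega>" if "\<omega> \<in> \<Omega>\<^sub>0" for x \<omega>
      using cocycle.recover[OF basicD(1)[OF basic[OF that] t]] .
    show "AE \<omega> in M. (\<lambda>n. Max ((\<lambda>x. \<bar>b t \<sigma> 0 x \<omega> - (of_int (fst x) * Lg t \<sigma> 1 + of_int (snd x) * Lg t \<sigma> 0)\<bar>)
        ` quadrant_layer n) / real n) \<longlonglongrightarrow> 0"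
      using fixed unfolding inner by (auto elim: eventually_mono)
    show "indep_set (generated_events M ({w x | x. x \<in> I} \<union> {b t \<sigma> x y | x y. x \<in> I \<and> x \<le> y}))
      (generated_events M {w x | x. \<forall>z\<in>I. \<not> z \<le> x})" for I
    proof -
      have "generated_events M ({w x | x. x \<in> I} \<union> {b t \<sigma> x y | x y. x \<in> I \<and> x \<le> y})
        \<subseteq> generated_events M ({w x | x. x \<in> I} \<union> {B \<xi> \<sigma> x y | \<xi> \<sigma> x y. \<xi> \<in> ri_dirs \<and> x \<in> I \<and> x \<le> y})"
      proof (rule generated_events_mono)
        have "dir t \<in> ri_dirs" using t by simp
        then show "{w x | x. x \<in> I} \<union> {b t \<sigma> x y | x y. x \<in> I \<and> x \<le> y}
          \<subseteq> {w x | x. x \<in> I} \<union> {B \<xi> \<sigma> x y | \<xi> \<sigma> x y. \<xi> \<in> ri_dirs \<and> x \<in> I \<and> x \<le> y}" by blast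
      qed
      then show ?thesis using B_indep[of I] unfolding indep_sets2_eq by blast
    qed
  qed
  show ?thesis
    using S.AE_merge fixed S.AE_good
  proof eventually_elim
    case (elim \<omega>)
    have st: "S.st \<omega> z = busemann_step (\<lambda>x y. b t \<sigma> x y \<omega>) \<sigma> z" for z
    proof -
      have "b t \<sigma> z (z + e1) \<omega> \<noteq> b t \<sigma> z (z + e2) \<omega>" using elim(2) by blast
      then show ?thesis unfolding S.st_def busemann_step_def by simp
    qed
    show ?case
      using coalesce_if_merge[OF basicD(1)[OF basic[OF elim(3)] t] st S.sm.step_map_axioms] elim(1) by blast
  qed
qed

text \<open>The shape of \<open>B\<close> from the origin, transported to each of the countably many
  sites by stationarity.\<close>

lemma AE_asymp:
  assumes t: "0 < t" "t < 1"
  shows "AE \<omega> in M. \<forall>x \<epsilon>. 0 < \<epsilon> \<longrightarrow> (\<exists>n0. \<forall>y. x \<le> y \<and> n0 \<le> level y - level x \<longrightarrow>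
      \<bar>b t \<sigma> x y \<omega> - (of_int (fst y - fst x) * Lg t \<sigma> 1 + of_int (snd y - snd x) * Lg t \<sigma> 0)\<bar>
        \<le> \<epsilon> * of_int (level y - level x))"
  unfolding AE_all_countable
proof
  fix x
  have "AE \<omega> in M. (\<lambda>n. Max ((\<lambda>x. \<bar>b t \<sigma> 0 x \<omega> - real_site x \<bullet> side_grad g (dir t) \<sigma>\<bar>) ` quadrant_layer n) / real n) \<longlonglongrightarrow> 0"
    using B_fixed_dir[of "dir t"] t by (auto elim: eventually_mono)
  from T_shift_AE[OF this, of x] AE_basic
  show "AE \<omega> in M. \<forall>\<epsilon>. 0 < \<epsilon> \<longrightarrow> (\<exists>n0. \<forall>y. x \<le> y \<and> n0 \<le> level y - level x \<longrightarrow>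
      \<bar>b t \<sigma> x y \<omega> - (of_int (fst y - fst x) * Lg t \<sigma> 1 + of_int (snd y - snd x) * Lg t \<sigma> 0)\<bar>
        \<le> \<epsilon> * of_int (level y - level x))"
  proof eventually_elim
    case (elim \<omega>)
    show ?case
    proof (intro allI impI)
      fix \<epsilon> :: real assume "0 < \<epsilon>"
      obtain n0 where n0: "\<And>n z. n \<ge> n0 \<Longrightarrow> z \<in> quadrant_layer n \<Longrightarrow>
          \<bar>b t \<sigma> 0 z (T x \<omega>) - real_site z \<bullet> side_grad g (dir t) \<sigma>\<bar> \<le> \<epsilon> * real n"
        using shape_bound[OF elim(1) \<open>0 < \<epsilon>\<close>] by blast
      show "\<exists>n0. \<forall>y. x \<le> y \<and> n0 \<le> level y - level x \<longrightarrow>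
      \<bar>b t \<sigma> x y \<omega> - (of_int (fst y - fst x) * Lg t \<sigma> 1 + of_int (snd y - snd x) * Lg t \<sigma> 0)\<bar>
        \<le> \<epsilon> * of_int (level y - level x)"
      proof (intro exI[of _ "int n0"] allI impI, elim conjE)
        fix y assume y: "x \<le> y" "int n0 \<le> level y - level x"
        define n where "n = nat (level y - level x)"
        have "y - x \<in> quadrant_layer n"
          using y by (auto simp: quadrant_layer_def n_def level_def less_eq_prod_def)
        moreover have "n0 \<le> n" using y by (simp add: n_def)
        ultimately have "\<bar>b t \<sigma> 0 (y - x) (T x \<omega>) - real_site (y - x) \<bullet> side_grad g (dir t) \<sigma>\<bar> \<le> \<epsilon> * real n"
          by (intro n0)
        moreover have "b t \<sigma> 0 (y - x) (T x \<omega>) = b t \<sigma> x y \<omega>"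
          using basicD(2)[OF elim(2) t, of \<sigma> 0 x "y - x"] by simp
        moreover have "real_site (y - x) \<bullet> side_grad g (dir t) \<sigma>
            = of_int (fst y - fst x) * Lg t \<sigma> 1 + of_int (snd y - snd x) * Lg t \<sigma> 0"
          using t by (simp add: side_grad_dir real_site_def)
        moreover have "real n = of_int (level y - level x)" using y by (simp add: n_def)
        ultimately show "\<bar>b t \<sigma> x y \<omega> - (of_int (fst y - fst x) * Lg t \<sigma> 1 + of_int (snd y - snd x) * Lg t \<sigma> 0)\<bar>
        \<le> \<epsilon> * of_int (level y - level x)" by simp
      qed
    qed
  qed
qed

text \<open>Monotonicity in the direction holds along unit edges only. Additivity joins
  \<open>x\<close> to \<open>y\<close> by such edges, and sums and negatives of measures follow
  along.\<close>

lemma increments_ex: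
  assumes \<omega>: "basic \<omega>" and ab: "0 < p" "p < q" "q < 1"
  shows "\<exists>m. increments (\<lambda>\<xi> \<sigma>. B \<xi> \<sigma> x y \<omega>) p q m"
proof -
  define sm where "sm x y \<longleftrightarrow> (\<exists>m. increments (\<lambda>\<xi> \<sigma>. B \<xi> \<sigma> x y \<omega>) p q m)" for x y
  have coc: "cocycle (\<lambda>z. w z \<omega>) (\<lambda>x y. b t \<sigma> x y \<omega>)" if "p \<le> t" "t \<le> q" for t \<sigma>
    using that ab by (intro basicD(1)[OF \<omega>]) auto
  have trans: "sm x z" if "sm x y" "sm y z" for x y z
  proof -
    obtain m m' where "increments (\<lambda>\<xi> \<sigma>. B \<xi> \<sigma> x y \<omega>) p q m" "increments (\<lambda>\<xi> \<sigma>. B \<xi> \<sigma> y z \<omega>) p q m'"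
      using \<open>sm x y\<close> \<open>sm y z\<close> by (auto simp: sm_def)
    from increments_add[OF this] have "increments (\<lambda>\<xi> \<sigma>. B \<xi> \<sigma> x z \<omega>) p q (\<lambda>A. m A + m' A)"
      by (rule increments_cong[rotated]) (rule cocycle.add[OF coc])
    then show ?thesis unfolding sm_def by blast
  qed
  have sym: "sm y x" if "sm x y" for x y
  proof -
    obtain m where "increments (\<lambda>\<xi> \<sigma>. B \<xi> \<sigma> x y \<omega>) p q m" using \<open>sm x y\<close> by (auto simp: sm_def)
    from increments_uminus[OF this] have "increments (\<lambda>\<xi> \<sigma>. B \<xi> \<sigma> y x \<omega>) p q (\<lambda>A. - m A)"
      by (rule increments_cong[rotated]) (rule cocycle.antisym[OF coc, symmetric])
    then show ?thesis unfolding sm_def by blast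
  qed
  have edge2: "sm x (x + e2)" for x
    unfolding sm_def using ab
    by (intro increments_mono) (auto intro!: basicD[OF \<omega>])
  have edge1: "sm x (x + e1)" for x
  proof -
    have "\<exists>m. increments (\<lambda>\<xi> \<sigma>. - B \<xi> \<sigma> x (x + e1) \<omega>) p q m"
      using ab by (intro increments_mono) (auto intro!: basicD[OF \<omega>] tendsto_minus)
    then obtain m where "increments (\<lambda>\<xi> \<sigma>. - B \<xi> \<sigma> x (x + e1) \<omega>) p q m" by blast
    from increments_uminus[OF this] show ?thesis unfolding sm_def by auto
  qed
  have "sm 0 0" using trans[OF edge1[of 0] sym[OF edge1[of 0]]] .
  have shift1: "sm 0 (i, 0)" for i :: int
  proof (induction i rule: int_induct[where k = 0])
    case base
    then show ?case using \<open>sm 0 0\<close> by (simp add: zero_prod_def)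
  next
    case (step1 i)
    then show ?case using trans[OF step1(2), of "(i + 1, 0)"] edge1[of "(i, 0)"] by (simp add: e1_def)
  next
    case (step2 i)
    then show ?case using trans[OF step2(2), of "(i - 1, 0)"] sym[OF edge1[of "(i - 1, 0)"]] by (simp add: e1_def)
  qed
  have shift2: "sm 0 (i, j)" for i j :: int
  proof (induction j rule: int_induct[where k = 0])
    case base
    then show ?case by (rule shift1)
  next
    case (step1 j)
    then show ?case using trans[OF step1(2), of "(i, j + 1)"] edge2[of "(i, j)"] by (simp add: e2_def)
  next
    case (step2 j)
    then show ?case using trans[OF step2(2), of "(i, j - 1)"] sym[OF edge2[of "(i, j - 1)"]] by (simp add: e2_def)
  qed
  have "sm 0 z" for z using shift2[of "fst z" "snd z"] by simp
  then have "sm x y" using trans sym by blast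
  then show ?thesis by (simp add: sm_def)
qed

text \<open>The support is a union over all intervals. A point where \<open>B\<close> is not locally
  constant is detected by every interval having it in its interior, and no interval detects a point
  of local constancy, not even at its ends.\<close>

lemma busemann_support_iff:
  assumes \<omega>: "basic \<omega>"
  shows "\<xi> \<in> busemann_support B \<omega> x y \<longleftrightarrow>
    (\<exists>t. \<xi> = dir t \<and> 0 < t \<and> t < 1 \<and> \<not> loc_const (\<lambda>\<xi> \<sigma>. B \<xi> \<sigma> x y \<omega>) t)"
proof -
  let ?f = "\<lambda>\<xi> \<sigma>. B \<xi> \<sigma> x y \<omega>"
  let ?m = "\<lambda>p q. busemann_measure ?f (dir_Icc (dir p) (dir q))"
  have inc: "increments ?f p q (?m p q)" if pq: "0 < p" "p < q" "q < 1" for p q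
  proof -
    obtain m where "increments ?f p q m" using increments_ex[OF \<omega> pq] by blast
    then show ?thesis by (rule busemann_measure_increments[OF pq])
  qed
  have supp: "\<xi> \<in> busemann_support B \<omega> x y \<longleftrightarrow>
    (\<exists>p q. 0 < p \<and> p < q \<and> q < 1 \<and> \<xi> \<in> signed_support (dir ` {p..q}) (?m p q))"
  proof -
    have "\<xi> \<in> busemann_support B \<omega> x y \<longleftrightarrow>
      (\<exists>p\<in>{0<..<1}. \<exists>q\<in>{0<..<1}. dir p \<prec> dir q \<and> \<xi> \<in> signed_support (dir_Icc (dir p) (dir q)) (?m p q))"
      unfolding busemann_support_def ri_dirs_eq by blast
    also have "\<dots> \<longleftrightarrow> (\<exists>p q. 0 < p \<and> p < q \<and> q < 1 \<and> \<xi> \<in> signed_support (dir ` {p..q}) (?m p q))"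
    proof -
      have eq: "p \<in> {0<..<1} \<and> q \<in> {0<..<1} \<and> dir p \<prec> dir q \<and>
          \<xi> \<in> signed_support (dir_Icc (dir p) (dir q)) (?m p q) \<longleftrightarrow>
        0 < p \<and> p < q \<and> q < 1 \<and> \<xi> \<in> signed_support (dir ` {p..q}) (?m p q)" for p q
        by (auto simp: dir_intervals)
      show ?thesis unfolding eq[symmetric] by blast
    qed
    finally show ?thesis .
  qed
  show ?thesis
  proof
    assume "\<xi> \<in> busemann_support B \<omega> x y"
    then obtain p q where pq: "0 < p" "p < q" "q < 1" and \<xi>: "\<xi> \<in> signed_support (dir ` {p..q}) (?m p q)"
      unfolding supp by blast
    have sm: "signed_measure (restrict_space borel (dir ` {p..q})) (?m p q)"
      using inc[OF pq] by (simp add: increments_def)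
    \<comment> \<open>The whole interval is one of the closed sets with null complement, so the
      support cannot leave it.\<close>
    have "total_variation (restrict_space borel (dir ` {p..q})) (?m p q) (dir ` {p..q} - dir ` {p..q}) = 0"
      using sm unfolding Diff_cancel by (subst total_variation_eq_0_iff[OF sm]) (auto simp: signed_measure_def)
    then have "\<xi> \<in> dir ` {p..q}" using \<xi> unfolding signed_support_def by (auto dest!: spec[of _ "dir ` {p..q}"])
    then obtain t where t: "\<xi> = dir t" "p \<le> t" "t \<le> q" by auto
    have "\<not> loc_const ?f t"
      using not_in_support_if_loc_const[OF pq t(2,3) inc[OF pq]] \<xi> t(1) by blast
    then show "\<exists>t. \<xi> = dir t \<and> 0 < t \<and> t < 1 \<and> \<not> loc_const ?f t" using t pq by auto
  next
    assume "\<exists>t. \<xi> = dir t \<and> 0 < t \<and> t < 1 \<and> \<not> loc_const ?f t"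
    then obtain t where t: "\<xi> = dir t" "0 < t" "t < 1" "\<not> loc_const ?f t" by blast
    define p q where "p = t / 2" and "q = (t + 1) / 2"
    have pq: "0 < p" "p < t" "t < q" "q < 1" using t by (auto simp: p_def q_def)
    then have "p < q" by simp
    have "dir t \<in> signed_support (dir ` {p..q}) (?m p q)"
    proof (rule ccontr)
      assume "dir t \<notin> signed_support (dir ` {p..q}) (?m p q)"
      then have "loc_const ?f t"
        using pq by (intro loc_const_if_not_in_support[OF pq inc[OF pq(1) \<open>p < q\<close> pq(4)]] basicD(3)[OF \<omega>]) auto
      then show False using t by blast
    qed
    then show "\<xi> \<in> busemann_support B \<omega> x y" unfolding supp using t(1) pq \<open>p < q\<close> by blast
  qed
qed

text \<open>Isolation leaves a punctured neighbourhood of \<open>t\<close> consisting of points of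
  local constancy, and each of its two halves is connected.\<close>

lemma isolated_locally_const:
  assumes \<omega>: "basic \<omega>" and t: "0 < t" "t < 1"
    and iso: "\<And>\<xi>. \<xi> \<in> busemann_support B \<omega> x y \<Longrightarrow> \<xi> isolated_in busemann_support B \<omega> x y"
  shows "\<exists>s<t. \<exists>c. \<forall>u \<sigma>. s < u \<and> u < t \<longrightarrow> b u \<sigma> x y \<omega> = c"
    "\<exists>s>t. \<exists>c. \<forall>u \<sigma>. t < u \<and> u < s \<longrightarrow> b u \<sigma> x y \<omega> = c"
proof -
  let ?f = "\<lambda>\<xi> \<sigma>. B \<xi> \<sigma> x y \<omega>"
  have "\<exists>e>0. \<forall>v. v \<noteq> t \<and> t - e < v \<and> v < t + e \<longrightarrow> loc_const ?f v"
  proof (cases "loc_const ?f t")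
    case True
    then obtain s u c where *: "s < t" "t < u" "\<forall>v \<sigma>. s < v \<and> v < u \<longrightarrow> ?f (dir v) \<sigma> = c"
      by (auto simp: loc_const_def)
    then have "loc_const ?f v" if "s < v" "v < u" for v using that unfolding loc_const_def by blast
    then show ?thesis using * by (intro exI[of _ "min (t - s) (u - t)"]) auto
  next
    case False
    then have "dir t \<in> busemann_support B \<omega> x y" using busemann_support_iff[OF \<omega>] t by blast
    then obtain U where U: "open U" "U \<inter> busemann_support B \<omega> x y = {dir t}"
      using iso unfolding isolated_in_def by blast
    have "open (dir -` U)" by (intro open_vimage U continuous_dir)
    moreover have "t \<in> dir -` U \<inter> {0<..<1}" using U t by auto
    ultimately obtain e where e: "e > 0" "\<And>v. dist v t < e \<Longrightarrow> v \<in> dir -` U \<inter> {0<..<1}"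
      using open_dist[THEN iffD1, OF open_Int[OF _ open_greaterThanLessThan[of 0 1]], of "dir -` U"] by blast
    have "loc_const ?f v" if v: "v \<noteq> t" "t - e < v" "v < t + e" for v
    proof (rule ccontr)
      assume "\<not> loc_const ?f v"
      have "v \<in> dir -` U \<inter> {0<..<1}" using v by (intro e(2)) (auto simp: dist_real_def)
      then have "dir v \<in> busemann_support B \<omega> x y" "dir v \<in> U"
        using busemann_support_iff[OF \<omega>] \<open>\<not> loc_const ?f v\<close> by auto
      then have "dir v = dir t" using U(2) by blast
      then show False using v by simp
    qed
    then show ?thesis using e(1) by blast
  qed
  then obtain e where e: "e > 0" "\<And>v. v \<noteq> t \<Longrightarrow> t - e < v \<Longrightarrow> v < t + e \<Longrightarrow> loc_const ?f v" by blast
  have "\<exists>c. \<forall>v \<sigma>. t - e < v \<and> v < t \<longrightarrow> ?f (dir v) \<sigma> = c" using e by (intro loc_const_interval) auto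
  then show "\<exists>s<t. \<exists>c. \<forall>u \<sigma>. s < u \<and> u < t \<longrightarrow> b u \<sigma> x y \<omega> = c"
    using e(1) by (intro exI[of _ "t - e"]) auto
  have "\<exists>c. \<forall>v \<sigma>. t < v \<and> v < t + e \<longrightarrow> ?f (dir v) \<sigma> = c" using e by (intro loc_const_interval) auto
  then show "\<exists>s>t. \<exists>c. \<forall>u \<sigma>. t < u \<and> u < s \<longrightarrow> b u \<sigma> x y \<omega> = c"
    using e(1) by (intro exI[of _ "t + e"]) auto
qed

lemma facet_dir: "0 < t \<Longrightarrow> t < 1 \<Longrightarrow> facet g (dir t) = dir ` flat_part hg dg t"
  by (rule facet_eq[OF g_facts])

lemma regular_slope:
  assumes "regularity_condition g" "0 < t" "t < 1" "flat_part hg dg t \<noteq> {t}"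
  shows "dir t \<in> diff_dirs g"
proof (rule ccontr)
  assume "dir t \<notin> diff_dirs g"
  then have "facet g (dir t) = {dir t}"
    using assms by (simp add: regularity_condition_def strictly_concave_at_def)
  then have "dir ` flat_part hg dg t = dir ` {t}" using facet_dir assms by simp
  then have "flat_part hg dg t = {t}" by (subst (asm) inj_image_eq_iff) (auto intro: injI)
  then show False using assms by simp
qed

text \<open>The almost sure statements about a fixed direction are needed for countably many
  directions only. The remaining assumptions come from the regular event, generic weights, the jump
  condition and the shape function.\<close>

lemma AE_config:
  assumes reg: "regularity_condition g" and jump: "jump_process_condition M B"
  shows "AE \<omega> in M. basic \<omega> \<and>
    busemann_config (\<lambda>z. w z \<omega>) (\<lambda>t \<sigma> x y. b t \<sigma> x y \<omega>) rational_dirs hg dg"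
proof -
  have Q: "0 < q" "q < 1" if "q \<in> rational_dirs" for q using that by (auto simp: rational_dirs_def)
  have coal: "AE \<omega> in M. \<forall>q\<in>rational_dirs. \<forall>\<sigma> x y.
      coalesce (cocycle.gam (\<lambda>x y. b q \<sigma> x y \<omega>) \<sigma> x) (cocycle.gam (\<lambda>x y. b q \<sigma> x y \<omega>) \<sigma> y)"
    unfolding AE_ball_countable[OF countable_rational_dirs]
  proof
    fix q assume "q \<in> rational_dirs"
    from AE_coalesce[OF Q[OF this], of Plus] AE_coalesce[OF Q[OF this], of Minus]
    show "AE \<omega> in M. \<forall>\<sigma> x y. coalesce (cocycle.gam (\<lambda>x y. b q \<sigma> x y \<omega>) \<sigma> x) (cocycle.gam (\<lambda>x y. b q \<sigma> x y \<omega>) \<sigma> y)"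
      by eventually_elim (simp only: all_side simp_thms)
  qed
  have asymp: "AE \<omega> in M. \<forall>q\<in>rational_dirs. \<forall>\<sigma> x \<epsilon>. 0 < \<epsilon> \<longrightarrow> (\<exists>n0. \<forall>y. x \<le> y \<and> n0 \<le> level y - level x \<longrightarrow>
      \<bar>b q \<sigma> x y \<omega> - (of_int (fst y - fst x) * Lg q \<sigma> 1 + of_int (snd y - snd x) * Lg q \<sigma> 0)\<bar>
        \<le> \<epsilon> * of_int (level y - level x))"
    unfolding AE_ball_countable[OF countable_rational_dirs]
  proof
    fix q assume "q \<in> rational_dirs"
    from AE_asymp[OF Q[OF this], of Plus] AE_asymp[OF Q[OF this], of Minus]
    show "AE \<omega> in M. \<forall>\<sigma> x \<epsilon>. 0 < \<epsilon> \<longrightarrow> (\<exists>n0. \<forall>y. x \<le> y \<and> n0 \<le> level y - level x \<longrightarrow>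
      \<bar>b q \<sigma> x y \<omega> - (of_int (fst y - fst x) * Lg q \<sigma> 1 + of_int (snd y - snd x) * Lg q \<sigma> 0)\<bar>
        \<le> \<epsilon> * of_int (level y - level x))"
      by eventually_elim (simp only: all_side simp_thms)
  qed
  have fixed: "AE \<omega> in M. \<forall>q\<in>rational_dirs. (\<forall>\<sigma> x. b q \<sigma> x (x + e1) \<omega> \<noteq> b q \<sigma> x (x + e2) \<omega>) \<and>
      (dir q \<in> diff_dirs g \<longrightarrow> (\<forall>x y. b q Plus x y \<omega> = b q Minus x y \<omega>))"
    unfolding AE_ball_countable[OF countable_rational_dirs]
  proof
    fix q assume "q \<in> rational_dirs"
    then have "dir q \<in> ri_dirs" using Q by simp
    from B_fixed_dir[OF this]
    show "AE \<omega> in M. (\<forall>\<sigma> x. b q \<sigma> x (x + e1) \<omega> \<noteq> b q \<sigma> x (x + e2) \<omega>) \<and>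
      (dir q \<in> diff_dirs g \<longrightarrow> (\<forall>x y. b q Plus x y \<omega> = b q Minus x y \<omega>))"
      by eventually_elim blast
  qed
  show ?thesis
    using AE_basic AE_generic_weights coal asymp fixed jump[unfolded jump_process_condition_def]
  proof eventually_elim
    case (elim \<omega>)
    note basic = basicD[OF elim(1)]
    have "busemann_config (\<lambda>z. w z \<omega>) (\<lambda>t \<sigma> x y. b t \<sigma> x y \<omega>) rational_dirs hg dg"
    proof (rule busemann_config.intro)
      show "generic_weights (\<lambda>z. w z \<omega>)" by (rule elim(2))
      show "rational_dirs \<subseteq> {0<..<1}" by (auto simp: rational_dirs_def)
      show "b q \<sigma> x (x + e1) \<omega> \<noteq> b q \<sigma> x (x + e2) \<omega>" if "q \<in> rational_dirs" for q \<sigma> x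
        using elim(5) that by blast
      show "coalesce (cocycle.gam (\<lambda>x y. b q \<sigma> x y \<omega>) \<sigma> x) (cocycle.gam (\<lambda>x y. b q \<sigma> x y \<omega>) \<sigma> y)"
        if "q \<in> rational_dirs" for q \<sigma> x y
        using elim(3) that by blast
      show "\<exists>n0. \<forall>y. x \<le> y \<and> n0 \<le> level y - level x \<longrightarrow>
      \<bar>b q \<sigma> x y \<omega> - (of_int (fst y - fst x) * Lg q \<sigma> 1 + of_int (snd y - snd x) * Lg q \<sigma> 0)\<bar>
        \<le> \<epsilon> * of_int (level y - level x)" if "q \<in> rational_dirs" "0 < \<epsilon>" for q \<epsilon> x \<sigma>
        by (rule elim(4)[rule_format, OF that])
      show "hg s \<le> Lg t \<sigma> s" if "0 < s" "s < 1" "0 < t" "t < 1" for s t \<sigma>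
        by (rule side_slope(2)[OF g_facts]) (use that in auto)
      show "((\<lambda>s. (hg s - hg t) / (s - t)) \<longlongrightarrow> dg t Plus) (at_right t)" if "0 < t" "t < 1" for t
        using side_slope(1)[OF g_facts that, of Plus] by (simp add: at_side_def)
      show "((\<lambda>s. (hg s - hg t) / (s - t)) \<longlongrightarrow> dg t Minus) (at_left t)" if "0 < t" "t < 1" for t
        using side_slope(1)[OF g_facts that, of Minus] by (simp add: at_side_def)
      show "(\<lambda>x y. b s \<sigma> x y \<omega>) = (\<lambda>x y. b t \<sigma> x y \<omega>)"
        if "0 < s" "s < 1" "0 < t" "t < 1" "Lg s \<sigma> = Lg t \<sigma>" for s t \<sigma>
        using B_grad[of "dir s" "dir t" \<sigma>] that by (simp add: side_grad_dir)
      show "dg t Plus = dg t Minus" if "0 < t" "t < 1" "flat_part hg dg t \<noteq> {t}" for t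
        by (rule diff_dirs_slope[OF g_facts regular_slope[OF reg that]])
      show "(\<lambda>x y. b q Plus x y \<omega>) = (\<lambda>x y. b q Minus x y \<omega>)"
        if q: "q \<in> rational_dirs" "flat_part hg dg q \<noteq> {q}" for q
      proof -
        have "dir q \<in> diff_dirs g" using regular_slope[OF reg Q[OF q(1)] q(2)] .
        then have "\<forall>x y. b q Plus x y \<omega> = b q Minus x y \<omega>" using elim(5) q(1) by blast
        then show ?thesis by (intro ext) blast
      qed
      have iso: "\<xi> isolated_in busemann_support B \<omega> x y" if "\<xi> \<in> busemann_support B \<omega> x y" for \<xi> x y
        using elim(6) that by blast
      show "\<exists>s<t. \<exists>c. \<forall>u \<sigma>. s < u \<and> u < t \<longrightarrow> b u \<sigma> x y \<omega> = c" if "0 < t" "t < 1" for t x y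
        by (rule isolated_locally_const(1)[OF elim(1) that iso])
      show "\<exists>s>t. \<exists>c. \<forall>u \<sigma>. t < u \<and> u < s \<longrightarrow> b u \<sigma> x y \<omega> = c" if "0 < t" "t < 1" for t x y
        by (rule isolated_locally_const(2)[OF elim(1) that iso])
      \<comment> \<open>The smaller of the two increments equals the weight, which does not depend
        on the direction. Once the increment along \<open>e1\<close> exceeds the weight, it is the
        larger one.\<close>
      show "\<exists>s. 0 < s \<and> s < 1 \<and> b s Plus z (z + e2) \<omega> < b s Plus z (z + e1) \<omega>" for z
      proof -
        have "eventually (\<lambda>s. w z \<omega> < b s Plus z (z + e1) \<omega>) (at_right 0)"
          using basic(9)[of Plus z] by (simp add: filterlim_at_top_dense)
        moreover have "eventually (\<lambda>s. 0 < s \<and> s < 1) (at_right (0::real))"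
          unfolding eventually_at_right_field by (intro exI[of _ 1]) auto
        ultimately have "eventually (\<lambda>s. 0 < s \<and> s < 1 \<and> w z \<omega> < b s Plus z (z + e1) \<omega>) (at_right 0)"
          by eventually_elim auto
        then obtain s where s: "0 < s" "s < 1" "w z \<omega> < b s Plus z (z + e1) \<omega>"
          using eventually_happens'[OF trivial_limit_at_right_real] by blast
        then show ?thesis using cocycle.recover[OF basic(1)[OF s(1,2), of Plus], of z]
          by (intro exI[of _ s]) auto
      qed
      show "\<exists>s. 0 < s \<and> s < 1 \<and> b s Plus z (z + e1) \<omega> < b s Plus z (z + e2) \<omega>" for z
      proof -
        have "eventually (\<lambda>s. w z \<omega> < b s Plus z (z + e2) \<omega>) (at_left 1)"
          using basic(10)[of Plus z] by (simp add: filterlim_at_top_dense)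
        moreover have "eventually (\<lambda>s. 0 < s \<and> s < 1) (at_left (1::real))"
          unfolding eventually_at_left_field by (intro exI[of _ 0]) auto
        ultimately have "eventually (\<lambda>s. 0 < s \<and> s < 1 \<and> w z \<omega> < b s Plus z (z + e2) \<omega>) (at_left 1)"
          by eventually_elim auto
        then obtain s where s: "0 < s" "s < 1" "w z \<omega> < b s Plus z (z + e2) \<omega>"
          using eventually_happens'[OF trivial_limit_at_left_real] by blast
        then show ?thesis using cocycle.recover[OF basic(1)[OF s(1,2), of Plus], of z]
          by (intro exI[of _ s]) auto
      qed
    qed (fact basic rational_dirs_dense steep)+
    then show ?case using elim(1) by blast
  qed
qed

section \<open>The assertions for a single realization\<close>

context
  fixes \<omega>
  assumes basic: "basic \<omega>"
    and config: "busemann_config (\<lambda>z. w z \<omega>) (\<lambda>t \<sigma> x y. b t \<sigma> x y \<omega>) rational_dirs hg dg"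
begin

interpretation C: busemann_config "\<lambda>z. w z \<omega>" "\<lambda>t \<sigma> x y. b t \<sigma> x y \<omega>" rational_dirs hg dg
  by (rule config)

text \<open>\<open>B\<close> is constant on either side of \<open>t\<close>, so only the values at
  \<open>t\<close> remain to be compared, and these are the limits of the two constants.\<close>

lemma jump_iff_not_loc_const:
  assumes t: "0 < t" "t < 1"
  shows "b t Minus x y \<omega> \<noteq> b t Plus x y \<omega> \<longleftrightarrow> \<not> loc_const (\<lambda>\<xi> \<sigma>. B \<xi> \<sigma> x y \<omega>) t"
proof
  assume "b t Minus x y \<omega> \<noteq> b t Plus x y \<omega>"
  then show "\<not> loc_const (\<lambda>\<xi> \<sigma>. B \<xi> \<sigma> x y \<omega>) t" unfolding loc_const_def by metis
next
  assume no: "\<not> loc_const (\<lambda>\<xi> \<sigma>. B \<xi> \<sigma> x y \<omega>) t"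
  show "b t Minus x y \<omega> \<noteq> b t Plus x y \<omega>"
  proof
    assume eq: "b t Minus x y \<omega> = b t Plus x y \<omega>"
    obtain s c where s: "s < t" "\<And>u \<sigma>. s < u \<Longrightarrow> u < t \<Longrightarrow> b u \<sigma> x y \<omega> = c"
      using C.locally_const(1)[OF t, of x y] by blast
    obtain u c' where u: "t < u" "\<And>v \<sigma>. t < v \<Longrightarrow> v < u \<Longrightarrow> b v \<sigma> x y \<omega> = c'"
      using C.locally_const(2)[OF t, of x y] by blast
    have "((\<lambda>v. b v Plus x y \<omega>) \<longlongrightarrow> c) (at_left t)"
    proof (rule Lim_transform_eventually[OF tendsto_const])
      show "eventually (\<lambda>v. c = b v Plus x y \<omega>) (at_left t)"
        unfolding eventually_at_left_field using s by (intro exI[of _ s]) auto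
    qed
    from tendsto_unique[OF _ C.lim_left[OF t] this] have c: "b t Minus x y \<omega> = c" by simp
    have "((\<lambda>v. b v Plus x y \<omega>) \<longlongrightarrow> c') (at_right t)"
    proof (rule Lim_transform_eventually[OF tendsto_const])
      show "eventually (\<lambda>v. c' = b v Plus x y \<omega>) (at_right t)"
        unfolding eventually_at_right_field using u by (intro exI[of _ u]) auto
    qed
    from tendsto_unique[OF _ C.lim_right[OF t] this] have c': "b t Plus x y \<omega> = c'" by simp
    have at: "b t \<sigma> x y \<omega> = c" for \<sigma> using eq c by (cases \<sigma>) auto
    have "b v \<sigma> x y \<omega> = c" if "s < v" "v < u" for v \<sigma>
    proof (cases v t rule: linorder_cases)
      case less then show ?thesis using s(2) that by blast
    next
      case equal then show ?thesis using at by simp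
    next
      case greater
      then have "b v \<sigma> x y \<omega> = c'" using u(2) that by blast
      then show ?thesis using eq c c' by simp
    qed
    then show False using no s(1) u(1) unfolding loc_const_def by blast
  qed
qed

lemma exceptional_iff_jump:
  assumes t: "0 < t" "t < 1"
  shows "dir t \<in> exceptional_dirs B \<omega> \<longleftrightarrow> C.jump t"
proof -
  have "dir t \<in> exceptional_dirs B \<omega> \<longleftrightarrow> (\<exists>x y. \<not> loc_const (\<lambda>\<xi> \<sigma>. B \<xi> \<sigma> x y \<omega>) t)"
    unfolding exceptional_dirs_def UN_iff busemann_support_iff[OF basic] dir_inject using t by blast
  also have "\<dots> \<longleftrightarrow> C.jump t"
    unfolding C.jump_def jump_iff_not_loc_const[OF t, symmetric] ..
  finally show ?thesis .
qed

text \<open>Shifting by \<open>x\<close> turns the increment between \<open>e1\<close> and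
  \<open>e2\<close> into \<open>delta\<close> at \<open>x\<close>. Existence and uniqueness of the
  crossing give the definite description its value.\<close>

lemma cif_dir_eq_iff: "dir t = cif_dir B (T x \<omega>) \<longleftrightarrow> C.crossing x t"
proof -
  have shift: "B (dir s) \<sigma> e1 e2 (T x \<omega>) = C.delta s \<sigma> x" if "0 < s" "s < 1" for s \<sigma>
  proof -
    have "B (dir s) \<sigma> e1 e2 (T x \<omega>) = b s \<sigma> (x + e1) (x + e2) \<omega>"
      using basicD(2)[OF basic that, of \<sigma> e1 x e2] by (simp add: add.commute)
    moreover have "b s \<sigma> x (x + e1) \<omega> + b s \<sigma> (x + e1) (x + e2) \<omega> = b s \<sigma> x (x + e2) \<omega>"
      by (rule cocycle.add[OF basicD(1)[OF basic that]])
    ultimately show ?thesis unfolding C.delta_def by simp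
  qed
  let ?P = "\<lambda>\<xi>. \<xi> \<in> ri_dirs \<and> (\<forall>\<zeta>\<in>ri_dirs. \<forall>\<sigma>.
    (\<zeta> \<prec> \<xi> \<longrightarrow> B \<zeta> \<sigma> e1 e2 (T x \<omega>) < 0) \<and> (\<xi> \<prec> \<zeta> \<longrightarrow> B \<zeta> \<sigma> e1 e2 (T x \<omega>) > 0))"
  have P: "?P (dir s) \<longleftrightarrow> C.crossing x s" for s
    unfolding ri_dirs_eq C.crossing_def by (auto simp: shift)
  obtain s where s: "C.crossing x s" using C.crossing_ex by blast
  have "cif_dir B (T x \<omega>) = dir s"
    unfolding cif_dir_def
  proof (rule the_equality)
    show "?P (dir s)" using P s by blast
    fix \<xi> assume \<xi>: "?P \<xi>"
    then obtain u where u: "\<xi> = dir u" unfolding ri_dirs_eq by blast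
    have "C.crossing x u" using \<xi> P[of u] unfolding u by blast
    then show "\<xi> = dir s" using C.crossing_unique[OF s] u by blast
  qed
  then have "dir t = cif_dir B (T x \<omega>) \<longleftrightarrow> t = s" by simp
  also have "\<dots> \<longleftrightarrow> C.crossing x t" using C.crossing_unique[OF _ s] s by blast
  finally show ?thesis .
qed

lemma geodesic_eq: "0 < t \<Longrightarrow> t < 1 \<Longrightarrow> busemann_geodesic B \<omega> x (dir t) \<sigma> = C.bgeo t \<sigma> x"
  by (intro ext) (simp add: busemann_geodesic_def cocycle.gam_def[OF C.cocycle])

lemma directed_into_facet_iff:
  assumes "0 < t" "t < 1" "up_right_on {level x..} \<pi>" "\<pi> (level x) = x"
  shows "directed_into \<pi> (facet g (dir t)) \<longleftrightarrow> (\<forall>u. limit_pt \<pi> u \<longrightarrow> u \<in> flat_part hg dg t)"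
  using directed_into_iff[OF assms(3,4), of "flat_part hg dg t"] facet_dir[OF assms(1,2)]
  by (simp add: dir_def[abs_def])

lemma regular_direction:
  assumes t: "0 < t" "t < 1" and "\<not> C.jump t"
  shows "busemann_geodesic B \<omega> x (dir t) Minus = busemann_geodesic B \<omega> x (dir t) Plus"
    "semi_infinite_geodesic (\<lambda>z. w z \<omega>) x (busemann_geodesic B \<omega> x (dir t) Plus)"
    "directed_into (busemann_geodesic B \<omega> x (dir t) Plus) (facet g (dir t))"
    "semi_infinite_geodesic (\<lambda>z. w z \<omega>) x \<pi> \<Longrightarrow> directed_into \<pi> (facet g (dir t)) \<Longrightarrow> level x \<le> k \<Longrightarrow>
      \<pi> k = busemann_geodesic B \<omega> x (dir t) Plus k"
    "coalesce (busemann_geodesic B \<omega> x (dir t) Plus) (busemann_geodesic B \<omega> y (dir t) Plus)"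
  unfolding geodesic_eq[OF t]
proof -
  show "C.bgeo t Minus x = C.bgeo t Plus x"
    using C.bgeo_eq_if_no_crossing[OF t] C.jump_iff_crossing[OF t] assms(3) by metis
  show "semi_infinite_geodesic (\<lambda>z. w z \<omega>) x (C.bgeo t Plus x)"
    by (rule cocycle.semi_infinite_geodesic_gam[OF C.cocycle[OF t]])
  show "directed_into (C.bgeo t Plus x) (facet g (dir t))"
    unfolding directed_into_facet_iff[OF t C.up_right_bgeo[OF t]] using C.limit_in_flat_part[OF t] by blast
  show "\<pi> k = C.bgeo t Plus x k"
    if geo: "semi_infinite_geodesic (\<lambda>z. w z \<omega>) x \<pi>" and dir: "directed_into \<pi> (facet g (dir t))" and "level x \<le> k"
  proof (rule C.unique_geodesic[OF t assms(3) geo _ \<open>level x \<le> k\<close>])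
    have "up_right_on {level x..} \<pi>" "\<pi> (level x) = x" using geo by (auto simp: semi_infinite_geodesic_def)
    then show "u \<in> flat_part hg dg t" if "limit_pt \<pi> u" for u
      using that dir directed_into_facet_iff[OF t] by blast
  qed
  show "coalesce (C.bgeo t Plus x) (C.bgeo t Plus y)" by (rule C.coalesce_path[OF t])
qed

lemma exceptional_direction:
  assumes t: "0 < t" "t < 1" and jump: "C.jump t"
  shows "semi_infinite_geodesic (\<lambda>z. w z \<omega>) x (busemann_geodesic B \<omega> x (dir t) \<sigma>)"
    "directed_to (busemann_geodesic B \<omega> x (dir t) \<sigma>) (dir t)"
    "separate_eventually (busemann_geodesic B \<omega> x (dir t) Minus) (busemann_geodesic B \<omega> x (dir t) Plus)"
    "coalesce (busemann_geodesic B \<omega> x (dir t) \<sigma>) (busemann_geodesic B \<omega> y (dir t) \<sigma>)"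
  unfolding geodesic_eq[OF t]
proof -
  show "semi_infinite_geodesic (\<lambda>z. w z \<omega>) x (C.bgeo t \<sigma> x)"
    by (rule cocycle.semi_infinite_geodesic_gam[OF C.cocycle[OF t]])
  have "u = t" if "limit_pt (C.bgeo t \<sigma> x) u" for u
    using C.limit_in_flat_part[OF t that] C.jump_flat_part[OF t jump] by blast
  from directed_toI[OF C.up_right_bgeo[OF t] this]
  show "directed_to (C.bgeo t \<sigma> x) (dir t)" by (simp add: dir_def)
  show "separate_eventually (C.bgeo t Minus x) (C.bgeo t Plus x)" by (rule C.separate[OF t jump])
  show "coalesce (C.bgeo t \<sigma> x) (C.bgeo t \<sigma> y)" by (rule C.coalesce_path[OF t])
qed

end

end

theorem theorem3p10:
  fixes M :: "'w::polish_space measure"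
    and T :: "site \<Rightarrow> 'w \<Rightarrow> 'w"
    and w :: "site \<Rightarrow> 'w \<Rightarrow> real"
    and g :: "vec \<Rightarrow> real"
    and B :: "vec \<Rightarrow> side \<Rightarrow> site \<Rightarrow> site \<Rightarrow> 'w \<Rightarrow> real"
  assumes "busemann_process M T w g B"
    and "regularity_condition g"
    and "jump_process_condition M B"
  shows "AE \<omega> in M. \<forall>\<xi>\<in>ri_dirs.
    (\<xi> \<in> exceptional_dirs B \<omega> \<longleftrightarrow> (\<exists>x y. B \<xi> Minus x y \<omega> \<noteq> B \<xi> Plus x y \<omega>)) \<and>
    (\<xi> \<in> exceptional_dirs B \<omega> \<longleftrightarrow> (\<exists>x. \<xi> = cif_dir B (T x \<omega>))) \<and>
    (\<xi> \<notin> exceptional_dirs B \<omega> \<longrightarrow>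
      (\<forall>x. busemann_geodesic B \<omega> x \<xi> Minus = busemann_geodesic B \<omega> x \<xi> Plus \<and>
           semi_infinite_geodesic (\<lambda>z. w z \<omega>) x (busemann_geodesic B \<omega> x \<xi> Plus) \<and>
           directed_into (busemann_geodesic B \<omega> x \<xi> Plus) (facet g \<xi>) \<and>
           (\<forall>\<pi>. semi_infinite_geodesic (\<lambda>z. w z \<omega>) x \<pi> \<and> directed_into \<pi> (facet g \<xi>) \<longrightarrow>
                (\<forall>k\<ge>level x. \<pi> k = busemann_geodesic B \<omega> x \<xi> Plus k))) \<and>
      (\<forall>x y. coalesce (busemann_geodesic B \<omega> x \<xi> Plus) (busemann_geodesic B \<omega> y \<xi> Plus))) \<and>
    (\<xi> \<in> exceptional_dirs B \<omega> \<longrightarrow>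
      (\<forall>x. (\<forall>\<sigma>. semi_infinite_geodesic (\<lambda>z. w z \<omega>) x (busemann_geodesic B \<omega> x \<xi> \<sigma>) \<and>
                directed_to (busemann_geodesic B \<omega> x \<xi> \<sigma>) \<xi>) \<and>
           separate_eventually (busemann_geodesic B \<omega> x \<xi> Minus)
                               (busemann_geodesic B \<omega> x \<xi> Plus)) \<and>
      (\<forall>x y \<sigma>. coalesce (busemann_geodesic B \<omega> x \<xi> \<sigma>) (busemann_geodesic B \<omega> y \<xi> \<sigma>)))"
proof -
  interpret busemann_process M T w g B by (rule assms(1))
  from AE_config[OF assms(2,3)] show ?thesis
  proof eventually_elim
    case (elim \<omega>)
    then have \<omega>: "basic \<omega>" "busemann_config (\<lambda>z. w z \<omega>) (\<lambda>t \<sigma> x y. b t \<sigma> x y \<omega>) rational_dirs hg dg"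
      by blast+
    interpret C: busemann_config "\<lambda>z. w z \<omega>" "\<lambda>t \<sigma> x y. b t \<sigma> x y \<omega>" rational_dirs hg dg
      by (rule \<omega>(2))
    show ?case (is "\<forall>\<xi>\<in>ri_dirs. ?P \<xi>")
    proof
      fix \<xi> assume "\<xi> \<in> ri_dirs"
      then obtain t where \<xi>: "\<xi> = dir t" and t: "0 < t" "t < 1" unfolding ri_dirs_eq by auto
      note regular = regular_direction[OF \<omega> t] and exceptional = exceptional_direction[OF \<omega> t]
      show "?P \<xi>"
        unfolding \<xi> exceptional_iff_jump[OF \<omega> t] cif_dir_eq_iff[OF \<omega>]
        by (intro conjI impI allI; (elim conjE)?)
          (rule C.jump_def C.jump_iff_crossing[OF t] | rule regular exceptional; assumption)+
    qed
  qed
qed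

end
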